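(* Let $\gamma$ be a type $D$ clan (an $(n,n)$-clan with the properties listed in the context) avoiding the pattern $(1,2,1,2)$. Let $X=G/B$ be the flag variety of $G=SO(2n,\mathbb{C})$, regarded as a closed subvariety of the flag variety $X'$ of $GL(2n,\mathbb{C})$, let $Q_\gamma'$ be the $K'=GL(n,\mathbb{C})\times GL(n,\mathbb{C})$-orbit on $X'$ associated to $\gamma$, and let $Q_\gamma=Q'_\gamma\cap X$, a $K=G\cap K'$-orbit on $X$. Let $u'=u(\gamma)$ and $v'=v(\gamma)$ be the elements of $S_{2n}$ defined in the context, which are the images of elements $u,v$ of the Weyl group $W$ of $G$. Then the $K$-orbit closure $Y_\gamma=\overline{Q_\gamma}$ is the Richardson variety $X_u^v=X_u\cap X^v$ in $X$.
   Context: **Groups.** $G=SO(2n,\mathbb{C})$ is the special isometry group (determinant one) of $\langle x,y\rangle=\sum_{i=1}^{2n}x_iy_{2n+1-i}$; $G'=GL(2n,\mathbb{C})$; $B'\subset G'$ is the group of upper triangular matrices, $B=B'\cap G$, and $B^-$ is the group of lower triangular elements of $G$. $X=G/B\hookrightarrow X'=G'/B'$ via $gB\mapsto gB'$; $X'$ is the variety of complete flags $F_\bullet$ in $\mathbb{C}^{2n}$. $K'\cong GL(n,\mathbb{C})\times GL(n,\mathbb{C})$ is the group of block-diagonal matrices with two $n\times n$ blocks, and $K=G\cap K'\cong GL(n,\mathbb{C})$. **Clans.** An $(n,n)$-clan is a string $(c_1,\dots,c_{2n})$ of symbols $+$, $-$, or natural numbers, in which every natural number that appears does so exactly twice, with equally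 many $+$ and $-$ signs; only the positions of matching numbers matter, not their values. It is skew-symmetric if for each $i$: if $c_i$ is a sign then $c_{2n+1-i}$ is the opposite sign; if $c_i$ is a number then so is $c_{2n+1-i}$, and $c_{2n+1-i}=c_j$ implies $c_i=c_{2n+1-j}$. A type $D$ clan is an $(n,n)$-clan such that (1) it is skew-symmetric; (2) if $c_i=c_j$ is a pair of equal natural numbers, then $j\ne2n+1-i$; (3) among $(c_1,\dots,c_n)$ the total number of $-$ signs and pairs of equal natural numbers is even. A clan avoids $(1,2,1,2)$ if no substring (not necessarily of consecutive positions) of length 4 equals $(1,2,1,2)$ as a clan. **Orbits.** $K'$-orbits on $X'$ are in bijection with $(n,n)$-clans in the standard way: let $E=\langle e_1,\dots,e_n\rangle$, $\tilde E=\langle e_{n+1},\dots,e_{2n}\rangle$, and $\pi:\mathbb{C}^{2n}\to E$ the projection with kernel $\tilde E$. Then $Q'_\gamma$ is the set of flags $F_\bullet$ such that for all $i$, $\dim(F_i\cap E)$ (resp. $\dim(F_i\cap\tilde E)$) is the number of $+$ (resp. $-$) signs plus the number of pairs of equal natural numbers among $c_1,\dots,c_i$, and for all $i<j$, $\dim(\pi(F_i)+F_j)=j+\#\{(s,t): c_s=c_t\in\mathbb{N},\ s\le i<j<t\}$. It is known that $Q'_\gamma\cap X\neq\emptyset$ if and only if $\gamma$ is a type $D$ clan, in which case it is a single $K$-orbit on $X$. **Permutations.** $u(\gamma)\in S_{2n}$ assigns the numbers $n,n-1,\dots,1$, in order from left to right, to those positions $i$ for which $c_i$ is a $+$ or the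 second occurrence of a natural number, and $2n,2n-1,\dots,n+1$, in order, to the remaining positions. $v(\gamma)\in S_{2n}$ assigns $1,\dots,n$, in order, to those positions $i$ for which $c_i$ is a $+$ or the first occurrence of a natural number, and $n+1,\dots,2n$, in order, to the remaining positions. **Weyl group and Schubert varieties.** $W$ is the group of signed permutations $\sigma$ of $[n]$ (bijections of $\{\pm1,\dots,\pm n\}$ with $\sigma(-i)=-\sigma(i)$) changing an even number of signs (i.e. $\#\{i\in[n]:\sigma(i)<0\}$ is even), embedded in $S_{2n}$ by $\sigma\mapsto\sigma'$, where for $1\le i\le n$, $\sigma'(i)=\sigma(i)$ if $\sigma(i)>0$, $\sigma'(i)=2n+1-|\sigma(i)|$ otherwise, and $\sigma'(2n+1-i)=2n+1-\sigma'(i)$. A representative of $\sigma$ in $G$ sends each $e_i$ to a multiple of $e_{\sigma'(i)}$. For $w\in W$: $X_w=\overline{BwB/B}$, $X^w=\overline{B^-wB/B}$. *)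

theory Defs
  imports
    "HOL-Analysis.Abstract_Topology"
    "HOL-Combinatorics.Permutations"
    "Jordan_Normal_Form.DL_Rank_Submatrix"
begin

section \<open>Clans\<close>

text \<open>
  A clan of length \<open>2 * n\<close> is a function on positions, of which only the values at
  \<open>1, ..., 2 * n\<close> matter. Every notion below sees natural numbers in a clan only through
  \<open>matched\<close>, hence is invariant under renaming them.
\<close>

datatype clan_symbol = Plus | Minus | Num nat

type_synonym clan = "nat \<Rightarrow> clan_symbol"

definition matched :: "clan \<Rightarrow> nat \<Rightarrow> nat \<Rightarrow> bool" where
  "matched c s t \<longleftrightarrow> (\<exists>a. c s = Num a \<and> c t = Num a)"

definition is_clan :: "nat \<Rightarrow> clan \<Rightarrow> bool" where
  "is_clan n c \<longleftrightarrow>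
     (\<forall>i\<in>{1..2*n}. \<forall>a. c i = Num a \<longrightarrow> card {j\<in>{1..2*n}. c j = Num a} = 2) \<and>
     card {i\<in>{1..2*n}. c i = Plus} = card {i\<in>{1..2*n}. c i = Minus}"

definition skew_symmetric_clan :: "nat \<Rightarrow> clan \<Rightarrow> bool" where
  "skew_symmetric_clan n c \<longleftrightarrow>
     (\<forall>i\<in>{1..2*n}.
        (c i = Plus \<longrightarrow> c (2*n+1-i) = Minus) \<and>
        (c i = Minus \<longrightarrow> c (2*n+1-i) = Plus) \<and>
        (\<forall>a. c i = Num a \<longrightarrow>
           (\<exists>b. c (2*n+1-i) = Num b) \<and>
           (\<forall>j\<in>{1..2*n}. c (2*n+1-i) = c j \<longrightarrow> c i = c (2*n+1-j))))"

definition num_pairs :: "clan \<Rightarrow> nat \<Rightarrow> nat" where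
  "num_pairs c i = card {(s, t). 1 \<le> s \<and> s < t \<and> t \<le> i \<and> matched c s t}"

definition type_D_clan :: "nat \<Rightarrow> clan \<Rightarrow> bool" where
  "type_D_clan n c \<longleftrightarrow>
     is_clan n c \<and>
     skew_symmetric_clan n c \<and>
     (\<forall>i\<in>{1..2*n}. \<forall>j\<in>{1..2*n}. matched c i j \<longrightarrow> j \<noteq> 2*n+1-i) \<and>
     even (card {i\<in>{1..n}. c i = Minus} + num_pairs c n)"

definition avoids_1212 :: "nat \<Rightarrow> clan \<Rightarrow> bool" where
  "avoids_1212 n c \<longleftrightarrow>
     \<not> (\<exists>i j k l. 1 \<le> i \<and> i < j \<and> j < k \<and> k < l \<and> l \<le> 2*n \<and>
          matched c i k \<and> matched c j l \<and> \<not> matched c i j)"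

definition first_occ :: "nat \<Rightarrow> clan \<Rightarrow> nat \<Rightarrow> bool" where
  "first_occ n c i \<longleftrightarrow> (\<exists>t. i < t \<and> t \<le> 2*n \<and> matched c i t)"

definition second_occ :: "clan \<Rightarrow> nat \<Rightarrow> bool" where
  "second_occ c i \<longleftrightarrow> (\<exists>s. 1 \<le> s \<and> s < i \<and> matched c s i)"


section \<open>Permutations and the Weyl group\<close>

text \<open>
  Elements of the symmetric group on \<open>{1..2*n}\<close> are functions that are the identity outside
  \<open>{1..2*n}\<close>. The position counted at \<open>i\<close> is the \<open>k\<close>-th one from the left
  in its class, where \<open>k\<close> is the cardinality that occurs in the definition.
\<close>

definition clan_u :: "nat \<Rightarrow> clan \<Rightarrow> nat \<Rightarrow> nat" where
  "clan_u n c i =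
     (let P = {j\<in>{1..2*n}. c j = Plus \<or> second_occ c j}
      in if i \<notin> {1..2*n} then i
         else if i \<in> P then n + 1 - card {j\<in>P. j \<le> i}
         else 2*n + 1 - card {j\<in>{1..2*n} - P. j \<le> i})"

definition clan_v :: "nat \<Rightarrow> clan \<Rightarrow> nat \<Rightarrow> nat" where
  "clan_v n c i =
     (let P = {j\<in>{1..2*n}. c j = Plus \<or> first_occ n c j}
      in if i \<notin> {1..2*n} then i
         else if i \<in> P then card {j\<in>P. j \<le> i}
         else n + card {j\<in>{1..2*n} - P. j \<le> i})"

definition weyl_D :: "nat \<Rightarrow> (int \<Rightarrow> int) set" where
  "weyl_D n =
     {\<sigma>. \<sigma> permutes ({- int n..int n} - {0}) \<and>
         (\<forall>i\<in>{- int n..int n} - {0}. \<sigma> (- i) = - \<sigma> i) \<and>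
         even (card {i\<in>{1..int n}. \<sigma> i < 0})}"

definition weyl_embed :: "nat \<Rightarrow> (int \<Rightarrow> int) \<Rightarrow> nat \<Rightarrow> nat" where
  "weyl_embed n \<sigma> i =
     (let p = (\<lambda>k. if \<sigma> (int k) > 0 then nat (\<sigma> (int k)) else 2*n + 1 - nat \<bar>\<sigma> (int k)\<bar>)
      in if i \<in> {1..n} then p i
         else if i \<in> {n+1..2*n} then 2*n + 1 - p (2*n + 1 - i)
         else i)"


section \<open>Linear algebra in complex coordinate space\<close>

abbreviation cvec_module :: "nat \<Rightarrow> (complex, complex vec) module" where
  "cvec_module N \<equiv> module_vec TYPE(complex) N"

abbreviation cspan :: "nat \<Rightarrow> complex vec set \<Rightarrow> complex vec set" where
  "cspan N S \<equiv> LinearCombinations.module.span class_ring (cvec_module N) S"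

abbreviation csubspace :: "nat \<Rightarrow> complex vec set \<Rightarrow> bool" where
  "csubspace N S \<equiv> VectorSpace.subspace class_ring S (cvec_module N)"

definition cdim :: "nat \<Rightarrow> complex vec set \<Rightarrow> nat" where
  "cdim N S = vectorspace.dim class_ring (cvec_module N\<lparr>carrier := S\<rparr>)"

text \<open>
  Basis vectors are numbered from 1, whereas vector and matrix entries are numbered from 0.
\<close>

definition basis_vec :: "nat \<Rightarrow> nat \<Rightarrow> complex vec" where
  "basis_vec N i = unit_vec N (i - 1)"

definition E_space :: "nat \<Rightarrow> complex vec set" where
  "E_space n = cspan (2*n) (basis_vec (2*n) ` {1..n})"

definition E_tilde :: "nat \<Rightarrow> complex vec set" where
  "E_tilde n = cspan (2*n) (basis_vec (2*n) ` {n+1..2*n})"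

definition proj_E :: "nat \<Rightarrow> complex vec \<Rightarrow> complex vec" where
  "proj_E n x = vec (2*n) (\<lambda>i. if i < n then x $ i else 0)"

definition symm_form :: "nat \<Rightarrow> complex vec \<Rightarrow> complex vec \<Rightarrow> complex" where
  "symm_form n x y = (\<Sum>i<2*n. x $ i * y $ (2*n - 1 - i))"


section \<open>Groups\<close>

definition GL :: "nat \<Rightarrow> complex mat set" where
  "GL N = {g \<in> carrier_mat N N. det g \<noteq> 0}"

definition SO :: "nat \<Rightarrow> complex mat set" where
  "SO n = {g \<in> carrier_mat (2*n) (2*n). det g = 1 \<and>
             (\<forall>x\<in>carrier_vec (2*n). \<forall>y\<in>carrier_vec (2*n).
                symm_form n (g *\<^sub>v x) (g *\<^sub>v y) = symm_form n x y)}"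

definition Borel :: "nat \<Rightarrow> complex mat set" where
  "Borel n = {g \<in> SO n. \<forall>i<2*n. \<forall>j<2*n. j < i \<longrightarrow> g $$ (i, j) = 0}"

definition Borel_opp :: "nat \<Rightarrow> complex mat set" where
  "Borel_opp n = {g \<in> SO n. \<forall>i<2*n. \<forall>j<2*n. i < j \<longrightarrow> g $$ (i, j) = 0}"

definition weyl_reps :: "nat \<Rightarrow> (int \<Rightarrow> int) \<Rightarrow> complex mat set" where
  "weyl_reps n w =
     {g \<in> SO n. \<forall>i\<in>{1..2*n}. \<exists>a.
        g *\<^sub>v basis_vec (2*n) i = a \<cdot>\<^sub>v basis_vec (2*n) (weyl_embed n w i)}"


section \<open>Flag varieties and the Zariski topology\<close>

text \<open>
  A flag \<open>F\<close> in an \<open>N\<close>-dimensional space is a function whose value at \<open>i \<le> N\<close> is the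
  \<open>i\<close>-dimensional member; beyond \<open>N\<close> it is constantly the whole space.
\<close>

type_synonym flag = "nat \<Rightarrow> complex vec set"

definition complete_flags :: "nat \<Rightarrow> flag set" where
  "complete_flags N =
     {F. (\<forall>i\<le>N. csubspace N (F i) \<and> cdim N (F i) = i) \<and>
         (\<forall>i<N. F i \<subseteq> F (Suc i)) \<and>
         (\<forall>i>N. F i = carrier_vec N)}"

text \<open>
  The flag of the coset of \<open>g\<close> modulo upper triangular matrices: its \<open>i\<close>-th member is
  spanned by the first \<open>i\<close> columns of \<open>g\<close>.
\<close>

definition flag_of :: "nat \<Rightarrow> complex mat \<Rightarrow> flag" where
  "flag_of N g = (\<lambda>i. cspan N (set (take i (cols g))))"

inductive_set poly_functions :: "nat \<Rightarrow> (complex mat \<Rightarrow> complex) set" for N :: nat where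
  const: "(\<lambda>A. a) \<in> poly_functions N"
| entry: "i < N \<Longrightarrow> j < N \<Longrightarrow> (\<lambda>A. A $$ (i, j)) \<in> poly_functions N"
| add: "p \<in> poly_functions N \<Longrightarrow> q \<in> poly_functions N \<Longrightarrow> (\<lambda>A. p A + q A) \<in> poly_functions N"
| mult: "p \<in> poly_functions N \<Longrightarrow> q \<in> poly_functions N \<Longrightarrow> (\<lambda>A. p A * q A) \<in> poly_functions N"

definition zariski_open :: "nat \<Rightarrow> complex mat set \<Rightarrow> bool" where
  "zariski_open N U \<longleftrightarrow>
     (\<exists>P \<subseteq> poly_functions N. U = {A \<in> carrier_mat N N. \<exists>p\<in>P. p A \<noteq> 0})"

definition zariski_GL :: "nat \<Rightarrow> complex mat topology" where
  "zariski_GL N = subtopology (topology (zariski_open N)) (GL N)"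

text \<open>
  The flag variety of \<open>GL N\<close> carries the quotient topology along \<open>flag_of N\<close>, which is its
  Zariski topology because the quotient morphism of algebraic varieties is open.
\<close>

definition zariski_flags :: "nat \<Rightarrow> flag topology" where
  "zariski_flags N =
     topology (\<lambda>U. U \<subseteq> complete_flags N \<and>
                   openin (zariski_GL N) {g \<in> GL N. flag_of N g \<in> U})"

lemma istopology_zariski: "istopology (zariski_open N)"
  unfolding istopology_def
proof (intro conjI allI impI)
  fix S T assume "zariski_open N S" "zariski_open N T"
  then obtain P Q where P: "P \<subseteq> poly_functions N" "S = {A \<in> carrier_mat N N. \<exists>p\<in>P. p A \<noteq> 0}"
    and Q: "Q \<subseteq> poly_functions N" "T = {A \<in> carrier_mat N N. \<exists>p\<in>Q. p A \<noteq> 0}"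
    unfolding zariski_open_def by blast
  let ?R = "{(\<lambda>A. p A * q A) | p q. p \<in> P \<and> q \<in> Q}"
  have R: "?R \<subseteq> poly_functions N"
  proof
    fix r assume "r \<in> ?R"
    then obtain p q where pq: "p \<in> P" "q \<in> Q" "r = (\<lambda>A. p A * q A)" by blast
    have "p \<in> poly_functions N" "q \<in> poly_functions N" using pq P(1) Q(1) by blast+
    then show "r \<in> poly_functions N" unfolding pq(3) by (rule poly_functions.mult)
  qed
  have "S \<inter> T = {A \<in> carrier_mat N N. \<exists>r\<in>?R. r A \<noteq> 0}"
  proof (intro equalityI subsetI)
    fix A assume "A \<in> S \<inter> T"
    then obtain p q where A: "A \<in> carrier_mat N N" and pq: "p \<in> P" "q \<in> Q"
      and nz: "p A \<noteq> 0" "q A \<noteq> 0"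
      unfolding P(2) Q(2) by blast
    have "(\<lambda>A. p A * q A) \<in> ?R" using pq by blast
    moreover have "(\<lambda>A. p A * q A) A \<noteq> 0" using nz by simp
    ultimately have "\<exists>r\<in>?R. r A \<noteq> 0" by (rule bexI[rotated, where x = "\<lambda>A. p A * q A"])
    with A show "A \<in> {A \<in> carrier_mat N N. \<exists>r\<in>?R. r A \<noteq> 0}" unfolding mem_Collect_eq by (rule conjI)
  next
    fix A assume "A \<in> {A \<in> carrier_mat N N. \<exists>r\<in>?R. r A \<noteq> 0}"
    then obtain r where A: "A \<in> carrier_mat N N" and r: "r \<in> ?R" "r A \<noteq> 0" by blast
    from r(1) obtain p q where pq: "p \<in> P" "q \<in> Q" "r = (\<lambda>A. p A * q A)" by blast
    have "p A * q A \<noteq> 0" using r(2) unfolding pq(3) .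
    then have "p A \<noteq> 0" "q A \<noteq> 0" by simp_all
    then show "A \<in> S \<inter> T" unfolding P(2) Q(2) using A pq(1,2) by blast
  qed
  with R show "zariski_open N (S \<inter> T)"
    unfolding zariski_open_def by blast
next
  fix \<K> assume "\<forall>K\<in>\<K>. zariski_open N K"
  then have "\<forall>K\<in>\<K>. \<exists>P. P \<subseteq> poly_functions N \<and> K = {A \<in> carrier_mat N N. \<exists>p\<in>P. p A \<noteq> 0}"
    unfolding zariski_open_def by blast
  from bchoice[OF this] obtain f where f: "\<forall>K\<in>\<K>. f K \<subseteq> poly_functions N \<and>
      K = {A \<in> carrier_mat N N. \<exists>p\<in>f K. p A \<noteq> 0}" ..
  have "(\<Union>K\<in>\<K>. f K) \<subseteq> poly_functions N" using f by blast
  moreover have "\<Union>\<K> = {A \<in> carrier_mat N N. \<exists>p\<in>(\<Union>K\<in>\<K>. f K). p A \<noteq> 0}"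
  proof (intro equalityI subsetI)
    fix A assume "A \<in> \<Union>\<K>"
    then obtain K where "K \<in> \<K>" "A \<in> K" by blast
    moreover from this have "A \<in> {A \<in> carrier_mat N N. \<exists>p\<in>f K. p A \<noteq> 0}" using f by blast
    ultimately show "A \<in> {A \<in> carrier_mat N N. \<exists>p\<in>(\<Union>K\<in>\<K>. f K). p A \<noteq> 0}" by blast
  next
    fix A assume "A \<in> {A \<in> carrier_mat N N. \<exists>p\<in>(\<Union>K\<in>\<K>. f K). p A \<noteq> 0}"
    then obtain K where "K \<in> \<K>" "A \<in> {A \<in> carrier_mat N N. \<exists>p\<in>f K. p A \<noteq> 0}" by blast
    moreover from this have "A \<in> K" using f by blast
    ultimately show "A \<in> \<Union>\<K>" by blast
  qed
  ultimately show "zariski_open N (\<Union>\<K>)"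
    unfolding zariski_open_def by blast
qed

lemma topspace_zariski: "topspace (topology (zariski_open N)) = carrier_mat N N"
proof -
  have "zariski_open N (carrier_mat N N)"
    unfolding zariski_open_def
    by (rule exI[of _ "{\<lambda>A. 1}"]) (auto intro: poly_functions.const)
  moreover have "U \<subseteq> carrier_mat N N" if "zariski_open N U" for U
    using that unfolding zariski_open_def by blast
  ultimately show ?thesis
    unfolding topspace_def topology_inverse'[OF istopology_zariski] by blast
qed

lemma topspace_zariski_GL: "topspace (zariski_GL N) = GL N"
  unfolding zariski_GL_def topspace_subtopology topspace_zariski GL_def by blast

lemma openin_zariski_flags:
  "openin (zariski_flags N) U \<longleftrightarrow>
     U \<subseteq> complete_flags N \<and> openin (zariski_GL N) {g \<in> GL N. flag_of N g \<in> U}"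
proof -
  have "istopology (\<lambda>U. U \<subseteq> complete_flags N \<and> openin (zariski_GL N) {g \<in> GL N. flag_of N g \<in> U})"
    unfolding istopology_def
  proof (intro conjI allI impI; (elim conjE)?)
    fix S T
    assume "openin (zariski_GL N) {g \<in> GL N. flag_of N g \<in> S}"
      "openin (zariski_GL N) {g \<in> GL N. flag_of N g \<in> T}"
    moreover have "{g \<in> GL N. flag_of N g \<in> S \<inter> T} =
        {g \<in> GL N. flag_of N g \<in> S} \<inter> {g \<in> GL N. flag_of N g \<in> T}" by blast
    ultimately show "openin (zariski_GL N) {g \<in> GL N. flag_of N g \<in> S \<inter> T}"
      by (simp add: openin_Int)
  next
    fix \<K> assume *: "\<forall>K\<in>\<K>. K \<subseteq> complete_flags N \<and> openin (zariski_GL N) {g \<in> GL N. flag_of N g \<in> K}"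
    have "{g \<in> GL N. flag_of N g \<in> \<Union>\<K>} = (\<Union>K\<in>\<K>. {g \<in> GL N. flag_of N g \<in> K})" by blast
    moreover have "openin (zariski_GL N) (\<Union>K\<in>\<K>. {g \<in> GL N. flag_of N g \<in> K})"
      by (rule openin_Union) (use * in blast)
    ultimately show "openin (zariski_GL N) {g \<in> GL N. flag_of N g \<in> \<Union>\<K>}"
      by (simp only:)
  qed blast+
  then show ?thesis
    unfolding zariski_flags_def by (simp add: topology_inverse')
qed

lemma flag_of_complete:
  assumes "g \<in> GL N"
  shows "flag_of N g \<in> complete_flags N"
proof -
  interpret vec_space "TYPE(complex)" N .
  have g: "g \<in> carrier_mat N N" and dg: "det g \<noteq> 0" using assms by (auto simp: GL_def)
  have rk: "rank g = N" using det_rank_iff[OF g] dg by blast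
  have dist: "distinct (cols g)" using non_distinct_low_rank[OF g] rk by auto
  have li: "lin_indpt (set (cols g))" using full_rank_lin_indpt[OF g rk dist] .
  have cc: "set (cols g) \<subseteq> carrier_vec N" using cols_dim g by blast
  have len: "length (cols g) = N" using g by simp
  have sub: "set (take i (cols g)) \<subseteq> carrier_vec N" for i
    using cc set_take_subset by fastforce
  have "cdim N (span (set (take i (cols g)))) = i" if "i \<le> N" for i
  proof -
    have "lin_indpt (set (take i (cols g)))"
      by (rule subset_li_is_li[OF li set_take_subset])
    then have "maximal (set (take i (cols g))) (\<lambda>T. T \<subseteq> set (take i (cols g)) \<and> lin_indpt T)"
      by (auto simp: maximal_def)
    then have "vectorspace.dim class_ring (span_vs (set (take i (cols g)))) = card (set (take i (cols g)))"
      by (intro dim_span) (use sub in auto)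
    also have "\<dots> = i" using dist that len by (simp add: distinct_card)
    finally show ?thesis by (simp add: cdim_def)
  qed
  moreover have "csubspace N (span (set (take i (cols g))))" for i
    using span_is_subspace sub by simp
  moreover have "span (set (take i (cols g))) \<subseteq> span (set (take (Suc i) (cols g)))" for i
    by (intro span_is_monotone set_take_subset_set_take) simp
  moreover have "span (set (take i (cols g))) = carrier_vec N" if "i > N" for i
  proof -
    have "card (set (cols g)) = dim"
      unfolding distinct_card[OF dist] len dim_is_n ..
    then have "basis (set (cols g))"
      using li cc by (metis List.finite_set dim_li_is_basis fin_dim order_refl)
    then show ?thesis using that len by (simp add: basis_def)
  qed
  ultimately show ?thesis by (simp add: complete_flags_def flag_of_def)
qed

lemma topspace_zariski_flags: "topspace (zariski_flags N) = complete_flags N"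
proof -
  have "{g \<in> GL N. flag_of N g \<in> complete_flags N} = topspace (zariski_GL N)"
    using flag_of_complete by (auto simp: topspace_zariski_GL)
  then have "openin (zariski_flags N) (complete_flags N)"
    unfolding openin_zariski_flags by (simp only: openin_topspace subset_refl simp_thms)
  then have "complete_flags N \<subseteq> topspace (zariski_flags N)"
    by (rule openin_subset)
  moreover have "topspace (zariski_flags N) \<subseteq> complete_flags N"
    using openin_topspace[of "zariski_flags N"] unfolding openin_zariski_flags[of N "topspace _"] by (rule conjunct1)
  ultimately show ?thesis by (rule equalityI[rotated])
qed

text \<open>The flag variety of \<open>SO n\<close>, as a subvariety of the one of \<open>GL (2*n)\<close>.\<close>

definition flags_D :: "nat \<Rightarrow> flag set" where
  "flags_D n = flag_of (2*n) ` SO n"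

definition zariski_D :: "nat \<Rightarrow> flag topology" where
  "zariski_D n = subtopology (zariski_flags (2*n)) (flags_D n)"


section \<open>Schubert varieties, Richardson varieties and orbits\<close>

definition schubert :: "nat \<Rightarrow> (int \<Rightarrow> int) \<Rightarrow> flag set" where
  "schubert n w = zariski_D n closure_of
     {flag_of (2*n) (b * g * b') | b g b'. b \<in> Borel n \<and> g \<in> weyl_reps n w \<and> b' \<in> Borel n}"

definition schubert_opp :: "nat \<Rightarrow> (int \<Rightarrow> int) \<Rightarrow> flag set" where
  "schubert_opp n w = zariski_D n closure_of
     {flag_of (2*n) (b * g * b') | b g b'. b \<in> Borel_opp n \<and> g \<in> weyl_reps n w \<and> b' \<in> Borel n}"

definition richardson :: "nat \<Rightarrow> (int \<Rightarrow> int) \<Rightarrow> (int \<Rightarrow> int) \<Rightarrow> flag set" where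
  "richardson n u v = schubert n u \<inter> schubert_opp n v"

definition orbit_GL :: "nat \<Rightarrow> clan \<Rightarrow> flag set" where
  "orbit_GL n c =
     {F \<in> complete_flags (2*n).
        (\<forall>i\<in>{1..2*n}.
           cdim (2*n) (F i \<inter> E_space n) = card {k\<in>{1..i}. c k = Plus} + num_pairs c i \<and>
           cdim (2*n) (F i \<inter> E_tilde n) = card {k\<in>{1..i}. c k = Minus} + num_pairs c i) \<and>
        (\<forall>i\<in>{1..2*n}. \<forall>j\<in>{1..2*n}. i < j \<longrightarrow>
           cdim (2*n) {proj_E n x + y | x y. x \<in> F i \<and> y \<in> F j} =
             j + card {(s, t). 1 \<le> s \<and> s \<le> i \<and> j < t \<and> t \<le> 2*n \<and> matched c s t})}"

definition orbit_D :: "nat \<Rightarrow> clan \<Rightarrow> flag set" where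
  "orbit_D n c = orbit_GL n c \<inter> flags_D n"

definition orbit_closure_D :: "nat \<Rightarrow> clan \<Rightarrow> flag set" where
  "orbit_closure_D n c = zariski_D n closure_of orbit_D n c"

end

(*
  The subspaces g^{-1} E and g^{-1} E~ are Lagrangian, and their positions relative to the standard
  flag are recorded by two sets J and L of n positions, one from each mirror pair. On the orbit these
  are the positions of + or second occurrences, and of - or second occurrences; J alone is also
  constant on the Schubert cell of u, and L alone on the opposite cell of v. A density argument in
  the stabilizer of E shows that every flag with the right J lies in X_u, and similarly for L and X^v.

  Conversely, dimensions of intersections are semicontinuous, so on the Richardson variety J and L
  dominate the two sets of the orbit. If J or L is not yet equal to its set, an explicit curve through the
  flag brings it closer while the other stays fixed: the two Lagrangian subspaces can be moved independently,
  because a correction by GL(n) x GL(n) makes the resulting matrix orthogonal again. By induction the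
  flag is a limit of flags with both positions right. Among these, a line towards an explicit base
  point of the orbit makes the third family of dimensions generically as large as possible; avoiding
  (1,2,1,2) is what makes the first two families force the same numbers as an upper bound.
*)
theory Submission
  imports Defs "Jordan_Normal_Form.Char_Poly"
begin

section \<open>Dimensions of subspaces of coordinate space\<close>

text \<open>Neither dimension counts of varieties nor irreducibility enter. Membership in a closure
  comes from a curve of matrices with a limit at t = 0, and a bound on a closure from one
  polynomial, a determinant, that does not vanish at the given point. The obstacle is that the
  curves have to run in SO(2n). It is met by families 1 + t f with f skew and f f = 0, by the copy
  of GL(n) in SO(2n), and, when two subspaces move at once, by a block diagonal factor. Parity is
  the second constraint. The determinant of an orthogonal g is the sign of the number of elements of
  J from n on, so J changes in two places at a time. Conditions (2) and (3) on a type D clan make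
  the corresponding numbers even. This puts u and v into W, gives their permutation matrices
  determinant one, and leaves room for such double moves. The third family of ranks is tied to the
  first two by a count: k is the sum of the two counts below k and of the number of arcs open at k.
  A cut k with few open arcs therefore bounds the dimension of pi(F_i) + F_j.\<close>

definition coord_space :: "nat \<Rightarrow> nat set \<Rightarrow> complex vec set" where
  "coord_space N K = {y \<in> carrier_vec N. \<forall>i<N. i \<notin> K \<longrightarrow> y $ i = 0}"

abbreviation apply_set :: "complex mat \<Rightarrow> complex vec set \<Rightarrow> complex vec set" where
  "apply_set h S \<equiv> (\<lambda>y. h *\<^sub>v y) ` S"

lemma csubspaceI:
  assumes "S \<subseteq> carrier_vec N" "0\<^sub>v N \<in> S" "\<And>x y. x \<in> S \<Longrightarrow> y \<in> S \<Longrightarrow> x + y \<in> S"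
    "\<And>a x. x \<in> S \<Longrightarrow> a \<cdot>\<^sub>v x \<in> S"
  shows "csubspace N S"
proof -
  interpret vec_space "TYPE(complex)" N .
  show ?thesis
    using assms by (auto simp: VectorSpace.subspace_def vec_vs submodule_def vec_module module_vec_simps)
qed

lemma csubspaceD:
  assumes "csubspace N S"
  shows "S \<subseteq> carrier_vec N" "0\<^sub>v N \<in> S" "x \<in> S \<Longrightarrow> y \<in> S \<Longrightarrow> x + y \<in> S"
    "x \<in> S \<Longrightarrow> a \<cdot>\<^sub>v x \<in> S"
proof -
  have *: "submodule class_ring S (cvec_module N)" using assms by (simp add: VectorSpace.subspace_def)
  show "S \<subseteq> carrier_vec N" "0\<^sub>v N \<in> S" "x \<in> S \<Longrightarrow> y \<in> S \<Longrightarrow> x + y \<in> S"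
    using submodule.subset[OF *] submodule.zero_closed[OF *] submodule.m_closed[OF *] by (auto simp: module_vec_simps)
  show "x \<in> S \<Longrightarrow> a \<cdot>\<^sub>v x \<in> S"
    using submodule.smult_closed[OF *, of a x] by (auto simp: module_vec_simps class_ring_simps)
qed

lemma csubspace_coord: "csubspace N (coord_space N K)"
  by (rule csubspaceI) (auto simp: coord_space_def)

lemma csubspace_Int: "csubspace N S \<Longrightarrow> csubspace N T \<Longrightarrow> csubspace N (S \<inter> T)"
  by (rule csubspaceI) (use csubspaceD[where N=N and S=S] csubspaceD[where N=N and S=T] in auto)

lemma csubspace_apply:
  assumes "h \<in> carrier_mat N M" "csubspace M S"
  shows "csubspace N (apply_set h S)"
proof (rule csubspaceI)
  note S = csubspaceD[OF assms(2)]
  show "apply_set h S \<subseteq> carrier_vec N" using assms(1) S by auto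
  show "0\<^sub>v N \<in> apply_set h S" using assms(1) S(2)
    by (intro image_eqI[of _ _ "0\<^sub>v M"]) auto
next
  note S = csubspaceD[OF assms(2)]
  fix x y assume "x \<in> apply_set h S" "y \<in> apply_set h S"
  then obtain a b where ab: "a \<in> S" "b \<in> S" "x = h *\<^sub>v a" "y = h *\<^sub>v b" by blast
  have "x + y = h *\<^sub>v (a + b)" unfolding ab using assms(1) S(1) ab(1,2) mult_add_distrib_mat_vec by (metis subsetD)
  then show "x + y \<in> apply_set h S" using ab S(3) by blast
next
  note S = csubspaceD[OF assms(2)]
  fix a x assume "x \<in> apply_set h S"
  then obtain b where b: "b \<in> S" "x = h *\<^sub>v b" by blast
  have "a \<cdot>\<^sub>v x = h *\<^sub>v (a \<cdot>\<^sub>v b)" unfolding b using assms(1) S(1) b(1) mult_mat_vec by (metis subsetD)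
  then show "a \<cdot>\<^sub>v x \<in> apply_set h S" using b S(4) by blast
qed

text \<open>\<open>cdim\<close> refers to the restricted structure with carrier S, so independence
  and span have to be carried over to the whole space before the exchange lemma applies. Finite
  dimension of S comes first: independent subsets have bounded size, so a maximal one
  exists.\<close>

lemma csubspace_basis:
  assumes "csubspace N S"
  obtains B where "finite B" "B \<subseteq> S" "card B = cdim N S" "S = cspan N B"
    "\<not> LinearCombinations.module.lin_dep class_ring (cvec_module N) B"
proof -
  interpret vec_space "TYPE(complex)" N .
  have sub: "submodule class_ring S V" using assms by (simp add: VectorSpace.subspace_def)
  have vs: "vectorspace class_ring (vs S)" using subspace_is_vs[OF assms] .
  then interpret S: vectorspace class_ring "vs S" .
  have "S.fin_dim"
  proof -
    have c: "S \<subseteq> carrier_vec N" using csubspaceD[OF assms] by auto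
    have small: "finite A \<and> card A \<le> dim" if "A \<subseteq> S \<and> S.lin_indpt A" for A
      using li_le_dim[OF fin_dim, of A] span_li_not_depend(2)[OF _ sub, of A] that c
      by (auto simp: subset_trans)
    have "\<exists>A. finite A \<and> maximal A (\<lambda>T. T \<subseteq> carrier (vs S) \<and> S.lin_indpt T)"
    proof (rule maximal_exists[where N = dim and B = "{}"])
      show "{} \<subseteq> carrier (vs S) \<and> S.lin_indpt {}" by (auto simp: S.lin_dep_def)
    qed (use small in auto)
    then obtain A where "finite A" "maximal A (\<lambda>T. T \<subseteq> carrier (vs S) \<and> S.lin_indpt T)" by blast
    then have "S.basis A" by (intro S.max_li_is_basis) auto
    then show ?thesis using \<open>finite A\<close> unfolding S.basis_def S.fin_dim_def by auto
  qed
  then obtain B where B: "finite B" "S.basis B" using S.finite_basis_exists by blast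
  have BS: "B \<subseteq> S" using B(2) by (simp add: S.basis_def)
  show thesis
  proof
    show "finite B" "B \<subseteq> S" by fact+
    show "card B = cdim N S" unfolding cdim_def using S.dim_basis[OF B] by simp
    show "S = cspan N B" using B(2) span_li_not_depend(1)[OF BS sub] by (simp add: S.basis_def)
    show "lin_indpt B" using B(2) span_li_not_depend(2)[OF BS sub] by (simp add: S.basis_def)
  qed
qed

text \<open>Steinitz exchange. \<open>replacement\<close> supplies a set whose size is at most
  \<open>card D\<close> minus \<open>card B\<close> as an integer; a size is not negative, so its
  mere existence is the inequality.\<close>

lemma cdim_span_le:
  assumes "finite D" "D \<subseteq> carrier_vec N"
  shows "cdim N (cspan N D) \<le> card D"
proof -
  interpret vec_space "TYPE(complex)" N .
  have "csubspace N (span D)" using span_is_subspace assms by auto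
  from csubspace_basis[OF this] obtain B where B: "finite B" "B \<subseteq> span D" "card B = cdim N (span D)"
    "span D = span B" "lin_indpt B" .
  have "D \<subseteq> carrier_vec N" using assms(2) by simp
  from replacement[OF B(1) assms(1) this B(5) B(2)] obtain C :: "complex vec set" where
    "int (card C) \<le> int (card D) - int (card B)" by blast
  then show ?thesis using B(3) by linarith
qed

lemma cdim_mono:
  assumes "csubspace N S" "csubspace N T" "S \<subseteq> T"
  shows "cdim N S \<le> cdim N T"
proof -
  interpret vec_space "TYPE(complex)" N .
  from csubspace_basis[OF assms(1)] obtain B where B: "finite B" "B \<subseteq> S" "card B = cdim N S"
    "S = span B" "lin_indpt B" .
  from csubspace_basis[OF assms(2)] obtain D where D: "finite D" "D \<subseteq> T" "card D = cdim N T"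
    "T = span D" "lin_indpt D" .
  have "D \<subseteq> carrier_vec N" using D(2) csubspaceD(1)[OF assms(2)] by auto
  moreover have "B \<subseteq> span D" using B(2) assms(3) D(4) by blast
  ultimately obtain C :: "complex vec set" where "int (card C) \<le> int (card D) - int (card B)"
    using replacement[OF B(1) D(1) _ B(5)] by meson
  then show ?thesis using B(3) D(3) by linarith
qed

lemma mult_mat_vec_eq_lincomb:
  assumes "h \<in> carrier_mat N M" "y \<in> carrier_vec M"
  shows "h *\<^sub>v y = vec N (\<lambda>i. \<Sum>k<M. h $$ (i,k) * y $ k)"
  using assms by (auto simp: scalar_prod_def atLeast0LessThan)

text \<open>Lets the subspaces below be treated as images of coordinate subspaces under matrices, so
  that questions of dimension become questions about index sets.\<close>

lemma apply_coord_span: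
  assumes h: "h \<in> carrier_mat N M" and K: "K \<subseteq> {..<M}"
  shows "apply_set h (coord_space M K) = cspan N (col h ` K)"
proof
  interpret vec_space "TYPE(complex)" N .
  have cc: "col h ` K \<subseteq> carrier_vec N" using h by auto
  have fK: "finite K" using K finite_subset by blast
  have sub: "csubspace N (span (col h ` K))" using span_is_subspace cc by auto
  show "apply_set h (coord_space M K) \<subseteq> span (col h ` K)"
  proof
    fix x assume "x \<in> apply_set h (coord_space M K)"
    then obtain y where y: "y \<in> carrier_vec M" "\<And>i. i < M \<Longrightarrow> i \<notin> K \<Longrightarrow> y $ i = 0" "x = h *\<^sub>v y"
      by (auto simp: coord_space_def)
    have main: "K' \<subseteq> K \<Longrightarrow> vec N (\<lambda>i. \<Sum>k\<in>K'. h $$ (i,k) * y $ k) \<in> span (col h ` K)" if "finite K'" for K'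
      using that
    proof (induction K')
      case empty
      have "vec N (\<lambda>i. \<Sum>k\<in>{}. h $$ (i,k) * y $ k) = 0\<^sub>v N" by auto
      then show ?case using csubspaceD(2)[OF sub] by simp
    next
      case (insert k K')
      have "k < M" using insert.prems K by auto
      have "vec N (\<lambda>i. \<Sum>l\<in>insert k K'. h $$ (i,l) * y $ l) =
          y $ k \<cdot>\<^sub>v col h k + vec N (\<lambda>i. \<Sum>l\<in>K'. h $$ (i,l) * y $ l)"
        using insert.hyps h \<open>k < M\<close> by auto
      moreover have "col h k \<in> span (col h ` K)" using insert.prems cc by (auto intro: span_mem)
      ultimately show ?case using insert csubspaceD(3,4)[OF sub] by auto
    qed
    have "x = vec N (\<lambda>i. \<Sum>k<M. h $$ (i,k) * y $ k)" using mult_mat_vec_eq_lincomb[OF h y(1)] y(3) by simp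
    also have "\<dots> = vec N (\<lambda>i. \<Sum>k\<in>K. h $$ (i,k) * y $ k)"
      using K y(2) by (intro eq_vecI) (auto intro!: sum.mono_neutral_right)
    finally show "x \<in> span (col h ` K)" using main[OF fK] by simp
  qed
  show "span (col h ` K) \<subseteq> apply_set h (coord_space M K)"
  proof (rule span_is_subset)
    show "submodule class_ring (apply_set h (coord_space M K)) V"
      using csubspace_apply[OF h csubspace_coord] by (simp add: VectorSpace.subspace_def)
    show "col h ` K \<subseteq> apply_set h (coord_space M K)"
    proof
      fix x assume "x \<in> col h ` K"
      then obtain k where k: "k \<in> K" "x = col h k" by blast
      have "k < M" using k K by auto
      have "x = h *\<^sub>v unit_vec M k" using k h \<open>k < M\<close> by (auto intro!: eq_vecI)
      moreover have "unit_vec M k \<in> coord_space M K" using k by (auto simp: coord_space_def unit_vec_def)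
      ultimately show "x \<in> apply_set h (coord_space M K)" by blast
    qed
  qed
qed

lemma mat_inverse_exists:
  fixes h :: "complex mat"
  assumes "h \<in> carrier_mat N N" "det h \<noteq> 0"
  obtains h' where "h' \<in> carrier_mat N N" "h * h' = 1\<^sub>m N" "h' * h = 1\<^sub>m N"
  using det_non_zero_imp_unit[OF assms, of "()"] unfolding Units_def ring_mat_def by auto

lemma cdim_apply_coord_le:
  assumes h: "h \<in> carrier_mat N M" and K: "K \<subseteq> {..<M}"
  shows "cdim N (apply_set h (coord_space M K)) \<le> card K"
proof -
  have "finite K" using K finite_subset by blast
  have "cdim N (cspan N (col h ` K)) \<le> card (col h ` K)"
    using h \<open>finite K\<close> by (intro cdim_span_le) auto
  also have "\<dots> \<le> card K" using \<open>finite K\<close> by (rule card_image_le)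
  finally show ?thesis unfolding apply_coord_span[OF assms] .
qed

lemma cols_lin_indpt:
  assumes h: "h \<in> carrier_mat N N" "det h \<noteq> 0" and K: "K \<subseteq> {..<N}"
  shows "\<not> LinearCombinations.module.lin_dep class_ring (cvec_module N) (col h ` K)" "inj_on (col h) K"
proof -
  interpret vec_space "TYPE(complex)" N .
  have rk: "rank h = N" using det_rank_iff[OF h(1)] h(2) by blast
  have dist: "distinct (cols h)" using non_distinct_low_rank[OF h(1)] rk by auto
  have li: "lin_indpt (set (cols h))" using full_rank_lin_indpt[OF h(1) rk dist] .
  have "col h ` K \<subseteq> set (cols h)" using h K by (auto simp: cols_def)
  then show "lin_indpt (col h ` K)" by (rule subset_li_is_li[OF li])
  show "inj_on (col h) K"
    using dist h(1) K unfolding cols_def distinct_map by (auto simp: atLeast0LessThan intro: inj_on_subset)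
qed

lemma cdim_apply_coord:
  assumes h: "h \<in> carrier_mat N N" "det h \<noteq> 0" and K: "K \<subseteq> {..<N}"
  shows "cdim N (apply_set h (coord_space N K)) = card K"
proof (rule antisym)
  show "cdim N (apply_set h (coord_space N K)) \<le> card K" by (rule cdim_apply_coord_le[OF h(1) K])
  interpret vec_space "TYPE(complex)" N .
  have fK: "finite K" using K finite_subset by blast
  have sub: "csubspace N (apply_set h (coord_space N K))" by (rule csubspace_apply[OF h(1) csubspace_coord])
  from csubspace_basis[OF this] obtain B where B: "finite B" "B \<subseteq> apply_set h (coord_space N K)"
    "card B = cdim N (apply_set h (coord_space N K))" "apply_set h (coord_space N K) = span B" "lin_indpt B" .
  have Bc: "B \<subseteq> carrier_vec N" using B(2) csubspaceD(1)[OF sub] by blast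
  have "col h ` K \<subseteq> span B" unfolding B(4)[symmetric] apply_coord_span[OF h(1) K]
    using h by (intro in_own_span) auto
  moreover have "finite (col h ` K)" "B \<subseteq> carrier_vec N" using fK Bc by auto
  ultimately obtain C :: "complex vec set" where "int (card C) \<le> int (card B) - int (card (col h ` K))"
    using replacement[OF _ B(1) _ cols_lin_indpt(1)[OF h K]] by meson
  then have "card (col h ` K) \<le> card B" by linarith
  then show "card K \<le> cdim N (apply_set h (coord_space N K))"
    using cols_lin_indpt(2)[OF h K] B(3) by (simp add: card_image)
qed

lemma apply_set_mult:
  assumes "A \<in> carrier_mat N M" "B \<in> carrier_mat M L" "S \<subseteq> carrier_vec L"
  shows "apply_set A (apply_set B S) = apply_set (A * B) S"
  unfolding image_image
proof (rule image_cong[OF refl])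
  fix y assume "y \<in> S"
  then have "y \<in> carrier_vec L" using assms(3) by blast
  then show "A *\<^sub>v (B *\<^sub>v y) = (A * B) *\<^sub>v y" using assoc_mult_mat_vec[OF assms(1,2)] by simp
qed

lemma apply_set_one: "S \<subseteq> carrier_vec N \<Longrightarrow> apply_set (1\<^sub>m N) S = S"
  by (auto simp: subset_iff image_iff)

text \<open>A basis of S, written as the columns of \<open>Bm\<close>, makes S the image of a full
  coordinate space. Then h S is the image of that space under \<open>h * Bm\<close>, and the bound
  by the number of columns applies.\<close>

lemma cdim_apply_le:
  assumes h: "h \<in> carrier_mat N M" and S: "csubspace M S"
  shows "cdim N (apply_set h S) \<le> cdim M S"
proof -
  interpret M: vec_space "TYPE(complex)" M .
  from csubspace_basis[OF S] obtain B where B: "finite B" "B \<subseteq> S" "card B = cdim M S" "S = M.span B" "M.lin_indpt B" .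
  have Bc: "B \<subseteq> carrier_vec M" using B(2) csubspaceD(1)[OF S] by blast
  obtain bs where bs: "set bs = B" "distinct bs" using finite_distinct_list[OF B(1)] by blast
  define Bm where "Bm = mat_of_cols M bs"
  have Bm: "Bm \<in> carrier_mat M (length bs)" by (auto simp: Bm_def)
  have "col Bm ` {..<length bs} = B"
  proof -
    have "col Bm i = bs ! i" if "i < length bs" for i
      using that bs Bc unfolding Bm_def by (metis col_mat_of_cols nth_mem subsetD)
    then show ?thesis using bs by (force simp: in_set_conv_nth)
  qed
  then have S': "S = apply_set Bm (coord_space (length bs) {..<length bs})"
    using apply_coord_span[OF Bm, of "{..<length bs}"] B(4) by simp
  have "apply_set h S = apply_set (h * Bm) (coord_space (length bs) {..<length bs})"
    unfolding S' by (rule apply_set_mult[OF h Bm]) (auto simp: coord_space_def)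
  then have "cdim N (apply_set h S) \<le> card {..<length bs}"
    using cdim_apply_coord_le[of "h * Bm" N "length bs" "{..<length bs}"] h Bm by auto
  then show ?thesis using bs B(3) distinct_card by fastforce
qed

lemma cdim_apply:
  assumes h: "h \<in> carrier_mat N N" "det h \<noteq> 0" and S: "csubspace N S"
  shows "cdim N (apply_set h S) = cdim N S"
proof (rule antisym)
  show "cdim N (apply_set h S) \<le> cdim N S" by (rule cdim_apply_le[OF h(1) S])
  obtain h' where h': "h' \<in> carrier_mat N N" "h' * h = 1\<^sub>m N" using mat_inverse_exists[OF h] by blast
  have Sc: "S \<subseteq> carrier_vec N" using csubspaceD[OF S] by simp
  have "apply_set h' (apply_set h S) = S"
    using apply_set_mult[OF h'(1) h(1) Sc] apply_set_one[OF Sc] h'(2) by simp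
  then show "cdim N S \<le> cdim N (apply_set h S)"
    using cdim_apply_le[OF h'(1) csubspace_apply[OF h(1) S]] by simp
qed

lemma flag_of_eq:
  assumes "g \<in> carrier_mat N N" "i \<le> N"
  shows "flag_of N g i = apply_set g (coord_space N {..<i})"
proof -
  have "col g ` {..<i} = set (take i (cols g))"
    using assms by (auto simp: cols_def take_map image_iff take_upt)
  then show ?thesis unfolding flag_of_def using apply_coord_span[OF assms(1), of "{..<i}"] assms(2) by simp
qed

lemma cspan_basis_vec:
  assumes "K \<subseteq> {..<N}"
  shows "cspan N (unit_vec N ` K) = coord_space N K"
proof -
  have 1: "col (1\<^sub>m N) ` K = unit_vec N ` K" using assms by (intro image_cong) (auto)
  have "coord_space N K \<subseteq> carrier_vec N" by (auto simp: coord_space_def)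
  from apply_set_one[OF this] show ?thesis
    using apply_coord_span[OF one_carrier_mat[of N] assms] unfolding 1 by simp
qed

lemma E_space_eq: "E_space n = coord_space (2*n) {..<n}"
proof -
  have "basis_vec (2*n) ` {1..n} = unit_vec (2*n) ` {..<n}"
  proof -
    have "{..<n} = (\<lambda>i. i - 1) ` {1..n}" by (force intro!: image_eqI[where x = "Suc _"])
    then show ?thesis by (simp add: image_image basis_vec_def)
  qed
  then show ?thesis unfolding E_space_def using cspan_basis_vec[of "{..<n}" "2*n"] by simp
qed

lemma E_tilde_eq: "E_tilde n = coord_space (2*n) {n..<2*n}"
proof -
  have "basis_vec (2*n) ` {n+1..2*n} = unit_vec (2*n) ` {n..<2*n}"
  proof -
    have "{n..<2*n} = (\<lambda>i. i - 1) ` {n+1..2*n}"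
    proof (unfold set_eq_iff, rule allI)
      fix x show "x \<in> {n..<2*n} \<longleftrightarrow> x \<in> (\<lambda>i. i - 1) ` {n+1..2*n}"
        by (force intro!: image_eqI[where x = "Suc x"])
    qed
    then show ?thesis by (simp add: image_image basis_vec_def)
  qed
  moreover have "{n..<2*n} \<subseteq> {..<2*n}" by auto
  ultimately show ?thesis unfolding E_tilde_def by (simp only: cspan_basis_vec)
qed

section \<open>Adjoints and orthogonal matrices\<close>

text \<open>The adjoint for \<open>symm_form\<close>, see \<open>symm_form_adjoint\<close>. As the
  reflection in the antidiagonal it keeps upper triangular and lower triangular matrices so.\<close>

definition adjoint :: "nat \<Rightarrow> complex mat \<Rightarrow> complex mat" where
  "adjoint n A = mat (2*n) (2*n) (\<lambda>(i,j). A $$ (2*n-1-j, 2*n-1-i))"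

text \<open>The Gram matrix of the form. It exchanges E and its complement, so a statement about E
  applied to \<open>flip_mat n * g\<close> becomes one about the complement.\<close>

definition flip_mat :: "nat \<Rightarrow> complex mat" where
  "flip_mat n = mat (2*n) (2*n) (\<lambda>(i,j). if i + j + 1 = 2*n then 1 else 0)"

definition diag_mat_of :: "nat \<Rightarrow> nat set \<Rightarrow> complex mat" where
  "diag_mat_of N K = mat N N (\<lambda>(i,j). if i = j \<and> i \<in> K then 1 else 0)"

definition orth :: "nat \<Rightarrow> complex mat set" where
  "orth n = {A \<in> carrier_mat (2*n) (2*n). adjoint n A * A = 1\<^sub>m (2*n)}"

abbreviation P_E :: "nat \<Rightarrow> complex mat" where
  "P_E n \<equiv> diag_mat_of (2*n) {..<n}"

abbreviation P_F :: "nat \<Rightarrow> complex mat" where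
  "P_F n \<equiv> diag_mat_of (2*n) {n..}"

abbreviation Mat :: "nat \<Rightarrow> complex mat set" where
  "Mat n \<equiv> carrier_mat (2*n) (2*n)"

lemma mat_index_mult:
  assumes "A \<in> carrier_mat N M" "B \<in> carrier_mat M L" "i < N" "j < L"
  shows "(A * B) $$ (i,j) = (\<Sum>k<M. A $$ (i,k) * B $$ (k,j))"
  using assms by (auto simp: scalar_prod_def atLeast0LessThan)

lemma diag_mat_of_carrier [simp]: "diag_mat_of N K \<in> carrier_mat N N"
  by (simp add: diag_mat_of_def)

lemma diag_mat_of_dim [simp]: "dim_row (diag_mat_of N K) = N" "dim_col (diag_mat_of N K) = N"
  by (simp_all add: diag_mat_of_def)

lemma diag_mat_of_index: "i < N \<Longrightarrow> j < N \<Longrightarrow> diag_mat_of N K $$ (i,j) = (if i = j \<and> i \<in> K then 1 else 0)"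
  by (simp add: diag_mat_of_def)

lemma diag_mult_left_index:
  assumes "A \<in> carrier_mat N M" "i < N" "j < M"
  shows "(diag_mat_of N K * A) $$ (i,j) = (if i \<in> K then A $$ (i,j) else 0)"
proof -
  have "(diag_mat_of N K * A) $$ (i,j) = (\<Sum>k<N. (if k = i then (if i \<in> K then A $$ (i,j) else 0) else 0))"
    unfolding mat_index_mult[OF diag_mat_of_carrier assms]
    using assms by (intro sum.cong) (auto simp: diag_mat_of_index)
  then show ?thesis using assms by simp
qed

lemma diag_mult_right_index:
  assumes "A \<in> carrier_mat M N" "i < M" "j < N"
  shows "(A * diag_mat_of N K) $$ (i,j) = (if j \<in> K then A $$ (i,j) else 0)"
proof -
  have "(A * diag_mat_of N K) $$ (i,j) = (\<Sum>k<N. (if k = j then (if j \<in> K then A $$ (i,j) else 0) else 0))"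
    unfolding mat_index_mult[OF assms(1) diag_mat_of_carrier assms(2,3)]
    using assms by (intro sum.cong) (auto simp: diag_mat_of_index)
  then show ?thesis using assms by simp
qed

lemma flip_carrier [simp]: "flip_mat n \<in> Mat n"
  by (simp add: flip_mat_def)

lemma flip_dim [simp]: "dim_row (flip_mat n) = 2*n" "dim_col (flip_mat n) = 2*n"
  by (simp_all add: flip_mat_def)

lemma flip_index: "i < 2*n \<Longrightarrow> j < 2*n \<Longrightarrow> flip_mat n $$ (i,j) = (if i = 2*n-1-j then 1 else 0)"
  by (auto simp: flip_mat_def)

lemma flip_index': "i < 2*n \<Longrightarrow> j < 2*n \<Longrightarrow> flip_mat n $$ (i,j) = (if j = 2*n-1-i then 1 else 0)"
  by (auto simp: flip_mat_def)

lemma flip_mult_index: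
  assumes "A \<in> carrier_mat (2*n) M" "i < 2*n" "j < M"
  shows "(flip_mat n * A) $$ (i,j) = A $$ (2*n-1-i, j)"
proof -
  have "(flip_mat n * A) $$ (i,j) = (\<Sum>k<2*n. (if k = 2*n-1-i then A $$ (2*n-1-i,j) else 0))"
    unfolding mat_index_mult[OF flip_carrier assms]
    using assms by (intro sum.cong) (auto simp: flip_index')
  then show ?thesis using assms by simp
qed

lemma mult_flip_index:
  assumes "A \<in> carrier_mat M (2*n)" "i < M" "j < 2*n"
  shows "(A * flip_mat n) $$ (i,j) = A $$ (i, 2*n-1-j)"
proof -
  have "(A * flip_mat n) $$ (i,j) = (\<Sum>k<2*n. (if k = 2*n-1-j then A $$ (i,2*n-1-j) else 0))"
    unfolding mat_index_mult[OF assms(1) flip_carrier assms(2,3)]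
    using assms by (intro sum.cong) (auto simp: flip_index)
  then show ?thesis using assms by simp
qed

lemma flip_mult_vec_index:
  assumes "y \<in> carrier_vec (2*n)" "i < 2*n"
  shows "(flip_mat n *\<^sub>v y) $ i = y $ (2*n-1-i)"
proof -
  have "(flip_mat n *\<^sub>v y) $ i = (\<Sum>k<2*n. flip_mat n $$ (i,k) * y $ k)"
    using mult_mat_vec_eq_lincomb[OF flip_carrier assms(1)] assms(2) by simp
  also have "\<dots> = (\<Sum>k<2*n. (if k = 2*n-1-i then y $ (2*n-1-i) else 0))"
    using assms by (intro sum.cong) (auto simp: flip_index')
  finally have "(flip_mat n *\<^sub>v y) $ i = (\<Sum>k<2*n. (if k = 2*n-1-i then y $ (2*n-1-i) else 0))" .
  then show ?thesis using assms by simp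
qed

lemma flip_flip: "flip_mat n * flip_mat n = 1\<^sub>m (2*n)"
  by (rule eq_matI) (auto simp del: index_mult_mat(1) simp: flip_mult_index[OF flip_carrier] flip_index)

lemma det_flip_square: "det (flip_mat n) * det (flip_mat n) = 1"
  using det_mult[OF flip_carrier flip_carrier, of n] by (simp add: flip_flip)

lemma adjoint_carrier [simp]: "adjoint n A \<in> Mat n"
  by (simp add: adjoint_def)

lemma adjoint_dim [simp]: "dim_row (adjoint n A) = 2*n" "dim_col (adjoint n A) = 2*n"
  by (simp_all add: adjoint_def)

lemma adjoint_index: "i < 2*n \<Longrightarrow> j < 2*n \<Longrightarrow> adjoint n A $$ (i,j) = A $$ (2*n-1-j, 2*n-1-i)"
  by (simp add: adjoint_def)

lemma adjoint_flip:
  assumes "A \<in> Mat n"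
  shows "adjoint n A = flip_mat n * (transpose_mat A * flip_mat n)"
proof (rule eq_matI)
  fix i j assume "i < dim_row (flip_mat n * (transpose_mat A * flip_mat n))"
    "j < dim_col (flip_mat n * (transpose_mat A * flip_mat n))"
  then have ij: "i < 2*n" "j < 2*n" by auto
  have "transpose_mat A * flip_mat n \<in> Mat n" using assms by (metis flip_carrier mult_carrier_mat transpose_carrier_mat)
  from flip_mult_index[OF this ij] mult_flip_index[of "transpose_mat A" "2*n" n "2*n-1-i" j] assms ij
  show "adjoint n A $$ (i,j) = (flip_mat n * (transpose_mat A * flip_mat n)) $$ (i,j)"
    by (simp add: adjoint_index)
qed auto

lemma det_adjoint:
  assumes "A \<in> Mat n"
  shows "det (adjoint n A) = det A"
proof -
  have "det (adjoint n A) = det (flip_mat n) * (det (transpose_mat A) * det (flip_mat n))"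
    unfolding adjoint_flip[OF assms] using assms
    by (subst det_mult[of _ "2*n"], simp, simp, subst det_mult[of _ "2*n"]) auto
  also have "\<dots> = det A" using det_transpose[OF assms] det_flip_square[of n] by (simp add: ac_simps)
  finally show ?thesis .
qed

lemma adjoint_adjoint: "A \<in> Mat n \<Longrightarrow> adjoint n (adjoint n A) = A"
  by (rule eq_matI) (auto simp: adjoint_index)

lemma adjoint_one: "adjoint n (1\<^sub>m (2*n)) = 1\<^sub>m (2*n)"
  by (rule eq_matI) (auto simp: adjoint_index)

lemma adjoint_add: "A \<in> Mat n \<Longrightarrow> B \<in> Mat n \<Longrightarrow> adjoint n (A + B) = adjoint n A + adjoint n B"
  by (rule eq_matI) (auto simp: adjoint_index)

lemma adjoint_smult: "A \<in> Mat n \<Longrightarrow> adjoint n (a \<cdot>\<^sub>m A) = a \<cdot>\<^sub>m adjoint n A"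
  by (rule eq_matI) (auto simp: adjoint_index)

lemma flip_pos:
  fixes i j m :: nat
  assumes "i < 2*m" "j < 2*m"
  shows "2*m-1-j = 2*m-1-i \<longleftrightarrow> i = j" "2*m-1-j < m \<longleftrightarrow> m \<le> j" "2*m-1-j < 2*m" "2*m-1-(2*m-1-j) = j"
    "m \<le> 2*m-1-j \<longleftrightarrow> j < m" "2*m-1-j = i \<longleftrightarrow> j = 2*m-1-i"
  using assms by linarith+

lemma adjoint_PE: "adjoint n (P_E n) = P_F n"
proof (rule eq_matI)
  fix i j assume "i < dim_row (P_F n)" "j < dim_col (P_F n)"
  then have ij: "i < 2*n" "j < 2*n" by simp_all
  then show "adjoint n (P_E n) $$ (i,j) = P_F n $$ (i,j)"
    unfolding adjoint_index[OF ij] diag_mat_of_index[OF ij]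
    by (subst diag_mat_of_index) (use flip_pos[OF ij] in auto)
qed simp_all

lemma adjoint_PF: "adjoint n (P_F n) = P_E n"
  using adjoint_adjoint[of "P_E n" n] by (simp add: adjoint_PE)

lemma sum_flip: "(\<Sum>k<(m::nat). f (m - 1 - k)) = (\<Sum>k<m. f k)"
  using sum.nat_diff_reindex[of f m] by simp

lemma adjoint_mult:
  assumes "A \<in> Mat n" "B \<in> Mat n"
  shows "adjoint n (A * B) = adjoint n B * adjoint n A"
proof (rule eq_matI)
  fix i j assume "i < dim_row (adjoint n B * adjoint n A)" "j < dim_col (adjoint n B * adjoint n A)"
  then have ij: "i < 2*n" "j < 2*n" by auto
  have "(adjoint n B * adjoint n A) $$ (i,j) = (\<Sum>k<2*n. B $$ (2*n-1-k, 2*n-1-i) * A $$ (2*n-1-j, 2*n-1-k))"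
    unfolding mat_index_mult[OF adjoint_carrier adjoint_carrier ij]
    using ij by (intro sum.cong) (auto simp: adjoint_index)
  also have "\<dots> = (\<Sum>k<2*n. B $$ (k, 2*n-1-i) * A $$ (2*n-1-j, k))"
    by (rule sum_flip)
  also have "\<dots> = adjoint n (A * B) $$ (i,j)"
    using ij by (simp add: adjoint_index mat_index_mult[OF assms] mult.commute del: index_mult_mat(1))
  finally show "adjoint n (A * B) $$ (i,j) = (adjoint n B * adjoint n A) $$ (i,j)" ..
qed auto

lemma PE_PF:
  "P_E n * P_E n = P_E n" "P_F n * P_F n = P_F n" "P_E n * P_F n = 0\<^sub>m (2*n) (2*n)"
  "P_F n * P_E n = 0\<^sub>m (2*n) (2*n)" "P_E n + P_F n = 1\<^sub>m (2*n)" "P_F n + P_E n = 1\<^sub>m (2*n)"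
  by (auto intro!: eq_matI simp del: index_mult_mat(1)
      simp: diag_mult_left_index[OF diag_mat_of_carrier] diag_mat_of_index)

lemma flip_PE: "flip_mat n * P_E n = P_F n * flip_mat n"
  by (auto intro!: eq_matI simp del: index_mult_mat(1)
      simp: diag_mult_left_index[OF flip_carrier] diag_mult_right_index[OF flip_carrier] flip_index)

context
  fixes n :: nat
begin

lemma Mat_mult_assoc: "A \<in> Mat n \<Longrightarrow> B \<in> Mat n \<Longrightarrow> C \<in> Mat n \<Longrightarrow> (A * B) * C = A * (B * C)"
  by (rule assoc_mult_mat)

lemma Mat_mult_closed [simp]: "A \<in> Mat n \<Longrightarrow> B \<in> Mat n \<Longrightarrow> A * B \<in> Mat n"
  by (rule mult_carrier_mat)

lemma Mat_distrib:
  "A \<in> Mat n \<Longrightarrow> B \<in> Mat n \<Longrightarrow> C \<in> Mat n \<Longrightarrow> (A + B) * C = A * C + B * C"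
  "A \<in> Mat n \<Longrightarrow> B \<in> Mat n \<Longrightarrow> C \<in> Mat n \<Longrightarrow> A * (B + C) = A * B + A * C"
  by (rule add_mult_distrib_mat mult_add_distrib_mat; assumption)+

lemma Mat_add_assoc: "A \<in> Mat n \<Longrightarrow> B \<in> Mat n \<Longrightarrow> C \<in> Mat n \<Longrightarrow> (A + B) + C = A + (B + C)"
  by (rule assoc_add_mat)

lemma Mat_mult_one [simp]: "A \<in> Mat n \<Longrightarrow> 1\<^sub>m (2*n) * A = A" "A \<in> Mat n \<Longrightarrow> A * 1\<^sub>m (2*n) = A"
  by (rule left_mult_one_mat right_mult_one_mat; assumption)+

lemma Mat_zero_simps [simp]: "A \<in> Mat n \<Longrightarrow> 0\<^sub>m (2*n) (2*n) * A = 0\<^sub>m (2*n) (2*n)" "A \<in> Mat n \<Longrightarrow> A * 0\<^sub>m (2*n) (2*n) = 0\<^sub>m (2*n) (2*n)"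
  "A \<in> Mat n \<Longrightarrow> 0\<^sub>m (2*n) (2*n) + A = A" "A \<in> Mat n \<Longrightarrow> A + 0\<^sub>m (2*n) (2*n) = A"
  by auto

lemma Mat_mult_vec_closed [simp]: "A \<in> Mat n \<Longrightarrow> y \<in> carrier_vec (2*n) \<Longrightarrow> A *\<^sub>v y \<in> carrier_vec (2*n)"
  by (rule mult_mat_vec_carrier)

lemma Mat_mult_vec_assoc: "A \<in> Mat n \<Longrightarrow> B \<in> Mat n \<Longrightarrow> y \<in> carrier_vec (2*n) \<Longrightarrow> (A * B) *\<^sub>v y = A *\<^sub>v (B *\<^sub>v y)"
  by (rule assoc_mult_mat_vec)

lemma orthD:
  assumes "g \<in> orth n"
  shows "g \<in> Mat n" "adjoint n g * g = 1\<^sub>m (2*n)" "g * adjoint n g = 1\<^sub>m (2*n)"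
proof -
  show g: "g \<in> Mat n" "adjoint n g * g = 1\<^sub>m (2*n)" using assms by (auto simp: orth_def)
  then show "g * adjoint n g = 1\<^sub>m (2*n)" using mat_mult_left_right_inverse[OF adjoint_carrier g(1)] by simp
qed

lemma orth_cancel:
  assumes "g \<in> orth n" "A \<in> Mat n"
  shows "adjoint n g * (g * A) = A" "g * (adjoint n g * A) = A"
  using assms orthD[OF assms(1)] by (simp_all flip: Mat_mult_assoc)

lemma orthI: "g \<in> Mat n \<Longrightarrow> g * adjoint n g = 1\<^sub>m (2*n) \<Longrightarrow> g \<in> orth n"
  using mat_mult_left_right_inverse[of g "2*n" "adjoint n g"] by (simp add: orth_def)

lemma orth_mult: "g \<in> orth n \<Longrightarrow> h \<in> orth n \<Longrightarrow> g * h \<in> orth n"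
proof -
  assume gh: "g \<in> orth n" "h \<in> orth n"
  note G = orthD[OF gh(1)] and H = orthD[OF gh(2)]
  have "adjoint n (g * h) * (g * h) = adjoint n h * (adjoint n g * (g * h))"
    using G(1) H(1) by (simp add: adjoint_mult Mat_mult_assoc)
  then show ?thesis using G(1) H(1,2) orth_cancel[OF gh(1) H(1)] by (simp add: orth_def)
qed

lemma orth_adjoint: "g \<in> orth n \<Longrightarrow> adjoint n g \<in> orth n"
  by (rule orthI) (simp_all add: orthD adjoint_adjoint)

lemma orth_one: "1\<^sub>m (2*n) \<in> orth n"
  by (simp add: orth_def adjoint_one)

lemma orth_flip: "flip_mat n \<in> orth n"
proof -
  have "adjoint n (flip_mat n) = flip_mat n"
    by (rule eq_matI) (auto simp: adjoint_index flip_mat_def)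
  then show ?thesis by (simp add: orth_def flip_flip)
qed

lemma orth_det: "g \<in> orth n \<Longrightarrow> det g * det g = 1"
  using det_mult[of "adjoint n g" "2*n" g] by (simp add: det_adjoint orthD)

lemma orth_det_nonzero: "g \<in> orth n \<Longrightarrow> det g \<noteq> 0"
  by (drule orth_det) auto

lemma orth_det_cases: "g \<in> orth n \<Longrightarrow> det g = 1 \<or> det g = -1"
  by (drule orth_det) (simp add: square_eq_1_iff)

lemma symm_form_adjoint:
  assumes "A \<in> Mat n" "x \<in> carrier_vec (2*n)" "y \<in> carrier_vec (2*n)"
  shows "symm_form n (A *\<^sub>v x) y = symm_form n x (adjoint n A *\<^sub>v y)"
proof -
  have "symm_form n (A *\<^sub>v x) y = (\<Sum>i<2*n. (\<Sum>k<2*n. A $$ (i,k) * x $ k) * y $ (2*n-1-i))"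
    unfolding symm_form_def using assms
    by (intro sum.cong) (auto simp: mult_mat_vec_eq_lincomb[OF assms(1,2)])
  also have "\<dots> = (\<Sum>k<2*n. x $ k * (\<Sum>i<2*n. A $$ (i,k) * y $ (2*n-1-i)))"
    unfolding sum_distrib_left sum_distrib_right by (subst sum.swap) (simp add: ac_simps)
  also have "\<dots> = (\<Sum>k<2*n. x $ k * (\<Sum>i<2*n. A $$ (2*n-1-i,k) * y $ (2*n-1-(2*n-1-i))))"
    by (subst sum_flip[symmetric]) simp
  also have "\<dots> = symm_form n x (adjoint n A *\<^sub>v y)"
    unfolding symm_form_def using assms
    by (intro sum.cong refl)
      (auto simp: mult_mat_vec_eq_lincomb[OF adjoint_carrier assms(3)] adjoint_index intro!: arg_cong2[where f = "(*)"] sum.cong)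
  finally show ?thesis .
qed

lemma symm_form_unit:
  assumes "i < 2*n" "y \<in> carrier_vec (2*n)"
  shows "symm_form n (unit_vec (2*n) i) y = y $ (2*n-1-i)"
proof -
  have "symm_form n (unit_vec (2*n) i) y = (\<Sum>k<2*n. if k = i then y $ (2*n-1-i) else 0)"
    unfolding symm_form_def using assms by (intro sum.cong) (auto simp: unit_vec_def)
  then show ?thesis using assms by simp
qed

lemma SO_iff: "g \<in> SO n \<longleftrightarrow> g \<in> orth n \<and> det g = 1"
proof
  assume "g \<in> SO n"
  then have g: "g \<in> Mat n" "det g = 1"
    and pres: "\<And>x y. x \<in> carrier_vec (2*n) \<Longrightarrow> y \<in> carrier_vec (2*n) \<Longrightarrow>
      symm_form n (g *\<^sub>v x) (g *\<^sub>v y) = symm_form n x y"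
    by (auto simp: SO_def)
  have "adjoint n g * g = 1\<^sub>m (2*n)"
  proof (rule eq_matI)
    fix i j assume "i < dim_row (1\<^sub>m (2*n))" "j < dim_col (1\<^sub>m (2*n))"
    then have ij: "i < 2*n" "j < 2*n" by auto
    \<comment> \<open>The form pairs coordinate i with coordinate 2n-1-i only, so pairing with this
      unit vector reads off entry i.\<close>
    define a b :: "complex vec" where "a = unit_vec (2*n) (2*n-1-i)" and "b = unit_vec (2*n) j"
    have ab: "a \<in> carrier_vec (2*n)" "b \<in> carrier_vec (2*n)" by (auto simp: a_def b_def)
    have "symm_form n a (adjoint n g *\<^sub>v (g *\<^sub>v b)) = symm_form n a b"
      using pres[OF ab] symm_form_adjoint[OF g(1) ab(1), of "g *\<^sub>v b"] g ab by simp
    then have "(adjoint n g *\<^sub>v (g *\<^sub>v b)) $ i = b $ i"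
      unfolding a_def using ij g ab by (simp add: symm_form_unit del: index_mult_mat_vec)
    then have "((adjoint n g * g) *\<^sub>v b) $ i = b $ i" using Mat_mult_vec_assoc[OF adjoint_carrier g(1) ab(2)] by simp
    then show "(adjoint n g * g) $$ (i,j) = 1\<^sub>m (2*n) $$ (i,j)"
      using ij g unfolding b_def by (simp add: row_mult) 
  qed (use g in auto)
  then show "g \<in> orth n \<and> det g = 1" using g by (simp add: orth_def)
next
  assume a: "g \<in> orth n \<and> det g = 1"
  note g = orthD[of g]
  have "symm_form n (g *\<^sub>v x) (g *\<^sub>v y) = symm_form n x y" if "x \<in> carrier_vec (2*n)" "y \<in> carrier_vec (2*n)" for x y
    using symm_form_adjoint[of g x "g *\<^sub>v y"] a g that Mat_mult_vec_assoc[of "adjoint n g" g y] by simp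
  then show "g \<in> SO n" using a g by (simp add: SO_def)
qed

definition upper_tri :: "nat \<Rightarrow> complex mat \<Rightarrow> bool" where
  "upper_tri N A \<longleftrightarrow> A \<in> carrier_mat N N \<and> (\<forall>i<N. \<forall>j<N. j < i \<longrightarrow> A $$ (i,j) = 0)"

definition lower_tri :: "nat \<Rightarrow> complex mat \<Rightarrow> bool" where
  "lower_tri N A \<longleftrightarrow> A \<in> carrier_mat N N \<and> (\<forall>i<N. \<forall>j<N. i < j \<longrightarrow> A $$ (i,j) = 0)"

lemma Borel_iff: "b \<in> Borel n \<longleftrightarrow> b \<in> SO n \<and> upper_tri (2*n) b"
  by (auto simp: Borel_def upper_tri_def SO_def)

lemma Borel_opp_iff: "b \<in> Borel_opp n \<longleftrightarrow> b \<in> SO n \<and> lower_tri (2*n) b"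
  by (auto simp: Borel_opp_def lower_tri_def SO_def)

lemma upper_tri_mult:
  assumes "upper_tri N A" "upper_tri N B"
  shows "upper_tri N (A * B)"
  unfolding upper_tri_def
proof (intro conjI allI impI)
  show "A * B \<in> carrier_mat N N" using assms by (auto simp: upper_tri_def)
  fix i j assume ij: "i < N" "j < N" "j < i"
  have "A \<in> carrier_mat N N" "B \<in> carrier_mat N N" using assms by (auto simp: upper_tri_def)
  note mat_index_mult[OF this ij(1,2)]
  moreover have "A $$ (i,k) * B $$ (k,j) = 0" if "k < N" for k
    using assms ij that unfolding upper_tri_def by (cases "k < i") auto
  ultimately show "(A * B) $$ (i,j) = 0" by simp
qed

lemma upper_tri_adjoint: "upper_tri (2*n) A \<Longrightarrow> upper_tri (2*n) (adjoint n A)"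
  by (auto simp: upper_tri_def adjoint_index)

lemma upper_tri_one: "upper_tri N (1\<^sub>m N)"
  by (auto simp: upper_tri_def)

lemma SO_mult: "g \<in> SO n \<Longrightarrow> h \<in> SO n \<Longrightarrow> g * h \<in> SO n"
  by (simp add: SO_iff orth_mult det_mult[OF orthD(1) orthD(1)])

lemma SO_adjoint: "g \<in> SO n \<Longrightarrow> adjoint n g \<in> SO n"
  by (simp add: SO_iff orth_adjoint det_adjoint orthD(1))

lemma SO_GL: "g \<in> SO n \<Longrightarrow> g \<in> GL (2*n)"
  by (auto simp: SO_def GL_def)

lemma SO_carrier: "g \<in> SO n \<Longrightarrow> g \<in> Mat n"
  by (auto simp: SO_def)

text \<open>Since \<open>1 + \<phi>\<close> is the square of \<open>1 + \<phi>/2\<close>, its determinant is a square of \<open>\<plusminus>1\<close>.\<close>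

lemma one_plus_skew_SO:
  assumes f: "f \<in> Mat n" and ff: "f * f = 0\<^sub>m (2*n) (2*n)" and skew: "adjoint n f = - f"
  shows "1\<^sub>m (2*n) + f \<in> SO n" "adjoint n (1\<^sub>m (2*n) + f) = 1\<^sub>m (2*n) + (- f)"
proof -
  have "adjoint n (1\<^sub>m (2*n) + f) = 1\<^sub>m (2*n) + (- f) \<and> 1\<^sub>m (2*n) + f \<in> orth n"
    if f: "f \<in> Mat n" and ff: "f * f = 0\<^sub>m (2*n) (2*n)" and skew: "adjoint n f = - f" for f
  proof -
    have a: "adjoint n (1\<^sub>m (2*n) + f) = 1\<^sub>m (2*n) + (- f)" using f skew by (simp add: adjoint_add adjoint_one)
    have mf: "- f \<in> Mat n" using f by simp
    have "(- f) * f = - (f * f)" using f by auto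
    then have "(1\<^sub>m (2*n) + (- f)) * (1\<^sub>m (2*n) + f) = 1\<^sub>m (2*n) + (f + (- f))"
      using f mf ff by (simp add: Mat_distrib) (intro eq_matI, auto)
    also have "\<dots> = 1\<^sub>m (2*n)" using f by (intro eq_matI) auto
    finally show ?thesis using a f by (simp add: orth_def)
  qed
  note * = this
  show "adjoint n (1\<^sub>m (2*n) + f) = 1\<^sub>m (2*n) + (- f)" using *[OF assms] by blast
  define h where "h = (1/2) \<cdot>\<^sub>m f"
  have h: "h \<in> Mat n" using f by (simp add: h_def)
  have hh: "h * h = 0\<^sub>m (2*n) (2*n)" unfolding h_def
    using mult_smult_assoc_mat[OF f, of "(1/2) \<cdot>\<^sub>m f" "2*n" "1/2"] mult_smult_distrib[OF f f, of "1/2"] f ff by simp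
  have "adjoint n h = - h" unfolding h_def using skew f by (simp add: adjoint_smult) (intro eq_matI, auto)
  from *[OF h hh this] have "1\<^sub>m (2*n) + h \<in> orth n" by blast
  from orth_det[OF this] have "det ((1\<^sub>m (2*n) + h) * (1\<^sub>m (2*n) + h)) = 1"
    using det_mult[of "1\<^sub>m (2*n) + h" "2*n" "1\<^sub>m (2*n) + h"] h by simp
  moreover have "(1\<^sub>m (2*n) + h) * (1\<^sub>m (2*n) + h) = 1\<^sub>m (2*n) + f"
  proof -
    have "(1\<^sub>m (2*n) + h) * (1\<^sub>m (2*n) + h) = 1\<^sub>m (2*n) + (h + h)"
      using h hh by (simp add: Mat_distrib Mat_add_assoc)
    also have "\<dots> = 1\<^sub>m (2*n) + f" unfolding h_def using f by (intro eq_matI) auto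
    finally show ?thesis .
  qed
  ultimately show "1\<^sub>m (2*n) + f \<in> SO n" using *[OF assms] by (simp add: SO_iff)
qed

end

section \<open>Matrix identities under equations between dimensions\<close>

lemma mult_mat_assoc: "dim_col A = dim_row B \<Longrightarrow> dim_col B = dim_row C \<Longrightarrow> (A * B) * C = A * (B * (C :: complex mat))"
  by (rule assoc_mult_mat[of _ "dim_row A" "dim_row B" _ "dim_row C" _ "dim_col C"]) auto

lemma mult_mat_distrib:
  "dim_row A = dim_row B \<Longrightarrow> dim_col A = dim_col B \<Longrightarrow> dim_col A = dim_row C \<Longrightarrow> (A + B) * C = A * C + B * (C :: complex mat)"
  "dim_row B = dim_row C \<Longrightarrow> dim_col B = dim_col C \<Longrightarrow> dim_col A = dim_row B \<Longrightarrow> A * (B + C) = A * B + A * C"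
   apply (rule add_mult_distrib_mat[of _ "dim_row B" "dim_row C" _ _ "dim_col C"]; auto intro!: carrier_matI)
  apply (rule mult_add_distrib_mat[of _ "dim_row A" "dim_row C" _ "dim_col C"]; auto intro!: carrier_matI)
  done

lemma mult_mat_vec_assoc: "dim_col A = dim_row B \<Longrightarrow> dim_col B = dim_vec v \<Longrightarrow> (A * B) *\<^sub>v v = A *\<^sub>v (B *\<^sub>v (v :: complex vec))"
  by (rule assoc_mult_mat_vec[of _ "dim_row A" "dim_row B" _ "dim_vec v"]) (auto intro: carrier_vecI)

lemma mult_mat_one [simp]:
  "dim_row A = N \<Longrightarrow> 1\<^sub>m N * A = (A :: complex mat)" "dim_col A = N \<Longrightarrow> A * 1\<^sub>m N = A"
  "dim_vec v = N \<Longrightarrow> 1\<^sub>m N *\<^sub>v v = (v :: complex vec)"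
  using left_mult_one_mat[of A N "dim_col A"] right_mult_one_mat[of A "dim_row A" N] one_mult_mat_vec[of v N]
  by (auto intro: carrier_vecI)

section \<open>The relative position of a flag and a Lagrangian subspace\<close>

text \<open>Positions are counted from 0 here, whereas clans and permutations count from 1.\<close>

definition lag :: "nat \<Rightarrow> nat set \<Rightarrow> bool" where
  "lag n J \<longleftrightarrow> J \<subseteq> {..<2*n} \<and> (\<forall>i<2*n. i \<in> J \<longleftrightarrow> 2*n-1-i \<notin> J)"

definition cols_in_E :: "nat \<Rightarrow> complex mat \<Rightarrow> nat set \<Rightarrow> bool" where
  "cols_in_E n g J \<longleftrightarrow> (\<forall>j\<in>J. \<forall>i\<in>{n..<2*n}. g $$ (i,j) = 0)"

text \<open>
  The \<open>B\<close>-orbit of the Lagrangian subspace \<open>h\<^sup>-\<^sup>1 E\<close> contains the span of the \<open>e\<^sub>j\<close>,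
  \<open>j \<in> J\<close>; equivalently \<open>hB\<close> lies in the parabolic cell indexed by \<open>J\<close>. The position of
  the complementary subspace is read off from \<open>flip_mat n * h\<close>.
\<close>

definition lag_pos :: "nat \<Rightarrow> complex mat \<Rightarrow> nat set \<Rightarrow> bool" where
  "lag_pos n h J \<longleftrightarrow> lag n J \<and> (\<exists>b\<in>orth n. upper_tri (2*n) b \<and> cols_in_E n (h * b) J)"

text \<open>The coordinates of a reduced echelon basis outside its leading positions J; skewness
  says that the spanned subspace is isotropic. Products of such matrices vanish, so the matrices 1 +
  f form an abelian group of upper triangular isometries.\<close>

definition skew_echelon :: "nat \<Rightarrow> nat set \<Rightarrow> complex mat \<Rightarrow> bool" where
  "skew_echelon n J f \<longleftrightarrow> f \<in> Mat n \<and> adjoint n f = - f \<and>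
     (\<forall>i<2*n. \<forall>k<2*n. f $$ (i,k) \<noteq> 0 \<longrightarrow> i \<notin> J \<and> k \<in> J \<and> i < k)"

lemma lagD:
  assumes "lag n J"
  shows "J \<subseteq> {..<2*n}" "i \<in> J \<Longrightarrow> i < 2*n" "i \<in> J \<Longrightarrow> 2*n-1-i \<notin> J" "i < 2*n \<Longrightarrow> i \<notin> J \<Longrightarrow> 2*n-1-i \<in> J"
  using assms unfolding lag_def by blast+

lemma flag_of_eq':
  assumes "g \<in> carrier_mat N N"
  shows "flag_of N g i = apply_set g (coord_space N {..<min i N})"
proof -
  have "flag_of N g i = flag_of N g (min i N)" using assms by (cases "i \<le> N") (auto simp: flag_of_def min_def)
  then show ?thesis using flag_of_eq[OF assms, of "min i N"] by simp
qed

lemma upper_tri_apply: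
  assumes b: "upper_tri N b"
  shows "apply_set b (coord_space N {..<i}) \<subseteq> coord_space N {..<i}"
proof
  fix x assume "x \<in> apply_set b (coord_space N {..<i})"
  then obtain y where y: "y \<in> carrier_vec N" "\<And>k. k < N \<Longrightarrow> \<not> k < i \<Longrightarrow> y $ k = 0" "x = b *\<^sub>v y"
    by (auto simp: coord_space_def)
  have bc: "b \<in> carrier_mat N N" using b by (simp add: upper_tri_def)
  have "x $ k = 0" if "k < N" "\<not> k < i" for k
  proof -
    have "b $$ (k,l) * y $ l = 0" if "l < N" for l
      using that \<open>k < N\<close> \<open>\<not> k < i\<close> b y(2)[of l] by (cases "l < k") (auto simp: upper_tri_def)
    then show ?thesis unfolding y(3) mult_mat_vec_eq_lincomb[OF bc y(1)] using that by (simp add: sum.neutral)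
  qed
  then show "x \<in> coord_space N {..<i}" using bc y by (auto simp: coord_space_def)
qed

text \<open>Both b and its inverse b' map every standard coordinate subspace into itself.\<close>

lemma flag_of_mult_upper:
  assumes g: "g \<in> carrier_mat N N" and b: "upper_tri N b" "upper_tri N b'" "b * b' = 1\<^sub>m N"
  shows "flag_of N (g * b) = flag_of N g"
proof
  fix i
  let ?C = "coord_space N {..<min i N}"
  have bc: "b \<in> carrier_mat N N" "b' \<in> carrier_mat N N" using b by (auto simp: upper_tri_def)
  have C: "?C \<subseteq> carrier_vec N" by (auto simp: coord_space_def)
  have "?C \<subseteq> apply_set b ?C"
  proof -
    have "?C = apply_set b (apply_set b' ?C)"
      using apply_set_mult[OF bc C] apply_set_one[OF C] b(3) by simp
    then show ?thesis using upper_tri_apply[OF b(2), of "min i N"] by blast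
  qed
  then have "apply_set b ?C = ?C" using upper_tri_apply[OF b(1), of "min i N"] by blast
  then have "apply_set (g * b) ?C = apply_set g ?C" using apply_set_mult[OF g bc(1) C] by simp
  then show "flag_of N (g * b) i = flag_of N g i"
    using flag_of_eq'[OF g] flag_of_eq'[of "g * b" N] g bc by simp
qed

context
  fixes n :: nat
begin

text \<open>The mirror map takes the elements of J from n on onto the elements below n that are
  missing from J.\<close>

lemma lag_cards:
  assumes "lag n J"
  shows "card J = n" "card (J \<inter> {..<n}) + card (J \<inter> {n..}) = n" "finite J"
proof -
  show f: "finite J" using lagD(1)[OF assms] finite_subset by blast
  have 1: "2*n-1-i \<in> {..<n} - J" "2*n-1-(2*n-1-i) = i" if "i \<in> J \<inter> {n..}" for i
  proof -
    have "i < 2*n" "2*n-1-i \<notin> J" using that lagD(2,3)[OF assms] by blast+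
    then show "2*n-1-i \<in> {..<n} - J" "2*n-1-(2*n-1-i) = i" using that by auto
  qed
  have 2: "2*n-1-i \<in> J \<inter> {n..}" "2*n-1-(2*n-1-i) = i" if "i \<in> {..<n} - J" for i
  proof -
    have "i < 2*n" using that by auto
    moreover from this have "2*n-1-i \<in> J" using that lagD(4)[OF assms] by blast
    ultimately show "2*n-1-i \<in> J \<inter> {n..}" "2*n-1-(2*n-1-i) = i" using that by auto
  qed
  have "bij_betw (\<lambda>i. 2*n-1-i) (J \<inter> {n..}) ({..<n} - J)"
    by (rule bij_betw_byWitness[where f' = "\<lambda>i. 2*n-1-i"]) (use 1 2 in blast)+
  then have 1: "card (J \<inter> {n..}) = card ({..<n} - J)" by (rule bij_betw_same_card)
  have "card ({..<n} - J) + card (J \<inter> {..<n}) = card (({..<n} - J) \<union> (J \<inter> {..<n}))"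
    by (rule card_Un_disjoint[symmetric]) auto
  also have "({..<n} - J) \<union> (J \<inter> {..<n}) = {..<n}" by auto
  finally show 2: "card (J \<inter> {..<n}) + card (J \<inter> {n..}) = n" using 1 by simp
  have "J = (J \<inter> {..<n}) \<union> (J \<inter> {n..})" by auto
  moreover have "card ((J \<inter> {..<n}) \<union> (J \<inter> {n..})) = card (J \<inter> {..<n}) + card (J \<inter> {n..})"
    using f by (intro card_Un_disjoint) auto
  ultimately show "card J = n" using 2 by simp
qed

text \<open>In the forward direction y is recovered by applying \<open>adjoint n g\<close> to a
  vector of E. Row i of the adjoint is column 2n-1-i of g read backwards, and this index lies in J
  when i does not; so the coordinates in E meet only entries known to vanish.\<close>

lemma cols_in_E_iff:
  assumes g: "g \<in> orth n" and J: "lag n J" and k: "cols_in_E n g J" and y: "y \<in> carrier_vec (2*n)"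
  shows "g *\<^sub>v y \<in> E_space n \<longleftrightarrow> y \<in> coord_space (2*n) J"
proof
  note gD = orthD[OF g]
  assume x: "g *\<^sub>v y \<in> E_space n"
  define x where "x = g *\<^sub>v y"
  have xc: "x \<in> carrier_vec (2*n)" "\<And>i. i < 2*n \<Longrightarrow> n \<le> i \<Longrightarrow> x $ i = 0"
    using x by (auto simp: x_def E_space_eq coord_space_def)
  have yx: "y = adjoint n g *\<^sub>v x" unfolding x_def using gD y by (simp flip: mult_mat_vec_assoc)
  have "y $ i = 0" if "i < 2*n" "i \<notin> J" for i
  proof -
    have "2*n-1-i \<in> J" using that lagD(4)[OF J] by blast
    then have "adjoint n g $$ (i,k) * x $ k = 0" if "k < 2*n" for k
      using that \<open>i < 2*n\<close> k xc(2)[of k] by (cases "n \<le> k") (auto simp: adjoint_index cols_in_E_def)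
    then show ?thesis unfolding yx mult_mat_vec_eq_lincomb[OF adjoint_carrier xc(1)] using that by (simp add: sum.neutral)
  qed
  then show "y \<in> coord_space (2*n) J" using y by (auto simp: coord_space_def)
next
  note gD = orthD[OF g]
  assume yJ: "y \<in> coord_space (2*n) J"
  have "(g *\<^sub>v y) $ i = 0" if "i < 2*n" "n \<le> i" for i
  proof -
    have "g $$ (i,l) * y $ l = 0" if "l < 2*n" for l
      using that \<open>i < 2*n\<close> \<open>n \<le> i\<close> k yJ by (cases "l \<in> J") (auto simp: cols_in_E_def coord_space_def)
    then show ?thesis unfolding mult_mat_vec_eq_lincomb[OF gD(1) y] using that by (simp add: sum.neutral)
  qed
  then show "g *\<^sub>v y \<in> E_space n" using gD y by (auto simp: E_space_eq coord_space_def)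
qed

lemma orth_upper_flag:
  assumes "g \<in> Mat n" "b \<in> orth n" "upper_tri (2*n) b"
  shows "flag_of (2*n) (g * b) = flag_of (2*n) g"
  by (rule flag_of_mult_upper[OF assms(1,3) upper_tri_adjoint[OF assms(3)] orthD(3)[OF assms(2)]])

text \<open>Multiplication by b keeps the flag. For \<open>h * b\<close> the intersection with E is
  the image of the coordinate subspace on J below i, by \<open>cols_in_E_iff\<close>, and an
  invertible matrix preserves its dimension.\<close>

lemma lag_pos_cdim:
  assumes h: "h \<in> orth n" and p: "lag_pos n h J" and i: "i \<le> 2*n"
  shows "cdim (2*n) (flag_of (2*n) h i \<inter> E_space n) = card (J \<inter> {..<i})"
proof -
  from p obtain b where J: "lag n J" and b: "b \<in> orth n" "upper_tri (2*n) b" "cols_in_E n (h * b) J"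
    by (auto simp: lag_pos_def)
  have hb: "h * b \<in> orth n" using h b by (simp add: orth_mult)
  have "flag_of (2*n) h i = apply_set (h * b) (coord_space (2*n) {..<i})"
    using orth_upper_flag[OF orthD(1)[OF h] b(1,2)] flag_of_eq[OF orthD(1)[OF hb] i] by simp
  then have "flag_of (2*n) h i \<inter> E_space n = apply_set (h * b) (coord_space (2*n) (J \<inter> {..<i}))"
    using cols_in_E_iff[OF hb J b(3)] by (auto simp: coord_space_def)
  then show ?thesis
    using cdim_apply_coord[OF orthD(1)[OF hb] orth_det_nonzero[OF hb], of "J \<inter> {..<i}"] i by (simp add: subset_iff)
qed

lemma skew_echelon_props:
  assumes J: "lag n J" and f: "skew_echelon n J f"
  shows "skew_echelon n J f' \<Longrightarrow> f * f' = 0\<^sub>m (2*n) (2*n)" "1\<^sub>m (2*n) + f \<in> SO n"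
    "1\<^sub>m (2*n) + f \<in> orth n" "upper_tri (2*n) (1\<^sub>m (2*n) + f)" "adjoint n (1\<^sub>m (2*n) + f) = 1\<^sub>m (2*n) + (- f)"
proof -
  have fc: "f \<in> Mat n" using f by (simp add: skew_echelon_def)
  have *: "f * f' = 0\<^sub>m (2*n) (2*n)" if f': "skew_echelon n J f'" for f'
  proof (rule eq_matI)
    fix i j assume "i < dim_row (0\<^sub>m (2*n) (2*n))" "j < dim_col (0\<^sub>m (2*n) (2*n))"
    then have ij: "i < 2*n" "j < 2*n" by auto
    have f'c: "f' \<in> Mat n" using f' by (simp add: skew_echelon_def)
    \<comment> \<open>A nonzero entry f (i,k) requires k in J, a nonzero entry f' (k,j) requires k
      outside J.\<close>
    have "f $$ (i,k) * f' $$ (k,j) = 0" if "k < 2*n" for k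
      using that ij f f' unfolding skew_echelon_def by (metis mult_eq_0_iff)
    then show "(f * f') $$ (i,j) = 0\<^sub>m (2*n) (2*n) $$ (i,j)"
      unfolding mat_index_mult[OF fc f'c ij] using ij by (simp add: sum.neutral)
  qed (use fc f' in \<open>auto simp: skew_echelon_def\<close>)
  show "skew_echelon n J f' \<Longrightarrow> f * f' = 0\<^sub>m (2*n) (2*n)" by (rule *)
  have skew: "adjoint n f = - f" using f by (simp add: skew_echelon_def)
  show "1\<^sub>m (2*n) + f \<in> SO n" "adjoint n (1\<^sub>m (2*n) + f) = 1\<^sub>m (2*n) + (- f)"
    using one_plus_skew_SO[OF fc *[OF f] skew] by blast+
  then show "1\<^sub>m (2*n) + f \<in> orth n" by (simp add: SO_iff)
  show "upper_tri (2*n) (1\<^sub>m (2*n) + f)"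
    using f fc unfolding upper_tri_def skew_echelon_def by (auto dest: less_asym)
qed

text \<open>
  The set \<open>J\<close> collects the leading positions of the vectors of \<open>g\<^sup>-\<^sup>1 E\<close>, and
  \<open>1 + f\<close> comes from the reduced echelon basis of that Lagrangian subspace. The matrix \<open>T\<close> below
  is injective because a vector of that subspace is determined by its coordinates in \<open>J\<close>.
\<close>

lemma lagrangian_echelon:
  assumes g: "g \<in> orth n"
  obtains J f where "lag n J" "skew_echelon n J f" "cols_in_E n (g * (1\<^sub>m (2*n) + f)) J"
proof -
  note gD = orthD[OF g]
  let ?N = "2*n"
  \<comment> \<open>The Lagrangian subspace g^-1 E, given by its equations.\<close>
  define A where "A = {y \<in> carrier_vec ?N. \<forall>i\<in>{n..<?N}. (g *\<^sub>v y) $ i = 0}"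
  define J where "J = {j. j < ?N \<and> (\<exists>y\<in>A. y $ j = 1 \<and> (\<forall>k<?N. j < k \<longrightarrow> y $ k = 0))}"
  have Ac: "y \<in> carrier_vec ?N" if "y \<in> A" for y using that by (simp add: A_def)
  have isotropic: "symm_form n y z = 0" if "y \<in> A" "z \<in> A" for y z
  proof -
    have "adjoint n g *\<^sub>v (g *\<^sub>v z) = z" using Ac[OF that(2)] gD by (simp flip: mult_mat_vec_assoc)
    then have "symm_form n y z = symm_form n (g *\<^sub>v y) (g *\<^sub>v z)"
      using symm_form_adjoint[OF gD(1) Ac[OF that(1)], of "g *\<^sub>v z"] gD(1) Ac[OF that(2)] by simp
    also have "\<dots> = 0" unfolding symm_form_def
    proof (rule sum.neutral, rule ballI)
      fix i assume "i \<in> {..<?N}"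
      then show "(g *\<^sub>v y) $ i * (g *\<^sub>v z) $ (?N - 1 - i) = 0"
        using that unfolding A_def by (cases "n \<le> i") auto
    qed
    finally show ?thesis .
  qed
  have top: "\<exists>j\<in>J. y $ j \<noteq> 0 \<and> (\<forall>k<?N. j < k \<longrightarrow> y $ k = 0)" if y: "y \<in> A" "l < ?N" "y $ l \<noteq> 0" for y l
  proof -
    let ?S = "{k. k < ?N \<and> y $ k \<noteq> 0}"
    define j where "j = Max ?S"
    have "finite ?S" "?S \<noteq> {}" using y by auto
    then have j: "j \<in> ?S" and jm: "\<And>k. k \<in> ?S \<Longrightarrow> k \<le> j" unfolding j_def by (rule Max_in, simp)
    define z where "z = (1 / (y $ j)) \<cdot>\<^sub>v y"
    have "z \<in> A" using y(1) gD unfolding A_def z_def by (auto simp: mult_mat_vec)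
    moreover have "z $ j = 1" "\<forall>k<?N. j < k \<longrightarrow> z $ k = 0"
      using j jm Ac[OF y(1)] unfolding z_def by (auto simp: not_le[symmetric])
    ultimately have "j \<in> J" using j unfolding J_def by blast
    moreover have "\<forall>k<?N. j < k \<longrightarrow> y $ k = 0" using jm by (auto simp: not_le[symmetric])
    ultimately show ?thesis using j by blast
  qed
  \<comment> \<open>Vectors with leading positions j and 2n-1-j, normalised to 1 there, would pair
    to 1: in every other term of the form one factor lies beyond the leading position of its
    vector.\<close>
  have excl: "?N-1-j \<notin> J" if jJ: "j \<in> J" for j
  proof
    assume "?N-1-j \<in> J"
    then obtain z where z: "z \<in> A" "z $ (?N-1-j) = 1" "\<And>k. k < ?N \<Longrightarrow> ?N-1-j < k \<Longrightarrow> z $ k = 0"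
      unfolding J_def by blast
    from jJ obtain y where y: "y \<in> A" "y $ j = 1" "\<And>k. k < ?N \<Longrightarrow> j < k \<Longrightarrow> y $ k = 0" and j: "j < ?N"
      unfolding J_def by blast
    have "symm_form n y z = (\<Sum>i<?N. if i = j then 1 else 0)"
      unfolding symm_form_def
    proof (rule sum.cong[OF refl])
      fix i assume i: "i \<in> {..<?N}"
      consider "i = j" | "i < j" | "j < i" by linarith
      then show "y $ i * z $ (?N - 1 - i) = (if i = j then 1 else 0)"
      proof cases
        case 2
        then have "?N-1-j < ?N-1-i" using j by linarith
        then show ?thesis using 2 z(3)[of "?N-1-i"] i by simp
      qed (use y z i in auto)
    qed
    then show False using isotropic[OF y(1) z(1)] j by simp
  qed
  define T where "T = mat ?N ?N (\<lambda>(i,k). if i < n then (if k \<in> J \<and> (k = i \<or> k = ?N-1-i) then 1 else 0) else g $$ (i,k))"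
  have Tc: "T \<in> Mat n" by (simp add: T_def)
  \<comment> \<open>The row of T reserved for the mirror pair of j. At most one index of the pair is
    in J, so this row reads off at most one coordinate.\<close>
  define \<tau> where "\<tau> j = min j (?N-1-j)" for j
  have \<tau>: "\<tau> j < n" if "j < ?N" for j using that unfolding \<tau>_def by linarith
  have Trow: "(T *\<^sub>v y) $ \<tau> j = y $ j" if "j \<in> J" "y \<in> carrier_vec ?N" for y j
  proof -
    have j: "j < ?N" using that by (simp add: J_def)
    have "(T *\<^sub>v y) $ \<tau> j = (\<Sum>k<?N. if k = j then y $ j else 0)"
    proof -
      have "T $$ (\<tau> j, k) * y $ k = (if k = j then y $ j else 0)" if k: "k < ?N" for k
      proof -
        have "k \<in> J \<and> (k = \<tau> j \<or> k = ?N-1-\<tau> j) \<longleftrightarrow> k = j"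
        proof
          assume a: "k \<in> J \<and> (k = \<tau> j \<or> k = ?N-1-\<tau> j)"
          then have "k = j \<or> k = ?N-1-j" using j unfolding \<tau>_def min_def by (auto split: if_splits)
          then show "k = j" using excl[OF \<open>j \<in> J\<close>] a by blast
        qed (use that j \<open>j \<in> J\<close> in \<open>auto simp: \<tau>_def min_def\<close>)
        then show ?thesis using \<tau>[OF j] k unfolding T_def by auto
      qed
      then show ?thesis unfolding mult_mat_vec_eq_lincomb[OF Tc that(2)] using \<tau>[OF j] by simp
    qed
    then show ?thesis using j by simp
  qed
  have Tlow: "(T *\<^sub>v y) $ i = (g *\<^sub>v y) $ i" if "n \<le> i" "i < ?N" "y \<in> carrier_vec ?N" for y i
    unfolding mult_mat_vec_eq_lincomb[OF Tc that(3)] mult_mat_vec_eq_lincomb[OF gD(1) that(3)]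
    using that by (simp add: T_def)
  have "det T \<noteq> 0"
  proof
    assume "det T = 0"
    then obtain y where y: "y \<in> carrier_vec ?N" "y \<noteq> 0\<^sub>v ?N" "T *\<^sub>v y = 0\<^sub>v ?N"
      using det_0_iff_vec_prod_zero_field[OF Tc] by blast
    have yA: "y \<in> A" using y Tlow[OF _ _ y(1)] by (auto simp: A_def simp del: index_mult_mat_vec)
    obtain l where "l < ?N" "y $ l \<noteq> 0" using y(1,2) by (metis carrier_vecD eq_vecI index_zero_vec)
    from top[OF yA this] obtain j where j: "j \<in> J" "y $ j \<noteq> 0" by blast
    have "\<tau> j < ?N" using j \<tau>[of j] by (auto simp: J_def)
    then show False using Trow[OF j(1) y(1)] j(2) y(3) by simp
  qed
  from mat_inverse_exists[OF Tc this] obtain T' where T': "T' \<in> Mat n" "T * T' = 1\<^sub>m ?N" by blast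
  have lag: "lag n J" unfolding lag_def
  proof (intro conjI allI impI)
    show "J \<subseteq> {..<?N}" by (auto simp: J_def)
    fix i assume i: "i < ?N"
    \<comment> \<open>If neither index of the pair were in J, row i of T would be zero, contrary to
      the invertibility of T.\<close>
    have ex: "i \<in> J \<or> ?N-1-i \<in> J" if "i < n" for i
    proof (rule ccontr)
      assume no: "\<not> (i \<in> J \<or> ?N-1-i \<in> J)"
      have "(T * T') $$ (i,i) = (\<Sum>k<?N. T $$ (i,k) * T' $$ (k,i))"
        using that by (intro mat_index_mult[OF Tc T'(1)]) auto
      also have "\<dots> = 0" using that no by (intro sum.neutral) (auto simp: T_def)
      finally show False unfolding T'(2) using that by simp
    qed
    show "i \<in> J \<longleftrightarrow> ?N-1-i \<notin> J"
      using ex[of i] ex[of "?N-1-i"] excl[of i] i by (cases "i < n") auto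
  qed
  define a where "a j = T' *\<^sub>v unit_vec ?N (\<tau> j)" for j
  have ac: "a j \<in> carrier_vec ?N" for j using T' by (simp add: a_def)
  have Ta: "T *\<^sub>v a j = unit_vec ?N (\<tau> j)" for j
    unfolding a_def using Mat_mult_vec_assoc[OF Tc T'(1), of "unit_vec ?N (\<tau> j)"] T'(2) by simp
  have aA: "a j \<in> A" if "j \<in> J" for j
  proof -
    have "\<tau> j < n" using that \<tau> by (auto simp: J_def)
    then show ?thesis using Tlow[OF _ _ ac[of j]] ac unfolding A_def Ta by auto
  qed
  have aJ: "a j $ k = (if k = j then 1 else 0)" if "j \<in> J" "k \<in> J" for j k
  proof -
    have jk: "j < ?N" "k < ?N" using that by (auto simp: J_def)
    have "\<tau> k = \<tau> j \<longleftrightarrow> k = j"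
    proof
      assume "\<tau> k = \<tau> j"
      then have "k = j \<or> k = ?N-1-j" using jk unfolding \<tau>_def min_def by (auto split: if_splits)
      then show "k = j" using excl[OF that(1)] that(2) by blast
    qed simp
    then show ?thesis using Trow[OF that(2) ac[of j]] \<tau>[OF jk(1)] \<tau>[OF jk(2)] unfolding Ta by auto
  qed
  \<comment> \<open>The leading position of \<open>a j\<close> lies in J, where \<open>a j\<close>
    vanishes except at j. So it is j, and all later coordinates are zero.\<close>
  have upper: "i < j" if "j \<in> J" "i < ?N" "i \<notin> J" "a j $ i \<noteq> 0" for i j
  proof -
    from top[OF aA[OF that(1)] that(2,4)] obtain t where t: "t \<in> J" "a j $ t \<noteq> 0" "\<forall>k<?N. t < k \<longrightarrow> a j $ k = 0" by blast
    then have "t = j" using aJ[OF that(1) t(1)] by (auto split: if_splits)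
    then show ?thesis using t that by (metis linorder_neqE_nat)
  qed
  define f where "f = mat ?N ?N (\<lambda>(i,k). if k \<in> J \<and> i \<notin> J then a k $ i else 0)"
  have fc: "f \<in> Mat n" by (simp add: f_def)
  have skew: "adjoint n f = - f"
  proof (rule eq_matI)
    fix i j assume "i < dim_row (- f)" "j < dim_col (- f)"
    then have ij: "i < ?N" "j < ?N" using fc by auto
    have m: "i \<in> J \<longleftrightarrow> ?N-1-i \<notin> J" "j \<in> J \<longleftrightarrow> ?N-1-j \<notin> J" using lagD(3,4)[OF lag] ij by blast+
    show "adjoint n f $$ (i,j) = (- f) $$ (i,j)"
    proof (cases "j \<in> J \<and> i \<notin> J")
      case False
      then show ?thesis using ij m by (auto simp: adjoint_index f_def)
    next
      case True
      then have iJ: "?N-1-i \<in> J" using m by simp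
      \<comment> \<open>On J both vectors look like unit vectors, and of k and its mirror image one
        is in J. Only the terms k = j and k = i survive; they are the two entries to be
        compared.\<close>
      have "symm_form n (a j) (a (?N-1-i)) =
          (\<Sum>k<?N. (if k = j then a (?N-1-i) $ (?N-1-j) else 0) + (if k = i then a j $ i else 0))"
        unfolding symm_form_def
      proof (rule sum.cong[OF refl])
        fix k assume k: "k \<in> {..<?N}"
        have mk: "k \<in> J \<longleftrightarrow> ?N-1-k \<notin> J" using lagD(3,4)[OF lag] k by blast
        show "a j $ k * a (?N-1-i) $ (?N-1-k) =
            (if k = j then a (?N-1-i) $ (?N-1-j) else 0) + (if k = i then a j $ i else 0)"
        proof (cases "k \<in> J")
          case kJ: True
          then show ?thesis using aJ[of j k] True by auto
        next
          case False
          have "a (?N-1-i) $ (?N-1-k) = (if k = i then 1 else 0)"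
            using aJ[OF iJ, of "?N-1-k"] False mk k ij by auto
          then show ?thesis using False True by auto
        qed
      qed
      also have "\<dots> = a (?N-1-i) $ (?N-1-j) + a j $ i" using ij by (simp add: sum.distrib)
      finally show ?thesis using isotropic[OF aA aA] True iJ m ij
        by (auto simp: adjoint_index f_def add_eq_0_iff)
    qed
  qed (use fc in auto)
  have sk: "skew_echelon n J f"
    unfolding skew_echelon_def using fc skew upper by (auto simp: f_def split: if_splits)
  have "cols_in_E n (g * (1\<^sub>m ?N + f)) J"
    unfolding cols_in_E_def
  proof (intro ballI)
    fix j i assume j: "j \<in> J" and i: "i \<in> {n..<?N}"
    have jN: "j < ?N" using j by (simp add: J_def)
    have col: "(1\<^sub>m ?N + f) $$ (k,j) = a j $ k" if "k < ?N" for k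
      using that jN j aJ[OF j, of k] by (auto simp: f_def)
    have "(g * (1\<^sub>m ?N + f)) $$ (i,j) = (\<Sum>k<?N. g $$ (i,k) * (1\<^sub>m ?N + f) $$ (k,j))"
      using i jN fc by (intro mat_index_mult[OF gD(1)]) auto
    also have "\<dots> = (\<Sum>k<?N. g $$ (i,k) * a j $ k)" by (intro sum.cong refl) (simp add: col del: index_add_mat)
    also have "\<dots> = (g *\<^sub>v a j) $ i" using i unfolding mult_mat_vec_eq_lincomb[OF gD(1) ac] by simp
    also have "\<dots> = 0" using aA[OF j] i by (auto simp: A_def)
    finally show "(g * (1\<^sub>m ?N + f)) $$ (i,j) = 0" .
  qed
  from that[OF lag sk this] show thesis .
qed

lemma skew_echelon_lag_pos:
  assumes "lag n J" "skew_echelon n J f" "cols_in_E n (g * (1\<^sub>m (2*n) + f)) J"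
  shows "lag_pos n g J"
  using assms skew_echelon_props[OF assms(1,2)] unfolding lag_pos_def by blast

text \<open>The dimensions equal both counting functions, and the successive differences of a
  counting function recover its set.\<close>

lemma lag_pos_unique:
  assumes h: "h \<in> orth n" and p: "lag_pos n h J" and J0: "J0 \<subseteq> {..<2*n}"
    and c: "\<And>i. i \<le> 2*n \<Longrightarrow> cdim (2*n) (flag_of (2*n) h i \<inter> E_space n) = card (J0 \<inter> {..<i})"
  shows "J = J0"
proof -
  have JN: "J \<subseteq> {..<2*n}" using p lagD(1) by (simp add: lag_pos_def)
  have eq: "card (J \<inter> {..<i}) = card (J0 \<inter> {..<i})" if "i \<le> 2*n" for i
    using lag_pos_cdim[OF h p that] c[OF that] by simp
  have step: "card (K \<inter> {..<Suc i}) = card (K \<inter> {..<i}) + (if i \<in> K then 1 else 0)" for K and i :: nat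
  proof -
    have "K \<inter> {..<Suc i} = (if i \<in> K then insert i (K \<inter> {..<i}) else K \<inter> {..<i})" by (auto simp: less_Suc_eq)
    then show ?thesis by auto
  qed
  have "i \<in> J \<longleftrightarrow> i \<in> J0" if "i < 2*n" for i
    using eq[of i] eq[of "Suc i"] step[of J i] step[of J0 i] that by (auto split: if_splits)
  then show ?thesis using JN J0 by blast
qed

text \<open>The set found by echelon reduction has the same counting function as J and hence is J.
  So the matrix b in \<open>lag_pos\<close> may be taken of the form 1 + f.\<close>

lemma skew_echelon_normal_form:
  assumes h: "h \<in> orth n" and p: "lag_pos n h J"
  obtains f where "skew_echelon n J f" "cols_in_E n (h * (1\<^sub>m (2*n) + f)) J"
proof -
  from lagrangian_echelon[OF h] obtain J' f where f: "lag n J'" "skew_echelon n J' f" "cols_in_E n (h * (1\<^sub>m (2*n) + f)) J'" .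
  have "J' = J"
    using p lagD(1) by (intro lag_pos_unique[OF h skew_echelon_lag_pos[OF f]] lag_pos_cdim[OF h p]) (auto simp: lag_pos_def)
  then show thesis using f that by blast
qed

end

subsection \<open>The determinant detects the family of a Lagrangian subspace\<close>

lemma PE_PF_left:
  assumes "dim_row A = 2*n"
  shows "P_E n * (P_E n * A) = P_E n * A" "P_F n * (P_F n * A) = P_F n * A"
    "P_E n * (P_F n * A) = 0\<^sub>m (2*n) (dim_col A)" "P_F n * (P_E n * A) = 0\<^sub>m (2*n) (dim_col A)"
  using assms PE_PF[of n] by (simp_all flip: mult_mat_assoc)

lemma split_PE:
  assumes "dim_row A = 2*n"
  shows "P_E n * A + P_F n * A = A"
  using mult_mat_distrib(1)[of "P_E n" "P_F n" A] assms by (simp add: PE_PF)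

lemma add_mat_comm: "dim_row A = dim_row B \<Longrightarrow> dim_col A = dim_col B \<Longrightarrow> A + B = B + (A :: complex mat)"
  by (rule comm_add_mat[of _ "dim_row B" "dim_col B"]) auto

lemma add_mat_assoc: "dim_row A = dim_row B \<Longrightarrow> dim_col A = dim_col B \<Longrightarrow> dim_row B = dim_row C \<Longrightarrow> dim_col B = dim_col C \<Longrightarrow>
    (A + B) + C = A + (B + (C :: complex mat))"
  by (rule assoc_add_mat[of _ "dim_row C" "dim_col C"]) auto

lemma add_mat_zero [simp]:
  "dim_row A = N \<Longrightarrow> dim_col A = M \<Longrightarrow> 0\<^sub>m N M + A = (A :: complex mat)"
  "dim_row A = N \<Longrightarrow> dim_col A = M \<Longrightarrow> A + 0\<^sub>m N M = (A :: complex mat)"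
  by auto

lemma mult_mat_zero [simp]:
  "dim_row A = M \<Longrightarrow> 0\<^sub>m N M * A = (0\<^sub>m N (dim_col A) :: complex mat)"
  "dim_col A = M \<Longrightarrow> A * 0\<^sub>m M N = (0\<^sub>m (dim_row A) N :: complex mat)"
  by (auto intro!: eq_matI simp: scalar_prod_def)

text \<open>Turns vanishing entries into an identity with projections, which can be carried through
  matrix products.\<close>

lemma cols_in_E_iff_mult:
  assumes "A \<in> Mat n" "J \<subseteq> {..<2*n}"
  shows "cols_in_E n A J \<longleftrightarrow> P_F n * (A * diag_mat_of (2*n) J) = 0\<^sub>m (2*n) (2*n)"
proof -
  have e: "(P_F n * (A * diag_mat_of (2*n) J)) $$ (i,j) = (if n \<le> i \<and> j \<in> J then A $$ (i,j) else 0)"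
    if "i < 2*n" "j < 2*n" for i j
    using diag_mult_left_index[of "A * diag_mat_of (2*n) J" "2*n" "2*n" i j] diag_mult_right_index[OF assms(1) that] that assms(1)
    by (simp del: index_mult_mat(1))
  show ?thesis
  proof
    assume "cols_in_E n A J"
    then show "P_F n * (A * diag_mat_of (2*n) J) = 0\<^sub>m (2*n) (2*n)"
      by (intro eq_matI) (auto simp: e cols_in_E_def simp del: index_mult_mat(1))
  next
    assume z: "P_F n * (A * diag_mat_of (2*n) J) = 0\<^sub>m (2*n) (2*n)"
    show "cols_in_E n A J" unfolding cols_in_E_def
    proof (intro ballI)
      fix j i assume "j \<in> J" "i \<in> {n..<2*n}"
      then have "i < 2*n" "j < 2*n" "n \<le> i" using assms(2) by auto
      then show "A $$ (i,j) = 0" using e[of i j] z \<open>j \<in> J\<close> by simp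
    qed
  qed
qed

lemma det_unipotent:
  fixes A :: "complex mat"
  assumes "A \<in> carrier_mat N N" "\<And>i j. i < N \<Longrightarrow> j < i \<Longrightarrow> A $$ (i,j) = 0" "\<And>i. i < N \<Longrightarrow> A $$ (i,i) = 1"
  shows "det A = 1"
proof -
  have "upper_triangular A" using assms by (intro upper_triangularI) auto
  then have "det A = prod_list (diag_mat A)" by (rule det_upper_triangular[OF _ assms(1)])
  also have "\<dots> = 1" unfolding prod_list_diag_prod using assms by simp
  finally show ?thesis .
qed

text \<open>A Levi decomposition: g is \<open>a * a'\<close> times a unipotent u, where a carries
  the block of g on E and a' the block on the complement. Orthogonality makes a' the inverse of the
  adjoint of a, so the two block determinants cancel.\<close>

lemma det_orth_parabolic:
  assumes g: "g \<in> orth n" and z: "P_F n * (g * P_E n) = 0\<^sub>m (2*n) (2*n)"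
  shows "det g = 1"
proof -
  let ?P = "P_E n" and ?F = "P_F n" and ?g = "adjoint n g"
  note gD = orthD[OF g]
  have [simp]: "dim_row g = 2*n" "dim_col g = 2*n" using gD(1) by auto
  have "adjoint n (?F * (g * ?P)) = ?F * (?g * ?P)"
    using gD(1) by (simp add: adjoint_mult adjoint_PE adjoint_PF mult_mat_assoc)
  moreover have "adjoint n (0\<^sub>m (2*n) (2*n)) = 0\<^sub>m (2*n) (2*n)" by (auto intro!: eq_matI simp: adjoint_index)
  ultimately have z': "?F * (?g * ?P) = 0\<^sub>m (2*n) (2*n)" unfolding z by simp
  \<comment> \<open>Since g preserves E, the part of X in E is lost under F g.\<close>
  have r1: "?F * (g * (?F * X)) = ?F * (g * X)" if "X \<in> Mat n" for X
  proof -
    have "?F * (g * X) = ?F * (g * (?P * X + ?F * X))" using split_PE[of X n] that by auto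
    also have "\<dots> = (?F * (g * ?P)) * X + ?F * (g * (?F * X))" using that by (simp add: mult_mat_distrib mult_mat_assoc)
    finally show ?thesis using that z by simp
  qed
  have r2: "?P * (?g * (?P * X)) = ?g * (?P * X)" if "X \<in> Mat n" for X
  proof -
    have "?g * (?P * X) = ?P * (?g * (?P * X)) + ?F * (?g * (?P * X))"
      using split_PE[of "?g * (?P * X)" n] by simp
    also have "?F * (?g * (?P * X)) = (?F * (?g * ?P)) * X" using that by (simp add: mult_mat_assoc)
    finally show ?thesis using that z' by simp
  qed
  define a where "a = ?P * (g * ?P) + ?F"
  define a' where "a' = ?P + ?F * (g * ?F)"
  have ac: "a \<in> Mat n" "a' \<in> Mat n" using gD(1) by (auto simp: a_def a'_def)
  have ada: "adjoint n a = ?F * (?g * ?F) + ?P"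
    unfolding a_def using gD(1) by (simp add: adjoint_add adjoint_mult adjoint_PE adjoint_PF mult_mat_assoc)
  have "a' * adjoint n a = ?P + ?F * (g * (?F * (?g * ?F)))"
    unfolding ada a'_def using gD(1) by (simp add: mult_mat_distrib mult_mat_assoc PE_PF PE_PF_left add_mat_comm)
  also have "?F * (g * (?F * (?g * ?F))) = ?F * (g * (?g * ?F))" by (rule r1) simp
  also have "g * (?g * ?F) = ?F" by (rule orth_cancel(2)[OF g]) simp
  finally have "a' * adjoint n a = 1\<^sub>m (2*n)" by (simp add: PE_PF)
  then have 1: "det a' * det a = 1"
    using det_mult[OF ac(2) adjoint_carrier, of a] by (simp add: det_adjoint[OF ac(1)])
  \<comment> \<open>The solution of P g P x = P g F. The inverse of g is its adjoint and preserves E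
    too, so its block on E is inverse to that of g.\<close>
  define x where "x = ?P * (?g * (?P * (g * ?F)))"
  define u where "u = 1\<^sub>m (2*n) + x"
  have xc: "x \<in> Mat n" using gD(1) by (auto simp: x_def)
  have uc: "u \<in> Mat n" using xc by (simp add: u_def)
  have "x = ?P * (x * ?F)" unfolding x_def using gD(1) by (simp add: mult_mat_assoc PE_PF PE_PF_left)
  then have "x $$ (i,j) = 0" if "i < 2*n" "j < 2*n" "\<not> (i < n \<and> n \<le> j)" for i j
    using that diag_mult_left_index[of "x * ?F" "2*n" "2*n" i j "{..<n}"] diag_mult_right_index[OF xc that(1,2), of "{n..}"] xc
    by (metis atLeast_iff lessThan_iff Mat_mult_closed diag_mat_of_carrier)
  then have "det u = 1"
    unfolding u_def using xc by (intro det_unipotent[of _ "2*n"]) auto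
  have d: "a * a' = ?P * (g * ?P) + ?F * (g * ?F)"
    unfolding a_def a'_def using gD(1) by (simp add: mult_mat_distrib mult_mat_assoc PE_PF PE_PF_left)
  have "(a * a') * u = a * a' + ?P * (g * (?P * (?g * (?P * (g * ?F)))))"
  proof -
    have "(a * a') * x = ?P * (g * (?P * (?g * (?P * (g * ?F)))))"
      unfolding d x_def using gD(1) by (simp add: mult_mat_distrib mult_mat_assoc PE_PF PE_PF_left)
    moreover have "(a * a') * u = a * a' + (a * a') * x"
      unfolding u_def using xc ac mult_mat_distrib(2)[of "1\<^sub>m (2*n)" x "a * a'"] by simp
    ultimately show ?thesis by simp
  qed
  also have "?P * (?g * (?P * (g * ?F))) = ?g * (?P * (g * ?F))" by (rule r2) (use gD in simp)
  also have "g * (?g * (?P * (g * ?F))) = ?P * (g * ?F)" by (rule orth_cancel(2)[OF g]) (use gD in simp)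
  also have "a * a' + ?P * (?P * (g * ?F)) = g"
  proof -
    have "g = ?P * (g * ?P + g * ?F) + ?F * (g * ?P + g * ?F)"
      using split_PE[of g n] mult_mat_distrib(2)[of ?P ?F g] by (simp add: PE_PF)
    also have "\<dots> = (?P * (g * ?P) + ?P * (g * ?F)) + ?F * (g * ?F)"
      using gD(1) by (simp add: mult_mat_distrib z)
    finally have e: "g = (?P * (g * ?P) + ?P * (g * ?F)) + ?F * (g * ?F)" .
    have "a * a' + ?P * (?P * (g * ?F)) = (?P * (g * ?P) + ?P * (g * ?F)) + ?F * (g * ?F)"
      unfolding d using add_mat_comm[of "?F * (g * ?F)" "?P * (g * ?F)"] by (simp add: PE_PF_left add_mat_assoc)
    then show ?thesis using e by (rule trans[OF _ sym])
  qed
  finally have "det g = det (a * a') * det u" using det_mult[of "a * a'" "2*n" u] ac uc by simp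
  then show ?thesis using 1 \<open>det u = 1\<close> det_mult[OF ac] by (simp add: mult.commute)
qed

text \<open>The form in which a permutation of columns can be checked: pairings of columns are
  compared with pairings of basis vectors.\<close>

lemma orth_entries:
  assumes "g \<in> Mat n"
  shows "g \<in> orth n \<longleftrightarrow> (\<forall>a<2*n. \<forall>b<2*n. (\<Sum>k<2*n. g $$ (2*n-1-k, a) * g $$ (k,b)) = (if b = 2*n-1-a then 1 else 0))"
    (is "?L \<longleftrightarrow> ?R")
proof -
  have e: "(adjoint n g * g) $$ (a,b) = (\<Sum>k<2*n. g $$ (2*n-1-k, 2*n-1-a) * g $$ (k,b))" if "a < 2*n" "b < 2*n" for a b
    unfolding mat_index_mult[OF adjoint_carrier assms that] using that by (intro sum.cong) (auto simp: adjoint_index)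
  show ?thesis
  proof
    assume ?L
    show ?R
    proof (intro allI impI)
      fix a b assume ab: "a < 2*n" "b < 2*n"
      then have "2*n-1-a < 2*n" "2*n-1-(2*n-1-a) = a" by auto
      with e[OF this(1) ab(2)] orthD(2)[OF \<open>?L\<close>] ab
      show "(\<Sum>k<2*n. g $$ (2*n-1-k, a) * g $$ (k,b)) = (if b = 2*n-1-a then 1 else 0)" by auto
    qed
  next
    assume ?R
    have "adjoint n g * g = 1\<^sub>m (2*n)"
    proof (rule eq_matI)
      fix a b assume "a < dim_row (1\<^sub>m (2*n) :: complex mat)" "b < dim_col (1\<^sub>m (2*n) :: complex mat)"
      then have ab: "a < 2*n" "b < 2*n" by auto
      then have "2*n-1-a < 2*n" "2*n-1-(2*n-1-a) = a" by auto
      with e[OF ab] \<open>?R\<close> ab show "(adjoint n g * g) $$ (a,b) = 1\<^sub>m (2*n) $$ (a,b)" by auto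
    qed (use assms in auto)
    then show ?L using assms by (simp add: orth_def)
  qed
qed

text \<open>The transposition s of a mirror pair commutes with the mirror map, so columns s a and s
  b are paired as columns a and b should be.\<close>

lemma orth_swapcols:
  assumes g: "g \<in> orth n" and j: "j < 2*n"
  shows "swapcols j (2*n-1-j) g \<in> orth n"
proof -
  define s where "s k = (if j = k then 2*n-1-j else if 2*n-1-j = k then j else k)" for k
  have gc: "g \<in> Mat n" using orthD[OF g] by simp
  then have [simp]: "dim_row g = 2*n" "dim_col g = 2*n" by auto
  have idx: "swapcols j (2*n-1-j) g $$ (i,k) = g $$ (i, s k)" if "i < 2*n" "k < 2*n" for i k
    using that unfolding s_def by simp
  have s: "s k < 2*n" "s (2*n-1-k) = 2*n-1-s k" "s (s k) = k" if "k < 2*n" for k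
    using that j unfolding s_def by auto
  have c: "swapcols j (2*n-1-j) g \<in> Mat n" by auto
  show ?thesis unfolding orth_entries[OF c]
  proof (intro allI impI)
    fix a b assume ab: "a < 2*n" "b < 2*n"
    have "(\<Sum>k<2*n. swapcols j (2*n-1-j) g $$ (2*n-1-k, a) * swapcols j (2*n-1-j) g $$ (k,b)) =
        (\<Sum>k<2*n. g $$ (2*n-1-k, s a) * g $$ (k, s b))"
    proof (intro sum.cong refl)
      fix k assume "k \<in> {..<2*n}"
      then have "k < 2*n" "2*n-1-k < 2*n" by auto
      then show "swapcols j (2*n-1-j) g $$ (2*n-1-k, a) * swapcols j (2*n-1-j) g $$ (k,b) =
          g $$ (2*n-1-k, s a) * g $$ (k, s b)"
        by (simp only: idx ab)
    qed
    also have "\<dots> = (if s b = 2*n-1-s a then 1 else 0)"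
      using g s(1)[OF ab(1)] s(1)[OF ab(2)] unfolding orth_entries[OF gc] by blast
    also have "s b = 2*n-1-s a \<longleftrightarrow> b = 2*n-1-a"
    proof
      assume "s b = 2*n-1-s a"
      then have "s b = s (2*n-1-a)" using s(2)[OF ab(1)] by simp
      then show "b = 2*n-1-a" using s(3)[OF ab(2)] s(3)[of "2*n-1-a"] ab by auto
    qed (use s(2)[OF ab(1)] in simp)
    finally show "(\<Sum>k<2*n. swapcols j (2*n-1-j) g $$ (2*n-1-k, a) * swapcols j (2*n-1-j) g $$ (k,b)) =
        (if b = 2*n-1-a then 1 else 0)" .
  qed
qed

text \<open>Induction on the number of elements of J from n on. Swapping such a column with its
  mirror image replaces the index by one below n and changes the sign of the determinant. When none
  is left, g preserves E and \<open>det_orth_parabolic\<close> applies.\<close>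

lemma det_cols_in_E:
  assumes "g \<in> orth n" "lag n J" "cols_in_E n g J"
  shows "det g = (-1) ^ card (J \<inter> {n..})"
  using assms
proof (induction "card (J \<inter> {n..})" arbitrary: g J)
  case 0
  note gD = orthD[OF 0(2)]
  have "finite J" using lag_cards(3)[OF 0(3)] .
  then have e: "J \<inter> {n..} = {}" using 0(1) by simp
  have "{..<n} \<subseteq> J"
  proof
    fix i assume i: "i \<in> {..<n}"
    show "i \<in> J"
    proof (rule ccontr)
      assume "i \<notin> J"
      with i have "2*n-1-i \<in> J" by (intro lagD(4)[OF 0(3)]) auto
      moreover have "n \<le> 2*n-1-i" using i by auto
      ultimately show False using e by auto
    qed
  qed
  then have "cols_in_E n g {..<n}" using 0(4) unfolding cols_in_E_def by blast
  then have "det g = 1" using cols_in_E_iff_mult[OF gD(1), of "{..<n}"] det_orth_parabolic[OF 0(2)] by auto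
  then show ?case using 0(1) by simp
next
  case (Suc m)
  have "J \<inter> {n..} \<noteq> {}" using Suc(2) by auto
  then obtain j where j: "j \<in> J" "n \<le> j" by auto
  have jN: "j < 2*n" using j lagD(2)[OF Suc(4)] by blast
  have jb: "2*n-1-j \<notin> J" using lagD(3)[OF Suc(4) j(1)] .
  have jn: "2*n-1-j < n" using j jN by auto
  define J' where "J' = insert (2*n-1-j) (J - {j})"
  have "J' \<inter> {n..} = (J \<inter> {n..}) - {j}" using jn unfolding J'_def by auto
  then have c: "card (J' \<inter> {n..}) = m" using Suc(2) j lag_cards(3)[OF Suc(4)] by simp
  have l: "lag n J'"
    unfolding lag_def
  proof (intro conjI allI impI)
    show "J' \<subseteq> {..<2*n}" using lagD(1)[OF Suc(4)] jN unfolding J'_def by auto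
    fix i assume i: "i < 2*n"
    have "i \<in> J \<longleftrightarrow> 2*n-1-i \<notin> J" using lagD(3,4)[OF Suc(4)] i by blast
    moreover have "2*n-1-i = 2*n-1-j \<longleftrightarrow> i = j" "2*n-1-i = j \<longleftrightarrow> i = 2*n-1-j" "2*n-1-j \<noteq> j" using i jN j jn by auto
    ultimately show "i \<in> J' \<longleftrightarrow> 2*n-1-i \<notin> J'" unfolding J'_def using j(1) by auto
  qed
  have gc: "g \<in> Mat n" using orthD[OF Suc(3)] by simp
  then have [simp]: "dim_row g = 2*n" "dim_col g = 2*n" by auto
  have k: "cols_in_E n (swapcols j (2*n-1-j) g) J'"
    unfolding cols_in_E_def
  proof (intro ballI)
    fix l i assume "l \<in> J'" "i \<in> {n..<2*n}"
    then show "swapcols j (2*n-1-j) g $$ (i,l) = 0"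
      using Suc(5) j jb jN jn lagD(2)[OF Suc(4), of l] unfolding cols_in_E_def J'_def by auto
  qed
  have "det (swapcols j (2*n-1-j) g) = - det g"
    using jN jn j(2) gc by (intro det_swapcols) auto
  moreover have "det (swapcols j (2*n-1-j) g) = (-1) ^ card (J' \<inter> {n..})"
    using Suc(1)[OF c[symmetric] orth_swapcols[OF Suc(3) jN] l k] .
  ultimately have "det g = - ((-1) ^ m)" using c by (metis add.inverse_inverse)
  then show ?case unfolding Suc(2)[symmetric] by simp
qed

lemma det_lag_pos:
  assumes h: "h \<in> orth n" and p: "lag_pos n h J"
  shows "det h = (-1) ^ card (J \<inter> {n..})"
proof -
  have J: "lag n J" using p by (simp add: lag_pos_def)
  from skew_echelon_normal_form[OF h p] obtain f where f: "skew_echelon n J f" "cols_in_E n (h * (1\<^sub>m (2*n) + f)) J" .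
  note fo = skew_echelon_props[OF J f(1)]
  have "det (h * (1\<^sub>m (2*n) + f)) = det h"
    using det_mult[OF orthD(1)[OF h] orthD(1)[OF fo(3)]] fo(2) by (simp add: SO_iff)
  then show ?thesis using det_cols_in_E[OF orth_mult[OF h fo(3)] J f(2)] by simp
qed

section \<open>Limits of matrices\<close>

text \<open>Entrywise convergence in the usual topology of the complex numbers. The filter
  \<open>at 0\<close> leaves out t = 0, so the value of the curve there does not matter.\<close>

definition mat_tendsto :: "nat \<Rightarrow> nat \<Rightarrow> (complex \<Rightarrow> complex mat) \<Rightarrow> complex mat \<Rightarrow> bool" where
  "mat_tendsto N M f A \<longleftrightarrow> (\<forall>t. f t \<in> carrier_mat N M) \<and> A \<in> carrier_mat N M \<and>
     (\<forall>i<N. \<forall>j<M. ((\<lambda>t. f t $$ (i,j)) \<longlongrightarrow> A $$ (i,j)) (at 0))"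

lemma mat_tendsto_const: "A \<in> carrier_mat N M \<Longrightarrow> mat_tendsto N M (\<lambda>t. A) A"
  by (simp add: mat_tendsto_def)

lemma mat_tendsto_mult:
  assumes "mat_tendsto N M f A" "mat_tendsto M L h B"
  shows "mat_tendsto N L (\<lambda>t. f t * h t) (A * B)"
  unfolding mat_tendsto_def
proof (intro conjI allI impI)
  fix i j assume ij: "i < N" "j < L"
  have c: "f t \<in> carrier_mat N M" "h t \<in> carrier_mat M L" "A \<in> carrier_mat N M" "B \<in> carrier_mat M L" for t
    using assms by (auto simp: mat_tendsto_def)
  show "((\<lambda>t. (f t * h t) $$ (i,j)) \<longlongrightarrow> (A * B) $$ (i,j)) (at 0)"
    unfolding mat_index_mult[OF c(1,2) ij] mat_index_mult[OF c(3,4) ij]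
    using assms ij by (intro tendsto_sum tendsto_mult) (auto simp: mat_tendsto_def)
qed (use assms in \<open>auto simp: mat_tendsto_def intro!: mult_carrier_mat\<close>)

lemma mat_tendsto_add:
  assumes "mat_tendsto N M f A" "mat_tendsto N M h B"
  shows "mat_tendsto N M (\<lambda>t. f t + h t) (A + B)"
  unfolding mat_tendsto_def
proof (intro conjI allI impI)
  fix i j assume ij: "i < N" "j < M"
  have c: "f t \<in> carrier_mat N M" "h t \<in> carrier_mat N M" "A \<in> carrier_mat N M" "B \<in> carrier_mat N M" for t
    using assms by (auto simp: mat_tendsto_def)
  have "((\<lambda>t. f t $$ (i,j) + h t $$ (i,j)) \<longlongrightarrow> A $$ (i,j) + B $$ (i,j)) (at 0)"
    using assms ij by (intro tendsto_add) (auto simp: mat_tendsto_def)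
  moreover have "(f t + h t) $$ (i,j) = f t $$ (i,j) + h t $$ (i,j)" for t
    using c(2)[of t] ij by auto
  ultimately show "((\<lambda>t. (f t + h t) $$ (i,j)) \<longlongrightarrow> (A + B) $$ (i,j)) (at 0)"
    using c ij by simp
qed (use assms in \<open>auto simp: mat_tendsto_def\<close>)

lemma mat_tendsto_adjoint:
  assumes "mat_tendsto (2*n) (2*n) f A"
  shows "mat_tendsto (2*n) (2*n) (\<lambda>t. adjoint n (f t)) (adjoint n A)"
  using assms unfolding mat_tendsto_def by (auto simp: adjoint_index)

lemma tendsto_det:
  assumes "mat_tendsto N N f A"
  shows "((\<lambda>t. det (f t)) \<longlongrightarrow> det A) (at 0)"
proof -
  have c: "f t \<in> carrier_mat N N" "A \<in> carrier_mat N N" for t using assms by (auto simp: mat_tendsto_def)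
  have "((\<lambda>t. f t $$ (i, p i)) \<longlongrightarrow> A $$ (i, p i)) (at 0)" if "p permutes {0..<N}" "i < N" for p i
    using assms that permutes_in_image[OF that(1), of i] by (auto simp: mat_tendsto_def)
  then show ?thesis unfolding det_def'[OF c(1)] det_def'[OF c(2)]
    by (intro tendsto_sum tendsto_mult tendsto_const tendsto_prod) auto
qed

text \<open>Cramer's rule: adjugate over determinant has continuous entries near the limit. Where
  the determinant is zero, h t is only a placeholder.\<close>

lemma mat_tendsto_inverse:
  assumes f: "mat_tendsto N N f (1\<^sub>m N)"
  obtains h where "mat_tendsto N N h (1\<^sub>m N)" "\<And>t. det (f t) \<noteq> 0 \<Longrightarrow> h t * f t = 1\<^sub>m N"
    "\<And>t. det (f t) \<noteq> 0 \<Longrightarrow> f t * h t = 1\<^sub>m N" "\<forall>\<^sub>F t in at 0. det (f t) \<noteq> 0"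
proof
  have c: "f t \<in> carrier_mat N N" for t using f by (auto simp: mat_tendsto_def)
  have dims: "dim_row (f t) = N" "dim_col (f t) = N" for t using c[of t] by auto
  have d: "((\<lambda>t. det (f t)) \<longlongrightarrow> 1) (at 0)" using tendsto_det[OF f] by simp
  then show "\<forall>\<^sub>F t in at 0. det (f t) \<noteq> 0" by (rule tendsto_imp_eventually_ne) simp
  define h where "h t = (1 / det (f t)) \<cdot>\<^sub>m adj_mat (f t)" for t
  have one: "adj_mat (1\<^sub>m N) = (1\<^sub>m N :: complex mat)"
    using adj_mat(1,2)[OF one_carrier_mat[of N], where ?'a = complex] by auto
  have "((\<lambda>t. adj_mat (f t) $$ (i,j)) \<longlongrightarrow> adj_mat (1\<^sub>m N) $$ (i,j)) (at 0)" if ij: "i < N" "j < N" for i j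
  proof -
    have "mat_tendsto (N-1) (N-1) (\<lambda>t. mat_delete (f t) j i) (mat_delete (1\<^sub>m N) j i)"
      unfolding mat_tendsto_def
    proof (intro conjI allI impI)
      fix k l assume "k < N - 1" "l < N - 1"
      then show "((\<lambda>t. mat_delete (f t) j i $$ (k,l)) \<longlongrightarrow> mat_delete (1\<^sub>m N) j i $$ (k,l)) (at 0)"
        using f dims unfolding mat_delete_def mat_tendsto_def by (auto simp del: index_one_mat(1))
    qed (use mat_delete_carrier[OF c, of _ j i] mat_delete_carrier[OF one_carrier_mat[of N]] in auto)
    from tendsto_det[OF this] show ?thesis
      unfolding adj_mat_def cofactor_def using dims ij by (auto intro!: tendsto_mult)
  qed
  then have "((\<lambda>t. (1 / det (f t)) * adj_mat (f t) $$ (i,j)) \<longlongrightarrow> (1 / 1) * 1\<^sub>m N $$ (i,j)) (at 0)" if "i < N" "j < N" for i j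
    using that unfolding one by (intro tendsto_mult tendsto_divide d) auto
  moreover have "dim_row (adj_mat (f t)) = N" "dim_col (adj_mat (f t)) = N" for t using adj_mat(1)[OF c[of t]] by auto
  ultimately show "mat_tendsto N N h (1\<^sub>m N)"
    using adj_mat(1)[OF c] unfolding mat_tendsto_def h_def by auto
  fix t assume nz: "det (f t) \<noteq> 0"
  have "h t * f t = (1 / det (f t)) \<cdot>\<^sub>m (adj_mat (f t) * f t)"
    unfolding h_def using adj_mat(1)[OF c[of t]] c by (intro mult_smult_assoc_mat) auto
  then show "h t * f t = 1\<^sub>m N" using adj_mat(3)[OF c[of t]] nz by (intro eq_matI) auto
  have "f t * h t = (1 / det (f t)) \<cdot>\<^sub>m (f t * adj_mat (f t))"
    unfolding h_def using adj_mat(1)[OF c[of t]] c by (intro mult_smult_distrib) auto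
  then show "f t * h t = 1\<^sub>m N" using adj_mat(2)[OF c[of t]] nz by (intro eq_matI) auto
qed

text \<open>The lower n rows of h are equations for h^-1 E. Multiplying these rows by D from the
  left keeps the columns in J zero, so the same b serves for h'.\<close>

lemma lag_pos_transfer:
  assumes h: "h \<in> Mat n" "h' \<in> Mat n" "D \<in> Mat n" and D: "P_F n * h' = D * (P_F n * h)" and p: "lag_pos n h J"
  shows "lag_pos n h' J"
proof -
  from p obtain b where J: "lag n J" and b: "b \<in> orth n" "upper_tri (2*n) b" "cols_in_E n (h * b) J"
    by (auto simp: lag_pos_def)
  have bc: "b \<in> Mat n" using orthD[OF b(1)] by simp
  note JN = lagD(1)[OF J]
  let ?d = "diag_mat_of (2*n) J"
  have "P_F n * ((h' * b) * ?d) = (P_F n * h') * (b * ?d)" using h bc by (simp add: mult_mat_assoc)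
  also have "\<dots> = D * (P_F n * ((h * b) * ?d))" unfolding D using h bc by (simp add: mult_mat_assoc)
  also have "\<dots> = 0\<^sub>m (2*n) (2*n)" using cols_in_E_iff_mult[of "h * b" n J] b(3) h bc JN by simp
  finally have "cols_in_E n (h' * b) J" using cols_in_E_iff_mult[of "h' * b" n J] h bc JN by simp
  then show ?thesis using J b(1,2) by (auto simp: lag_pos_def)
qed

text \<open>
  The subspaces \<open>g\<^sup>-\<^sup>1 E\<close> and \<open>g\<^sup>-\<^sup>1 E'\<close> depend on the lower and the upper rows of \<open>g\<close>,
  each up to a change of basis. If they are moved by \<open>x1\<close> and \<open>x2\<close> independently, then a block diagonal
  correction \<open>D\<close> turns the resulting matrix into an orthogonal one.
\<close>

lemma lift_curves:
  assumes g: "g \<in> SO n" and x: "\<And>t. x1 t \<in> orth n" "\<And>t. x2 t \<in> orth n"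
    and lim: "mat_tendsto (2*n) (2*n) x1 (1\<^sub>m (2*n))" "mat_tendsto (2*n) (2*n) x2 (1\<^sub>m (2*n))"
  obtains G D where "mat_tendsto (2*n) (2*n) G g"
    "\<forall>\<^sub>F t in at 0. G t \<in> SO n \<and> D t \<in> Mat n \<and> det (D t) \<noteq> 0 \<and> P_E n * D t = D t * P_E n \<and>
       G t = D t * (P_E n * (g * x2 t) + P_F n * (g * x1 t))"
proof -
  let ?P = "P_E n" and ?F = "P_F n"
  have go: "g \<in> orth n" using g by (simp add: SO_iff)
  note gD = orthD[OF go]
  have x1c: "x1 t \<in> Mat n" and x2c: "x2 t \<in> Mat n" for t using x orthD by blast+
  have [simp]: "dim_row g = 2*n" "dim_col g = 2*n" using gD(1) by auto
  have [simp]: "dim_row (x1 t) = 2*n" "dim_col (x1 t) = 2*n" "dim_row (x2 t) = 2*n" "dim_col (x2 t) = 2*n" for t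
    using x1c[of t] x2c[of t] by auto
  define k where "k t = g * (x2 t * (adjoint n (x1 t) * adjoint n g))" for t
  have kc: "k t \<in> Mat n" for t unfolding k_def using gD(1) x2c by simp
  \<comment> \<open>Below, G' times its adjoint turns out to be block diagonal, with the block of k
    on E and that of its adjoint on the complement. M has the block of k on E and the identity on
    the complement, hence the same product with its own adjoint; so the inverse D of M makes D G'
    orthogonal.\<close>
  define M where "M t = ?P * (k t * ?P) + ?F" for t
  have Mc: "M t \<in> Mat n" for t unfolding M_def using kc by simp
  note mt = mat_tendsto_mult[of "2*n" "2*n" _ _ "2*n"]
  have klim: "mat_tendsto (2*n) (2*n) k (g * (1\<^sub>m (2*n) * (adjoint n (1\<^sub>m (2*n)) * adjoint n g)))"
    unfolding k_def by (intro mt mat_tendsto_const mat_tendsto_adjoint lim gD(1) adjoint_carrier)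
  have "mat_tendsto (2*n) (2*n) M (?P * ((g * (1\<^sub>m (2*n) * (adjoint n (1\<^sub>m (2*n)) * adjoint n g))) * ?P) + ?F)"
    unfolding M_def by (intro mt mat_tendsto_add mat_tendsto_const klim diag_mat_of_carrier)
  also have "?P * ((g * (1\<^sub>m (2*n) * (adjoint n (1\<^sub>m (2*n)) * adjoint n g))) * ?P) + ?F = 1\<^sub>m (2*n)"
    using gD by (simp add: adjoint_one PE_PF)
  finally have Mlim: "mat_tendsto (2*n) (2*n) M (1\<^sub>m (2*n))" .
  from mat_tendsto_inverse[OF Mlim] obtain D where Dlim: "mat_tendsto (2*n) (2*n) D (1\<^sub>m (2*n))"
    and D: "\<And>t. det (M t) \<noteq> 0 \<Longrightarrow> D t * M t = 1\<^sub>m (2*n)" "\<And>t. det (M t) \<noteq> 0 \<Longrightarrow> M t * D t = 1\<^sub>m (2*n)"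
    and ev: "\<forall>\<^sub>F t in at 0. det (M t) \<noteq> 0" by blast
  have Dc: "D t \<in> Mat n" for t using Dlim by (simp add: mat_tendsto_def)
  have [simp]: "dim_row (D t) = 2*n" "dim_col (D t) = 2*n" "dim_row (M t) = 2*n" "dim_col (M t) = 2*n"
    "dim_row (k t) = 2*n" "dim_col (k t) = 2*n" for t
    using Dc[of t] Mc[of t] kc[of t] by auto
  define G' where "G' t = ?P * (g * x2 t) + ?F * (g * x1 t)" for t
  define G where "G t = D t * G' t" for t
  have G'c: "G' t \<in> Mat n" for t unfolding G'_def using gD x1c x2c by simp
  have [simp]: "dim_row (G' t) = 2*n" "dim_col (G' t) = 2*n" for t using G'c[of t] by auto
  have Gc: "G t \<in> Mat n" for t unfolding G_def using G'c Dc by simp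
  have "mat_tendsto (2*n) (2*n) G (1\<^sub>m (2*n) * (?P * (g * 1\<^sub>m (2*n)) + ?F * (g * 1\<^sub>m (2*n))))"
    unfolding G_def G'_def by (intro mt mat_tendsto_add mat_tendsto_const Dlim lim gD(1) diag_mat_of_carrier)
  then have Glim: "mat_tendsto (2*n) (2*n) G g" using split_PE[of g n] by simp
  have orthG: "G t \<in> orth n" if nz: "det (M t) \<noteq> 0" for t
  proof -
    have aG': "adjoint n (G' t) = adjoint n (x2 t) * (adjoint n g * ?F) + adjoint n (x1 t) * (adjoint n g * ?P)"
      unfolding G'_def using gD(1) x1c x2c by (simp add: adjoint_add adjoint_mult adjoint_PE adjoint_PF mult_mat_assoc)
    have ak: "adjoint n (k t) = g * (x1 t * (adjoint n (x2 t) * adjoint n g))"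
      unfolding k_def using gD(1) x1c x2c by (simp add: adjoint_mult adjoint_adjoint mult_mat_assoc)
    have c: "g * (x2 t * (adjoint n (x2 t) * (adjoint n g * ?F))) = ?F" "g * (x1 t * (adjoint n (x1 t) * (adjoint n g * ?P))) = ?P"
      using orth_cancel(2)[OF x(2)[of t], of "adjoint n g * ?F"] orth_cancel(2)[OF x(1)[of t], of "adjoint n g * ?P"]
        orth_cancel(2)[OF go] by simp_all
    have "G' t * adjoint n (G' t) = ?P * (k t * ?P) + ?F * (adjoint n (k t) * ?F)"
      unfolding aG' ak unfolding G'_def k_def
      by (simp add: mult_mat_distrib mult_mat_assoc c PE_PF add_mat_comm)
    moreover have "adjoint n (M t) = ?F * (adjoint n (k t) * ?F) + ?P"
      unfolding M_def using kc by (simp add: adjoint_add adjoint_mult adjoint_PE adjoint_PF mult_mat_assoc)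
    then have "M t * adjoint n (M t) = ?P * (k t * ?P) + ?F * (adjoint n (k t) * ?F)"
      unfolding M_def by (simp add: mult_mat_distrib mult_mat_assoc PE_PF PE_PF_left add_mat_comm)
    ultimately have GM: "G' t * adjoint n (G' t) = M t * adjoint n (M t)" by simp
    have "G t * adjoint n (G t) = D t * ((G' t * adjoint n (G' t)) * adjoint n (D t))"
      unfolding G_def using Dc G'c by (simp add: adjoint_mult mult_mat_assoc)
    also have "\<dots> = (D t * M t) * adjoint n (D t * M t)"
      unfolding GM using Dc Mc by (simp add: adjoint_mult mult_mat_assoc)
    also have "\<dots> = 1\<^sub>m (2*n)" unfolding D(1)[OF nz] by (simp add: adjoint_one)
    finally show ?thesis by (intro orthI Gc)
  qed
  \<comment> \<open>Orthogonal matrices have determinant 1 or -1, and near the limit g the value -1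
    is excluded.\<close>
  have "((\<lambda>t. det (G t)) \<longlongrightarrow> 1) (at 0)" using tendsto_det[OF Glim] g by (simp add: SO_iff)
  then have "\<forall>\<^sub>F t in at 0. det (G t) \<noteq> -1" by (rule tendsto_imp_eventually_ne) simp
  with ev have "\<forall>\<^sub>F t in at 0. G t \<in> SO n \<and> D t \<in> Mat n \<and> det (D t) \<noteq> 0 \<and> ?P * D t = D t * ?P \<and>
       G t = D t * (?P * (g * x2 t) + ?F * (g * x1 t))"
  proof eventually_elim
    case (elim t)
    have "G t \<in> SO n" using orthG[OF elim(1)] orth_det_cases[OF orthG[OF elim(1)]] elim(2) by (auto simp: SO_iff)
    moreover have "det (D t) \<noteq> 0"
    proof
      assume "det (D t) = 0"
      then have "det (D t * M t) = 0" using det_mult[OF Dc Mc, of t t] by simp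
      then show False unfolding D(1)[OF elim(1)] by simp
    qed
    moreover have "?P * D t = D t * ?P"
    proof -
      have "?P * M t = M t * ?P" unfolding M_def by (simp add: mult_mat_distrib mult_mat_assoc PE_PF PE_PF_left)
      then have "D t * ((?P * M t) * D t) = D t * ((M t * ?P) * D t)" by simp
      then have "(D t * ?P) * (M t * D t) = (D t * M t) * (?P * D t)" by (simp add: mult_mat_assoc)
      then show ?thesis unfolding D(1)[OF elim(1)] D(2)[OF elim(1)] by simp
    qed
    ultimately show ?case using Dc by (simp add: G_def G'_def)
  qed
  with Glim show thesis by (rule that)
qed

text \<open>D commutes with both projections, so the lower rows of G are D times those of
  \<open>g * x1\<close> and the upper rows D times those of \<open>g * x2\<close>. Each of the two
  positions depends on one half of the rows only.\<close>

lemma lift_lag_pos: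
  assumes g: "g \<in> Mat n" "x1 \<in> Mat n" "x2 \<in> Mat n" and D: "D \<in> Mat n" "P_E n * D = D * P_E n"
    and G: "G = D * (P_E n * (g * x2) + P_F n * (g * x1))"
  shows "lag_pos n (g * x1) J \<Longrightarrow> lag_pos n G J"
    "lag_pos n (flip_mat n * (g * x2)) J \<Longrightarrow> lag_pos n (flip_mat n * G) J"
proof -
  let ?P = "P_E n" and ?F = "P_F n" and ?Q = "flip_mat n"
  have [simp]: "dim_row g = 2*n" "dim_col g = 2*n" "dim_row x1 = 2*n" "dim_col x1 = 2*n" "dim_row x2 = 2*n" "dim_col x2 = 2*n"
    "dim_row D = 2*n" "dim_col D = 2*n" using g D by auto
  have DP: "?P * (D * X) = D * (?P * X)" if "X \<in> Mat n" for X
    using arg_cong[OF D(2), of "\<lambda>Y. Y * X"] that by (simp add: mult_mat_assoc)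
  have DF: "?F * (D * X) = D * (?F * X)" if X: "X \<in> Mat n" for X
  proof -
    have [simp]: "dim_row X = 2*n" "dim_col X = 2*n" using X by auto
    have "D * (?P * X) + ?F * (D * X) = D * (?P * X) + D * (?F * X)"
    proof -
      have "D * (?P * X) + ?F * (D * X) = D * X" using split_PE[of "D * X" n] DP[OF X] by simp
      also have "\<dots> = D * (?P * X + ?F * X)" using split_PE[of X n] by simp
      finally show ?thesis by (simp add: mult_mat_distrib)
    qed
    then show ?thesis using D(1) X by (auto simp: mat_eq_iff simp del: index_mult_mat(1))
  qed
  have Gc: "G \<in> Mat n" unfolding G using g D by simp
  have "?F * G = D * (?F * (g * x1))" unfolding G using g D by (simp add: DF mult_mat_distrib PE_PF_left)
  then show "lag_pos n (g * x1) J \<Longrightarrow> lag_pos n G J"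
    using lag_pos_transfer[OF _ Gc D(1), of "g * x1" J] g by simp
  have PG: "?P * G = D * (?P * (g * x2))" unfolding G using g D by (simp add: DP mult_mat_distrib PE_PF_left)
  have FQ: "?F * (?Q * X) = ?Q * (?P * X)" if "X \<in> Mat n" for X
    using arg_cong[OF flip_PE[of n], of "\<lambda>Y. Y * X"] that by (simp add: mult_mat_assoc)
  have QQ: "?Q * (?Q * X) = X" if "X \<in> Mat n" for X
    using arg_cong[OF flip_flip[of n], of "\<lambda>Y. Y * X"] that by (simp add: mult_mat_assoc)
  have "?F * (?Q * G) = (?Q * (D * ?Q)) * (?F * (?Q * (g * x2)))"
    using g D Gc by (simp add: FQ PG QQ mult_mat_assoc)
  then show "lag_pos n (?Q * (g * x2)) J \<Longrightarrow> lag_pos n (?Q * G) J"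
    using lag_pos_transfer[of "?Q * (g * x2)" n "?Q * G" "?Q * (D * ?Q)" J] g D Gc by simp
qed

lemma mult_mat_zero_vec: "A \<in> carrier_mat N M \<Longrightarrow> A *\<^sub>v 0\<^sub>v M = (0\<^sub>v N :: complex vec)"
  by auto

section \<open>Closures in the flag variety\<close>

lemma poly_sum:
  "finite S \<Longrightarrow> (\<And>s. s \<in> S \<Longrightarrow> p s \<in> poly_functions N) \<Longrightarrow> (\<lambda>A. \<Sum>s\<in>S. p s A) \<in> poly_functions N"
  by (induction S rule: finite_induct) (auto intro: poly_functions.intros)

lemma poly_prod:
  "finite S \<Longrightarrow> (\<And>s. s \<in> S \<Longrightarrow> p s \<in> poly_functions N) \<Longrightarrow> (\<lambda>A. \<Prod>s\<in>S. p s A) \<in> poly_functions N"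
  by (induction S rule: finite_induct) (auto intro: poly_functions.intros)

lemma poly_det:
  assumes "\<And>A. M A \<in> carrier_mat m m" "\<And>i j. i < m \<Longrightarrow> j < m \<Longrightarrow> (\<lambda>A. M A $$ (i,j)) \<in> poly_functions N"
  shows "(\<lambda>A. det (M A)) \<in> poly_functions N"
proof -
  have "(\<lambda>A. M A $$ (i, p i)) \<in> poly_functions N" if "p permutes {0..<m}" "i < m" for p i
    using assms(2) that permutes_in_image[OF that(1), of i] by auto
  then show ?thesis unfolding det_def'[OF assms(1)]
    by (intro poly_sum poly_functions.mult poly_functions.const poly_prod finite_permutations) auto
qed

text \<open>Right translation is polynomial. Agreement is claimed on N x N matrices, where the
  entries of \<open>A * b\<close> are given by the expected sums.\<close>

lemma poly_subst:
  assumes "p \<in> poly_functions N" "b \<in> carrier_mat N N"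
  shows "\<exists>q\<in>poly_functions N. \<forall>A\<in>carrier_mat N N. q A = p (A * b)"
  using assms(1)
proof induction
  case (const a)
  then show ?case by (intro bexI[of _ "\<lambda>A. a"]) (auto intro: poly_functions.intros)
next
  case (entry i j)
  have "(\<lambda>A. \<Sum>k<N. A $$ (i,k) * b $$ (k,j)) \<in> poly_functions N"
    using entry by (intro poly_sum poly_functions.mult poly_functions.const poly_functions.entry) auto
  moreover have "\<forall>A\<in>carrier_mat N N. (\<Sum>k<N. A $$ (i,k) * b $$ (k,j)) = (A * b) $$ (i,j)"
    using entry assms(2) by (simp add: mat_index_mult del: index_mult_mat(1))
  ultimately show ?case by (intro bexI[where x = "\<lambda>A. \<Sum>k<N. A $$ (i,k) * b $$ (k,j)"])
next
  case (add p q)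
  then obtain p' q' where "p' \<in> poly_functions N" "\<forall>A\<in>carrier_mat N N. p' A = p (A * b)"
    "q' \<in> poly_functions N" "\<forall>A\<in>carrier_mat N N. q' A = q (A * b)" by blast
  then show ?case by (intro bexI[of _ "\<lambda>A. p' A + q' A"]) (auto intro: poly_functions.intros)
next
  case (mult p q)
  then obtain p' q' where "p' \<in> poly_functions N" "\<forall>A\<in>carrier_mat N N. p' A = p (A * b)"
    "q' \<in> poly_functions N" "\<forall>A\<in>carrier_mat N N. q' A = q (A * b)" by blast
  then show ?case by (intro bexI[of _ "\<lambda>A. p' A * q' A"]) (auto intro: poly_functions.intros)
qed

lemma poly_tendsto:
  assumes "p \<in> poly_functions N" "mat_tendsto N N f A"
  shows "((\<lambda>t. p (f t)) \<longlongrightarrow> p A) (at 0)"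
  using assms(1)
  by induction (use assms(2) in \<open>auto simp: mat_tendsto_def intro: tendsto_add tendsto_mult\<close>)

lemma openin_GL_polys:
  assumes "P \<subseteq> poly_functions N"
  shows "openin (zariski_GL N) {g \<in> GL N. \<exists>p\<in>P. p g \<noteq> 0}"
  unfolding zariski_GL_def openin_subtopology topology_inverse'[OF istopology_zariski]
  using assms by (intro exI[of _ "{A \<in> carrier_mat N N. \<exists>p\<in>P. p A \<noteq> 0}"]) (auto simp: zariski_open_def GL_def)

lemma openin_GL_poly_at:
  assumes "openin (zariski_GL N) U" "g \<in> U"
  obtains p where "p \<in> poly_functions N" "p g \<noteq> 0" "\<And>A. A \<in> GL N \<Longrightarrow> p A \<noteq> 0 \<Longrightarrow> A \<in> U"
proof -
  from assms(1) obtain T where T: "zariski_open N T" "U = T \<inter> GL N"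
    unfolding zariski_GL_def openin_subtopology topology_inverse'[OF istopology_zariski] by blast
  from T(1) obtain P where P: "P \<subseteq> poly_functions N" "T = {A \<in> carrier_mat N N. \<exists>p\<in>P. p A \<noteq> 0}"
    unfolding zariski_open_def by blast
  from assms(2) obtain p where p: "p \<in> P" "p g \<noteq> 0" unfolding T(2) P(2) by blast
  show thesis
  proof
    show "p \<in> poly_functions N" "p g \<noteq> 0" using p P by auto
    show "A \<in> U" if "A \<in> GL N" "p A \<noteq> 0" for A using that p unfolding T(2) P(2) by (auto simp: GL_def)
  qed
qed

lemma GL_inverse:
  assumes "g \<in> GL N"
  obtains h where "h \<in> GL N" "g * h = 1\<^sub>m N" "h * g = 1\<^sub>m N"
proof -
  from assms have g: "g \<in> carrier_mat N N" "det g \<noteq> 0" by (auto simp: GL_def)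
  from mat_inverse_exists[OF this] obtain h where h: "h \<in> carrier_mat N N" "g * h = 1\<^sub>m N" "h * g = 1\<^sub>m N" by blast
  have "det g * det h = 1" using det_mult[OF g(1) h(1)] h(2) by simp
  then have "det h \<noteq> 0" by auto
  then show thesis using h by (intro that) (auto simp: GL_def)
qed

lemma GL_mult: "g \<in> GL N \<Longrightarrow> h \<in> GL N \<Longrightarrow> g * h \<in> GL N"
  by (auto simp: GL_def det_mult)

text \<open>Column j of g' lies in the span of the first j+1 columns of g, and h, the inverse of g,
  turns it into a vector with coordinates up to j only.\<close>

lemma flag_of_subset_upper:
  assumes g: "g \<in> carrier_mat N N" "h \<in> carrier_mat N N" "h * g = 1\<^sub>m N" and g': "g' \<in> carrier_mat N N"
    and eq: "flag_of N g' = flag_of N g"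
  shows "upper_tri N (h * g')"
  unfolding upper_tri_def
proof (intro conjI allI impI)
  show "h * g' \<in> carrier_mat N N" using g g' by simp
  fix i j assume ij: "i < N" "j < N" "j < i"
  have u: "unit_vec N j \<in> coord_space N {..<Suc j}" by (auto simp: coord_space_def unit_vec_def)
  have "g' *\<^sub>v unit_vec N j \<in> flag_of N g' (Suc j)"
    using flag_of_eq[OF g', of "Suc j"] ij u by auto
  then have "g' *\<^sub>v unit_vec N j \<in> apply_set g (coord_space N {..<Suc j})"
    unfolding eq using flag_of_eq[OF g(1), of "Suc j"] ij by simp
  then obtain y where y: "y \<in> coord_space N {..<Suc j}" "g' *\<^sub>v unit_vec N j = g *\<^sub>v y" by blast
  have yc: "y \<in> carrier_vec N" using y by (simp add: coord_space_def)
  have "(h * g') *\<^sub>v unit_vec N j = h *\<^sub>v (g *\<^sub>v y)"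
    unfolding y(2)[symmetric] using assoc_mult_mat_vec[OF g(2) g'] by simp
  also have "\<dots> = y" using assoc_mult_mat_vec[OF g(2,1) yc] g(3) yc by simp
  finally have "((h * g') *\<^sub>v unit_vec N j) $ i = y $ i" by simp
  moreover have "((h * g') *\<^sub>v unit_vec N j) $ i = (h * g') $$ (i,j)"
  proof -
    have c: "h * g' \<in> carrier_mat N N" using g g' by simp
    have "((h * g') *\<^sub>v unit_vec N j) $ i = (\<Sum>k<N. (h * g') $$ (i,k) * unit_vec N j $ k)"
      using mult_mat_vec_eq_lincomb[OF c unit_vec_carrier] ij by simp
    also have "\<dots> = (\<Sum>k<N. if k = j then (h * g') $$ (i,j) else 0)"
      using ij by (intro sum.cong) (auto simp del: index_mult_mat(1))
    finally show ?thesis using ij by simp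
  qed
  ultimately show "(h * g') $$ (i,j) = 0" using y(1) ij by (simp add: coord_space_def)
qed

text \<open>Openness of the quotient map on a basic open set. The matrices whose flag lies in the
  set form the saturation of p \<noteq> 0 under invertible upper triangular b, that is, the union
  over b of the open conditions p(A b) \<noteq> 0.\<close>

lemma openin_flags_poly:
  assumes p: "p \<in> poly_functions N"
  shows "openin (zariski_flags N) {F. \<exists>g\<in>GL N. F = flag_of N g \<and> p g \<noteq> 0}" (is "openin _ ?U")
proof -
  define B where "B = {b \<in> GL N. upper_tri N b \<and> (\<exists>b'. upper_tri N b' \<and> b * b' = 1\<^sub>m N)}"
  have "\<forall>b\<in>B. \<exists>q. q \<in> poly_functions N \<and> (\<forall>A\<in>carrier_mat N N. q A = p (A * b))"
    using poly_subst[OF p] by (auto simp: B_def GL_def)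
  from bchoice[OF this] obtain q where q: "\<And>b. b \<in> B \<Longrightarrow> q b \<in> poly_functions N"
    "\<And>b A. b \<in> B \<Longrightarrow> A \<in> carrier_mat N N \<Longrightarrow> q b A = p (A * b)" by blast
  have "{g \<in> GL N. flag_of N g \<in> ?U} = {g \<in> GL N. \<exists>r\<in>q ` B. r g \<noteq> 0}"
  proof (intro equalityI subsetI)
    fix g assume "g \<in> {g \<in> GL N. flag_of N g \<in> ?U}"
    then obtain g' where g: "g \<in> GL N" and g': "g' \<in> GL N" "flag_of N g = flag_of N g'" "p g' \<noteq> 0" by blast
    obtain h where h: "h \<in> GL N" "g * h = 1\<^sub>m N" "h * g = 1\<^sub>m N" using GL_inverse[OF g] .
    obtain h' where h': "h' \<in> GL N" "g' * h' = 1\<^sub>m N" "h' * g' = 1\<^sub>m N" using GL_inverse[OF g'(1)] .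
    have c: "g \<in> carrier_mat N N" "g' \<in> carrier_mat N N" "h \<in> carrier_mat N N" "h' \<in> carrier_mat N N"
      using g g' h h' by (auto simp: GL_def)
    have d: "dim_row g = N" "dim_row g' = N" "dim_row h = N" "dim_row h' = N"
      "dim_col g = N" "dim_col g' = N" "dim_col h = N" "dim_col h' = N" using c by auto
    have "(h * g') * (h' * g) = h * ((g' * h') * g)" using d by (simp add: mult_mat_assoc)
    then have "(h * g') * (h' * g) = 1\<^sub>m N" using d h h' by simp
    moreover have "upper_tri N (h * g')" "upper_tri N (h' * g)"
      using flag_of_subset_upper[OF c(1,3) h(3) c(2)] flag_of_subset_upper[OF c(2,4) h'(3) c(1)] g'(2) by auto
    ultimately have b: "h * g' \<in> B" unfolding B_def using GL_mult[OF h(1) g'(1)] by blast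
    have "g * (h * g') = g'" using d h(2) by (simp flip: mult_mat_assoc)
    then have "q (h * g') g \<noteq> 0" using q(2)[OF b c(1)] g'(3) by simp
    then show "g \<in> {g \<in> GL N. \<exists>r\<in>q ` B. r g \<noteq> 0}" using g b by blast
  next
    fix g assume "g \<in> {g \<in> GL N. \<exists>r\<in>q ` B. r g \<noteq> 0}"
    then obtain b where g: "g \<in> GL N" and b: "b \<in> B" "q b g \<noteq> 0" by blast
    have gc: "g \<in> carrier_mat N N" using g by (simp add: GL_def)
    from b(1) obtain b' where b': "upper_tri N b" "upper_tri N b'" "b * b' = 1\<^sub>m N" "b \<in> GL N" by (auto simp: B_def)
    have "p (g * b) \<noteq> 0" using q(2)[OF b(1) gc] b(2) by simp
    then have "flag_of N g \<in> ?U"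
      using flag_of_mult_upper[OF gc b'(1-3)] GL_mult[OF g b'(4)] by (auto intro!: bexI[of _ "g * b"])
    then show "g \<in> {g \<in> GL N. flag_of N g \<in> ?U}" using g by blast
  qed
  moreover have "openin (zariski_GL N) {g \<in> GL N. \<exists>r\<in>q ` B. r g \<noteq> 0}"
    using q(1) by (intro openin_GL_polys) auto
  moreover have "?U \<subseteq> complete_flags N" using flag_of_complete by blast
  ultimately show ?thesis unfolding openin_zariski_flags by simp
qed

lemma topspace_zariski_D: "topspace (zariski_D n) = flags_D n"
  using flag_of_complete SO_GL
  by (auto simp: zariski_D_def topspace_subtopology topspace_zariski_flags flags_D_def)

text \<open>Polynomials are continuous, so limits in the usual topology lie in the Zariski closure.\<close>

lemma limit_in_closure:
  assumes g: "g \<in> SO n" and f: "mat_tendsto (2*n) (2*n) f g"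
    and ev: "\<forall>\<^sub>F t in at 0. f t \<in> SO n \<and> flag_of (2*n) (f t) \<in> S"
  shows "flag_of (2*n) g \<in> zariski_D n closure_of S"
  unfolding in_closure_of topspace_zariski_D
proof (intro conjI allI impI)
  show "flag_of (2*n) g \<in> flags_D n" using g by (simp add: flags_D_def)
  fix T assume T: "flag_of (2*n) g \<in> T \<and> openin (zariski_D n) T"
  then obtain U where U: "openin (zariski_flags (2*n)) U" "T = U \<inter> flags_D n"
    unfolding zariski_D_def openin_subtopology by blast
  have "openin (zariski_GL (2*n)) {h \<in> GL (2*n). flag_of (2*n) h \<in> U}"
    using U(1) unfolding openin_zariski_flags by blast
  moreover have "g \<in> {h \<in> GL (2*n). flag_of (2*n) h \<in> U}" using T U(2) SO_GL[OF g] by simp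
  ultimately obtain p where p: "p \<in> poly_functions (2*n)" "p g \<noteq> 0"
    "\<And>A. A \<in> GL (2*n) \<Longrightarrow> p A \<noteq> 0 \<Longrightarrow> A \<in> {h \<in> GL (2*n). flag_of (2*n) h \<in> U}"
    by (rule openin_GL_poly_at) blast
  have "\<forall>\<^sub>F t in at 0. p (f t) \<noteq> 0" using poly_tendsto[OF p(1) f] p(2) by (rule tendsto_imp_eventually_ne)
  with ev have "\<forall>\<^sub>F t in at 0. f t \<in> SO n \<and> flag_of (2*n) (f t) \<in> S \<and> p (f t) \<noteq> 0" by eventually_elim blast
  then obtain t where t: "f t \<in> SO n" "flag_of (2*n) (f t) \<in> S" "p (f t) \<noteq> 0"
    using eventually_happens'[OF at_neq_bot] by blast
  have "flag_of (2*n) (f t) \<in> T" using p(3)[OF SO_GL[OF t(1)] t(3)] t(1) U(2) by (simp add: flags_D_def)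
  then show "\<exists>y. y \<in> S \<and> y \<in> T" using t(2) by blast
qed

text \<open>The matrix that tests a position J: its lower rows are the equations of A^-1 E, its
  upper rows read off the coordinates in J, one row for each mirror pair. For Lagrangian J it is
  invertible when these coordinates determine a vector of A^-1 E.\<close>

definition lag_rows :: "nat \<Rightarrow> nat set \<Rightarrow> complex mat \<Rightarrow> complex mat" where
  "lag_rows n J A = mat (2*n) (2*n) (\<lambda>(i,k). if i < n then (if k \<in> J \<and> (k = i \<or> k = 2*n-1-i) then 1 else 0) else A $$ (i,k))"

lemma lag_rows_carrier [simp]: "lag_rows n J A \<in> Mat n"
  by (simp add: lag_rows_def)

lemma lag_rows_low:
  assumes "A \<in> Mat n" "n \<le> i" "i < 2*n" "y \<in> carrier_vec (2*n)"
  shows "(lag_rows n J A *\<^sub>v y) $ i = (A *\<^sub>v y) $ i"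
  unfolding mult_mat_vec_eq_lincomb[OF lag_rows_carrier assms(4)] mult_mat_vec_eq_lincomb[OF assms(1,4)]
  using assms by (simp add: lag_rows_def)

lemma lag_rows_high:
  assumes J: "J \<subseteq> {..<2*n}" "\<And>j. j \<in> J \<Longrightarrow> 2*n-1-j \<notin> J" and j: "j \<in> J" and y: "y \<in> carrier_vec (2*n)"
  shows "(lag_rows n J A *\<^sub>v y) $ (min j (2*n-1-j)) = y $ j"
proof -
  let ?r = "min j (2*n-1-j)"
  have jN: "j < 2*n" using J j by auto
  have r: "?r < n" using jN by linarith
  have "lag_rows n J A $$ (?r, k) * y $ k = (if k = j then y $ j else 0)" if k: "k < 2*n" for k
  proof -
    have "k \<in> J \<and> (k = ?r \<or> k = 2*n-1-?r) \<longleftrightarrow> k = j"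
    proof
      assume a: "k \<in> J \<and> (k = ?r \<or> k = 2*n-1-?r)"
      then have "k = j \<or> k = 2*n-1-j" using jN unfolding min_def by (auto split: if_splits)
      then show "k = j" using J(2)[OF j] a by blast
    qed (use jN j in \<open>auto simp: min_def\<close>)
    then show ?thesis using r k unfolding lag_rows_def by auto
  qed
  then have "(lag_rows n J A *\<^sub>v y) $ ?r = (\<Sum>k<2*n. if k = j then y $ j else 0)"
    unfolding mult_mat_vec_eq_lincomb[OF lag_rows_carrier y] using r by simp
  then show ?thesis using jN by simp
qed

text \<open>A kernel vector y lies in h^-1 E and vanishes on J. In the echelon basis the coordinates
  in J are the coefficients, so y is zero.\<close>

lemma lag_pos_lag_rows:
  assumes h: "h \<in> orth n" and p: "lag_pos n h J"
  shows "det (lag_rows n J h) \<noteq> 0"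
proof
  assume "det (lag_rows n J h) = 0"
  then obtain y where y: "y \<in> carrier_vec (2*n)" "y \<noteq> 0\<^sub>v (2*n)" "lag_rows n J h *\<^sub>v y = 0\<^sub>v (2*n)"
    using det_0_iff_vec_prod_zero_field[OF lag_rows_carrier] by blast
  have J: "lag n J" using p by (simp add: lag_pos_def)
  from skew_echelon_normal_form[OF h p] obtain f where f: "skew_echelon n J f" "cols_in_E n (h * (1\<^sub>m (2*n) + f)) J" .
  have fc: "f \<in> Mat n" using f by (simp add: skew_echelon_def)
  note fo = skew_echelon_props[OF J f(1)]
  define b where "b = 1\<^sub>m (2*n) + f"
  have bo: "b \<in> orth n" using fo(3) by (simp add: b_def)
  note bD = orthD[OF bo] and hD = orthD[OF h]
  define z where "z = adjoint n b *\<^sub>v y"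
  have zc: "z \<in> carrier_vec (2*n)" unfolding z_def using y by simp
  have yz: "y = b *\<^sub>v z" unfolding z_def using y(1) bD by (simp flip: mult_mat_vec_assoc)
  have "h *\<^sub>v y \<in> E_space n"
    using y hD(1) lag_rows_low[OF hD(1) _ _ y(1), of _ J] by (auto simp: E_space_eq coord_space_def simp del: index_mult_mat_vec)
  then have "(h * b) *\<^sub>v z \<in> E_space n" using assoc_mult_mat_vec[OF hD(1) bD(1) zc] yz by simp
  then have zJ: "z \<in> coord_space (2*n) J"
    using cols_in_E_iff[OF orth_mult[OF h bo] J _ zc] f(2) by (simp add: b_def)
  have "z $ j = 0" if j: "j \<in> J" for j
  proof -
    have jN: "j < 2*n" using lagD(2)[OF J j] .
    have "y $ j = (\<Sum>k<2*n. b $$ (j,k) * z $ k)"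
      unfolding yz mult_mat_vec_eq_lincomb[OF bD(1) zc] using jN by simp
    also have "\<dots> = (\<Sum>k<2*n. if k = j then z $ j else 0)"
    proof (rule sum.cong[OF refl])
      fix k assume k: "k \<in> {..<2*n}"
      have "f $$ (j,k) = 0" using f(1) j jN k unfolding skew_echelon_def by blast
      then show "b $$ (j,k) * z $ k = (if k = j then z $ j else 0)" unfolding b_def using jN k fc by auto
    qed
    finally have "y $ j = z $ j" using jN by simp
    moreover have "y $ j = 0"
      using lag_rows_high[OF lagD(1)[OF J] lagD(3)[OF J] j y(1), of h] y(3) jN by simp
    ultimately show ?thesis by simp
  qed
  then have "z = 0\<^sub>v (2*n)" using zJ by (intro eq_vecI) (auto simp: coord_space_def)
  then show False using yz y(2) mult_mat_zero_vec[OF bD(1)] by simp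
qed

text \<open>The invertible matrix \<open>lag_rows n J A\<close> maps the part of A^-1 E inside the
  first i coordinates into the coordinate subspace on the rows that belong to J below i.\<close>

lemma lag_rows_cdim_le:
  assumes A: "A \<in> Mat n" "det A \<noteq> 0" and J: "lag n J" and d: "det (lag_rows n J A) \<noteq> 0" and i: "i \<le> 2*n"
  shows "cdim (2*n) (flag_of (2*n) A i \<inter> E_space n) \<le> card (J \<inter> {..<i})"
proof -
  let ?W = "{y \<in> coord_space (2*n) {..<i}. A *\<^sub>v y \<in> E_space n}"
  let ?\<tau> = "\<lambda>j. min j (2*n-1-j)"
  let ?T = "?\<tau> ` (J \<inter> {..<i})"
  have E: "csubspace (2*n) (E_space n)" unfolding E_space_eq by (rule csubspace_coord)
  have C: "csubspace (2*n) (coord_space (2*n) {..<i})" by (rule csubspace_coord)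
  have W: "csubspace (2*n) ?W"
  proof (rule csubspaceI)
    show "?W \<subseteq> carrier_vec (2*n)" by (auto simp: coord_space_def)
    show "0\<^sub>v (2*n) \<in> ?W" using csubspaceD(2)[OF E] csubspaceD(2)[OF C] by (simp add: mult_mat_zero_vec[OF A(1)])
    show "x + y \<in> ?W" if "x \<in> ?W" "y \<in> ?W" for x y
      using that csubspaceD(3)[OF E] csubspaceD(3)[OF C] csubspaceD(1)[OF C]
      by (auto simp: mult_add_distrib_mat_vec[OF A(1)] subset_iff)
    show "a \<cdot>\<^sub>v x \<in> ?W" if "x \<in> ?W" for a x
      using that csubspaceD(4)[OF E] csubspaceD(4)[OF C] csubspaceD(1)[OF C]
      by (auto simp: mult_mat_vec[OF A(1)] subset_iff)
  qed
  have "flag_of (2*n) A i \<inter> E_space n = apply_set A ?W" using flag_of_eq[OF A(1) i] by auto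
  then have "cdim (2*n) (flag_of (2*n) A i \<inter> E_space n) = cdim (2*n) ?W" using cdim_apply[OF A W] by simp
  also have "\<dots> = cdim (2*n) (apply_set (lag_rows n J A) ?W)"
    using cdim_apply[OF lag_rows_carrier d W] by simp
  also have "\<dots> \<le> cdim (2*n) (coord_space (2*n) ?T)"
  proof (rule cdim_mono[OF csubspace_apply[OF lag_rows_carrier W] csubspace_coord], rule subsetI)
    fix x assume "x \<in> apply_set (lag_rows n J A) ?W"
    then obtain y where y: "y \<in> coord_space (2*n) {..<i}" "A *\<^sub>v y \<in> E_space n" "x = lag_rows n J A *\<^sub>v y" by blast
    have yc: "y \<in> carrier_vec (2*n)" using y by (simp add: coord_space_def)
    have "x $ r = 0" if r: "r < 2*n" "r \<notin> ?T" for r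
    proof (cases "n \<le> r")
      case True
      then show ?thesis unfolding y(3) using lag_rows_low[OF A(1) True r(1) yc] y(2) r
        by (simp add: E_space_eq coord_space_def)
    next
      case False
      have "lag_rows n J A $$ (r,k) * y $ k = 0" if k: "k < 2*n" for k
      proof (rule ccontr)
        assume "\<not> lag_rows n J A $$ (r,k) * y $ k = 0"
        then have a: "k \<in> J" "k = r \<or> k = 2*n-1-r" "y $ k \<noteq> 0"
          using False k by (auto simp: lag_rows_def split: if_splits)
        then have "k < i" using y(1) k unfolding coord_space_def by blast
        moreover have "r = ?\<tau> k" using a(2) False k by auto
        ultimately show False using r(2) a(1) by blast
      qed
      then show ?thesis unfolding y(3) mult_mat_vec_eq_lincomb[OF lag_rows_carrier yc] using r by (simp add: sum.neutral)
    qed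
    then show "x \<in> coord_space (2*n) ?T" using y(3) yc by (simp add: coord_space_def)
  qed
  also have "cdim (2*n) (coord_space (2*n) ?T) \<le> card ?T"
  proof -
    have "?T \<subseteq> {..<2*n}" using lagD(2)[OF J] by (auto simp: min_less_iff_disj)
    from cdim_apply_coord_le[OF one_carrier_mat this] show ?thesis
      using apply_set_one[of "coord_space (2*n) ?T" "2*n"] by (simp add: coord_space_def)
  qed
  also have "card ?T \<le> card (J \<inter> {..<i})" by (rule card_image_le) auto
  finally show ?thesis .
qed

text \<open>The determinant of \<open>lag_rows\<close> is a polynomial that is nonzero at g, hence
  also at some flag of S, where it bounds the dimension. The factor c is 1 for E and
  \<open>flip_mat n\<close> for the complement. The representative g' ranges over GL because open
  sets of flags are tested there.\<close>

lemma cdim_semicontinuous: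
  assumes g: "g \<in> SO n" and c: "c \<in> orth n" and p: "lag_pos n (c * g) J" and i: "i \<le> 2*n"
    and cl: "flag_of (2*n) g \<in> zariski_D n closure_of S"
    and S: "\<And>g'. g' \<in> GL (2*n) \<Longrightarrow> flag_of (2*n) g' \<in> S \<Longrightarrow> a \<le> cdim (2*n) (flag_of (2*n) (c * g') i \<inter> E_space n)"
  shows "a \<le> card (J \<inter> {..<i})"
proof -
  note cD = orthD[OF c]
  have J: "lag n J" using p by (simp add: lag_pos_def)
  \<comment> \<open>This is \<open>lag_rows n J (c * A)\<close> with the product written out, so
    that each entry is visibly a polynomial in the entries of A.\<close>
  let ?M = "\<lambda>A. mat (2*n) (2*n) (\<lambda>(i,k). if i < n then (if k \<in> J \<and> (k = i \<or> k = 2*n-1-i) then 1 else 0)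
       else (\<Sum>l<2*n. c $$ (i,l) * A $$ (l,k)))"
  let ?p = "\<lambda>A. det (?M A)"
  have M: "?M A = lag_rows n J (c * A)" if "A \<in> Mat n" for A
    using that cD(1) by (intro eq_matI) (auto simp: lag_rows_def mat_index_mult[OF cD(1) that] simp del: index_mult_mat(1))
  have pp: "?p \<in> poly_functions (2*n)"
  proof (rule poly_det)
    fix r s assume "r < 2*n" "s < 2*n"
    then show "(\<lambda>A. ?M A $$ (r,s)) \<in> poly_functions (2*n)"
      by (cases "r < n") (auto intro!: poly_functions.const poly_sum poly_functions.mult poly_functions.entry)
  qed simp
  define U where "U = {F. \<exists>g\<in>GL (2*n). F = flag_of (2*n) g \<and> ?p g \<noteq> 0}"
  have "openin (zariski_D n) (U \<inter> flags_D n)"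
    unfolding zariski_D_def openin_subtopology using openin_flags_poly[OF pp] unfolding U_def by blast
  moreover have "flag_of (2*n) g \<in> U \<inter> flags_D n"
  proof -
    have "c * g \<in> orth n" using orth_mult[OF c] g by (simp add: SO_iff)
    from lag_pos_lag_rows[OF this p] show ?thesis
      using M[OF SO_carrier[OF g]] SO_GL[OF g] g by (auto simp: flags_D_def U_def)
  qed
  moreover have "\<And>T. flag_of (2*n) g \<in> T \<and> openin (zariski_D n) T \<Longrightarrow> \<exists>y. y \<in> S \<and> y \<in> T"
    using cl unfolding in_closure_of by simp
  ultimately obtain F where F: "F \<in> S" "F \<in> U" by blast
  then obtain g' where g': "g' \<in> GL (2*n)" "F = flag_of (2*n) g'" "?p g' \<noteq> 0" unfolding U_def by blast
  have g'c: "g' \<in> Mat n" "det g' \<noteq> 0" using g'(1) by (auto simp: GL_def)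
  have "det (c * g') \<noteq> 0" using det_mult[OF cD(1) g'c(1)] orth_det_nonzero[OF c] g'c(2) by simp
  then have "cdim (2*n) (flag_of (2*n) (c * g') i \<inter> E_space n) \<le> card (J \<inter> {..<i})"
    using M[OF g'c(1)] g'(3) cD(1) g'c(1) by (intro lag_rows_cdim_le[OF _ _ J _ i]) auto
  with S[OF g'(1)] F(1) g'(2) show ?thesis by force
qed

section \<open>Combinatorics of clans\<close>

text \<open>On the orbit these are the places where the dimension of F_i \<inter> E jumps, see
  \<open>card_plus\<close>.\<close>

definition plus_or_second :: "nat \<Rightarrow> clan \<Rightarrow> nat set" where
  "plus_or_second n c = {i. i < 2*n \<and> (c (Suc i) = Plus \<or> second_occ c (Suc i))}"

definition minus_or_second :: "nat \<Rightarrow> clan \<Rightarrow> nat set" where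
  "minus_or_second n c = {i. i < 2*n \<and> (c (Suc i) = Minus \<or> second_occ c (Suc i))}"

lemma matched_sym: "matched c s t \<Longrightarrow> matched c t s"
  by (auto simp: matched_def)

lemma even_card_involution:
  fixes X :: "nat set"
  assumes "finite X" "\<And>x. x \<in> X \<Longrightarrow> f x \<in> X" "\<And>x. x \<in> X \<Longrightarrow> f (f x) = x" "\<And>x. x \<in> X \<Longrightarrow> f x \<noteq> x"
  shows "even (card X)"
proof -
  let ?Y = "{x \<in> X. x < f x}" and ?Z = "{x \<in> X. f x < x}"
  have "bij_betw f ?Y ?Z"
    by (rule bij_betw_byWitness[where f' = f]) (use assms in auto)
  then have "card ?Y = card ?Z" by (rule bij_betw_same_card)
  moreover have "X = ?Y \<union> ?Z" using assms(4) by (auto simp: neq_iff)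
  moreover have "card (?Y \<union> ?Z) = card ?Y + card ?Z" using assms(1) by (intro card_Un_disjoint) auto
  ultimately show ?thesis by simp
qed

locale clan_D =
  fixes n :: nat and c :: clan
  assumes type_D: "type_D_clan n c"
begin

lemma partner_unique:
  assumes "i \<in> {1..2*n}" "j \<in> {1..2*n}" "k \<in> {1..2*n}" "matched c i j" "matched c i k" "j \<noteq> i" "k \<noteq> i"
  shows "j = k"
proof -
  from assms(4,5) obtain a where a: "c i = Num a" "c j = Num a" "c k = Num a" by (auto simp: matched_def)
  have "card {l\<in>{1..2*n}. c l = Num a} = 2" using type_D assms(1) a by (auto simp: type_D_clan_def is_clan_def)
  moreover have "card {i,j,k} \<le> card {l\<in>{1..2*n}. c l = Num a}" using assms a by (intro card_mono) auto
  ultimately show ?thesis using assms(6,7) by (auto simp: card_insert_if split: if_splits)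
qed

lemma partner_exists:
  assumes "i \<in> {1..2*n}" "c i = Num a"
  obtains j where "j \<in> {1..2*n}" "j \<noteq> i" "matched c i j"
proof -
  have "card {l\<in>{1..2*n}. c l = Num a} = 2" using type_D assms by (auto simp: type_D_clan_def is_clan_def)
  then obtain x y where "{l\<in>{1..2*n}. c l = Num a} = {x, y}" "x \<noteq> y" by (auto simp: card_2_iff)
  then have "\<exists>j. j \<in> {1..2*n} \<and> j \<noteq> i \<and> c j = Num a" using assms by auto
  then show thesis using that assms(2) by (auto simp: matched_def)
qed

lemma symbol_cases:
  assumes "i \<in> {1..2*n}"
  obtains "c i = Plus" "\<not> first_occ n c i" "\<not> second_occ c i" |
    "c i = Minus" "\<not> first_occ n c i" "\<not> second_occ c i" |
    "first_occ n c i" "\<not> second_occ c i" "c i \<noteq> Plus" "c i \<noteq> Minus" |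
    "second_occ c i" "\<not> first_occ n c i" "c i \<noteq> Plus" "c i \<noteq> Minus"
proof (cases "c i")
  case (Num a)
  from partner_exists[OF assms Num] obtain j where j: "j \<in> {1..2*n}" "j \<noteq> i" "matched c i j" .
  have u: "k = j" if "k \<in> {1..2*n}" "matched c i k" "k \<noteq> i" for k
    using partner_unique[OF assms that(1) j(1) that(2) j(3) that(3) j(2)] .
  show ?thesis
  proof (cases "i < j")
    case True
    then have "first_occ n c i" using j by (auto simp: first_occ_def)
    moreover have "\<not> second_occ c i"
    proof
      assume "second_occ c i"
      then obtain s where s: "1 \<le> s" "s < i" "matched c s i" by (auto simp: second_occ_def)
      then have "s = j" using assms matched_sym[OF s(3)] by (intro u) auto
      then show False using s True by simp
    qed
    ultimately show ?thesis using that(3) Num by simp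
  next
    case False
    then have "second_occ c i" using j matched_sym[OF j(3)] by (auto simp: second_occ_def intro!: exI[of _ j])
    moreover have "\<not> first_occ n c i"
    proof
      assume "first_occ n c i"
      then obtain t where t: "i < t" "t \<le> 2*n" "matched c i t" by (auto simp: first_occ_def)
      then have "t = j" using assms by (intro u) auto
      then show False using t False by simp
    qed
    ultimately show ?thesis using that(4) Num by simp
  qed
qed (use that in \<open>auto simp: first_occ_def second_occ_def matched_def\<close>)

lemma matched_flip:
  assumes "i \<in> {1..2*n}" "j \<in> {1..2*n}" "matched c i j"
  shows "matched c (2*n+1-i) (2*n+1-j)"
proof -
  from assms(3) obtain a where a: "c i = Num a" "c j = Num a" by (auto simp: matched_def)
  have sk: "skew_symmetric_clan n c" using type_D by (simp add: type_D_clan_def)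
  have i': "2*n+1-i \<in> {1..2*n}" "2*n+1-(2*n+1-i) = i" using assms(1) by auto
  obtain b where b: "c (2*n+1-i) = Num b" using sk assms(1) a unfolding skew_symmetric_clan_def by blast
  have "c (2*n+1-(2*n+1-i)) = c j" using i' a by simp
  then have "c (2*n+1-i) = c (2*n+1-j)" using sk i'(1) b assms(2) unfolding skew_symmetric_clan_def by blast
  then show ?thesis using b by (auto simp: matched_def)
qed

lemma matched_not_flip: "i \<in> {1..2*n} \<Longrightarrow> j \<in> {1..2*n} \<Longrightarrow> matched c i j \<Longrightarrow> j \<noteq> 2*n+1-i"
  using type_D by (auto simp: type_D_clan_def)

lemma first_flip:
  assumes "i \<in> {1..2*n}"
  shows "first_occ n c (2*n+1-i) \<longleftrightarrow> second_occ c i"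
proof
  assume "first_occ n c (2*n+1-i)"
  then obtain t where t: "2*n+1-i < t" "t \<le> 2*n" "matched c (2*n+1-i) t" by (auto simp: first_occ_def)
  have "matched c (2*n+1-(2*n+1-i)) (2*n+1-t)" using t assms by (intro matched_flip) auto
  moreover have "2*n+1-(2*n+1-i) = i" using assms by auto
  ultimately have "matched c (2*n+1-t) i" by (simp add: matched_sym)
  moreover have "1 \<le> 2*n+1-t" "2*n+1-t < i" using t assms by auto
  ultimately show "second_occ c i" unfolding second_occ_def by blast
next
  assume "second_occ c i"
  then obtain s where s: "1 \<le> s" "s < i" "matched c s i" by (auto simp: second_occ_def)
  then have "matched c (2*n+1-i) (2*n+1-s)" using assms matched_sym[OF s(3)] by (intro matched_flip) auto
  moreover have "2*n+1-i < 2*n+1-s" "2*n+1-s \<le> 2*n" using s assms by auto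
  ultimately show "first_occ n c (2*n+1-i)" unfolding first_occ_def by blast
qed

lemma sign_flip:
  assumes "i \<in> {1..2*n}"
  shows "c (2*n+1-i) = Plus \<longleftrightarrow> c i = Minus" "c (2*n+1-i) = Minus \<longleftrightarrow> c i = Plus"
proof -
  have sk: "skew_symmetric_clan n c" using type_D by (simp add: type_D_clan_def)
  have 1: "(c j = Plus \<longrightarrow> c (2*n+1-j) = Minus) \<and> (c j = Minus \<longrightarrow> c (2*n+1-j) = Plus)" if "j \<in> {1..2*n}" for j
    using sk that unfolding skew_symmetric_clan_def by blast
  define d where "d = 2*n+1-i"
  have d: "d \<in> {1..2*n}" "2*n+1-d = i" using assms by (auto simp: d_def)
  have "(c i = Plus \<longrightarrow> c d = Minus) \<and> (c i = Minus \<longrightarrow> c d = Plus)" using 1[OF assms] unfolding d_def .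
  moreover have "(c d = Plus \<longrightarrow> c i = Minus) \<and> (c d = Minus \<longrightarrow> c i = Plus)" using 1[OF d(1)] unfolding d(2) .
  ultimately show "c (2*n+1-i) = Plus \<longleftrightarrow> c i = Minus" "c (2*n+1-i) = Minus \<longleftrightarrow> c i = Plus"
    unfolding d_def[symmetric] by blast+
qed

text \<open>The mirror map exchanges plus with minus and first with second occurrences, and every
  position is of exactly one of these four kinds.\<close>

lemma lag_plus: "lag n (plus_or_second n c)" and lag_minus: "lag n (minus_or_second n c)"
proof -
  have m: "(i \<in> plus_or_second n c \<longleftrightarrow> 2*n-1-i \<notin> plus_or_second n c) \<and>
      (i \<in> minus_or_second n c \<longleftrightarrow> 2*n-1-i \<notin> minus_or_second n c)" if i: "i < 2*n" for i
  proof -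
    define j where "j = 2*n+1-Suc i"
    have S: "Suc (2*n-1-i) = j" "Suc i \<in> {1..2*n}" "j \<in> {1..2*n}" "2*n+1-j = Suc i" "2*n-1-i < 2*n"
      using i by (auto simp: j_def)
    have f: "second_occ c j \<longleftrightarrow> first_occ n c (Suc i)" using first_flip[OF S(3)] unfolding S(4) by simp
    have sf: "c j = Plus \<longleftrightarrow> c (Suc i) = Minus" "c j = Minus \<longleftrightarrow> c (Suc i) = Plus"
      unfolding j_def by (rule sign_flip[OF S(2)])+
    have "i < 2*n \<and> Q \<longleftrightarrow> Q" "2*n-1-i < 2*n \<and> Q \<longleftrightarrow> Q" for Q using i S(5) by blast+
    then show ?thesis unfolding plus_or_second_def minus_or_second_def mem_Collect_eq S(1) f sf
      by (simp only:) (cases rule: symbol_cases[OF S(2)], auto)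
  qed
  show "lag n (plus_or_second n c)" "lag n (minus_or_second n c)"
    unfolding lag_def using m by (auto simp: plus_or_second_def minus_or_second_def)
qed

lemma num_pairs_second:
  assumes "i \<le> 2*n"
  shows "num_pairs c i = card {t\<in>{1..i}. second_occ c t}"
proof -
  have "bij_betw snd {(s, t). 1 \<le> s \<and> s < t \<and> t \<le> i \<and> matched c s t} {t\<in>{1..i}. second_occ c t}"
    unfolding bij_betw_def
  proof
    show "inj_on snd {(s, t). 1 \<le> s \<and> s < t \<and> t \<le> i \<and> matched c s t}"
    proof (rule inj_onI, clarsimp)
      fix s s' t assume "Suc 0 \<le> s" "s < t" "t \<le> i" "matched c s t" "Suc 0 \<le> s'" "s' < t" "matched c s' t"
      then show "s = s'" using assms matched_sym[of c s t] matched_sym[of c s' t] by (intro partner_unique[of t]) auto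
    qed
    show "snd ` {(s, t). 1 \<le> s \<and> s < t \<and> t \<le> i \<and> matched c s t} = {t\<in>{1..i}. second_occ c t}"
      by (force simp: second_occ_def image_iff)
  qed
  then show ?thesis unfolding num_pairs_def by (rule bij_betw_same_card)
qed

lemma card_shift: "card {i. i < m \<and> Q (Suc i)} = card {k\<in>{1..m}. Q k}"
proof -
  have "bij_betw Suc {i. i < m \<and> Q (Suc i)} {k\<in>{1..m}. Q k}"
    by (rule bij_betw_byWitness[where f' = "\<lambda>k. k - 1"]) (auto simp: image_iff)
  then show ?thesis by (rule bij_betw_same_card)
qed

lemma card_sign_second:
  assumes i: "i \<le> 2*n" and X: "X = Plus \<or> X = Minus"
  shows "card {k\<in>{1..i}. c k = X} + num_pairs c i = card {k. k < i \<and> (c (Suc k) = X \<or> second_occ c (Suc k))}"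
proof -
  have "card {k\<in>{1..i}. c k = X} + num_pairs c i =
      card ({k\<in>{1..i}. c k = X} \<union> {t\<in>{1..i}. second_occ c t})"
    unfolding num_pairs_second[OF i]
    by (rule card_Un_disjoint[symmetric]) (use X in \<open>auto simp: second_occ_def matched_def\<close>)
  also have "{k\<in>{1..i}. c k = X} \<union> {t\<in>{1..i}. second_occ c t} = {k\<in>{1..i}. c k = X \<or> second_occ c k}" by auto
  finally show ?thesis using card_shift[of i "\<lambda>k. c k = X \<or> second_occ c k"] by simp
qed

lemma card_plus:
  assumes "i \<le> 2*n"
  shows "card {k\<in>{1..i}. c k = Plus} + num_pairs c i = card (plus_or_second n c \<inter> {..<i})"
proof -
  have "plus_or_second n c \<inter> {..<i} = {k. k < i \<and> (c (Suc k) = Plus \<or> second_occ c (Suc k))}"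
    using assms by (auto simp: plus_or_second_def)
  then show ?thesis using card_sign_second[OF assms, of Plus] by simp
qed

lemma card_minus:
  assumes "i \<le> 2*n"
  shows "card {k\<in>{1..i}. c k = Minus} + num_pairs c i = card (minus_or_second n c \<inter> {..<i})"
proof -
  have "minus_or_second n c \<inter> {..<i} = {k. k < i \<and> (c (Suc k) = Minus \<or> second_occ c (Suc k))}"
    using assms by (auto simp: minus_or_second_def)
  then show ?thesis using card_sign_second[OF assms, of Minus] by simp
qed

definition open_arcs :: "nat \<Rightarrow> nat \<Rightarrow> (nat \<times> nat) set" where
  "open_arcs i j = {(s, t). 1 \<le> s \<and> s \<le> i \<and> j < t \<and> t \<le> 2*n \<and> matched c s t}"

lemma finite_open_arcs: "finite (open_arcs i j)"
  by (rule finite_subset[of _ "{..i} \<times> {..2*n}"]) (auto simp: open_arcs_def)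

text \<open>A first occurrence up to k either has its partner up to k or begins an arc open at k.
  Second occurrences are counted in both sets, once for themselves and once for their
  partners.\<close>

lemma card_positions:
  assumes k: "k \<le> 2*n"
  shows "k = card (plus_or_second n c \<inter> {..<k}) + card (minus_or_second n c \<inter> {..<k}) + card (open_arcs k k)"
proof -
  let ?A = "\<lambda>Q. {i\<in>{1..k}. Q i}"
  have fin: "finite (?A Q)" for Q by simp
  have "card {1..k} = card (?A (\<lambda>i. c i = Plus) \<union> (?A (\<lambda>i. c i = Minus) \<union> (?A (first_occ n c) \<union> ?A (second_occ c))))"
  proof (rule arg_cong[of _ _ card], rule equalityI; rule subsetI)
    fix i assume i: "i \<in> {1..k}"
    then have "i \<in> {1..2*n}" using k by auto
    then show "i \<in> ?A (\<lambda>i. c i = Plus) \<union> (?A (\<lambda>i. c i = Minus) \<union> (?A (first_occ n c) \<union> ?A (second_occ c)))"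
      using i by (cases rule: symbol_cases) auto
  qed auto
  also have "\<dots> = card (?A (\<lambda>i. c i = Plus)) + (card (?A (\<lambda>i. c i = Minus)) + (card (?A (first_occ n c)) + card (?A (second_occ c))))"
  proof -
    have d: "\<not> (first_occ n c i \<and> second_occ c i)" if "i \<in> {1..k}" for i
    proof -
      have "i \<in> {1..2*n}" using that k by auto
      then show ?thesis by (cases rule: symbol_cases) auto
    qed
    show ?thesis
      by (subst card_Un_disjoint; (subst card_Un_disjoint)?; (subst card_Un_disjoint)?)
        (use d in \<open>auto simp: first_occ_def second_occ_def matched_def\<close>)
  qed
  also have "card (?A (first_occ n c)) = num_pairs c k + card (open_arcs k k)"
  proof -
    let ?S = "{(s, t). 1 \<le> s \<and> s < t \<and> t \<le> k \<and> matched c s t}"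
    have fS: "finite ?S" by (rule finite_subset[of _ "{..k} \<times> {..k}"]) auto
    have "bij_betw fst (?S \<union> open_arcs k k) (?A (first_occ n c))"
      unfolding bij_betw_def
    proof
      show "inj_on fst (?S \<union> open_arcs k k)"
      proof (rule inj_onI)
        fix x y assume "x \<in> ?S \<union> open_arcs k k" "y \<in> ?S \<union> open_arcs k k" "fst x = fst y"
        then show "x = y" using k by (cases x; cases y) (auto simp: open_arcs_def intro!: partner_unique[of "fst x"])
      qed
      show "fst ` (?S \<union> open_arcs k k) = ?A (first_occ n c)"
      proof (intro equalityI subsetI)
        fix s assume "s \<in> fst ` (?S \<union> open_arcs k k)"
        then obtain t where "(s,t) \<in> ?S \<union> open_arcs k k" by force
        then have "1 \<le> s \<and> s \<le> k \<and> s < t \<and> t \<le> 2*n \<and> matched c s t" using k by (auto simp: open_arcs_def)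
        then show "s \<in> ?A (first_occ n c)" by (auto simp: first_occ_def)
      next
        fix s assume "s \<in> ?A (first_occ n c)"
        then obtain t where "1 \<le> s" "s \<le> k" "s < t" "t \<le> 2*n" "matched c s t" by (auto simp: first_occ_def)
        then have "(s,t) \<in> ?S \<union> open_arcs k k" by (cases "t \<le> k") (auto simp: open_arcs_def)
        then show "s \<in> fst ` (?S \<union> open_arcs k k)" by force
      qed
    qed
    then have "card (?A (first_occ n c)) = card (?S \<union> open_arcs k k)" by (simp add: bij_betw_same_card)
    also have "\<dots> = card ?S + card (open_arcs k k)"
      using fS finite_open_arcs by (intro card_Un_disjoint) (auto simp: open_arcs_def)
    finally show ?thesis by (simp add: num_pairs_def)
  qed
  finally show ?thesis using card_plus[OF k] card_minus[OF k] num_pairs_second[OF k] by simp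
qed

lemma even_minus: "even (card (minus_or_second n c \<inter> {..<n}))"
  using card_minus[of n] type_D by (auto simp: type_D_clan_def)

text \<open>The mirror image of an arc open at n is again open at n, and condition (2) on the clan
  excludes arcs that are their own image; so the number of these arcs is even. The count in
  \<open>card_positions\<close> then carries the parity in condition (3) over from minus to
  plus.\<close>

lemma even_plus: "even (card (plus_or_second n c \<inter> {n..}))"
proof -
  \<comment> \<open>The start of the mirror image of the arc that starts at s.\<close>
  define f where "f s = 2*n+1 - (THE t. (s,t) \<in> open_arcs n n)" for s
  let ?X = "fst ` open_arcs n n"
  have uniq: "t = t'" if "(s,t) \<in> open_arcs n n" "(s,t') \<in> open_arcs n n" for s t t'
    using that by (auto simp: open_arcs_def intro!: partner_unique[of s])
  have f: "f s = 2*n+1-t" if "(s,t) \<in> open_arcs n n" for s t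
    unfolding f_def using uniq[OF that] that by (metis the_equality)
  have flip: "(2*n+1-t, 2*n+1-s) \<in> open_arcs n n" if "(s,t) \<in> open_arcs n n" for s t
    using that matched_flip[of t s] by (auto simp: open_arcs_def matched_sym)
  have "even (card ?X)"
  proof (rule even_card_involution[where f = f])
    show "finite ?X" using finite_open_arcs by blast
  next
    fix s assume "s \<in> ?X"
    then obtain t where st: "(s,t) \<in> open_arcs n n" by auto
    have r: "1 \<le> s" "s \<le> n" "n < t" "t \<le> 2*n" "matched c s t" using st by (auto simp: open_arcs_def)
    show "f s \<in> ?X" using f[OF st] flip[OF st] by force
    show "f (f s) = s" using f[OF st] f[OF flip[OF st]] r by simp
    show "f s \<noteq> s" using f[OF st] matched_not_flip[of s t] r by auto
  qed
  moreover have "card ?X = card (open_arcs n n)"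
    by (rule card_image, rule inj_onI) (use uniq in auto)
  ultimately have "even (card (open_arcs n n))" by simp
  moreover have "n = card (plus_or_second n c \<inter> {..<n}) + card (minus_or_second n c \<inter> {..<n}) + card (open_arcs n n)"
    by (rule card_positions) simp
  moreover have "card (plus_or_second n c \<inter> {..<n}) + card (plus_or_second n c \<inter> {n..}) = n"
    using lag_cards(2)[OF lag_plus] .
  ultimately have "card (plus_or_second n c \<inter> {n..}) = card (minus_or_second n c \<inter> {..<n}) + card (open_arcs n n)"
    by linarith
  then show ?thesis using even_minus \<open>even (card (open_arcs n n))\<close> by simp
qed

text \<open>
  In a clan avoiding \<open>1212\<close>, at the last position up to \<open>j\<close> where an arc from the first \<open>i\<close>
  positions ends, every open arc starts before \<open>i\<close> and ends after \<open>j\<close>.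
\<close>

lemma noncrossing_cut:
  assumes av: "avoids_1212 n c" and ij: "1 \<le> i" "i \<le> j" "j \<le> 2*n"
  obtains k where "i \<le> k" "k \<le> j" "open_arcs k k \<subseteq> open_arcs i j"
proof -
  define T where "T = {t. i < t \<and> t \<le> j \<and> (\<exists>s. 1 \<le> s \<and> s \<le> i \<and> matched c s t)}"
  \<comment> \<open>Inserting i makes k = i when no arc from the first i positions ends in (i,
    j].\<close>
  define k where "k = Max (insert i T)"
  have fT: "finite (insert i T)" by (auto simp: T_def)
  have kin: "k \<in> insert i T" unfolding k_def by (rule Max_in) (use fT in auto)
  have kmax: "t \<le> k" if "t \<in> insert i T" for t unfolding k_def using fT that by simp
  have ik: "i \<le> k" using kmax by simp
  have kj: "k \<le> j" using kin ij by (auto simp: T_def)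
  have cross: False if "1 \<le> p" "p < q" "q < r" "r < s" "s \<le> 2*n" "matched c p r" "matched c q s" for p q r s
  proof -
    have "\<not> matched c p q"
    proof
      assume "matched c p q"
      then have "q = r" using that by (intro partner_unique[of p]) auto
      then show False using that by simp
    qed
    then show False using av that unfolding avoids_1212_def by blast
  qed
  have "open_arcs k k \<subseteq> open_arcs i j"
  proof (clarsimp simp: open_arcs_def)
    fix s t assume st: "Suc 0 \<le> s" "s \<le> k" "k < t" "t \<le> 2*n" "matched c s t"
    have si: "s \<le> i"
    proof (rule ccontr)
      assume "\<not> s \<le> i"
      then have "k \<in> T" using kin st by auto
      then obtain s1 where s1: "1 \<le> s1" "s1 \<le> i" "matched c s1 k" by (auto simp: T_def)
      have "s \<noteq> k"
      proof
        assume "s = k"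
        then have "s1 = t" using s1 st \<open>k \<in> T\<close> matched_sym[OF s1(3)] ij
          by (intro partner_unique[of k]) (auto simp: T_def)
        then show False using s1 st ik by simp
      qed
      then show False using cross[of s1 s k t] s1 st \<open>\<not> s \<le> i\<close> by auto
    qed
    moreover have "j < t"
    proof (rule ccontr)
      assume "\<not> j < t"
      then have "t \<in> T" using st si ik unfolding T_def by auto
      then show False using kmax[of t] st by simp
    qed
    ultimately show "s \<le> i \<and> j < t" by simp
  qed
  then show thesis using ik kj that by blast
qed

end

subsection \<open>The signed permutations of a clan\<close>

definition rank_in :: "nat set \<Rightarrow> nat \<Rightarrow> nat" where
  "rank_in K i = card {j\<in>K. j \<le> i}"

lemma rank_in_less: "finite K \<Longrightarrow> k \<in> K \<Longrightarrow> i < k \<Longrightarrow> rank_in K i < rank_in K k"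
  unfolding rank_in_def
proof (rule psubset_card_mono)
  assume "finite K" "k \<in> K" "i < k"
  then have "k \<in> {j\<in>K. j \<le> k}" "k \<notin> {j\<in>K. j \<le> i}" "{j\<in>K. j \<le> i} \<subseteq> {j\<in>K. j \<le> k}" by auto
  then show "{j\<in>K. j \<le> i} \<subset> {j\<in>K. j \<le> k}" by blast
qed auto

lemma rank_in_bounds: "finite K \<Longrightarrow> k \<in> K \<Longrightarrow> 1 \<le> rank_in K k \<and> rank_in K k \<le> card K"
  unfolding rank_in_def by (auto intro: card_mono simp: Suc_le_eq card_gt_0_iff)

text \<open>A position j > n stands for the negative number -(2n+1-j); \<open>val\<close> and
  \<open>lav\<close> translate. Commuting with the mirror map becomes oddness, and the positions i
  \<le> n with p i > n become the sign changes.\<close>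

lemma weyl_embed_onto:
  assumes p: "p permutes {1..2*n}" and bar: "\<And>i. i \<in> {1..2*n} \<Longrightarrow> p (2*n+1-i) = 2*n+1 - p i"
    and ev: "even (card {i\<in>{1..n}. n < p i})"
  shows "\<exists>s\<in>weyl_D n. weyl_embed n s = p"
proof -
  let ?S = "{- int n..int n} - {0}"
  define val where "val k = (if k > 0 then nat k else nat (2 * int n + 1 + k))" for k :: int
  define lav where "lav j = (if j \<le> n then int j else int j - (2 * int n + 1))" for j :: nat
  define s where "s k = (if k \<in> ?S then lav (p (val k)) else k)" for k :: int
  have val: "val k \<in> {1..2*n}" "lav (val k) = k" if "k \<in> ?S" for k
    using that by (auto simp: val_def lav_def)
  have lav: "lav j \<in> ?S" "val (lav j) = j" if "j \<in> {1..2*n}" for j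
    using that by (auto simp: val_def lav_def)
  have pin: "p j \<in> {1..2*n}" if "j \<in> {1..2*n}" for j using permutes_in_image[OF p, of j] that by blast
  have bv: "bij_betw val ?S {1..2*n}"
    by (rule bij_betw_byWitness[where f' = lav]; (rule ballI image_subsetI)?) (rule val lav; assumption)+
  have bl: "bij_betw lav {1..2*n} ?S"
    by (rule bij_betw_byWitness[where f' = val]; (rule ballI image_subsetI)?) (rule val lav; assumption)+
  have "bij_betw (lav \<circ> (p \<circ> val)) ?S ?S"
    by (rule bij_betw_trans[OF bij_betw_trans[OF bv permutes_imp_bij[OF p]] bl])
  then have "bij_betw s ?S ?S" by (rule bij_betw_cong[THEN iffD1, rotated]) (simp add: s_def)
  then have perm: "s permutes ?S" by (rule bij_imp_permutes) (auto simp: s_def)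
  have neg: "s (- k) = - s k" if k: "k \<in> ?S" for k
  proof -
    have mk: "- k \<in> ?S" using k by auto
    have "val (- k) = 2*n+1 - val k" using k by (auto simp: val_def)
    then have "p (val (- k)) = 2*n+1 - p (val k)" using bar[OF val(1)[OF k]] by simp
    moreover have "lav (2*n+1-j) = - lav j" if "j \<in> {1..2*n}" for j using that by (auto simp: lav_def)
    ultimately show ?thesis unfolding s_def using k mk pin[OF val(1)[OF k]] by simp
  qed
  have sgn: "s (int i) = lav (p i)" if "i \<in> {1..n}" for i using that by (simp add: s_def val_def)
  have "{k\<in>{1..int n}. s k < 0} = int ` {i\<in>{1..n}. n < p i}"
  proof (intro equalityI subsetI)
    fix k assume "k \<in> {k\<in>{1..int n}. s k < 0}"
    then have k: "1 \<le> k" "k \<le> int n" "s k < 0" by auto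
    then have "nat k \<in> {1..n}" "int (nat k) = k" by auto
    with sgn[OF this(1)] k(3) have "nat k \<in> {i\<in>{1..n}. n < p i}" by (auto simp: lav_def split: if_splits)
    then show "k \<in> int ` {i\<in>{1..n}. n < p i}" using \<open>int (nat k) = k\<close> by (metis imageI)
  next
    fix k assume "k \<in> int ` {i\<in>{1..n}. n < p i}"
    then obtain i where i: "i \<in> {1..n}" "n < p i" "k = int i" by blast
    have "p i \<le> 2*n" using pin[of i] i(1) by auto
    then show "k \<in> {k\<in>{1..int n}. s k < 0}" using sgn[OF i(1)] i by (auto simp: lav_def)
  qed
  then have "even (card {k\<in>{1..int n}. s k < 0})" using ev by (simp add: card_image)
  then have sD: "s \<in> weyl_D n" using perm neg by (simp add: weyl_D_def)
  have e: "(if s (int k) > 0 then nat (s (int k)) else 2*n+1 - nat \<bar>s (int k)\<bar>) = p k" if k: "k \<in> {1..n}" for k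
  proof -
    have "p k \<in> {1..2*n}" using pin[of k] k by auto
    then show ?thesis unfolding sgn[OF k] lav_def by auto
  qed
  have "weyl_embed n s i = p i" for i
  proof -
    consider "i \<in> {1..n}" | "i \<in> {n+1..2*n}" | "i \<notin> {1..2*n}" by fastforce
    then show ?thesis
    proof cases
      case 1
      then show ?thesis using e[OF 1] unfolding weyl_embed_def Let_def by simp
    next
      case 2
      then have k: "2*n+1-i \<in> {1..n}" "2*n+1-i \<in> {1..2*n}" "2*n+1-(2*n+1-i) = i" "i \<notin> {1..n}" by auto
      have "2*n+1 - p (2*n+1-i) = p i" using bar[OF k(2)] k(3) by simp
      then show ?thesis using e[OF k(1)] 2 k(4) unfolding weyl_embed_def Let_def by simp
    next
      case 3
      then have "i \<notin> {1..n}" "i \<notin> {n+1..2*n}" by auto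
      then show ?thesis using permutes_not_in[OF p 3] unfolding weyl_embed_def Let_def by (simp only: if_False)
    qed
  qed
  then show ?thesis using sD by blast
qed

text \<open>The mirror map exchanges P and Q and reverses the order, so a rank in Q from the left is
  a rank in P from the right. The element i itself is counted from both sides, whence n + 1.\<close>

lemma rank_perm:
  assumes P: "P \<subseteq> {1..2*n}" "\<forall>i\<in>{1..2*n}. i \<in> P \<longleftrightarrow> 2*n+1-i \<notin> P"
  defines "Q \<equiv> {1..2*n} - P"
  shows "i \<in> P \<Longrightarrow> rank_in Q (2*n+1-i) = n + 1 - rank_in P i" "card P = n" "card Q = n"
proof -
  have fin: "finite P" "finite Q" using P(1) finite_subset by (auto simp: Q_def)
  have m1: "2*n+1-i \<in> Q" if "i \<in> P" for i
    using bspec[OF P(2), of i] subsetD[OF P(1) that] that by (auto simp: Q_def)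
  have m2: "2*n+1-i \<in> P" if "i \<in> Q" for i
    using bspec[OF P(2), of i] that by (auto simp: Q_def)
  have inv: "2*n+1-(2*n+1-i) = i" if "i \<in> {1..2*n}" for i using that by auto
  have PQ: "i \<in> {1..2*n}" if "i \<in> P \<or> i \<in> Q" for i using that P(1) by (auto simp: Q_def)
  have b: "bij_betw (\<lambda>i. 2*n+1-i) P Q"
    by (rule bij_betw_byWitness[where f' = "\<lambda>i. 2*n+1-i"]) (use m1 m2 inv PQ in blast)+
  have "card P + card Q = card (P \<union> Q)" using fin by (intro card_Un_disjoint[symmetric]) (auto simp: Q_def)
  also have "P \<union> Q = {1..2*n}" using P(1) by (auto simp: Q_def)
  finally have "card P + card Q = 2*n" by simp
  then show cP: "card P = n" "card Q = n" using bij_betw_same_card[OF b] by auto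
  show "rank_in Q (2*n+1-i) = n + 1 - rank_in P i" if i: "i \<in> P"
  proof -
    have i': "i \<in> {1..2*n}" using PQ i by blast
    have "bij_betw (\<lambda>i. 2*n+1-i) {j\<in>P. i \<le> j} {j\<in>Q. j \<le> 2*n+1-i}"
    proof (rule bij_betw_byWitness[where f' = "\<lambda>i. 2*n+1-i"])
      show "(\<lambda>i. 2*n+1-i) ` {j\<in>Q. j \<le> 2*n+1-i} \<subseteq> {j\<in>P. i \<le> j}" using m2 i' by auto
      show "(\<lambda>i. 2*n+1-i) ` {j\<in>P. i \<le> j} \<subseteq> {j\<in>Q. j \<le> 2*n+1-i}" using m1 by auto
    qed (use inv PQ in blast)+
    then have "rank_in Q (2*n+1-i) = card {j\<in>P. i \<le> j}" unfolding rank_in_def by (simp add: bij_betw_same_card)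
    moreover have "card {j\<in>P. i \<le> j} + rank_in P i = n + 1"
    proof -
      have "card ({j\<in>P. i \<le> j} \<union> {j\<in>P. j \<le> i}) + card ({j\<in>P. i \<le> j} \<inter> {j\<in>P. j \<le> i}) = card {j\<in>P. i \<le> j} + card {j\<in>P. j \<le> i}"
        using fin by (intro card_Un_Int[symmetric]) auto
      moreover have "{j\<in>P. i \<le> j} \<union> {j\<in>P. j \<le> i} = P" "{j\<in>P. i \<le> j} \<inter> {j\<in>P. j \<le> i} = {i}" using i by auto
      ultimately show ?thesis using cP by (simp add: rank_in_def)
    qed
    ultimately show ?thesis by simp
  qed
qed

section \<open>The permutations u(\<gamma>) and v(\<gamma>) as signed permutations\<close>

context clan_D
begin

text \<open>The last property is what the Schubert cell needs: u reverses the order inside each of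
  its two classes, so conjugation by its matrix turns a block diagonal lower triangular matrix into
  an upper triangular one.\<close>

lemma clan_u_props:
  defines "P \<equiv> Suc ` plus_or_second n c"
  shows "clan_u n c permutes {1..2*n}"
    "i \<in> {1..2*n} \<Longrightarrow> clan_u n c (2*n+1-i) = 2*n+1 - clan_u n c i"
    "i \<in> {1..2*n} \<Longrightarrow> n < clan_u n c i \<longleftrightarrow> i \<notin> P"
    "i \<in> {1..2*n} \<Longrightarrow> k \<in> {1..2*n} \<Longrightarrow> i < k \<Longrightarrow> (i \<in> P \<longleftrightarrow> k \<in> P) \<Longrightarrow> clan_u n c k < clan_u n c i"
proof -
  let ?Q = "{1..2*n} - P"
  have P1: "P \<subseteq> {1..2*n}" using lagD(1)[OF lag_plus] by (auto simp: P_def)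
  have memP: "j \<in> P \<longleftrightarrow> j - 1 \<in> plus_or_second n c" if "j \<in> {1..2*n}" for j
    using that by (cases j) (auto simp: P_def)
  have P2: "j \<in> P \<longleftrightarrow> 2*n+1-j \<notin> P" if j: "j \<in> {1..2*n}" for j
  proof -
    have j': "2*n+1-j \<in> {1..2*n}" "2*n+1-j-1 = 2*n-1-(j-1)" "j - 1 < 2*n" using j by auto
    show ?thesis unfolding memP[OF j] memP[OF j'(1)] j'(2) using lagD(3,4)[OF lag_plus] j'(3) by blast
  qed
  then have P2': "\<forall>j\<in>{1..2*n}. j \<in> P \<longleftrightarrow> 2*n+1-j \<notin> P" by blast
  have Peq: "{j\<in>{1..2*n}. c j = Plus \<or> second_occ c j} = P"
  proof (intro equalityI subsetI)
    fix j assume "j \<in> {j\<in>{1..2*n}. c j = Plus \<or> second_occ c j}"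
    then show "j \<in> P" unfolding P_def plus_or_second_def by (intro image_eqI[of _ _ "j - 1"]) auto
  qed (auto simp: P_def plus_or_second_def)
  have u: "clan_u n c i = (if i \<notin> {1..2*n} then i else if i \<in> P then n + 1 - rank_in P i else 2*n + 1 - rank_in ?Q i)" for i
    unfolding clan_u_def Peq Let_def rank_in_def ..
  note rp = rank_perm[OF P1 P2']
  have fin: "finite P" "finite ?Q" using P1 finite_subset by auto
  have bP: "1 \<le> rank_in P i \<and> rank_in P i \<le> n" if "i \<in> P" for i using rank_in_bounds[OF fin(1) that] rp by simp
  have bQ: "1 \<le> rank_in ?Q i \<and> rank_in ?Q i \<le> n" if "i \<in> ?Q" for i using rank_in_bounds[OF fin(2) that] rp by simp
  have uP: "clan_u n c i \<in> {1..n}" if "i \<in> P" for i using u[of i] bP[OF that] that P1 by auto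
  have uQ: "clan_u n c i \<in> {n+1..2*n}" if "i \<in> ?Q" for i using u[of i] bQ[OF that] that by auto
  show 3: "n < clan_u n c i \<longleftrightarrow> i \<notin> P" if "i \<in> {1..2*n}" for i using uP[of i] uQ[of i] that by fastforce
  show 4: "clan_u n c k < clan_u n c i" if ik: "i \<in> {1..2*n}" "k \<in> {1..2*n}" "i < k" "i \<in> P \<longleftrightarrow> k \<in> P" for i k
  proof (cases "i \<in> P")
    case True
    then show ?thesis using u[of i] u[of k] ik rank_in_less[OF fin(1), of k i] bP[of k] bP[of i] by simp
  next
    case False
    then have "i \<in> ?Q" "k \<in> ?Q" using ik by auto
    then show ?thesis using u[of i] u[of k] ik False rank_in_less[OF fin(2), of k i] bQ[of k] bQ[of i] by simp
  qed
  have "inj_on (clan_u n c) {1..2*n}"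
  proof (rule inj_onI)
    fix i k assume ik: "i \<in> {1..2*n}" "k \<in> {1..2*n}" "clan_u n c i = clan_u n c k"
    then have "i \<in> P \<longleftrightarrow> k \<in> P" using 3[of i] 3[of k] by auto
    then show "i = k" using 4[of i k] 4[of k i] ik by (metis linorder_neqE_nat less_irrefl)
  qed
  moreover have "clan_u n c ` {1..2*n} \<subseteq> {1..2*n}"
  proof
    fix x assume "x \<in> clan_u n c ` {1..2*n}"
    then obtain i where "i \<in> {1..2*n}" "x = clan_u n c i" by blast
    then show "x \<in> {1..2*n}" using uP[of i] uQ[of i] by (cases "i \<in> P") auto
  qed
  ultimately have "bij_betw (clan_u n c) {1..2*n} {1..2*n}"
    unfolding bij_betw_def using endo_inj_surj[of "{1..2*n}" "clan_u n c"] by simp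
  then show "clan_u n c permutes {1..2*n}" by (rule bij_imp_permutes) (simp add: u)
  have flipP: "clan_u n c (2*n+1-i) = 2*n+1 - clan_u n c i" if i: "i \<in> P" for i
  proof -
    have "i \<in> {1..2*n}" using P1 i by blast
    then have i': "2*n+1-i \<in> {1..2*n}" "2*n+1-i \<notin> P" using P2[of i] i by auto
    show ?thesis using u[of i] u[of "2*n+1-i"] i i' \<open>i \<in> {1..2*n}\<close> rp(1)[OF i] bP[OF i] by simp
  qed
  show "clan_u n c (2*n+1-i) = 2*n+1 - clan_u n c i" if i: "i \<in> {1..2*n}"
  proof (cases "i \<in> P")
    case False
    then have "2*n+1-i \<in> P" "2*n+1-(2*n+1-i) = i" using P2[OF i] i by auto
    from flipP[OF this(1)] this(2) have "clan_u n c i = 2*n+1 - clan_u n c (2*n+1-i)" by simp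
    moreover have "clan_u n c (2*n+1-i) \<le> 2*n" using uP[OF \<open>2*n+1-i \<in> P\<close>] by simp
    ultimately show ?thesis by simp
  qed (rule flipP)
qed

text \<open>Here the order inside the classes is preserved, because the opposite cell is treated
  after conjugation by \<open>flip_mat n\<close>, which already makes lower triangular matrices
  upper triangular.\<close>

lemma clan_v_props:
  defines "Q \<equiv> Suc ` minus_or_second n c"
  shows "clan_v n c permutes {1..2*n}"
    "i \<in> {1..2*n} \<Longrightarrow> clan_v n c (2*n+1-i) = 2*n+1 - clan_v n c i"
    "i \<in> {1..2*n} \<Longrightarrow> n < clan_v n c i \<longleftrightarrow> i \<in> Q"
    "i \<in> {1..2*n} \<Longrightarrow> k \<in> {1..2*n} \<Longrightarrow> i < k \<Longrightarrow> (i \<in> Q \<longleftrightarrow> k \<in> Q) \<Longrightarrow> clan_v n c i < clan_v n c k"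
proof -
  define P where "P = {1..2*n} - Q"
  have Q1: "Q \<subseteq> {1..2*n}" using lagD(1)[OF lag_minus] by (auto simp: Q_def)
  have PQ: "{1..2*n} - P = Q" using Q1 by (auto simp: P_def)
  have P1: "P \<subseteq> {1..2*n}" by (auto simp: P_def)
  have memQ: "j \<in> Q \<longleftrightarrow> j - 1 \<in> minus_or_second n c" if "j \<in> {1..2*n}" for j
    using that by (cases j) (auto simp: Q_def)
  have P2: "j \<in> P \<longleftrightarrow> 2*n+1-j \<notin> P" if j: "j \<in> {1..2*n}" for j
  proof -
    have j': "2*n+1-j \<in> {1..2*n}" "2*n+1-j-1 = 2*n-1-(j-1)" "j - 1 < 2*n" using j by auto
    have "j \<in> Q \<longleftrightarrow> 2*n+1-j \<notin> Q"
      unfolding memQ[OF j] memQ[OF j'(1)] j'(2) using lagD(3,4)[OF lag_minus] j'(3) by blast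
    then show ?thesis using j j'(1) by (auto simp: P_def)
  qed
  then have P2': "\<forall>j\<in>{1..2*n}. j \<in> P \<longleftrightarrow> 2*n+1-j \<notin> P" by blast
  have Peq: "{j\<in>{1..2*n}. c j = Plus \<or> first_occ n c j} = P"
  proof -
    have "(c j = Plus \<or> first_occ n c j) \<longleftrightarrow> j \<notin> Q" if j: "j \<in> {1..2*n}" for j
    proof -
      have "j - 1 < 2*n" "Suc (j - 1) = j" using j by auto
      then have e: "j \<in> Q \<longleftrightarrow> c j = Minus \<or> second_occ c j" using memQ[OF j] by (simp add: minus_or_second_def)
      show ?thesis unfolding e by (cases rule: symbol_cases[OF j]) auto
    qed
    then show ?thesis unfolding P_def by blast
  qed
  have v: "clan_v n c i = (if i \<notin> {1..2*n} then i else if i \<in> P then rank_in P i else n + rank_in Q i)" for i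
    unfolding clan_v_def Peq Let_def rank_in_def PQ ..
  note rp = rank_perm[OF P1 P2', unfolded PQ]
  have fin: "finite P" "finite Q" using P1 Q1 finite_subset by auto
  have bP: "1 \<le> rank_in P i \<and> rank_in P i \<le> n" if "i \<in> P" for i using rank_in_bounds[OF fin(1) that] rp by simp
  have bQ: "1 \<le> rank_in Q i \<and> rank_in Q i \<le> n" if "i \<in> Q" for i using rank_in_bounds[OF fin(2) that] rp by simp
  have ex: "i \<in> P \<longleftrightarrow> i \<notin> Q" if "i \<in> {1..2*n}" for i using that by (auto simp: P_def)
  have vP: "clan_v n c i \<in> {1..n}" if "i \<in> P" for i using v[of i] bP[OF that] that P1 by auto
  have vQ: "clan_v n c i \<in> {n+1..2*n}" if "i \<in> Q" for i using v[of i] bQ[OF that] that ex[of i] Q1 by auto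
  show 3: "n < clan_v n c i \<longleftrightarrow> i \<in> Q" if "i \<in> {1..2*n}" for i using vP[of i] vQ[of i] ex[OF that] by fastforce
  show 4: "clan_v n c i < clan_v n c k" if ik: "i \<in> {1..2*n}" "k \<in> {1..2*n}" "i < k" "i \<in> Q \<longleftrightarrow> k \<in> Q" for i k
  proof (cases "i \<in> P")
    case True
    then show ?thesis using v[of i] v[of k] ik ex[of i] ex[of k] rank_in_less[OF fin(1), of k i] by simp
  next
    case False
    then show ?thesis using v[of i] v[of k] ik ex[of i] ex[of k] rank_in_less[OF fin(2), of k i] by simp
  qed
  have "inj_on (clan_v n c) {1..2*n}"
  proof (rule inj_onI)
    fix i k assume ik: "i \<in> {1..2*n}" "k \<in> {1..2*n}" "clan_v n c i = clan_v n c k"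
    then have "i \<in> Q \<longleftrightarrow> k \<in> Q" using 3[of i] 3[of k] by auto
    then show "i = k" using 4[of i k] 4[of k i] ik by (metis linorder_neqE_nat less_irrefl)
  qed
  moreover have "clan_v n c ` {1..2*n} \<subseteq> {1..2*n}"
  proof
    fix x assume "x \<in> clan_v n c ` {1..2*n}"
    then obtain i where "i \<in> {1..2*n}" "x = clan_v n c i" by blast
    then show "x \<in> {1..2*n}" using vP[of i] vQ[of i] ex[of i] by (cases "i \<in> P") auto
  qed
  ultimately have "bij_betw (clan_v n c) {1..2*n} {1..2*n}"
    unfolding bij_betw_def using endo_inj_surj[of "{1..2*n}" "clan_v n c"] by simp
  then show "clan_v n c permutes {1..2*n}" by (rule bij_imp_permutes) (simp add: v)
  have flipP: "clan_v n c (2*n+1-i) = 2*n+1 - clan_v n c i" if i: "i \<in> P" for i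
  proof -
    have "i \<in> {1..2*n}" using P1 i by blast
    then have i': "2*n+1-i \<in> {1..2*n}" "2*n+1-i \<notin> P" using P2[of i] i by auto
    show ?thesis using v[of i] v[of "2*n+1-i"] i i' \<open>i \<in> {1..2*n}\<close> rp(1)[OF i] bP[OF i] by simp
  qed
  show "clan_v n c (2*n+1-i) = 2*n+1 - clan_v n c i" if i: "i \<in> {1..2*n}"
  proof (cases "i \<in> P")
    case False
    then have "2*n+1-i \<in> P" "2*n+1-(2*n+1-i) = i" using P2[OF i] i by auto
    from flipP[OF this(1)] this(2) have "clan_v n c i = 2*n+1 - clan_v n c (2*n+1-i)" by simp
    moreover have "clan_v n c (2*n+1-i) \<le> 2*n" using vP[OF \<open>2*n+1-i \<in> P\<close>] by simp
    ultimately show ?thesis by simp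
  qed (rule flipP)
qed

text \<open>The sign changes of u are the places below n outside \<open>plus_or_second n c\<close>.
  Their mirror images are its elements from n on, an even number by
  \<open>even_plus\<close>.\<close>

lemma clan_u_weyl: "\<exists>u\<in>weyl_D n. weyl_embed n u = clan_u n c"
proof (rule weyl_embed_onto[OF clan_u_props(1,2)])
  have "{i\<in>{1..n}. n < clan_u n c i} = {i\<in>{1..n}. i - 1 \<notin> plus_or_second n c}"
  proof (rule Collect_cong, rule conj_cong[OF refl])
    fix i assume "i \<in> {1..n}"
    then have "i \<in> {1..2*n}" "Suc (i - 1) = i" by auto
    then show "(n < clan_u n c i) = (i - 1 \<notin> plus_or_second n c)" using clan_u_props(3)[of i]
      by (metis image_iff nat.inject)
  qed
  then have "card {i\<in>{1..n}. n < clan_u n c i} = card {i. i < n \<and> i \<notin> plus_or_second n c}"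
    using card_shift[of n "\<lambda>i. i - 1 \<notin> plus_or_second n c"] by simp
  also have "\<dots> = card ({..<n} - plus_or_second n c \<inter> {..<n})" by (rule arg_cong[of _ _ card]) auto
  also have "\<dots> = n - card (plus_or_second n c \<inter> {..<n})" by (subst card_Diff_subset) auto
  also have "\<dots> = card (plus_or_second n c \<inter> {n..})" using lag_cards(2)[OF lag_plus] by simp
  finally show "even (card {i\<in>{1..n}. n < clan_u n c i})" using even_plus by simp
qed

lemma clan_v_weyl: "\<exists>v\<in>weyl_D n. weyl_embed n v = clan_v n c"
proof (rule weyl_embed_onto[OF clan_v_props(1,2)])
  have "{i\<in>{1..n}. n < clan_v n c i} = {i\<in>{1..n}. i - 1 \<in> minus_or_second n c}"
  proof (rule Collect_cong, rule conj_cong[OF refl])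
    fix i assume "i \<in> {1..n}"
    then have "i \<in> {1..2*n}" "Suc (i - 1) = i" by auto
    then show "(n < clan_v n c i) = (i - 1 \<in> minus_or_second n c)" using clan_v_props(3)[of i]
      by (metis image_iff nat.inject)
  qed
  then have "card {i\<in>{1..n}. n < clan_v n c i} = card {i. i < n \<and> i \<in> minus_or_second n c}"
    using card_shift[of n "\<lambda>i. i - 1 \<in> minus_or_second n c"] by simp
  also have "\<dots> = card (minus_or_second n c \<inter> {..<n})" by (rule arg_cong[of _ _ card]) auto
  finally show "even (card {i\<in>{1..n}. n < clan_v n c i})" using even_minus by simp
qed

end

section \<open>Cells are dense in their unions under the parabolic subgroup\<close>

lemma eventually_notin_finite: "finite T \<Longrightarrow> \<forall>\<^sub>F t in at (0::complex). t \<notin> T"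
proof -
  assume "finite T"
  then have "open (- (T - {0}))" by (intro open_Compl finite_imp_closed) auto
  then show ?thesis unfolding eventually_at_topological by (intro exI[of _ "- (T - {0})"]) auto
qed

section \<open>Triangular and block diagonal isometries\<close>

lemma lower_tri_inverse:
  assumes A: "lower_tri N A" and B: "B \<in> carrier_mat N N" and AB: "A * B = 1\<^sub>m N"
  shows "lower_tri N B"
proof -
  have Ac: "A \<in> carrier_mat N N" using A by (simp add: lower_tri_def)
  have "det A * det B = 1" using det_mult[OF Ac B] AB by simp
  then have "det A \<noteq> 0" by auto
  moreover have "det A = prod_list (diag_mat A)"
    using A by (intro det_lower_triangular[OF _ Ac]) (auto simp: lower_tri_def)
  ultimately have diag: "A $$ (i,i) \<noteq> 0" if "i < N" for i
    using that Ac unfolding prod_list_diag_prod by auto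
  have "\<forall>j<N. i < j \<longrightarrow> B $$ (i,j) = 0" if "i < N" for i
    using that
  proof (induction i rule: less_induct)
    case (less i)
    show ?case
    proof (intro allI impI)
      fix j assume j: "j < N" "i < j"
      \<comment> \<open>Forward substitution: terms with l > i vanish because A is lower triangular,
        terms with l < i by the induction hypothesis on the rows of B.\<close>
      have e: "A $$ (i,l) * B $$ (l,j) = (if l = i then A $$ (i,i) * B $$ (i,j) else 0)" if "l < N" for l
      proof (cases l i rule: linorder_cases)
        case less': less
        then have "B $$ (l,j) = 0" using less.IH[OF less' that] j by auto
        then show ?thesis using less' by simp
      qed (use A less.prems that in \<open>auto simp: lower_tri_def\<close>)
      have "(A * B) $$ (i,j) = (\<Sum>l<N. if l = i then A $$ (i,i) * B $$ (i,j) else 0)"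
        unfolding mat_index_mult[OF Ac B less.prems j(1)] by (rule sum.cong[OF refl]) (rule e, simp)
      then have "(A * B) $$ (i,j) = A $$ (i,i) * B $$ (i,j)" using less.prems by simp
      then show "B $$ (i,j) = 0" using AB diag[OF less.prems] j less.prems by simp
    qed
  qed
  then show ?thesis using B by (auto simp: lower_tri_def)
qed

lemma upper_tri_inverse:
  assumes A: "upper_tri N A" and B: "B \<in> carrier_mat N N" and BA: "B * A = 1\<^sub>m N"
  shows "upper_tri N B"
proof -
  have Ac: "A \<in> carrier_mat N N" using A by (simp add: upper_tri_def)
  have "lower_tri N (transpose_mat B)"
  proof (rule lower_tri_inverse[of N "transpose_mat A"])
    show "lower_tri N (transpose_mat A)" using A by (auto simp: upper_tri_def lower_tri_def)
    show "transpose_mat A * transpose_mat B = 1\<^sub>m N" using transpose_mult[OF B Ac] BA by simp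
  qed (use B in simp)
  then show ?thesis using B by (auto simp: upper_tri_def lower_tri_def)
qed

lemma lower_tri_adjoint: "lower_tri (2*n) A \<Longrightarrow> lower_tri (2*n) (adjoint n A)"
  by (auto simp: lower_tri_def adjoint_index)

lemma entries_PE_PF:
  assumes "A \<in> Mat n" "i < 2*n" "j < 2*n"
  shows "(P_E n * A) $$ (i,j) = (if i < n then A $$ (i,j) else 0)"
    "(P_F n * A) $$ (i,j) = (if n \<le> i then A $$ (i,j) else 0)"
    "(A * P_E n) $$ (i,j) = (if j < n then A $$ (i,j) else 0)"
    "(A * P_F n) $$ (i,j) = (if n \<le> j then A $$ (i,j) else 0)"
  using diag_mult_left_index[OF assms] diag_mult_right_index[OF assms] by auto

lemma mat_eq_zero_entry: "A = 0\<^sub>m N M \<Longrightarrow> i < N \<Longrightarrow> j < M \<Longrightarrow> A $$ (i,j) = 0"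
  by simp

text \<open>The embedding of GL(n) into SO(2n): a acts on E and trivially on the complement, the
  adjoint of its inverse h acts on the complement and trivially on E. The determinants of the two
  factors are inverse to each other.\<close>

lemma block_SO:
  assumes a: "a \<in> Mat n" "a = P_E n * (a * P_E n) + P_F n" and h: "h \<in> Mat n" "a * h = 1\<^sub>m (2*n)" "h * a = 1\<^sub>m (2*n)"
  shows "a * adjoint n h \<in> SO n" "P_E n * (a * adjoint n h) = P_E n * (a * P_E n)"
    "P_F n * (a * adjoint n h) = P_F n * adjoint n h" "P_F n * ((a * adjoint n h) * P_E n) = 0\<^sub>m (2*n) (2*n)"
    "P_E n * ((a * adjoint n h) * P_F n) = 0\<^sub>m (2*n) (2*n)"
proof -
  let ?P = "P_E n" and ?F = "P_F n"
  have [simp]: "dim_row a = 2*n" "dim_col a = 2*n" "dim_row h = 2*n" "dim_col h = 2*n" using a h by auto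
  have aa: "adjoint n a = ?F * (adjoint n a * ?F) + ?P"
  proof -
    have "adjoint n a = adjoint n (?P * (a * ?P) + ?F)" using a(2) by simp
    also have "\<dots> = ?F * (adjoint n a * ?F) + ?P"
      using a(1) by (simp add: adjoint_add adjoint_mult adjoint_PE adjoint_PF mult_mat_assoc)
    finally show ?thesis .
  qed
  have ah: "adjoint n h * adjoint n a = 1\<^sub>m (2*n)" "adjoint n a * adjoint n h = 1\<^sub>m (2*n)"
    unfolding adjoint_mult[OF a(1) h(1), symmetric] adjoint_mult[OF h(1) a(1), symmetric] h(2,3) adjoint_one by (rule refl)+
  have Fa: "?F * a = ?F" by (subst a(2)) (simp add: mult_mat_distrib mult_mat_assoc PE_PF PE_PF_left)
  have Pa: "?P * a = ?P * (a * ?P)" by (subst a(2)) (simp add: mult_mat_distrib mult_mat_assoc PE_PF PE_PF_left)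
  have "?P * adjoint n a = ?P" by (subst aa) (simp add: mult_mat_distrib mult_mat_assoc PE_PF PE_PF_left)
  then have "(?P * adjoint n a) * adjoint n h = ?P * adjoint n h" by simp
  then have Ph: "?P * adjoint n h = ?P" using ah by (simp add: mult_mat_assoc)
  have "adjoint n a * ?P = ?P" by (subst aa) (simp add: mult_mat_distrib mult_mat_assoc PE_PF PE_PF_left)
  then have "adjoint n h * (adjoint n a * ?P) = adjoint n h * ?P" by simp
  then have hP: "adjoint n h * ?P = ?P" using ah by (simp flip: mult_mat_assoc)
  show 2: "?P * (a * adjoint n h) = ?P * (a * ?P)"
  proof -
    have "?P * (a * adjoint n h) = (?P * a) * adjoint n h" by (simp add: mult_mat_assoc)
    also have "\<dots> = ?P * (a * (?P * adjoint n h))" unfolding Pa by (simp add: mult_mat_assoc)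
    finally show ?thesis unfolding Ph .
  qed
  show "?F * (a * adjoint n h) = ?F * adjoint n h" using Fa by (simp flip: mult_mat_assoc)
  then show "?F * ((a * adjoint n h) * ?P) = 0\<^sub>m (2*n) (2*n)"
    using hP by (metis (no_types, lifting) PE_PF(4) adjoint_carrier mult_mat_assoc adjoint_dim diag_mat_of_dim index_mult_mat(2,3) \<open>dim_col a = 2*n\<close> \<open>dim_row a = 2*n\<close>)
  show "?P * ((a * adjoint n h) * ?F) = 0\<^sub>m (2*n) (2*n)"
  proof -
    have "?P * ((a * adjoint n h) * ?F) = (?P * (a * adjoint n h)) * ?F" by (simp add: mult_mat_assoc)
    then show ?thesis unfolding 2 by (simp add: mult_mat_assoc PE_PF)
  qed
  have comm: "a * adjoint n a = adjoint n a * a"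
  proof -
    have "a * adjoint n a = ?P * (a * ?P) + ?F * (adjoint n a * ?F)"
      by (subst a(2), subst aa) (simp add: mult_mat_distrib mult_mat_assoc PE_PF PE_PF_left add_mat_comm)
    moreover have "adjoint n a * a = ?P * (a * ?P) + ?F * (adjoint n a * ?F)"
      by (subst aa, subst (2) a(2)) (simp add: mult_mat_distrib mult_mat_assoc PE_PF PE_PF_left add_mat_comm)
    ultimately show ?thesis by simp
  qed
  have "adjoint n (a * adjoint n h) * (a * adjoint n h) = h * ((adjoint n a * a) * adjoint n h)"
    using a h by (simp add: adjoint_mult adjoint_adjoint mult_mat_assoc)
  also have "\<dots> = (h * a) * (adjoint n a * adjoint n h)" unfolding comm[symmetric] by (simp add: mult_mat_assoc)
  finally have "a * adjoint n h \<in> orth n" using a h ah by (simp add: orth_def)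
  moreover have "det (a * adjoint n h) = det (a * h)"
    using det_mult[OF a(1) adjoint_carrier, of h] det_mult[OF a(1) h(1)] det_adjoint[OF h(1)] by simp
  ultimately show "a * adjoint n h \<in> SO n" using h(2) by (simp add: SO_iff)
qed

text \<open>The block on the complement is the adjoint of the inverse of the block on E, and both
  operations keep matrices upper triangular. B is that inverse.\<close>

lemma parabolic_upper:
  assumes Z: "Z \<in> orth n" "P_F n * (Z * P_E n) = 0\<^sub>m (2*n) (2*n)"
    and up: "\<And>i j. i < n \<Longrightarrow> j < i \<Longrightarrow> Z $$ (i,j) = 0"
  shows "upper_tri (2*n) Z"
proof -
  let ?P = "P_E n" and ?F = "P_F n"
  note ZD = orthD[OF Z(1)]
  have [simp]: "dim_row Z = 2*n" "dim_col Z = 2*n" using ZD(1) by auto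
  define A where "A = ?P * (Z * ?P) + ?F"
  define B where "B = ?P * (adjoint n Z * ?P) + ?F"
  have AB: "A \<in> Mat n" "B \<in> Mat n" unfolding A_def B_def using ZD(1) by auto
  have z': "?F * (Z * ?P) = 0\<^sub>m (2*n) (2*n)" by (rule Z(2))
  have PZ: "?P * (Z * ?P) = Z * ?P" using split_PE[of "Z * ?P" n] Z(2) by simp
  have e: "Z $$ (i,j) = 0" if "n \<le> i" "i < 2*n" "j < n" for i j
    using mat_eq_zero_entry[OF Z(2), of i j] that ZD(1)
      entries_PE_PF(2)[of "Z * ?P" n i j] entries_PE_PF(3)[OF ZD(1), of i j] by simp
  have BA: "B * A = 1\<^sub>m (2*n)"
  proof -
    have "B * A = ?P * (adjoint n Z * (?P * (Z * ?P))) + ?F"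
      unfolding A_def B_def by (simp add: mult_mat_distrib mult_mat_assoc PE_PF PE_PF_left)
    also have "adjoint n Z * (?P * (Z * ?P)) = ?P" unfolding PZ using ZD by (simp flip: mult_mat_assoc)
    finally show ?thesis by (simp add: PE_PF)
  qed
  have Aidx: "A $$ (i,j) = (if i < n \<and> j < n then Z $$ (i,j) else 0) + (if i = j \<and> n \<le> i then 1 else 0)" if "i < 2*n" "j < 2*n" for i j
    using that ZD(1) entries_PE_PF(1)[of "Z * ?P" n i j] entries_PE_PF(3)[OF ZD(1), of i j]
    unfolding A_def by (simp add: diag_mat_of_index del: index_mult_mat(1))
  have Bidx: "B $$ (i,j) = adjoint n Z $$ (i,j)" if "i < n" "j < n" for i j
    using that entries_PE_PF(1)[of "adjoint n Z * ?P" n i j] entries_PE_PF(3)[OF adjoint_carrier, of i n j Z]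
    unfolding B_def by (simp add: diag_mat_of_index del: index_mult_mat(1))
  have "upper_tri (2*n) A" using AB up by (auto simp: upper_tri_def Aidx)
  from upper_tri_inverse[OF this AB(2) BA] have B: "B $$ (i,j) = 0" if "i < n" "j < i" for i j
    using that by (auto simp: upper_tri_def)
  have "Z $$ (i,j) = 0" if ij: "i < 2*n" "j < 2*n" "j < i" for i j
  proof (cases "n \<le> j")
    case True
    have "B $$ (2*n-1-j, 2*n-1-i) = 0" using ij True by (intro B) auto
    moreover have "B $$ (2*n-1-j, 2*n-1-i) = adjoint n Z $$ (2*n-1-j, 2*n-1-i)" using ij True by (intro Bidx) auto
    moreover have "adjoint n Z $$ (2*n-1-j, 2*n-1-i) = Z $$ (i,j)" using ij by (simp add: adjoint_index)
    ultimately show ?thesis by simp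
  next
    case False
    then show ?thesis using up[of i j] e[of i j] ij by (cases "i < n") auto
  qed
  then show ?thesis using ZD(1) by (auto simp: upper_tri_def)
qed

text \<open>The first hypothesis says that all trailing principal blocks of B are nonsingular. Then
  B is upper times lower triangular, and x is, up to a factor, column j of the inverse of the lower
  factor.\<close>

lemma trailing_solve:
  fixes B :: "complex mat"
  assumes nz: "\<And>k x. k < m \<Longrightarrow> x \<in> carrier_vec m \<Longrightarrow> (\<And>l. l < m \<Longrightarrow> l < k \<Longrightarrow> x $ l = 0) \<Longrightarrow>
      (\<And>i. i < m \<Longrightarrow> k \<le> i \<Longrightarrow> (\<Sum>l<m. B $$ (i,l) * x $ l) = 0) \<Longrightarrow> x = 0\<^sub>v m"
    and j: "j < m"
  obtains x where "x \<in> carrier_vec m" "\<And>l. l < m \<Longrightarrow> l < j \<Longrightarrow> x $ l = 0" "x $ j \<noteq> 0"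
    "\<And>i. i < m \<Longrightarrow> j < i \<Longrightarrow> (\<Sum>l<m. B $$ (i,l) * x $ l) = 0"
proof -
  \<comment> \<open>The rows above j force the earlier coordinates to vanish and the others form the
    system for B, so C is singular only if the trailing block from j on is.\<close>
  define C where "C = mat m m (\<lambda>(i,l). if i < j then (if i = l then 1 else 0) else B $$ (i,l))"
  have Cc: "C \<in> carrier_mat m m" by (simp add: C_def)
  have Cx: "(C *\<^sub>v x) $ i = (if i < j then x $ i else (\<Sum>l<m. B $$ (i,l) * x $ l))" if "x \<in> carrier_vec m" "i < m" for x i
  proof (cases "i < j")
    case True
    have "(C *\<^sub>v x) $ i = (\<Sum>l<m. C $$ (i,l) * x $ l)" using mult_mat_vec_eq_lincomb[OF Cc that(1)] that(2) by simp
    also have "\<dots> = (\<Sum>l<m. if l = i then x $ i else 0)"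
      using that(2) True by (intro sum.cong) (auto simp: C_def)
    finally have "(C *\<^sub>v x) $ i = (\<Sum>l<m. if l = i then x $ i else 0)" .
    then show ?thesis using True that by simp
  next
    case False
    then show ?thesis using mult_mat_vec_eq_lincomb[OF Cc that(1)] that(2) by (simp add: C_def)
  qed
  have "det C \<noteq> 0"
  proof
    assume "det C = 0"
    then obtain x where x: "x \<in> carrier_vec m" "x \<noteq> 0\<^sub>v m" "C *\<^sub>v x = 0\<^sub>v m"
      using det_0_iff_vec_prod_zero_field[OF Cc] by blast
    have "x = 0\<^sub>v m"
    proof (rule nz[OF j x(1)])
      fix l assume "l < m" "l < j"
      then show "x $ l = 0" using Cx[OF x(1), of l] x(3) by simp
    next
      fix i assume "i < m" "j \<le> i"
      then show "(\<Sum>l<m. B $$ (i,l) * x $ l) = 0" using Cx[OF x(1), of i] x(3) by simp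
    qed
    then show False using x(2) by simp
  qed
  from mat_inverse_exists[OF Cc this] obtain C' where C': "C' \<in> carrier_mat m m" "C * C' = 1\<^sub>m m" by blast
  define x where "x = C' *\<^sub>v unit_vec m j"
  have xc: "x \<in> carrier_vec m" using C' by (simp add: x_def)
  have "C *\<^sub>v x = unit_vec m j" unfolding x_def using assoc_mult_mat_vec[OF Cc C'(1), of "unit_vec m j"] C'(2) by simp
  then have Cxu: "(C *\<^sub>v x) $ i = (if i = j then 1 else 0)" if "i < m" for i using that j by simp
  show thesis
  proof (rule that[OF xc])
    show low: "x $ l = 0" if "l < m" "l < j" for l using Cx[OF xc that(1)] Cxu[OF that(1)] that by simp
    show hi: "(\<Sum>l<m. B $$ (i,l) * x $ l) = 0" if "i < m" "j < i" for i using Cx[OF xc that(1)] Cxu[OF that(1)] that by simp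
    show "x $ j \<noteq> 0"
    proof
      assume xj: "x $ j = 0"
      \<comment> \<open>If x vanishes at j as well, the trailing block starting at j+1 annihilates
        it.\<close>
      have "x = 0\<^sub>v m"
      proof (cases "Suc j < m")
        case True
        show ?thesis
        proof (rule nz[OF True xc])
          show "x $ l = 0" if "l < m" "l < Suc j" for l using that low xj by (cases "l = j") auto
        qed (use hi in auto)
      next
        case False
        then show ?thesis using low xj xc by (intro eq_vecI) (auto, metis less_antisym less_trans_Suc linorder_neqE_nat not_less_eq)
      qed
      then have "C *\<^sub>v x = 0\<^sub>v m" using mult_mat_zero_vec[OF Cc] by simp
      then show False using Cxu[OF j] j by simp
    qed
  qed
qed

text \<open>A vector annihilated by a trailing block of B + t is an eigenvector, for the eigenvalue
  -t, of the block of B filled up with zeros to full size. Finitely many blocks have finitely many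
  eigenvalues, so all small t \<noteq> 0 are good.\<close>

lemma generic_shift_trailing:
  fixes B :: "complex mat"
  shows "\<forall>\<^sub>F t in at 0. \<forall>k x. k < m \<longrightarrow> x \<in> carrier_vec m \<longrightarrow> (\<forall>l<m. l < k \<longrightarrow> x $ l = 0) \<longrightarrow>
      (\<forall>i<m. k \<le> i \<longrightarrow> (\<Sum>l<m. (B $$ (i,l) + (if i = l then t else 0)) * x $ l) = 0) \<longrightarrow> x = 0\<^sub>v m"
proof -
  define A where "A k = mat m m (\<lambda>(i,l). if i < k \<or> l < k then 0 else B $$ (i,l))" for k :: nat
  have Ac: "A k \<in> carrier_mat m m" for k by (simp add: A_def)
  have fin: "finite {e. poly (char_poly (A k)) e = 0}" for k
    using degree_monic_char_poly[OF Ac[of k]] by (intro poly_roots_finite) auto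
  have "finite (\<Union>k<m. uminus ` {e. poly (char_poly (A k)) e = 0})" using fin by blast
  from eventually_notin_finite[OF this] show ?thesis
  proof (rule eventually_mono, intro allI impI)
    fix t k and x :: "complex vec"
    assume t: "t \<notin> (\<Union>k<m. uminus ` {e. poly (char_poly (A k)) e = 0})" and k: "k < m"
      and xc: "x \<in> carrier_vec m" and x0: "\<forall>l<m. l < k \<longrightarrow> x $ l = 0"
      and eq: "\<forall>i<m. k \<le> i \<longrightarrow> (\<Sum>l<m. (B $$ (i,l) + (if i = l then t else 0)) * x $ l) = 0"
    show "x = 0\<^sub>v m"
    proof (rule ccontr)
      assume nz: "x \<noteq> 0\<^sub>v m"
      have "A k *\<^sub>v x = (- t) \<cdot>\<^sub>v x"
      proof (rule eq_vecI)
        fix i assume "i < dim_vec ((- t) \<cdot>\<^sub>v x)"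
        then have i: "i < m" using xc by simp
        have Ax: "(A k *\<^sub>v x) $ i = (\<Sum>l<m. A k $$ (i,l) * x $ l)"
          using mult_mat_vec_eq_lincomb[OF Ac xc] i by simp
        show "(A k *\<^sub>v x) $ i = ((- t) \<cdot>\<^sub>v x) $ i"
        proof (cases "i < k")
          case True
          then show ?thesis unfolding Ax using x0 i xc by (simp add: A_def)
        next
          case False
          have "(\<Sum>l<m. A k $$ (i,l) * x $ l) = (\<Sum>l<m. B $$ (i,l) * x $ l)"
            using x0 i False by (intro sum.cong) (auto simp: A_def)
          moreover have "(\<Sum>l<m. (B $$ (i,l) + (if i = l then t else 0)) * x $ l)
              = (\<Sum>l<m. B $$ (i,l) * x $ l) + (\<Sum>l<m. (if l = i then t * x $ i else 0))"
            unfolding sum.distrib[symmetric] by (intro sum.cong) (auto simp: distrib_right)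
          ultimately show ?thesis unfolding Ax using eq i False xc by (simp add: add_eq_0_iff2)
        qed
      qed (use xc Ac in auto)
      then have "eigenvalue (A k) (- t)"
        unfolding eigenvalue_def eigenvector_def using Ac[of k] xc nz by (intro exI[of _ x]) auto
      then have "poly (char_poly (A k)) (- t) = 0" using eigenvalue_root_char_poly[OF Ac] by simp
      then have "t \<in> uminus ` {e. poly (char_poly (A k)) e = 0}" by (intro image_eqI[of _ _ "- t"]) auto
      then show False using t k by blast
    qed
  qed
qed

text \<open>A generic matrix is upper times lower triangular, and p can be made generic inside the
  stabiliser of E: multiplying from the left by an element of the copy of GL(n) adds t times the
  identity to the block of p on E, which for small t \<noteq> 0 makes all trailing blocks
  nonsingular.\<close>

lemma parabolic_dense:
  assumes p: "p \<in> SO n" and z: "P_F n * (p * P_E n) = 0\<^sub>m (2*n) (2*n)"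
  obtains Y where "mat_tendsto (2*n) (2*n) Y p"
    "\<forall>\<^sub>F t in at 0. Y t \<in> SO n \<and> (\<exists>X\<in>SO n. lower_tri (2*n) X \<and>
       (\<forall>i<2*n. \<forall>j<2*n. (i < n) \<noteq> (j < n) \<longrightarrow> X $$ (i,j) = 0) \<and> upper_tri (2*n) (Y t * X))"
proof -
  let ?P = "P_E n" and ?F = "P_F n"
  have po: "p \<in> orth n" using p by (simp add: SO_iff)
  note pD = orthD[OF po]
  have [simp]: "dim_row p = 2*n" "dim_col p = 2*n" using pD(1) by auto
  \<comment> \<open>The inverse of the block of p on E, so that 1 + t q adds t times the identity to
    that block.\<close>
  define q where "q = ?P * (adjoint n p * ?P)"
  have qc: "q \<in> Mat n" by (simp add: q_def)
  have [simp]: "dim_row q = 2*n" "dim_col q = 2*n" using qc by auto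
  define a where "a t = 1\<^sub>m (2*n) + t \<cdot>\<^sub>m q" for t
  have ac: "a t \<in> Mat n" for t using qc by (simp add: a_def)
  have [simp]: "dim_row (a t) = 2*n" "dim_col (a t) = 2*n" for t using ac[of t] by auto
  have alim: "mat_tendsto (2*n) (2*n) a (1\<^sub>m (2*n))"
  proof -
    have "((\<lambda>t. 1\<^sub>m (2*n) $$ (i,j) + t * q $$ (i,j)) \<longlongrightarrow> 1\<^sub>m (2*n) $$ (i,j) + 0 * q $$ (i,j)) (at 0)" for i j
      by (intro tendsto_intros)
    then show ?thesis using ac qc unfolding mat_tendsto_def a_def by (auto simp del: index_one_mat(1))
  qed
  have qP: "?P * (q * ?P) = q" unfolding q_def by (simp add: mult_mat_assoc PE_PF PE_PF_left)
  have ablock: "a t = ?P * (a t * ?P) + ?F" for t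
  proof -
    have "t \<cdot>\<^sub>m q * ?P = t \<cdot>\<^sub>m (q * ?P)" using qc by (intro mult_smult_assoc_mat) auto
    moreover have "?P * (t \<cdot>\<^sub>m (q * ?P)) = t \<cdot>\<^sub>m (?P * (q * ?P))" using qc by (intro mult_smult_distrib) auto
    ultimately have "?P * (a t * ?P) + ?F = (?P + t \<cdot>\<^sub>m q) + ?F"
      unfolding a_def using qP by (simp add: mult_mat_distrib PE_PF)
    also have "\<dots> = (?P + ?F) + t \<cdot>\<^sub>m q" by (simp add: add_mat_assoc add_mat_comm[of "t \<cdot>\<^sub>m q" ?F])
    finally show ?thesis by (simp add: PE_PF a_def)
  qed
  from mat_tendsto_inverse[OF alim] obtain h where hlim: "mat_tendsto (2*n) (2*n) h (1\<^sub>m (2*n))"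
    and h: "\<And>t. det (a t) \<noteq> 0 \<Longrightarrow> h t * a t = 1\<^sub>m (2*n)" "\<And>t. det (a t) \<noteq> 0 \<Longrightarrow> a t * h t = 1\<^sub>m (2*n)"
    and ev: "\<forall>\<^sub>F t in at 0. det (a t) \<noteq> 0" by blast
  have hc: "h t \<in> Mat n" for t using hlim by (simp add: mat_tendsto_def)
  have [simp]: "dim_row (h t) = 2*n" "dim_col (h t) = 2*n" for t using hc[of t] by auto
  define y where "y t = a t * adjoint n (h t)" for t
  have yc: "y t \<in> Mat n" for t unfolding y_def using ac hc by simp
  have [simp]: "dim_row (y t) = 2*n" "dim_col (y t) = 2*n" for t using yc[of t] by auto
  define Y where "Y t = y t * p" for t
  have "mat_tendsto (2*n) (2*n) Y ((1\<^sub>m (2*n) * adjoint n (1\<^sub>m (2*n))) * p)"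
    unfolding Y_def y_def
    by (intro mat_tendsto_mult[of "2*n" "2*n" _ _ "2*n"] mat_tendsto_adjoint alim hlim mat_tendsto_const pD(1))
  then have Ylim: "mat_tendsto (2*n) (2*n) Y p" by (simp add: adjoint_one)
  have Ytop: "Y t $$ (i,j) = p $$ (i,j) + (if i = j then t else 0)" if nz: "det (a t) \<noteq> 0" and ij: "i < n" "j < n" for t i j
  proof -
    note bl = block_SO[OF ac ablock hc h(2,1), OF nz nz]
    have PpP: "?P * (p * ?P) = p * ?P" using split_PE[of "p * ?P" n] z by simp
    have "?P * (Y t * ?P) = (?P * (y t)) * (p * ?P)" unfolding Y_def by (simp add: mult_mat_assoc)
    also have "\<dots> = ?P * (a t * (?P * (p * ?P)))" unfolding y_def bl(2) by (simp add: mult_mat_assoc)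
    also have "\<dots> = ?P * (p * ?P) + t \<cdot>\<^sub>m (?P * (adjoint n p * (p * ?P)))"
    proof -
      have "a t * (?P * (p * ?P)) = ?P * (p * ?P) + t \<cdot>\<^sub>m q * (?P * (p * ?P))"
        unfolding a_def by (simp add: mult_mat_distrib)
      also have "t \<cdot>\<^sub>m q * (?P * (p * ?P)) = t \<cdot>\<^sub>m (q * (?P * (p * ?P)))"
        using qc pD(1) by (intro mult_smult_assoc_mat) auto
      also have "q * (?P * (p * ?P)) = ?P * (adjoint n p * (?P * (p * ?P)))"
        unfolding q_def by (simp add: mult_mat_assoc PE_PF_left)
      also have "\<dots> = ?P * (adjoint n p * (p * ?P))" unfolding PpP ..
      finally have e: "a t * (?P * (p * ?P)) = ?P * (p * ?P) + t \<cdot>\<^sub>m (?P * (adjoint n p * (p * ?P)))" .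
      have c: "?P * (adjoint n p * (p * ?P)) \<in> Mat n" using pD(1) by simp
      have "?P * (t \<cdot>\<^sub>m (?P * (adjoint n p * (p * ?P)))) = t \<cdot>\<^sub>m (?P * (?P * (adjoint n p * (p * ?P))))"
        by (rule mult_smult_distrib[OF diag_mat_of_carrier c])
      then show ?thesis unfolding e by (simp add: mult_mat_distrib PE_PF_left)
    qed
    also have "adjoint n p * (p * ?P) = ?P" using pD(2) by (simp flip: mult_mat_assoc)
    finally have e: "?P * (Y t * ?P) = ?P * (p * ?P) + t \<cdot>\<^sub>m ?P" by (simp add: PE_PF)
    have Yc: "Y t \<in> Mat n" unfolding Y_def using yc pD(1) by simp
    have "(?P * (Y t * ?P)) $$ (i,j) = Y t $$ (i,j)" "(?P * (p * ?P)) $$ (i,j) = p $$ (i,j)"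
      using ij Yc pD(1) entries_PE_PF(1)[of "Y t * ?P" n i j] entries_PE_PF(3)[OF Yc, of i j]
        entries_PE_PF(1)[of "p * ?P" n i j] entries_PE_PF(3)[OF pD(1), of i j] by (simp_all del: index_mult_mat(1))
    then have "Y t $$ (i,j) = p $$ (i,j) + t * (if i = j then 1 else 0)"
      unfolding e using ij pD(1) by (simp add: diag_mat_of_index del: index_mult_mat(1))
    then show ?thesis by (cases "i = j") auto
  qed
  from ev generic_shift_trailing[of n p]
  have "\<forall>\<^sub>F t in at 0. Y t \<in> SO n \<and> (\<exists>X\<in>SO n. lower_tri (2*n) X \<and>
       (\<forall>i<2*n. \<forall>j<2*n. (i < n) \<noteq> (j < n) \<longrightarrow> X $$ (i,j) = 0) \<and> upper_tri (2*n) (Y t * X))"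
  proof eventually_elim
    case (elim t)
    note nz = elim(1)
    note bl = block_SO[OF ac ablock hc h(2,1), OF nz nz]
    have YSO: "Y t \<in> SO n" unfolding Y_def y_def by (rule SO_mult[OF bl(1) p])
    have Yc: "Y t \<in> Mat n" by (rule SO_carrier[OF YSO])
    have [simp]: "dim_row (Y t) = 2*n" "dim_col (Y t) = 2*n" using Yc by auto
    have FYP: "?F * (Y t * ?P) = 0\<^sub>m (2*n) (2*n)"
    proof -
      have PpP: "?P * (p * ?P) = p * ?P" using split_PE[of "p * ?P" n] z by simp
      have "?F * (Y t * ?P) = ?F * (y t * (?P * (p * ?P)))" unfolding PpP Y_def by (simp add: mult_mat_assoc)
      also have "\<dots> = (?F * (y t * ?P)) * (p * ?P)" by (simp add: mult_mat_assoc)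
      finally show ?thesis using bl(4) unfolding y_def by simp
    qed
    have low: "Y t $$ (i,j) = 0" if "n \<le> i" "i < 2*n" "j < n" for i j
      using mat_eq_zero_entry[OF FYP, of i j] that Yc
        entries_PE_PF(2)[of "Y t * ?P" n i j] entries_PE_PF(3)[OF Yc, of i j] by simp
    have "\<exists>x. x \<in> carrier_vec n \<and> (\<forall>l<n. l < j \<longrightarrow> x $ l = 0) \<and> x $ j \<noteq> 0 \<and>
        (\<forall>i<n. j < i \<longrightarrow> (\<Sum>l<n. Y t $$ (i,l) * x $ l) = 0)" if j: "j < n" for j
    proof (rule trailing_solve[of n "Y t" j])
      fix k and x :: "complex vec"
      assume "k < n" "x \<in> carrier_vec n" "\<And>l. l < n \<Longrightarrow> l < k \<Longrightarrow> x $ l = 0"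
        "\<And>i. i < n \<Longrightarrow> k \<le> i \<Longrightarrow> (\<Sum>l<n. Y t $$ (i,l) * x $ l) = 0"
      moreover have "(\<Sum>l<n. Y t $$ (i,l) * x $ l) = (\<Sum>l<n. (p $$ (i,l) + (if i = l then t else 0)) * x $ l)" if "i < n" for i
        using that by (intro sum.cong) (auto simp: Ytop[OF nz])
      ultimately show "x = 0\<^sub>v n" using elim(2) by auto
    qed (use j in auto)
    then have "\<forall>j\<in>{..<n}. \<exists>x. x \<in> carrier_vec n \<and> (\<forall>l<n. l < j \<longrightarrow> x $ l = 0) \<and> x $ j \<noteq> 0 \<and>
        (\<forall>i<n. j < i \<longrightarrow> (\<Sum>l<n. Y t $$ (i,l) * x $ l) = 0)" by blast
    from bchoice[OF this] obtain x where "\<forall>j\<in>{..<n}. x j \<in> carrier_vec n \<and> (\<forall>l<n. l < j \<longrightarrow> x j $ l = 0) \<and> x j $ j \<noteq> 0 \<and>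
        (\<forall>i<n. j < i \<longrightarrow> (\<Sum>l<n. Y t $$ (i,l) * x j $ l) = 0)" ..
    then have x: "\<And>j. j < n \<Longrightarrow> x j \<in> carrier_vec n" "\<And>j l. j < n \<Longrightarrow> l < n \<Longrightarrow> l < j \<Longrightarrow> x j $ l = 0"
      "\<And>j. j < n \<Longrightarrow> x j $ j \<noteq> 0" "\<And>j i. j < n \<Longrightarrow> i < n \<Longrightarrow> j < i \<Longrightarrow> (\<Sum>l<n. Y t $$ (i,l) * x j $ l) = 0"
      by simp_all
    \<comment> \<open>On E the columns are the solutions of the trailing systems: each is nonzero on
      the diagonal and zero above it, and together they make \<open>Y t\<close> upper triangular
      there.\<close>
    define b where "b = mat (2*n) (2*n) (\<lambda>(i,j). if i < n \<and> j < n then x j $ i else if i = j then 1 else 0)"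
    have bc: "b \<in> Mat n" by (simp add: b_def)
    have [simp]: "dim_row b = 2*n" "dim_col b = 2*n" using bc by auto
    have blow: "lower_tri (2*n) b" using x(2) unfolding lower_tri_def b_def by auto
    have "det b = prod_list (diag_mat b)" using blow by (intro det_lower_triangular[OF _ bc]) (auto simp: lower_tri_def)
    then have "det b \<noteq> 0" using x(3) unfolding prod_list_diag_prod by (auto simp: b_def)
    from mat_inverse_exists[OF bc this] obtain b' where b': "b' \<in> Mat n" "b * b' = 1\<^sub>m (2*n)" "b' * b = 1\<^sub>m (2*n)" .
    have [simp]: "dim_row b' = 2*n" "dim_col b' = 2*n" using b' by auto
    have bblock: "b = ?P * (b * ?P) + ?F"
    proof (rule eq_matI)
      fix i j assume "i < dim_row (?P * (b * ?P) + ?F)" "j < dim_col (?P * (b * ?P) + ?F)"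
      then have ij: "i < 2*n" "j < 2*n" by auto
      show "b $$ (i,j) = (?P * (b * ?P) + ?F) $$ (i,j)"
        using ij bc entries_PE_PF(1)[of "b * ?P" n i j] entries_PE_PF(3)[OF bc, of i j]
        by (simp add: diag_mat_of_index del: index_mult_mat(1)) (auto simp: b_def)
    qed auto
    note Bl = block_SO[OF bc bblock b']
    define X where "X = b * adjoint n b'"
    have XSO: "X \<in> SO n" unfolding X_def by (rule Bl(1))
    have Xc: "X \<in> Mat n" by (rule SO_carrier[OF XSO])
    have [simp]: "dim_row X = 2*n" "dim_col X = 2*n" using Xc by auto
    have Xtop: "X $$ (i,j) = (if j < n then b $$ (i,j) else 0)" if "i < n" "j < 2*n" for i j
      using that Bl(2) bc Xc entries_PE_PF(1)[OF Xc, of i j] entries_PE_PF(1)[of "b * ?P" n i j] entries_PE_PF(3)[OF bc, of i j]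
      unfolding X_def[symmetric] by (simp del: index_mult_mat(1))
    have Xbot: "X $$ (i,j) = adjoint n b' $$ (i,j)" if "n \<le> i" "i < 2*n" "j < 2*n" for i j
      using that Bl(3) entries_PE_PF(2)[OF Xc, of i j] entries_PE_PF(2)[OF adjoint_carrier, of i n j b']
      unfolding X_def[symmetric] by (simp del: index_mult_mat(1))
    have b'low: "lower_tri (2*n) (adjoint n b')"
      by (rule lower_tri_adjoint[OF lower_tri_inverse[OF blow b'(1,2)]])
    have Xlow: "lower_tri (2*n) X" unfolding lower_tri_def
    proof (intro conjI allI impI Xc)
      fix i j assume ij: "i < 2*n" "j < 2*n" "i < j"
      then show "X $$ (i,j) = 0" using Xtop[of i j] Xbot[of i j] blow b'low
        by (cases "i < n") (auto simp: lower_tri_def)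
    qed
    have FXP: "?F * (X * ?P) = 0\<^sub>m (2*n) (2*n)" unfolding X_def by (rule Bl(4))
    have Xoff: "X $$ (i,j) = 0" if "n \<le> i" "i < 2*n" "j < n" for i j
      using mat_eq_zero_entry[OF FXP, of i j] that Xc
        entries_PE_PF(2)[of "X * ?P" n i j] entries_PE_PF(3)[OF Xc, of i j] by simp
    have Xblock: "\<forall>i<2*n. \<forall>j<2*n. (i < n) \<noteq> (j < n) \<longrightarrow> X $$ (i,j) = 0"
      using Xtop Xoff by auto
    have YX: "Y t * X \<in> orth n" using SO_mult[OF YSO XSO] by (simp add: SO_iff)
    have "upper_tri (2*n) (Y t * X)"
    proof (rule parabolic_upper[OF YX])
      have "?F * ((Y t * X) * ?P) = ?F * (Y t * (?P * (X * ?P)))"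
        using split_PE[of "X * ?P" n] FXP by (simp add: mult_mat_assoc)
      also have "\<dots> = (?F * (Y t * ?P)) * (X * ?P)" by (simp add: mult_mat_assoc)
      finally show "?F * ((Y t * X) * ?P) = 0\<^sub>m (2*n) (2*n)" unfolding FYP by simp
    next
      fix i j assume ij: "i < n" "j < i"
      have "(Y t * X) $$ (i,j) = (\<Sum>l<2*n. Y t $$ (i,l) * X $$ (l,j))"
        using ij by (intro mat_index_mult[OF Yc Xc]) auto
      also have "\<dots> = (\<Sum>l<n. Y t $$ (i,l) * X $$ (l,j))"
        using Xoff ij by (intro sum.mono_neutral_right) auto
      also have "\<dots> = (\<Sum>l<n. Y t $$ (i,l) * x j $ l)"
        using ij by (intro sum.cong) (auto simp: Xtop b_def)
      finally show "(Y t * X) $$ (i,j) = 0" using x(4)[of j i] ij by simp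
    qed
    then show ?case using YSO XSO Xlow Xblock by blast
  qed
  with Ylim show thesis by (rule that)
qed

subsection \<open>Schubert cells of the permutations of a clan\<close>

definition perm_mat :: "nat \<Rightarrow> (nat \<Rightarrow> nat) \<Rightarrow> complex mat" where
  "perm_mat n w = mat (2*n) (2*n) (\<lambda>(i,k). if Suc i = w (Suc k) then 1 else 0)"

locale flip_perm =
  fixes n :: nat and w :: "nat \<Rightarrow> nat"
  assumes perm: "w permutes {1..2*n}"
    and bar: "\<And>i. i \<in> {1..2*n} \<Longrightarrow> w (2*n+1-i) = 2*n+1 - w i"
begin

definition p :: "nat \<Rightarrow> nat" where "p k = w (Suc k) - 1"

lemma w_p: "k < 2*n \<Longrightarrow> w (Suc k) = Suc (p k)" "k < 2*n \<Longrightarrow> p k < 2*n"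
  using permutes_in_image[OF perm, of "Suc k"] by (auto simp: p_def)

lemma p_inj: "i < 2*n \<Longrightarrow> k < 2*n \<Longrightarrow> p i = p k \<longleftrightarrow> i = k"
  using w_p(1)[of i] w_p(1)[of k] permutes_inj[OF perm] by (metis inj_eq nat.inject)

lemma p_bar:
  assumes "k < 2*n"
  shows "p (2*n-1-k) = 2*n-1-p k"
proof -
  have "2*n+1-Suc k = Suc (2*n-1-k)" "Suc k \<in> {1..2*n}" using assms by auto
  with bar[of "Suc k"] have "w (Suc (2*n-1-k)) = 2*n+1 - w (Suc k)" by simp
  then show ?thesis unfolding p_def[of "2*n-1-k"] using w_p[OF assms] by simp
qed

lemma perm_mat_carrier [simp]: "perm_mat n w \<in> Mat n"
  by (simp add: perm_mat_def)

lemma perm_mat_dim [simp]: "dim_row (perm_mat n w) = 2*n" "dim_col (perm_mat n w) = 2*n"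
  by (simp_all add: perm_mat_def)

lemma perm_mat_index: "i < 2*n \<Longrightarrow> k < 2*n \<Longrightarrow> perm_mat n w $$ (i,k) = (if i = p k then 1 else 0)"
  using w_p(1)[of k] by (auto simp: perm_mat_def)

lemma mult_perm_mat_index:
  assumes "A \<in> Mat n" "i < 2*n" "k < 2*n"
  shows "(A * perm_mat n w) $$ (i,k) = A $$ (i, p k)"
proof -
  have "(A * perm_mat n w) $$ (i,k) = (\<Sum>l<2*n. if l = p k then A $$ (i, p k) else 0)"
    unfolding mat_index_mult[OF assms(1) perm_mat_carrier assms(2,3)]
    using assms by (intro sum.cong) (auto simp: perm_mat_index)
  then show ?thesis using w_p(2)[OF assms(3)] by simp
qed

lemma perm_mat_orth: "perm_mat n w \<in> orth n"
  unfolding orth_entries[OF perm_mat_carrier]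
proof (intro allI impI)
  fix a b assume ab: "a < 2*n" "b < 2*n"
  have "perm_mat n w $$ (2*n-1-k, a) * perm_mat n w $$ (k,b) = (if k = p b then (if b = 2*n-1-a then 1 else 0) else 0)"
    if k: "k < 2*n" for k
  proof -
    have k': "2*n-1-k < 2*n" using k by auto
    have "2*n-1-p b = p a \<longleftrightarrow> b = 2*n-1-a"
    proof -
      have "2*n-1-p b = p a \<longleftrightarrow> p (2*n-1-b) = p a" using p_bar[OF ab(2)] by simp
      also have "\<dots> \<longleftrightarrow> 2*n-1-b = a" using ab by (intro p_inj) auto
      finally show ?thesis using ab by auto
    qed
    then show ?thesis unfolding perm_mat_index[OF k' ab(1)] perm_mat_index[OF k ab(2)] by auto
  qed
  then have "(\<Sum>k<2*n. perm_mat n w $$ (2*n-1-k, a) * perm_mat n w $$ (k,b)) =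
      (\<Sum>k<2*n. if k = p b then (if b = 2*n-1-a then 1 else 0) else 0)"
    by (intro sum.cong refl) simp
  then show "(\<Sum>k<2*n. perm_mat n w $$ (2*n-1-k, a) * perm_mat n w $$ (k,b)) = (if b = 2*n-1-a then 1 else 0)"
    using w_p(2)[OF ab(2)] by simp
qed

lemma conj_perm_index:
  assumes X: "X \<in> Mat n" and ij: "i < 2*n" "j < 2*n"
  shows "(adjoint n (perm_mat n w) * (X * perm_mat n w)) $$ (i,j) = X $$ (p i, p j)"
proof -
  have XW: "X * perm_mat n w \<in> Mat n" using X by simp
  have "(adjoint n (perm_mat n w) * (X * perm_mat n w)) $$ (i,j) = (\<Sum>l<2*n. if l = p i then X $$ (p i, p j) else 0)"
    unfolding mat_index_mult[OF adjoint_carrier XW ij]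
  proof (rule sum.cong[OF refl])
    fix l assume "l \<in> {..<2*n}"
    then have l: "l < 2*n" by simp
    have r: "2*n-1-l < 2*n" "2*n-1-i < 2*n" "2*n-1-l = 2*n-1-p i \<longleftrightarrow> l = p i" using l ij w_p(2)[OF ij(1)] by auto
    have "adjoint n (perm_mat n w) $$ (i,l) = (if l = p i then 1 else 0)"
      unfolding adjoint_index[OF ij(1) l] perm_mat_index[OF r(1,2)] p_bar[OF ij(1)] r(3) ..
    then show "adjoint n (perm_mat n w) $$ (i,l) * (X * perm_mat n w) $$ (l,j) = (if l = p i then X $$ (p i, p j) else 0)"
      using mult_perm_mat_index[OF X l ij(2)] by simp
  qed
  then show ?thesis using w_p(2)[OF ij(1)] by simp
qed

lemma perm_conj_SO:
  assumes X: "X \<in> SO n"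
  shows "adjoint n (perm_mat n w) * (X * perm_mat n w) \<in> SO n"
proof -
  have "X \<in> orth n" "det X = 1" using X by (auto simp: SO_iff)
  moreover have "det (adjoint n (perm_mat n w) * (X * perm_mat n w)) = det (perm_mat n w) * det (perm_mat n w) * det X"
    using det_mult[of "adjoint n (perm_mat n w)" "2*n" "X * perm_mat n w"] det_mult[OF SO_carrier[OF X] perm_mat_carrier] SO_carrier[OF X]
    by (simp add: det_adjoint)
  ultimately show ?thesis
    using orth_det[OF perm_mat_orth] by (simp add: SO_iff orth_mult orth_adjoint perm_mat_orth)
qed

lemma perm_mat_rep:
  assumes "weyl_embed n s = w" "det (perm_mat n w) = 1"
  shows "perm_mat n w \<in> weyl_reps n s"
  unfolding weyl_reps_def mem_Collect_eq
proof (intro conjI ballI)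
  show "perm_mat n w \<in> SO n" using perm_mat_orth assms(2) by (simp add: SO_iff)
  fix i assume i: "i \<in> {1..2*n}"
  then have i': "i - 1 < 2*n" "Suc (i - 1) = i" by auto
  have wi: "w i - 1 < 2*n" "w i - 1 = p (i - 1)" using w_p[OF i'(1)] i'(2) by auto
  have "perm_mat n w *\<^sub>v basis_vec (2*n) i = 1 \<cdot>\<^sub>v basis_vec (2*n) (weyl_embed n s i)"
    unfolding assms(1) basis_vec_def using i'(1) wi
    by (intro eq_vecI) (auto simp: perm_mat_index simp del: One_nat_def)
  then show "\<exists>a. perm_mat n w *\<^sub>v basis_vec (2*n) i = a \<cdot>\<^sub>v basis_vec (2*n) (weyl_embed n s i)" ..
qed

text \<open>The cells are defined through all representatives in SO, so the zero pattern is needed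
  for each of them and not only for the permutation matrix.\<close>

lemma weyl_rep_index:
  assumes s: "weyl_embed n s = w" and g: "g \<in> weyl_reps n s" and ij: "i < 2*n" "j < 2*n" "i \<noteq> p j"
  shows "g $$ (i,j) = 0"
proof -
  have gc: "g \<in> Mat n" using g SO_carrier by (auto simp: weyl_reps_def)
  have "Suc j \<in> {1..2*n}" using ij by auto
  then obtain a where a: "g *\<^sub>v basis_vec (2*n) (Suc j) = a \<cdot>\<^sub>v basis_vec (2*n) (w (Suc j))"
    using g s unfolding weyl_reps_def by blast
  have "(g *\<^sub>v basis_vec (2*n) (Suc j)) $ i = g $$ (i,j)" using gc ij by (simp add: basis_vec_def)
  moreover have "(a \<cdot>\<^sub>v basis_vec (2*n) (w (Suc j))) $ i = 0"
    using w_p[OF ij(2)] ij by (simp add: basis_vec_def)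
  ultimately show ?thesis using a by simp
qed

end

lemma adjoint_flip_mat: "adjoint n (flip_mat n) = flip_mat n"
  by (rule eq_matI) (auto simp: adjoint_index flip_mat_def)

lemma flip_conj_index:
  assumes "A \<in> Mat n" "i < 2*n" "j < 2*n"
  shows "(flip_mat n * (A * flip_mat n)) $$ (i,j) = A $$ (2*n-1-i, 2*n-1-j)"
  using flip_mult_index[of "A * flip_mat n" n "2*n" i j] mult_flip_index[OF assms(1), of "2*n-1-i" j] assms
  by (simp del: index_mult_mat(1))

lemma flip_conj_SO: "X \<in> SO n \<Longrightarrow> flip_mat n * (X * flip_mat n) \<in> SO n"
proof -
  assume X: "X \<in> SO n"
  have "det (flip_mat n * (X * flip_mat n)) = det (flip_mat n) * det (flip_mat n) * det X"
    using det_mult[of "flip_mat n" "2*n" "X * flip_mat n"] det_mult[OF SO_carrier[OF X] flip_carrier] SO_carrier[OF X] by simp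
  then show ?thesis using X det_flip_square[of n] by (simp add: SO_iff orth_mult orth_flip)
qed

lemma flip_flip_left: "dim_row A = 2*n \<Longrightarrow> flip_mat n * (flip_mat n * A) = A"
  using flip_flip[of n] by (simp flip: mult_mat_assoc)

lemma cols_in_E_col_zero:
  "cols_in_E n A J \<Longrightarrow> j \<in> J \<Longrightarrow> n \<le> i \<Longrightarrow> i < 2*n \<Longrightarrow> A $$ (i,j) = 0"
  by (auto simp: cols_in_E_def)

text \<open>Both a and b send the coordinate subspace on J onto E, so a b^-1 preserves E.\<close>

lemma cols_in_E_parabolic:
  assumes a: "a \<in> orth n" "cols_in_E n a J" and b: "b \<in> orth n" "cols_in_E n b J" and J: "lag n J"
  shows "P_F n * ((a * adjoint n b) * P_E n) = 0\<^sub>m (2*n) (2*n)"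
proof -
  note aD = orthD[OF a(1)] and bD = orthD[OF b(1)]
  have abc: "a * adjoint n b \<in> Mat n" using aD by simp
  have "(a * adjoint n b) $$ (i,j) = 0" if ij: "n \<le> i" "i < 2*n" "j < n" for i j
  proof -
    have "a $$ (i,l) * adjoint n b $$ (l,j) = 0" if l: "l < 2*n" for l
    proof (cases "l \<in> J")
      case True
      then show ?thesis using cols_in_E_col_zero[OF a(2) True] ij by simp
    next
      case False
      then have "2*n-1-l \<in> J" using lagD(4)[OF J l] by simp
      then have "b $$ (2*n-1-j, 2*n-1-l) = 0" using ij by (intro cols_in_E_col_zero[OF b(2)]) auto
      then show ?thesis using l ij by (simp add: adjoint_index)
    qed
    moreover have "(a * adjoint n b) $$ (i,j) = (\<Sum>l<2*n. a $$ (i,l) * adjoint n b $$ (l,j))"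
      using ij by (intro mat_index_mult[OF aD(1) adjoint_carrier]) auto
    ultimately show ?thesis by (simp add: sum.neutral)
  qed
  then show ?thesis
    using abc by (intro eq_matI)
      (auto simp: entries_PE_PF(2)[of "(a * adjoint n b) * P_E n"] entries_PE_PF(3)[OF abc] simp del: index_mult_mat(1))
qed

text \<open>Passes from the stabiliser of E to flags: Y(t) W f^-1 tends to A f^-1 = g, and its flag
  is that of Y(t) W because f is upper triangular.\<close>

lemma closure_flag_conj:
  assumes f: "f \<in> orth n" "upper_tri (2*n) f" "f \<in> SO n" and W: "W \<in> SO n" and A: "A \<in> SO n"
    and lim: "mat_tendsto (2*n) (2*n) Y (A * adjoint n W)"
    and ev: "\<forall>\<^sub>F t in at 0. Y t \<in> SO n \<and> flag_of (2*n) (Y t * W) \<in> S"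
    and g: "g = A * adjoint n f"
  shows "flag_of (2*n) g \<in> zariski_D n closure_of S"
proof (rule limit_in_closure[where f = "\<lambda>t. Y t * (W * adjoint n f)"])
  have [simp]: "dim_row A = 2*n" "dim_col A = 2*n" "dim_row W = 2*n" "dim_col W = 2*n"
    using SO_carrier[OF A] SO_carrier[OF W] by auto
  show "g \<in> SO n" unfolding g by (rule SO_mult[OF A SO_adjoint[OF f(3)]])
  have Wo: "W \<in> orth n" using W by (simp add: SO_iff)
  have "mat_tendsto (2*n) (2*n) (\<lambda>t. Y t * (W * adjoint n f)) ((A * adjoint n W) * (W * adjoint n f))"
    by (intro mat_tendsto_mult[of "2*n" "2*n" _ _ "2*n"] lim mat_tendsto_const) (use SO_carrier[OF W] in simp)
  also have "(A * adjoint n W) * (W * adjoint n f) = g"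
    unfolding g using orth_cancel(1)[OF Wo adjoint_carrier, of f] by (simp add: mult_mat_assoc)
  finally show "mat_tendsto (2*n) (2*n) (\<lambda>t. Y t * (W * adjoint n f)) g" .
  show "\<forall>\<^sub>F t in at 0. Y t * (W * adjoint n f) \<in> SO n \<and> flag_of (2*n) (Y t * (W * adjoint n f)) \<in> S"
    using ev
  proof eventually_elim
    case (elim t)
    have YW: "Y t * W \<in> SO n" using SO_mult elim W by blast
    have [simp]: "dim_row (Y t) = 2*n" "dim_col (Y t) = 2*n" using SO_carrier[of "Y t" n] elim by auto
    have e: "Y t * (W * adjoint n f) = (Y t * W) * adjoint n f" by (simp add: mult_mat_assoc)
    have "flag_of (2*n) ((Y t * W) * adjoint n f) = flag_of (2*n) (Y t * W)"
      by (rule orth_upper_flag[OF SO_carrier[OF YW] orth_adjoint[OF f(1)] upper_tri_adjoint[OF f(2)]])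
    then show ?case unfolding e using elim SO_mult[OF YW SO_adjoint[OF f(3)]] by simp
  qed
qed

section \<open>Permutation matrices of u(\<gamma>) and v(\<gamma>)\<close>

context clan_D
begin

abbreviation "JP \<equiv> plus_or_second n c"
abbreviation "JM \<equiv> minus_or_second n c"

sublocale u: flip_perm n "clan_u n c"
  using clan_u_props(1,2) by unfold_locales

sublocale v: flip_perm n "clan_v n c"
  using clan_v_props(1,2) by unfold_locales

abbreviation "Wu \<equiv> perm_mat n (clan_u n c)"
abbreviation "Wv \<equiv> perm_mat n (clan_v n c)"

lemma u_class: "k < 2*n \<Longrightarrow> u.p k < n \<longleftrightarrow> k \<in> JP"
proof -
  assume k: "k < 2*n"
  then have "n < clan_u n c (Suc k) \<longleftrightarrow> Suc k \<notin> Suc ` JP" by (intro clan_u_props(3)) auto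
  moreover have "Suc k \<in> Suc ` JP \<longleftrightarrow> k \<in> JP" by auto
  ultimately show ?thesis using u.w_p(1)[OF k] by auto
qed

lemma v_class: "k < 2*n \<Longrightarrow> n \<le> v.p k \<longleftrightarrow> k \<in> JM"
proof -
  assume k: "k < 2*n"
  then have "n < clan_v n c (Suc k) \<longleftrightarrow> Suc k \<in> Suc ` JM" by (intro clan_v_props(3)) auto
  moreover have "Suc k \<in> Suc ` JM \<longleftrightarrow> k \<in> JM" by auto
  ultimately show ?thesis using v.w_p(1)[OF k] by auto
qed

lemma u_mono:
  assumes "i < k" "k < 2*n" "i \<in> JP \<longleftrightarrow> k \<in> JP"
  shows "u.p k < u.p i"
proof -
  have "clan_u n c (Suc k) < clan_u n c (Suc i)" using assms by (intro clan_u_props(4)) auto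
  then show ?thesis using u.w_p(1)[of i] u.w_p(1)[of k] assms by auto
qed

lemma v_mono:
  assumes "i < k" "k < 2*n" "i \<in> JM \<longleftrightarrow> k \<in> JM"
  shows "v.p i < v.p k"
proof -
  have "clan_v n c (Suc i) < clan_v n c (Suc k)" using assms by (intro clan_v_props(4)) auto
  then show ?thesis using v.w_p(1)[of i] v.w_p(1)[of k] assms by auto
qed

lemma Wu_cols_in_E: "cols_in_E n Wu JP"
  unfolding cols_in_E_def
proof (intro ballI)
  fix j i assume j: "j \<in> JP" and i: "i \<in> {n..<2*n}"
  have jN: "j < 2*n" by (rule lagD(2)[OF lag_plus j])
  then have "u.p j < n" using u_class j by simp
  then show "Wu $$ (i,j) = 0" using i jN by (auto simp: u.perm_mat_index)
qed

lemma Wu_SO: "Wu \<in> SO n"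
  using det_cols_in_E[OF u.perm_mat_orth lag_plus Wu_cols_in_E] even_plus u.perm_mat_orth by (simp add: SO_iff)

lemma Wv_cols_in_E: "cols_in_E n (flip_mat n * Wv) JM"
  unfolding cols_in_E_def
proof (intro ballI)
  fix j i assume j: "j \<in> JM" and i: "i \<in> {n..<2*n}"
  have jN: "j < 2*n" by (rule lagD(2)[OF lag_minus j])
  then have "n \<le> v.p j" using v_class j by simp
  then have "2*n-1-i \<noteq> v.p j" "2*n-1-i < 2*n" using i by auto
  then have "Wv $$ (2*n-1-i, j) = 0" using jN by (simp add: v.perm_mat_index)
  then show "(flip_mat n * Wv) $$ (i,j) = 0" using flip_mult_index[OF v.perm_mat_carrier, of i j] i jN by simp
qed

end

lemma det_flip: "det (flip_mat n) = (-1) ^ n"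
proof -
  have l: "lag n {n..<2*n}" unfolding lag_def by auto
  have "cols_in_E n (flip_mat n) {n..<2*n}" unfolding cols_in_E_def by (auto simp: flip_index)
  from det_cols_in_E[OF orth_flip l this] show ?thesis by (simp add: Int_absorb2 subset_iff)
qed

text \<open>The factor (-1)^n of \<open>flip_mat n\<close> turns the parity of L from n on into that
  of L below n, since the two counts add up to n.\<close>

lemma det_lag_pos_flip:
  assumes g: "g \<in> orth n" and L: "lag n L" and k: "det (flip_mat n * g) = (-1) ^ card (L \<inter> {n..})"
  shows "det g = (-1) ^ card (L \<inter> {..<n})"
proof -
  have "det (flip_mat n * g) = (-1) ^ n * det g"
    using det_mult[OF flip_carrier orthD(1)[OF g]] det_flip[of n] by simp
  then have "(-1) ^ n * det g = (-1) ^ card (L \<inter> {n..})" using k by simp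
  moreover have "n = card (L \<inter> {..<n}) + card (L \<inter> {n..})" using lag_cards(2)[OF L] by simp
  ultimately have "(-1) ^ (card (L \<inter> {..<n}) + card (L \<inter> {n..})) * det g = (-1) ^ card (L \<inter> {n..})" by simp
  then show ?thesis by (simp add: power_add) (metis minus_one_mult_self mult.left_commute mult.right_neutral)
qed

context clan_D
begin

lemma Wv_SO: "Wv \<in> SO n"
proof -
  have "det (flip_mat n * Wv) = (-1) ^ card (JM \<inter> {n..})"
    by (rule det_cols_in_E[OF orth_mult[OF orth_flip v.perm_mat_orth] lag_minus Wv_cols_in_E])
  then have "det Wv = (-1) ^ card (JM \<inter> {..<n})" by (rule det_lag_pos_flip[OF v.perm_mat_orth lag_minus])
  then show ?thesis using even_minus v.perm_mat_orth by (simp add: SO_iff)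
qed

text \<open>After the correction by b, both g b and \<open>Wu\<close> send the coordinate subspace
  on \<open>JP\<close> onto E. Hence g b Wu^-1 stabilises E, and \<open>parabolic_dense\<close>
  applies to it.\<close>

lemma flag_in_schubert:
  assumes g: "g \<in> SO n" and p: "lag_pos n g JP" and s: "weyl_embed n s = clan_u n c"
  shows "flag_of (2*n) g \<in> schubert n s"
proof -
  have go: "g \<in> orth n" using g by (simp add: SO_iff)
  from skew_echelon_normal_form[OF go p] obtain f where f: "skew_echelon n JP f" "cols_in_E n (g * (1\<^sub>m (2*n) + f)) JP" .
  note fo = skew_echelon_props[OF lag_plus f(1)]
  define b where "b = 1\<^sub>m (2*n) + f"
  have b: "b \<in> orth n" "upper_tri (2*n) b" "b \<in> SO n" unfolding b_def using fo by auto
  have [simp]: "dim_row g = 2*n" "dim_col g = 2*n" "dim_row b = 2*n" "dim_col b = 2*n"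
    using SO_carrier[OF g] SO_carrier[OF b(3)] by auto
  have gb: "g * b \<in> SO n" by (rule SO_mult[OF g b(3)])
  have gbo: "g * b \<in> orth n" using gb by (simp add: SO_iff)
  have "P_F n * (((g * b) * adjoint n Wu) * P_E n) = 0\<^sub>m (2*n) (2*n)"
    using f(2) by (intro cols_in_E_parabolic[OF gbo _ u.perm_mat_orth Wu_cols_in_E lag_plus]) (simp add: b_def)
  from parabolic_dense[OF SO_mult[OF gb SO_adjoint[OF Wu_SO]] this]
  obtain Y where Y: "mat_tendsto (2*n) (2*n) Y ((g * b) * adjoint n Wu)"
    and ev: "\<forall>\<^sub>F t in at 0. Y t \<in> SO n \<and> (\<exists>X\<in>SO n. lower_tri (2*n) X \<and>
       (\<forall>i<2*n. \<forall>j<2*n. (i < n) \<noteq> (j < n) \<longrightarrow> X $$ (i,j) = 0) \<and> upper_tri (2*n) (Y t * X))" .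
  have g': "g = (g * b) * adjoint n b" using orthD(3)[OF b(1)] by (simp add: mult_mat_assoc)
  show ?thesis unfolding schubert_def
  proof (rule closure_flag_conj[OF b Wu_SO gb Y _ g'])
    show "\<forall>\<^sub>F t in at 0. Y t \<in> SO n \<and> flag_of (2*n) (Y t * Wu) \<in>
       {flag_of (2*n) (b * g * b') |b g b'. b \<in> Borel n \<and> g \<in> weyl_reps n s \<and> b' \<in> Borel n}"
      using ev
    proof eventually_elim
      case (elim t)
      then obtain X where X: "X \<in> SO n" "lower_tri (2*n) X"
        "\<forall>i<2*n. \<forall>j<2*n. (i < n) \<noteq> (j < n) \<longrightarrow> X $$ (i,j) = 0" "upper_tri (2*n) (Y t * X)" and YS: "Y t \<in> SO n" by blast
      have Xc: "X \<in> Mat n" using SO_carrier[OF X(1)] .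
      have [simp]: "dim_row X = 2*n" "dim_col X = 2*n" "dim_row (Y t) = 2*n" "dim_col (Y t) = 2*n"
        using Xc SO_carrier[OF YS] by auto
      \<comment> \<open>Entry (i,j) of d is the entry of X at (u i, u j). Inside a class u reverses
        the order and X is lower triangular; between classes X vanishes. So d is upper triangular,
        and Y Wu = (Y X) Wu d^-1 has its flag in the cell of u.\<close>
      define d where "d = adjoint n Wu * (X * Wu)"
      have dS: "d \<in> SO n" unfolding d_def by (rule u.perm_conj_SO[OF X(1)])
      have "upper_tri (2*n) d" unfolding upper_tri_def
      proof (intro conjI allI impI)
        show "d \<in> Mat n" by (rule SO_carrier[OF dS])
        fix i j assume ij: "i < 2*n" "j < 2*n" "j < i"
        have pij: "u.p i < 2*n" "u.p j < 2*n" using u.w_p(2) ij by auto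
        show "d $$ (i,j) = 0"
        proof (cases "i \<in> JP \<longleftrightarrow> j \<in> JP")
          case True
          then have "u.p i < u.p j" using ij by (intro u_mono) auto
          then show ?thesis unfolding d_def u.conj_perm_index[OF Xc ij(1,2)] using X(2) pij by (auto simp: lower_tri_def)
        next
          case False
          then have "(u.p i < n) \<noteq> (u.p j < n)" using u_class ij by auto
          then show ?thesis unfolding d_def u.conj_perm_index[OF Xc ij(1,2)] using X(3) pij by blast
        qed
      qed
      then have "flag_of (2*n) ((Y t * Wu) * d) = flag_of (2*n) (Y t * Wu)"
        using dS SO_carrier[OF SO_mult[OF YS Wu_SO]] by (intro orth_upper_flag) (auto simp: SO_iff)
      moreover have "Wu * d = X * Wu" unfolding d_def by (rule orth_cancel(2)[OF u.perm_mat_orth]) (use Xc in simp)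
      then have "(Y t * Wu) * d = ((Y t * X) * Wu) * 1\<^sub>m (2*n)" using SO_carrier[OF dS] by (simp add: mult_mat_assoc)
      ultimately have "flag_of (2*n) (Y t * Wu) = flag_of (2*n) ((Y t * X) * Wu * 1\<^sub>m (2*n))" by metis
      moreover have "Y t * X \<in> Borel n" "Wu \<in> weyl_reps n s" "1\<^sub>m (2*n) \<in> Borel n"
        using SO_mult[OF YS X(1)] X(4) u.perm_mat_rep[OF s] Wu_SO
        by (auto simp: Borel_iff upper_tri_one SO_iff orth_one)
      ultimately show ?case using YS by blast
    qed
  qed
qed

text \<open>The argument for u conjugated by \<open>flip_mat n\<close>, which exchanges E with its
  complement and upper with lower triangular matrices; Z and X are the conjugates of Y and
  X'.\<close>

lemma flag_in_schubert_opp: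
  assumes g: "g \<in> SO n" and p: "lag_pos n (flip_mat n * g) JM" and s: "weyl_embed n s = clan_v n c"
  shows "flag_of (2*n) g \<in> schubert_opp n s"
proof -
  let ?Q = "flip_mat n"
  have go: "g \<in> orth n" using g by (simp add: SO_iff)
  have Qg: "?Q * g \<in> orth n" by (rule orth_mult[OF orth_flip go])
  from skew_echelon_normal_form[OF Qg p] obtain f where f: "skew_echelon n JM f" "cols_in_E n ((?Q * g) * (1\<^sub>m (2*n) + f)) JM" .
  note fo = skew_echelon_props[OF lag_minus f(1)]
  define b where "b = 1\<^sub>m (2*n) + f"
  have b: "b \<in> orth n" "upper_tri (2*n) b" "b \<in> SO n" unfolding b_def using fo by auto
  have [simp]: "dim_row g = 2*n" "dim_col g = 2*n" "dim_row b = 2*n" "dim_col b = 2*n"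
    using SO_carrier[OF g] SO_carrier[OF b(3)] by auto
  have gb: "g * b \<in> SO n" by (rule SO_mult[OF g b(3)])
  define A where "A = (g * b) * adjoint n Wv"
  have A: "A \<in> SO n" unfolding A_def by (rule SO_mult[OF gb SO_adjoint[OF Wv_SO]])
  have [simp]: "dim_row A = 2*n" "dim_col A = 2*n" using SO_carrier[OF A] by auto
  have "adjoint n (?Q * Wv) = adjoint n Wv * ?Q"
    by (simp add: adjoint_mult adjoint_flip_mat)
  then have Ae: "((?Q * (g * b)) * adjoint n (?Q * Wv)) = ?Q * (A * ?Q)" unfolding A_def by (simp add: mult_mat_assoc)
  have "P_F n * (((?Q * (g * b)) * adjoint n (?Q * Wv)) * P_E n) = 0\<^sub>m (2*n) (2*n)"
    using f(2) gb by (intro cols_in_E_parabolic[OF orth_mult[OF orth_flip] _ orth_mult[OF orth_flip v.perm_mat_orth] Wv_cols_in_E lag_minus])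
      (simp_all add: b_def[symmetric] mult_mat_assoc SO_iff)
  then have z: "P_F n * ((?Q * (A * ?Q)) * P_E n) = 0\<^sub>m (2*n) (2*n)" unfolding Ae .
  from parabolic_dense[OF flip_conj_SO[OF A] z]
  obtain Y where Y: "mat_tendsto (2*n) (2*n) Y (?Q * (A * ?Q))"
    and ev: "\<forall>\<^sub>F t in at 0. Y t \<in> SO n \<and> (\<exists>X\<in>SO n. lower_tri (2*n) X \<and>
       (\<forall>i<2*n. \<forall>j<2*n. (i < n) \<noteq> (j < n) \<longrightarrow> X $$ (i,j) = 0) \<and> upper_tri (2*n) (Y t * X))" .
  define Z where "Z t = ?Q * (Y t * ?Q)" for t
  have "mat_tendsto (2*n) (2*n) Z (?Q * ((?Q * (A * ?Q)) * ?Q))"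
    unfolding Z_def by (intro mat_tendsto_mult[of "2*n" "2*n" _ _ "2*n"] mat_tendsto_const Y flip_carrier)
  also have "?Q * ((?Q * (A * ?Q)) * ?Q) = A" by (simp add: mult_mat_assoc flip_flip flip_flip_left)
  finally have Z: "mat_tendsto (2*n) (2*n) Z ((g * b) * adjoint n Wv)" unfolding A_def .
  have g': "g = (g * b) * adjoint n b" using orthD(3)[OF b(1)] by (simp add: mult_mat_assoc)
  show ?thesis unfolding schubert_opp_def
  proof (rule closure_flag_conj[OF b Wv_SO gb Z _ g'])
    show "\<forall>\<^sub>F t in at 0. Z t \<in> SO n \<and> flag_of (2*n) (Z t * Wv) \<in>
       {flag_of (2*n) (b * g * b') |b g b'. b \<in> Borel_opp n \<and> g \<in> weyl_reps n s \<and> b' \<in> Borel n}"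
      using ev
    proof eventually_elim
      case (elim t)
      then obtain X' where X': "X' \<in> SO n" "lower_tri (2*n) X'"
        "\<forall>i<2*n. \<forall>j<2*n. (i < n) \<noteq> (j < n) \<longrightarrow> X' $$ (i,j) = 0" "upper_tri (2*n) (Y t * X')" and YS: "Y t \<in> SO n" by blast
      define X where "X = ?Q * (X' * ?Q)"
      have X: "X \<in> SO n" unfolding X_def by (rule flip_conj_SO[OF X'(1)])
      have Xc: "X \<in> Mat n" and X'c: "X' \<in> Mat n" and Yc: "Y t \<in> Mat n" using SO_carrier X X' YS by auto
      have ZS: "Z t \<in> SO n" unfolding Z_def by (rule flip_conj_SO[OF YS])
      have [simp]: "dim_row X = 2*n" "dim_col X = 2*n" "dim_row (Y t) = 2*n" "dim_col (Y t) = 2*n"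
        "dim_row X' = 2*n" "dim_col X' = 2*n" "dim_row (Z t) = 2*n" "dim_col (Z t) = 2*n"
        using Xc X'c Yc SO_carrier[OF ZS] by auto
      have Xi: "X $$ (i,j) = X' $$ (2*n-1-i, 2*n-1-j)" if "i < 2*n" "j < 2*n" for i j
        unfolding X_def using flip_conj_index[OF X'c that] .
      define d where "d = adjoint n Wv * (X * Wv)"
      have dS: "d \<in> SO n" unfolding d_def by (rule v.perm_conj_SO[OF X])
      have "upper_tri (2*n) d" unfolding upper_tri_def
      proof (intro conjI allI impI)
        show "d \<in> Mat n" by (rule SO_carrier[OF dS])
        fix i j assume ij: "i < 2*n" "j < 2*n" "j < i"
        have pij: "v.p i < 2*n" "v.p j < 2*n" using v.w_p(2) ij by auto
        then have pij': "2*n-1-v.p i < 2*n" "2*n-1-v.p j < 2*n" by auto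
        show "d $$ (i,j) = 0"
        proof (cases "i \<in> JM \<longleftrightarrow> j \<in> JM")
          case True
          then have "v.p j < v.p i" using ij by (intro v_mono) auto
          then have "2*n-1-v.p i < 2*n-1-v.p j" using pij by auto
          then have "X' $$ (2*n-1-v.p i, 2*n-1-v.p j) = 0" using X'(2) pij' by (auto simp: lower_tri_def)
          then show ?thesis unfolding d_def v.conj_perm_index[OF Xc ij(1,2)] Xi[OF pij] .
        next
          case False
          then have "(n \<le> v.p i) \<noteq> (n \<le> v.p j)" using v_class ij by auto
          then have "(2*n-1-v.p i < n) \<noteq> (2*n-1-v.p j < n)" using pij by auto
          then have "X' $$ (2*n-1-v.p i, 2*n-1-v.p j) = 0" using X'(3) pij' by blast
          then show ?thesis unfolding d_def v.conj_perm_index[OF Xc ij(1,2)] Xi[OF pij] .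
        qed
      qed
      then have "flag_of (2*n) ((Z t * Wv) * d) = flag_of (2*n) (Z t * Wv)"
        using dS SO_carrier[OF SO_mult[OF ZS Wv_SO]] by (intro orth_upper_flag) (auto simp: SO_iff)
      moreover have "Wv * d = X * Wv" unfolding d_def by (rule orth_cancel(2)[OF v.perm_mat_orth]) (use Xc in simp)
      then have "(Z t * Wv) * d = ((Z t * X) * Wv) * 1\<^sub>m (2*n)" using SO_carrier[OF dS] by (simp add: mult_mat_assoc)
      ultimately have "flag_of (2*n) (Z t * Wv) = flag_of (2*n) ((Z t * X) * Wv * 1\<^sub>m (2*n))" by metis
      moreover have "lower_tri (2*n) (Z t * X)"
      proof -
        have e: "Z t * X = ?Q * ((Y t * X') * ?Q)" unfolding Z_def X_def by (simp add: mult_mat_assoc flip_flip_left)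
        have YX: "Y t * X' \<in> Mat n" using Yc X'c by simp
        have "(Z t * X) $$ (i,j) = 0" if "i < 2*n" "j < 2*n" "i < j" for i j
          unfolding e flip_conj_index[OF YX that(1,2)] using X'(4) that by (auto simp: upper_tri_def)
        then show ?thesis using SO_carrier[OF SO_mult[OF ZS X]] by (simp add: lower_tri_def)
      qed
      then have "Z t * X \<in> Borel_opp n" "Wv \<in> weyl_reps n s" "1\<^sub>m (2*n) \<in> Borel n"
        using SO_mult[OF ZS X] v.perm_mat_rep[OF s] Wv_SO
        by (auto simp: Borel_iff Borel_opp_iff upper_tri_one SO_iff orth_one)
      ultimately show ?case using ZS by blast
    qed
  qed
qed

end

section \<open>Moving a Lagrangian subspace towards the generic position\<close>

lemma card_lessThan_Suc_Int:
  "card (K \<inter> {..<Suc i}) = card (K \<inter> {..<i}) + (if i \<in> K then 1 else (0::nat))"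
proof -
  have "K \<inter> {..<Suc i} = (if i \<in> K then insert i (K \<inter> {..<i}) else K \<inter> {..<i})" by (auto simp: less_Suc_eq)
  then show ?thesis by auto
qed

text \<open>The places from m to 2n-m-1 form n-m mirror pairs, and J contains one element of
  each.\<close>

lemma lag_count_flip:
  assumes J: "lag n J" and m: "m \<le> n"
  shows "card (J \<inter> {..<2*n-m}) = n - m + card (J \<inter> {..<m})"
  using m
proof (induction m)
  case 0
  have "J \<inter> {..<2*n} = J" using lagD(1)[OF J] by auto
  then show ?case using lag_cards(1)[OF J] by simp
next
  case (Suc m)
  have e: "2*n-m = Suc (2*n-1-m)" "2*n - Suc m = 2*n-1-m" "m < 2*n" using Suc(2) by auto
  have "2*n-1-m \<in> J \<longleftrightarrow> m \<notin> J" using lagD(3,4)[OF J] e(3) by blast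
  then show ?case using Suc card_lessThan_Suc_Int[of J "2*n-1-m"] card_lessThan_Suc_Int[of J m] unfolding e(1,2)
    by (auto split: if_splits)
qed

text \<open>
  Replacing \<open>i\<close> and \<open>k\<close> by their mirror images lowers the counting function of \<open>J\<close> by one on
  \<open>(i, 2n-1-k]\<close> and on the mirrored interval. The first discrepancy \<open>i\<close> of \<open>J\<close> and \<open>J0\<close> is moved to the
  first free place, and in the middle the parity condition provides the second unit that is needed.
\<close>

definition lag_move :: "nat \<Rightarrow> nat set \<Rightarrow> nat \<Rightarrow> nat \<Rightarrow> nat set" where
  "lag_move n J i k = (J - {i,k}) \<union> {2*n-1-i, 2*n-1-k}"

lemma lag_move_lag:
  assumes J: "lag n J" and ik: "i \<in> J" "k \<in> J" "i \<noteq> k"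
  shows "lag n (lag_move n J i k)"
  unfolding lag_def
proof (intro conjI allI impI)
  have iN: "i < 2*n" "k < 2*n" using lagD(2)[OF J] ik by auto
  show "lag_move n J i k \<subseteq> {..<2*n}" using lagD(1)[OF J] iN by (auto simp: lag_move_def)
  fix l assume l: "l < 2*n"
  have a: "l \<in> J \<longleftrightarrow> 2*n-1-l \<notin> J" using lagD(3,4)[OF J] l by blast
  have b: "2*n-1-i \<notin> J" "2*n-1-k \<notin> J" using lagD(3)[OF J] ik by auto
  have e: "2*n-1-l = 2*n-1-i \<longleftrightarrow> l = i" "2*n-1-l = 2*n-1-k \<longleftrightarrow> l = k" "2*n-1-l = i \<longleftrightarrow> l = 2*n-1-i"
    "2*n-1-l = k \<longleftrightarrow> l = 2*n-1-k" using l iN by auto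
  show "l \<in> lag_move n J i k \<longleftrightarrow> 2*n-1-l \<notin> lag_move n J i k"
    unfolding lag_move_def Un_iff Diff_iff insert_iff e using a b ik by auto
qed

lemma card_pair_lessThan:
  assumes "a \<noteq> b"
  shows "card ({a,b} \<inter> {..<m}) = (if a < m then 1 else 0) + (if b < m then 1 else (0::nat))"
proof -
  have "{a,b} \<inter> {..<m} = (if a < m then {a} else {}) \<union> (if b < m then {b} else {})" by auto
  then show ?thesis using assms by auto
qed

text \<open>Additive, since a difference of natural numbers would be truncated.\<close>

lemma lag_move_card:
  assumes J: "lag n J" and ik: "i \<in> J" "k \<in> J" "i \<noteq> k"
  shows "card (lag_move n J i k \<inter> {..<m}) + (if i < m then 1 else 0) + (if k < m then 1 else 0) =
    card (J \<inter> {..<m}) + (if 2*n-1-i < m then 1 else 0) + (if 2*n-1-k < m then 1 else (0::nat))"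
proof -
  define a b where "a = 2*n-1-i" and "b = 2*n-1-k"
  have iN: "i < 2*n" "k < 2*n" using lagD(2)[OF J] ik by auto
  have ab: "a \<notin> J" "b \<notin> J" unfolding a_def b_def using lagD(3)[OF J] ik by auto
  have ne: "a \<noteq> b" unfolding a_def b_def using iN ik(3) by linarith
  let ?X = "(J - {i,k}) \<inter> {..<m}"
  have fin: "finite ?X" by simp
  have "card (?X \<union> ({i,k} \<inter> {..<m})) = card ?X + card ({i,k} \<inter> {..<m})" by (intro card_Un_disjoint) auto
  moreover have "?X \<union> ({i,k} \<inter> {..<m}) = J \<inter> {..<m}" using ik by blast
  moreover have "card (?X \<union> ({a,b} \<inter> {..<m})) = card ?X + card ({a,b} \<inter> {..<m})"
    using ab by (intro card_Un_disjoint) auto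
  moreover have "?X \<union> ({a,b} \<inter> {..<m}) = lag_move n J i k \<inter> {..<m}"
    unfolding lag_move_def a_def[symmetric] b_def[symmetric] by blast
  ultimately show ?thesis
    unfolding a_def[symmetric] b_def[symmetric] using card_pair_lessThan[OF ik(3), of m] card_pair_lessThan[OF ne, of m] by simp
qed

lemma exists_lag_move:
  assumes J: "lag n J" and J0: "lag n J0" and ne: "J \<noteq> J0"
    and dom: "\<And>m. m \<le> 2*n \<Longrightarrow> card (J0 \<inter> {..<m}) \<le> card (J \<inter> {..<m})"
    and par: "even (card (J \<inter> {..<n}) + card (J0 \<inter> {..<n}))"
  obtains i k where "i \<in> J" "k \<in> J" "i \<noteq> k" "i < 2*n-1-k"
    "\<And>m. m \<le> 2*n \<Longrightarrow> card (J0 \<inter> {..<m}) \<le> card (lag_move n J i k \<inter> {..<m})"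
proof -
  define j where "j m = card (J \<inter> {..<m})" for m
  define j0 where "j0 m = card (J0 \<inter> {..<m})" for m
  note Sj = card_lessThan_Suc_Int[of J, folded j_def] card_lessThan_Suc_Int[of J0, folded j0_def]
  note dm = dom[folded j_def j0_def]
  have sym: "j (2*n-m) + j0 m = j0 (2*n-m) + j m" if "m \<le> n" for m
    using lag_count_flip[OF J that] lag_count_flip[OF J0 that] unfolding j_def j0_def by simp
  have sym': "j m + j0 (2*n-m) = j0 m + j (2*n-m)" if "m \<le> 2*n" for m
  proof (cases "m \<le> n")
    case False
    then have "2*n-m \<le> n" "2*n-(2*n-m) = m" using that by auto
    with sym[OF this(1)] show ?thesis by simp
  qed (use sym[of m] in simp)
  \<comment> \<open>Membership in the upper half is determined by the lower half, so two different
    sets already differ there.\<close>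
  have "\<exists>m. m \<le> n \<and> j0 m < j m"
  proof (rule ccontr)
    assume no: "\<not> ?thesis"
    have eqn: "j m = j0 m" if "m \<le> n" for m using no that dm[of m] by (metis le_antisym not_le le_trans mult_2 le_add1)
    have "l \<in> J \<longleftrightarrow> l \<in> J0" if "l < n" for l
      using eqn[of l] eqn[of "Suc l"] Sj[of l] that by (auto split: if_splits)
    then have "l \<in> J \<longleftrightarrow> l \<in> J0" if "l < 2*n" for l
    proof (cases "l < n")
      case False
      then have "2*n-1-l < n" using that by auto
      then have "2*n-1-l \<in> J \<longleftrightarrow> 2*n-1-l \<in> J0" by fact
      then show ?thesis using lagD(3,4)[OF J] lagD(3,4)[OF J0] that by blast
    qed
    then have "J = J0" using lagD(1)[OF J] lagD(1)[OF J0] by blast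
    then show False using ne by simp
  qed
  then obtain m0 where m0: "m0 \<le> n" "j0 m0 < j m0" by blast
  \<comment> \<open>The first discrepancy i is m1 - 1: by minimality the counts agree at i, so the
    surplus at m1 is caused by i itself.\<close>
  define m1 where "m1 = (LEAST m. j0 m < j m)"
  have m1: "j0 m1 < j m1" unfolding m1_def using m0(2) by (rule LeastI)
  have m1n: "m1 \<le> n" using Least_le[of "\<lambda>m. j0 m < j m" m0] m0 unfolding m1_def by simp
  have "m1 \<noteq> 0" using m1 by (auto simp: j_def j0_def intro: ccontr)
  then obtain i where i: "m1 = Suc i" by (cases m1) auto
  have "\<not> j0 i < j i" using not_less_Least[of i "\<lambda>m. j0 m < j m"] i unfolding m1_def by simp
  then have ji: "j i = j0 i" using dm[of i] m1n i by simp
  have iJ: "i \<in> J" using m1 ji Sj[of i] unfolding i by (auto split: if_splits)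
  have in': "i < n" using m1n i by simp
  have grow: "j0 m < j m" if "i < m" "m \<le> q" "\<And>l. i < l \<Longrightarrow> l < q \<Longrightarrow> l \<in> J" for m q
    using that(1,2)
  proof (induction m)
    case (Suc m)
    show ?case
    proof (cases "m = i")
      case True
      then show ?thesis using m1 i by simp
    next
      case False
      then have "i < m" "m < q" using Suc(2,3) by auto
      then show ?thesis using Suc(1) that(3)[of m] Sj[of m] by simp
    qed
  qed simp
  \<comment> \<open>The move costs one unit on (i, 2n-1-k] and one on the mirrored interval (k,
    2n-1-i]. A surplus on the first interval gives one on the second by the symmetry of the counts;
    two units are needed only where the intervals overlap.\<close>
  have fin: "j0 m \<le> card (lag_move n J i k \<inter> {..<m})"
    if k: "k \<in> J" "i \<noteq> k" "i < 2*n-1-k" and d1: "\<And>m. i < m \<Longrightarrow> m \<le> 2*n-1-k \<Longrightarrow> j0 m < j m"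
      and d2: "\<And>m. i < m \<Longrightarrow> m \<le> 2*n-1-k \<Longrightarrow> k < m \<Longrightarrow> m \<le> 2*n-1-i \<Longrightarrow> j0 m + 2 \<le> j m" and m: "m \<le> 2*n" for k m
  proof -
    have kN: "k < 2*n" using lagD(2)[OF J k(1)] .
    have ki: "k < 2*n-1-i" using k(3) kN in' by linarith
    note c = lag_move_card[OF J iJ k(1,2), of m, folded j_def]
    have b2: "j0 m < j m" if "k < m" "m \<le> 2*n-1-i"
    proof -
      have "j0 (2*n-m) < j (2*n-m)" using that kN m in' by (intro d1) auto
      then show ?thesis using sym'[OF m] by linarith
    qed
    show ?thesis
      using c d1[of m] d2[of m] b2 dm[OF m] k(3) ki by (auto split: if_splits)
  qed
  show thesis
  proof (cases "\<exists>q. i < q \<and> q < n \<and> q \<notin> J")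
    case True
    define q where "q = (LEAST q. i < q \<and> q < n \<and> q \<notin> J)"
    have q: "i < q" "q < n" "q \<notin> J" using LeastI_ex[OF True] unfolding q_def by auto
    have qm: "l \<in> J" if "i < l" "l < q" for l
      using not_less_Least[of l "\<lambda>q. i < q \<and> q < n \<and> q \<notin> J"] that q(2) unfolding q_def by auto
    \<comment> \<open>The surplus persists up to q, the first place after i missing from J, and q <
      n \<le> k keeps the two intervals apart.\<close>
    define k where "k = 2*n-1-q"
    have k: "k \<in> J" "2*n-1-k = q" "n \<le> k" unfolding k_def using lagD(4)[OF J, of q] q by auto
    show thesis
    proof (rule that[OF iJ k(1)])
      show "i \<noteq> k" "i < 2*n-1-k" using k q in' by auto
      fix m assume m: "m \<le> 2*n"
      have "j0 m \<le> card (lag_move n J i k \<inter> {..<m})"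
      proof (rule fin[OF k(1) _ _ _ _ m])
        show "i \<noteq> k" "i < 2*n-1-k" using k q in' by auto
        show "j0 m < j m" if "i < m" "m \<le> 2*n-1-k" for m using grow[of m q] qm that k(2) by auto
      qed (use k q in auto)
      then show "card (J0 \<inter> {..<m}) \<le> card (lag_move n J i k \<inter> {..<m})" by (simp add: j0_def)
    qed
  next
    case False
    then have all: "l \<in> J" if "i < l" "l < n" for l using that by auto
    have dn: "j0 n < j n" using grow[of n n] all in' by auto
    then have dn2: "j0 n + 2 \<le> j n" using par unfolding j_def[symmetric] j0_def[symmetric] by presburger
    have "i \<noteq> n - 1"
    proof
      assume "i = n - 1"
      then have "n = Suc i" using in' by simp
      then have "j n \<le> j i + 1" "j0 i \<le> j0 n" using Sj[of i] by auto
      then show False using dn2 ji by simp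
    qed
    then have il: "i < n - 1" using in' by simp
    \<comment> \<open>The intervals are now (i, n] and (n-1, 2n-1-i], which meet only in n. There
      the surplus is positive and even, hence at least 2.\<close>
    define k where "k = n - 1"
    have k: "k \<in> J" "2*n-1-k = n" "i \<noteq> k" "i < k" "k < n" unfolding k_def using all[of "n-1"] il by auto
    show thesis
    proof (rule that[OF iJ k(1,3)])
      show "i < 2*n-1-k" using k by simp
      fix m assume m: "m \<le> 2*n"
      have "j0 m \<le> card (lag_move n J i k \<inter> {..<m})"
      proof (rule fin[OF k(1,3) _ _ _ m])
        show "i < 2*n-1-k" using k by simp
        show "j0 m < j m" if "i < m" "m \<le> 2*n-1-k" for m using grow[of m n] all that k(2) by auto
        show "j0 m + 2 \<le> j m" if "i < m" "m \<le> 2*n-1-k" "k < m" "m \<le> 2*n-1-i" for m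
        proof -
          have "m = n" using that k unfolding k_def by linarith
          then show ?thesis using dn2 by simp
        qed
      qed
      then show "card (J0 \<inter> {..<m}) \<le> card (lag_move n J i k \<inter> {..<m})" by (simp add: j0_def)
    qed
  qed
qed

text \<open>Provides the decrease for the induction in \<open>flag_in_orbit_closure\<close>; the
  count drops at m = i+1.\<close>

lemma lag_move_less:
  assumes J: "lag n J" and ik: "i \<in> J" "k \<in> J" "i \<noteq> k" "i < 2*n-1-k"
  shows "(\<Sum>m\<le>2*n. card (lag_move n J i k \<inter> {..<m})) < (\<Sum>m\<le>2*n. card (J \<inter> {..<m}))"
proof (rule sum_strict_mono_ex1)
  have kN: "k < 2*n" "i < 2*n" using lagD(2)[OF J] ik by auto
  have ki: "k < 2*n-1-i" using ik(4) kN by linarith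
  note c = lag_move_card[OF J ik(1-3)]
  show "\<forall>m\<in>{..2*n}. card (lag_move n J i k \<inter> {..<m}) \<le> card (J \<inter> {..<m})"
  proof
    fix m
    show "card (lag_move n J i k \<inter> {..<m}) \<le> card (J \<inter> {..<m})" using c[of m] ik(4) ki by (auto split: if_splits)
  qed
  have "card (lag_move n J i k \<inter> {..<Suc i}) < card (J \<inter> {..<Suc i})" using c[of "Suc i"] ik(4) ki by (auto split: if_splits)
  then show "\<exists>m\<in>{..2*n}. card (lag_move n J i k \<inter> {..<m}) < card (J \<inter> {..<m})" using kN by (intro bexI[of _ "Suc i"]) auto
qed simp

lemma mat_tendsto_line:
  assumes "A \<in> carrier_mat N M" "B \<in> carrier_mat N M"
  shows "mat_tendsto N M (\<lambda>t. A + t \<cdot>\<^sub>m B) A"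
proof -
  have "((\<lambda>t. A $$ (i,j) + t * B $$ (i,j)) \<longlongrightarrow> A $$ (i,j) + 0 * B $$ (i,j)) (at 0)" for i j
    by (intro tendsto_intros)
  then show ?thesis using assms unfolding mat_tendsto_def by auto
qed

text \<open>Two mirrored copies, on the pairs i, 2n-1-k and k, 2n-1-i, of the product of the matrix
  with rows (1, 0), (-t, 1) and the matrix with rows (1, 1/t), (0, 1); the second copy has -t for t.
  The product has rows (1, 1/t), (-t, 0), and its zero entry puts the columns of the two new places
  into the old subspace. The first factor y(t) tends to 1 and moves the subspace; the second, z(t),
  is upper triangular since i < 2n-1-k and is absorbed into b.\<close>

lemma move_curve:
  assumes h: "h \<in> orth n" and p: "lag_pos n h J" and ik: "i \<in> J" "k \<in> J" "i \<noteq> k" "i < 2*n-1-k"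
  obtains x where "\<And>t. x t \<in> orth n" "mat_tendsto (2*n) (2*n) x (1\<^sub>m (2*n))"
    "\<And>t. t \<noteq> 0 \<Longrightarrow> lag_pos n (h * x t) (lag_move n J i k)"
proof -
  from p obtain b where J: "lag n J" and b: "b \<in> orth n" "upper_tri (2*n) b" "cols_in_E n (h * b) J"
    by (auto simp: lag_pos_def)
  define i' k' where "i' = 2*n-1-i" and "k' = 2*n-1-k"
  have iN: "i < 2*n" "k < 2*n" "i' < 2*n" "k' < 2*n" using lagD(2)[OF J] ik by (auto simp: i'_def k'_def)
  have nJ: "i' \<notin> J" "k' \<notin> J" unfolding i'_def k'_def using lagD(3)[OF J] ik by auto
  have ik': "i < k'" using ik(4) by (simp add: k'_def)
  have ki: "k < i'" using ik(4) iN unfolding i'_def by linarith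
  have ne: "i' \<noteq> k'" using iN ik(3) unfolding i'_def k'_def by linarith
  have lm: "s \<in> lag_move n J i k \<longleftrightarrow> s \<in> J \<and> s \<noteq> i \<and> s \<noteq> k \<or> s = i' \<or> s = k'" for s
    by (auto simp: lag_move_def i'_def k'_def)
  define U :: "complex mat" where "U = mat (2*n) (2*n) (\<lambda>(r,s). if r = k' \<and> s = i then 1 else if r = i' \<and> s = k then -1 else 0)"
  define V :: "complex mat" where "V = mat (2*n) (2*n) (\<lambda>(r,s). if r = i \<and> s = k' then 1 else if r = k \<and> s = i' then -1 else 0)"
  have UV: "U \<in> Mat n" "V \<in> Mat n" by (simp_all add: U_def V_def)
  have ds: "i \<noteq> i'" "i \<noteq> k'" "k \<noteq> i'" "k \<noteq> k'" using nJ ik by metis+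
  have UU: "U * U = 0\<^sub>m (2*n) (2*n)" "V * V = 0\<^sub>m (2*n) (2*n)"
  proof -
    have "U $$ (r,l) * U $$ (l,s) = 0" "V $$ (r,l) * V $$ (l,s) = 0" if "r < 2*n" "l < 2*n" "s < 2*n" for r l s
      using that ds ne ik(3) unfolding U_def V_def by auto
    then show "U * U = 0\<^sub>m (2*n) (2*n)" "V * V = 0\<^sub>m (2*n) (2*n)"
      using UV by (auto intro!: eq_matI simp: mat_index_mult[OF UV(1) UV(1)] mat_index_mult[OF UV(2) UV(2)] sum.neutral simp del: index_mult_mat(1))
  qed
  have sk: "adjoint n U = - U" "adjoint n V = - V"
  proof -
    have "adjoint n U $$ (r,s) = (- U) $$ (r,s) \<and> adjoint n V $$ (r,s) = (- V) $$ (r,s)" if rs: "r < 2*n" "s < 2*n" for r s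
    proof -
      define r' s' where "r' = 2*n-1-r" and "s' = 2*n-1-s"
      have c: "r' < 2*n" "s' < 2*n" "s' = k' \<longleftrightarrow> s = k" "s' = i' \<longleftrightarrow> s = i" "r' = k' \<longleftrightarrow> r = k" "r' = i' \<longleftrightarrow> r = i"
        "s' = k \<longleftrightarrow> s = k'" "s' = i \<longleftrightarrow> s = i'" "r' = k \<longleftrightarrow> r = k'" "r' = i \<longleftrightarrow> r = i'"
        using rs iN unfolding r'_def s'_def i'_def k'_def by linarith+
      have "U $$ (s', r') = (if s = k \<and> r = i' then 1 else if s = i \<and> r = k' then -1 else 0)"
        unfolding U_def index_mat(1)[OF c(2,1)] prod.case c by simp
      moreover have "V $$ (s', r') = (if s = i' \<and> r = k then 1 else if s = k' \<and> r = i then -1 else 0)"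
        unfolding V_def index_mat(1)[OF c(2,1)] prod.case c by simp
      ultimately show ?thesis using rs UV ds ne ik(3)
        unfolding adjoint_index[OF rs] r'_def[symmetric] s'_def[symmetric] by (auto simp: U_def V_def)
    qed
    then show "adjoint n U = - U" "adjoint n V = - V" using UV by (auto intro!: eq_matI)
  qed
  have smul: "a \<cdot>\<^sub>m X * (a \<cdot>\<^sub>m X) = 0\<^sub>m (2*n) (2*n)" "adjoint n (a \<cdot>\<^sub>m X) = - (a \<cdot>\<^sub>m X)"
    if X: "X \<in> Mat n" "X * X = 0\<^sub>m (2*n) (2*n)" "adjoint n X = - X" for a X
  proof -
    show "a \<cdot>\<^sub>m X * (a \<cdot>\<^sub>m X) = 0\<^sub>m (2*n) (2*n)"
      using mult_smult_assoc_mat[OF X(1), of "a \<cdot>\<^sub>m X" "2*n" a] mult_smult_distrib[OF X(1,1), of a] X by simp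
    show "adjoint n (a \<cdot>\<^sub>m X) = - (a \<cdot>\<^sub>m X)" using X by (simp add: adjoint_smult) (intro eq_matI, auto)
  qed
  define y where "y t = 1\<^sub>m (2*n) + (- t) \<cdot>\<^sub>m U" for t
  define z where "z t = 1\<^sub>m (2*n) + (1/t) \<cdot>\<^sub>m V" for t
  have yo: "y t \<in> orth n" for t
    using one_plus_skew_SO(1)[OF _ smul(1,2)[OF UV(1) UU(1) sk(1)], of "- t"] UV(1) unfolding y_def by (simp add: SO_iff)
  have zo: "z t \<in> orth n" for t
    using one_plus_skew_SO(1)[OF _ smul(1,2)[OF UV(2) UU(2) sk(2)], of "1/t"] UV(2) unfolding z_def by (simp add: SO_iff)
  have zup: "upper_tri (2*n) (z t)" for t
    using ik' ki UV(2) unfolding upper_tri_def z_def V_def by auto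
  have yc: "y t \<in> Mat n" and zc: "z t \<in> Mat n" for t using orthD(1)[OF yo] orthD(1)[OF zo] by auto
  define x where "x t = b * (y t * adjoint n b)" for t
  have [simp]: "dim_row h = 2*n" "dim_col h = 2*n" "dim_row b = 2*n" "dim_col b = 2*n"
    "dim_row (y t) = 2*n" "dim_col (y t) = 2*n" "dim_row (z t) = 2*n" "dim_col (z t) = 2*n" for t
    using orthD(1)[OF h] orthD(1)[OF b(1)] yc[of t] zc[of t] by auto
  show thesis
  proof (rule that[of x])
    show "x t \<in> orth n" for t unfolding x_def by (intro orth_mult b(1) yo orth_adjoint)
    have "mat_tendsto (2*n) (2*n) y (1\<^sub>m (2*n))"
    proof -
      have "y = (\<lambda>t. 1\<^sub>m (2*n) + t \<cdot>\<^sub>m (- U))" unfolding y_def using UV(1) by (intro ext eq_matI) auto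
      then show ?thesis using mat_tendsto_line[of "1\<^sub>m (2*n)" "2*n" "2*n" "- U"] UV(1) by simp
    qed
    then have "mat_tendsto (2*n) (2*n) x (b * (1\<^sub>m (2*n) * adjoint n b))"
      unfolding x_def by (intro mat_tendsto_mult[of "2*n" "2*n" _ _ "2*n"] mat_tendsto_const orthD(1)[OF b(1)] adjoint_carrier)
    then show "mat_tendsto (2*n) (2*n) x (1\<^sub>m (2*n))" using orthD(3)[OF b(1)] by simp
    fix t :: complex assume t: "t \<noteq> 0"
    have "(h * x t) * (b * z t) = (h * b) * (y t * z t)"
      unfolding x_def using orth_cancel(1)[OF b(1) zc[of t]] by (simp add: mult_mat_assoc)
    moreover have "cols_in_E n ((h * b) * (y t * z t)) (lag_move n J i k)"
      unfolding cols_in_E_def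
    proof (intro ballI)
      fix s r assume s: "s \<in> lag_move n J i k" and r: "r \<in> {n..<2*n}"
      have sN: "s < 2*n" using s iN lagD(2)[OF J] by (auto simp: lm)
      have yz0: "(y t * z t) $$ (l,s) = 0" if l: "l < 2*n" "l \<notin> J" for l
      proof -
        have z_s: "z t $$ (m,s) = (if m = s then 1 else 0) + (if s = k' \<and> m = i then 1/t else 0) + (if s = i' \<and> m = k then - 1/t else 0)"
          if "m < 2*n" for m using that sN ds ne ik(3) UV(2) unfolding z_def V_def by auto
        have "(y t * z t) $$ (l,s) = (\<Sum>m<2*n. (if m = s then y t $$ (l,s) else 0) +
            (if m = i then (if s = k' then y t $$ (l,i) / t else 0) else 0) +
            (if m = k then (if s = i' then - y t $$ (l,k) / t else 0) else 0))"
          unfolding mat_index_mult[OF yc zc l(1) sN] by (intro sum.cong refl) (auto simp: z_s distrib_left right_diff_distrib)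
        also have "\<dots> = y t $$ (l,s) + (if s = k' then y t $$ (l,i) / t else 0) + (if s = i' then - y t $$ (l,k) / t else 0)"
          using sN iN by (simp add: sum.distrib)
        also have "\<dots> = 0"
        proof -
          have li: "l \<noteq> i" "l \<noteq> k" using l ik by auto
          have ye: "y t $$ (l,m) = (if l = m then 1 else 0) - t * U $$ (l,m)" if "m < 2*n" for m
            using that l UV(1) unfolding y_def by simp
          have Ul: "U $$ (l,i) = (if l = k' then 1 else 0)" "U $$ (l,k) = (if l = i' then -1 else 0)"
            using l iN ik(3) unfolding U_def by auto
          consider "s = k'" | "s = i'" | "s \<in> J" "s \<noteq> i" "s \<noteq> k" using s by (auto simp: lm)
          then show ?thesis
          proof cases
            case 1
            then have "U $$ (l,s) = 0" using l ds iN unfolding U_def by auto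
            then show ?thesis using 1 ne li t Ul iN sN by (auto simp: ye)
          next
            case 2
            then have "U $$ (l,s) = 0" using l ds iN unfolding U_def by auto
            then show ?thesis using 2 ne li t Ul iN sN by (auto simp: ye)
          next
            case 3
            then have "U $$ (l,s) = 0" using l sN unfolding U_def by auto
            moreover have "s \<noteq> i'" "s \<noteq> k'" "l \<noteq> s" using 3 nJ l by auto
            ultimately show ?thesis using sN by (simp add: ye)
          qed
        qed
        finally show ?thesis .
      qed
      have hb: "h * b \<in> Mat n" "y t * z t \<in> Mat n" using orthD(1)[OF h] orthD(1)[OF b(1)] yc zc by auto
      have "(h * b) $$ (r,l) * (y t * z t) $$ (l,s) = 0" if "l < 2*n" for l
        using cols_in_E_col_zero[OF b(3), of l r] yz0[OF that] r by (cases "l \<in> J") auto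
      then show "((h * b) * (y t * z t)) $$ (r,s) = 0"
        using mat_index_mult[OF hb, of r s] r sN by (simp add: sum.neutral del: index_mult_mat(1))
    qed
    ultimately have "cols_in_E n ((h * x t) * (b * z t)) (lag_move n J i k)" by simp
    then show "lag_pos n (h * x t) (lag_move n J i k)"
      unfolding lag_pos_def using lag_move_lag[OF J ik(1-3)] orth_mult[OF b(1) zo] upper_tri_mult[OF b(2) zup] by blast
  qed
qed

section \<open>The third family of rank conditions\<close>

definition pair_sum :: "nat \<Rightarrow> flag \<Rightarrow> nat \<Rightarrow> nat \<Rightarrow> complex vec set" where
  "pair_sum n F i j = {proj_E n x + y | x y. x \<in> F i \<and> y \<in> F j}"

lemma cspan_props:
  assumes "B \<subseteq> carrier_vec N"
  shows "csubspace N (cspan N B)" "B \<subseteq> cspan N B" "csubspace N W \<Longrightarrow> B \<subseteq> W \<Longrightarrow> cspan N B \<subseteq> W"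
proof -
  interpret vec_space "TYPE(complex)" N .
  show "csubspace N (span B)" using span_is_subspace assms by simp
  show "B \<subseteq> span B" using in_own_span assms by simp
  show "csubspace N W \<Longrightarrow> B \<subseteq> W \<Longrightarrow> span B \<subseteq> W" by (rule span_is_subset) (auto simp: VectorSpace.subspace_def)
qed

lemma csubspace_complement:
  assumes S: "csubspace N S" and T: "csubspace N T" and ST: "S \<subseteq> T"
  obtains A C where "finite C" "A \<subseteq> S" "C \<subseteq> T" "S = cspan N A" "T = cspan N (A \<union> C)" "card C + cdim N S \<le> cdim N T"
proof -
  interpret vec_space "TYPE(complex)" N .
  from csubspace_basis[OF S] obtain A where A: "finite A" "A \<subseteq> S" "card A = cdim N S" "S = span A" "lin_indpt A" .
  from csubspace_basis[OF T] obtain B where B: "finite B" "B \<subseteq> T" "card B = cdim N T" "T = span B" "lin_indpt B" .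
  have "B \<subseteq> carrier_vec N" using B(2) csubspaceD(1)[OF T] by blast
  moreover have "A \<subseteq> span B" using A(2) ST B(4) by blast
  ultimately obtain C :: "complex vec set" where C: "finite C" "C \<subseteq> span B" "int (card C) \<le> int (card B) - int (card A)"
    "span (A \<union> C) = span B"
    using replacement[OF A(1) B(1) _ A(5)] by meson
  show thesis
  proof (rule that[OF C(1) A(2) _ A(4)])
    show "C \<subseteq> T" using C(2) B(4) by simp
    show "T = span (A \<union> C)" using C(4) B(4) by simp
    show "card C + cdim N S \<le> cdim N T" using C(3) A(3) B(3) by linarith
  qed
qed

lemma csubspace_flag:
  assumes "A \<in> carrier_mat N N"
  shows "csubspace N (flag_of N A i)"
  unfolding flag_of_eq'[OF assms] by (rule csubspace_apply[OF assms csubspace_coord])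

lemma flag_mono:
  assumes "A \<in> carrier_mat N N" "i \<le> j"
  shows "flag_of N A i \<subseteq> flag_of N A j"
  unfolding flag_of_eq'[OF assms(1)] using assms(2) by (intro image_mono) (auto simp: coord_space_def)

lemma flag_mult:
  assumes "D \<in> carrier_mat N N" "A \<in> carrier_mat N N"
  shows "flag_of N (D * A) i = apply_set D (flag_of N A i)"
proof -
  have "coord_space N {..<min i N} \<subseteq> carrier_vec N" by (auto simp: coord_space_def)
  from apply_set_mult[OF assms this] show ?thesis
    using flag_of_eq'[of "D * A" N i] flag_of_eq'[OF assms(2)] assms by simp
qed

lemma proj_E_mult: "x \<in> carrier_vec (2*n) \<Longrightarrow> proj_E n x = P_E n *\<^sub>v x"
proof (rule eq_vecI)
  fix i assume x: "x \<in> carrier_vec (2*n)" and "i < dim_vec (P_E n *\<^sub>v x)"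
  then have i: "i < 2*n" by simp
  have "(P_E n *\<^sub>v x) $ i = (\<Sum>k<2*n. P_E n $$ (i,k) * x $ k)"
    using mult_mat_vec_eq_lincomb[OF diag_mat_of_carrier x] i by simp
  also have "\<dots> = (\<Sum>k<2*n. if k = i then (if i < n then x $ i else 0) else 0)"
    using i by (intro sum.cong) (auto simp: diag_mat_of_index)
  finally show "proj_E n x $ i = (P_E n *\<^sub>v x) $ i" using i by (simp add: proj_E_def)
qed (simp add: proj_E_def)

lemma csubspace_pair_sum:
  assumes "csubspace (2*n) (F i)" "csubspace (2*n) (F j)"
  shows "csubspace (2*n) (pair_sum n F i j)"
proof -
  note Fi = csubspaceD[OF assms(1)] and Fj = csubspaceD[OF assms(2)]
  have P: "P_E n \<in> Mat n" by simp
  have e: "pair_sum n F i j = {P_E n *\<^sub>v x + y | x y. x \<in> F i \<and> y \<in> F j}"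
    unfolding pair_sum_def using proj_E_mult Fi(1) by (intro Collect_cong) (metis subsetD)
  show ?thesis unfolding e
  proof (rule csubspaceI)
    show "{P_E n *\<^sub>v x + y |x y. x \<in> F i \<and> y \<in> F j} \<subseteq> carrier_vec (2*n)"
    proof
      fix z assume "z \<in> {P_E n *\<^sub>v x + y |x y. x \<in> F i \<and> y \<in> F j}"
      then obtain x y where "z = P_E n *\<^sub>v x + y" "x \<in> F i" "y \<in> F j" by blast
      then show "z \<in> carrier_vec (2*n)"
        using subsetD[OF Fj(1)] mult_mat_vec_carrier[OF P] subsetD[OF Fi(1)] by simp
    qed
    show "0\<^sub>v (2*n) \<in> {P_E n *\<^sub>v x + y |x y. x \<in> F i \<and> y \<in> F j}"
      using Fi(2) Fj(2) mult_mat_zero_vec[OF P] by (intro CollectI exI[of _ "0\<^sub>v (2*n)"]) auto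
  next
    fix a b assume "a \<in> {P_E n *\<^sub>v x + y |x y. x \<in> F i \<and> y \<in> F j}" "b \<in> {P_E n *\<^sub>v x + y |x y. x \<in> F i \<and> y \<in> F j}"
    then obtain x y x' y' where xy: "a = P_E n *\<^sub>v x + y" "x \<in> F i" "y \<in> F j" "b = P_E n *\<^sub>v x' + y'" "x' \<in> F i" "y' \<in> F j" by blast
    have c: "x \<in> carrier_vec (2*n)" "x' \<in> carrier_vec (2*n)" "y \<in> carrier_vec (2*n)" "y' \<in> carrier_vec (2*n)"
      using xy Fi(1) Fj(1) by auto
    have "a + b = P_E n *\<^sub>v (x + x') + (y + y')"
      unfolding xy(1,4) mult_add_distrib_mat_vec[OF P c(1,2)] using c by (intro eq_vecI) auto
    then show "a + b \<in> {P_E n *\<^sub>v x + y |x y. x \<in> F i \<and> y \<in> F j}" using xy Fi(3) Fj(3) by blast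
  next
    fix s a assume "a \<in> {P_E n *\<^sub>v x + y |x y. x \<in> F i \<and> y \<in> F j}"
    then obtain x y where xy: "a = P_E n *\<^sub>v x + y" "x \<in> F i" "y \<in> F j" by blast
    have c: "x \<in> carrier_vec (2*n)" "y \<in> carrier_vec (2*n)" using xy Fi(1) Fj(1) by auto
    have "s \<cdot>\<^sub>v a = P_E n *\<^sub>v (s \<cdot>\<^sub>v x) + s \<cdot>\<^sub>v y"
      unfolding xy(1) mult_mat_vec[OF P c(1)] using c by (intro smult_add_distrib_vec) auto
    then show "s \<cdot>\<^sub>v a \<in> {P_E n *\<^sub>v x + y |x y. x \<in> F i \<and> y \<in> F j}" using xy Fi(4) Fj(4) by blast
  qed
qed

text \<open>A block diagonal D commutes with the projection to E and carries the whole construction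
  along.\<close>

lemma pair_sum_block:
  assumes D: "D \<in> Mat n" "P_E n * D = D * P_E n" and A: "A \<in> Mat n"
  shows "pair_sum n (flag_of (2*n) (D * A)) i j = apply_set D (pair_sum n (flag_of (2*n) A) i j)"
proof -
  have c: "x \<in> carrier_vec (2*n)" if "x \<in> flag_of (2*n) A k" for x k
    using that csubspaceD(1)[OF csubspace_flag[OF A]] by blast
  have e: "proj_E n (D *\<^sub>v x) + D *\<^sub>v y = D *\<^sub>v (proj_E n x + y)"
    if "x \<in> flag_of (2*n) A i" "y \<in> flag_of (2*n) A j" for x y
  proof -
    note xc = c[OF that(1)] and yc = c[OF that(2)]
    have "proj_E n (D *\<^sub>v x) = (P_E n * D) *\<^sub>v x"
      using D(1) xc proj_E_mult[of "D *\<^sub>v x" n] assoc_mult_mat_vec[OF diag_mat_of_carrier D(1) xc] by simp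
    also have "\<dots> = D *\<^sub>v proj_E n x"
      unfolding D(2) using assoc_mult_mat_vec[OF D(1) diag_mat_of_carrier xc] proj_E_mult[OF xc] by simp
    finally show ?thesis
      using mult_add_distrib_mat_vec[OF D(1) _ yc, of "proj_E n x"] by (simp add: proj_E_def)
  qed
  show ?thesis unfolding pair_sum_def flag_mult[OF D(1) A]
  proof (intro equalityI subsetI)
    fix z assume "z \<in> {proj_E n x + y |x y. x \<in> apply_set D (flag_of (2*n) A i) \<and> y \<in> apply_set D (flag_of (2*n) A j)}"
    then obtain x y where "x \<in> flag_of (2*n) A i" "y \<in> flag_of (2*n) A j" "z = proj_E n (D *\<^sub>v x) + D *\<^sub>v y" by blast
    then show "z \<in> apply_set D {proj_E n x + y |x y. x \<in> flag_of (2*n) A i \<and> y \<in> flag_of (2*n) A j}"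
      using e by blast
  next
    fix z assume "z \<in> apply_set D {proj_E n x + y |x y. x \<in> flag_of (2*n) A i \<and> y \<in> flag_of (2*n) A j}"
    then obtain x y where "x \<in> flag_of (2*n) A i" "y \<in> flag_of (2*n) A j" "z = D *\<^sub>v (proj_E n x + y)" by blast
    then show "z \<in> {proj_E n x + y |x y. x \<in> apply_set D (flag_of (2*n) A i) \<and> y \<in> apply_set D (flag_of (2*n) A j)}"
      using e[symmetric] by blast
  qed
qed

lemma cdim_E_tilde:
  assumes A: "A \<in> Mat n"
  shows "cdim (2*n) (flag_of (2*n) A i \<inter> E_tilde n) = cdim (2*n) (flag_of (2*n) (flip_mat n * A) i \<inter> E_space n)"
proof -
  have Fs: "csubspace (2*n) (flag_of (2*n) A i)" by (rule csubspace_flag[OF A])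
  have "flip_mat n *\<^sub>v x \<in> E_space n \<longleftrightarrow> x \<in> E_tilde n" if x: "x \<in> carrier_vec (2*n)" for x
  proof -
    have "(\<forall>r<2*n. r \<notin> {..<n} \<longrightarrow> (flip_mat n *\<^sub>v x) $ r = 0) \<longleftrightarrow> (\<forall>r<2*n. r \<notin> {n..<2*n} \<longrightarrow> x $ r = 0)" (is "?L \<longleftrightarrow> ?R")
    proof
      assume L: ?L
      show ?R
      proof (intro allI impI)
        fix r assume r: "r < 2*n" "r \<notin> {n..<2*n}"
        then have "2*n-1-r < 2*n" "2*n-1-r \<notin> {..<n}" "2*n-1-(2*n-1-r) = r" by auto
        then show "x $ r = 0" using L flip_mult_vec_index[OF x, of "2*n-1-r"] by metis
      qed
    next
      assume R: ?R
      show ?L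
      proof (intro allI impI)
        fix r assume r: "r < 2*n" "r \<notin> {..<n}"
        then have "2*n-1-r < 2*n" "2*n-1-r \<notin> {n..<2*n}" by auto
        then show "(flip_mat n *\<^sub>v x) $ r = 0" using R flip_mult_vec_index[OF x r(1)] by metis
      qed
    qed
    then show ?thesis using x by (simp add: E_space_eq E_tilde_eq coord_space_def)
  qed
  then have "apply_set (flip_mat n) (flag_of (2*n) A i \<inter> E_tilde n) = flag_of (2*n) (flip_mat n * A) i \<inter> E_space n"
    unfolding flag_mult[OF flip_carrier A] using csubspaceD(1)[OF Fs] by blast
  moreover have "csubspace (2*n) (flag_of (2*n) A i \<inter> E_tilde n)"
    unfolding E_tilde_eq by (rule csubspace_Int[OF Fs csubspace_coord])
  moreover have "det (flip_mat n) \<noteq> 0" using orth_det_nonzero[OF orth_flip] .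
  ultimately show ?thesis using cdim_apply[OF flip_carrier] by metis
qed

text \<open>pi(F_i) + F_j lies in pi(F_k) + F_j. The dimension of pi(F_k) is at most k minus that of
  the intersection of F_k with the complement of E, and pi(F_k) contains F_k \<inter> E, which
  already lies in F_j; so the two counts are saved.\<close>

lemma pair_sum_upper_bound:
  assumes A: "A \<in> orth n" and p: "lag_pos n A J" "lag_pos n (flip_mat n * A) L" and ijk: "i \<le> k" "k \<le> j" "j \<le> 2*n"
  shows "cdim (2*n) (pair_sum n (flag_of (2*n) A) i j) + card (J \<inter> {..<k}) + card (L \<inter> {..<k}) \<le> j + k"
proof -
  let ?N = "2*n"
  let ?F = "flag_of ?N A"
  note AD = orthD[OF A]
  have kN: "k \<le> ?N" using ijk by simp
  have Fs: "csubspace ?N (?F l)" for l by (rule csubspace_flag[OF AD(1)])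
  have Fd: "cdim ?N (?F l) = l" if "l \<le> ?N" for l
    using cdim_apply_coord[OF AD(1) orth_det_nonzero[OF A], of "{..<l}"] flag_of_eq[OF AD(1) that] that by auto
  define U1 where "U1 = ?F k \<inter> E_space n"
  define U2 where "U2 = ?F k \<inter> E_tilde n"
  have U1: "csubspace ?N U1" unfolding U1_def E_space_eq by (rule csubspace_Int[OF Fs csubspace_coord])
  have U2: "csubspace ?N U2" unfolding U2_def E_tilde_eq by (rule csubspace_Int[OF Fs csubspace_coord])
  have d1: "cdim ?N U1 = card (J \<inter> {..<k})" unfolding U1_def by (rule lag_pos_cdim[OF A p(1) kN])
  have d2: "cdim ?N U2 = card (L \<inter> {..<k})"
    unfolding U2_def cdim_E_tilde[OF AD(1)] by (rule lag_pos_cdim[OF orth_mult[OF orth_flip A] p(2) kN])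
  define R where "R = apply_set (P_E n) (?F k)"
  have Rs: "csubspace ?N R" unfolding R_def by (rule csubspace_apply[OF diag_mat_of_carrier Fs])
  have "U2 \<subseteq> ?F k" by (simp add: U2_def)
  from csubspace_complement[OF U2 Fs this] obtain A2 C2 where C2: "finite C2" "A2 \<subseteq> U2" "C2 \<subseteq> ?F k"
    "U2 = cspan ?N A2" "?F k = cspan ?N (A2 \<union> C2)" "card C2 + cdim ?N U2 \<le> cdim ?N (?F k)" .
  have c2: "C2 \<subseteq> carrier_vec ?N" "A2 \<subseteq> carrier_vec ?N" using C2(2,3) csubspaceD(1)[OF Fs] csubspaceD(1)[OF U2] by blast+
  let ?B = "apply_set (P_E n) C2"
  have Bc: "?B \<subseteq> carrier_vec ?N" using c2 by auto
  note sB = cspan_props[OF Bc]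
  \<comment> \<open>V contains A2, which projects to zero, and C2, hence all of F_k; so the
    projections of C2 span pi(F_k).\<close>
  define V where "V = {x \<in> carrier_vec ?N. P_E n *\<^sub>v x \<in> cspan ?N ?B}"
  have P: "P_E n \<in> Mat n" by simp
  have Vs: "csubspace ?N V"
  proof (rule csubspaceI)
    note sb = csubspaceD[OF sB(1)]
    show "0\<^sub>v ?N \<in> V" using sb(2) mult_mat_zero_vec[OF P] by (simp add: V_def)
    show "x + y \<in> V" if "x \<in> V" "y \<in> V" for x y
      using that sb(3) by (auto simp: V_def mult_add_distrib_mat_vec[OF P])
    show "a \<cdot>\<^sub>v x \<in> V" if "x \<in> V" for a x
      using that sb(4) by (auto simp: V_def mult_mat_vec[OF P])
  qed (auto simp: V_def)
  have "A2 \<union> C2 \<subseteq> V"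
  proof
    fix x assume x: "x \<in> A2 \<union> C2"
    have xc: "x \<in> carrier_vec ?N" using x c2 by blast
    show "x \<in> V"
    proof (cases "x \<in> C2")
      case True
      then show ?thesis using xc sB(2) by (auto simp: V_def)
    next
      case False
      then have "x \<in> E_tilde n" using x C2(2) by (auto simp: U2_def)
      then have "proj_E n x = 0\<^sub>v ?N" by (intro eq_vecI) (auto simp: proj_E_def E_tilde_eq coord_space_def)
      then show ?thesis using xc csubspaceD(2)[OF sB(1)] proj_E_mult[OF xc] by (simp add: V_def)
    qed
  qed
  then have "?F k \<subseteq> V" unfolding C2(5) using c2 by (intro cspan_props(3)[OF _ Vs]) auto
  then have "R \<subseteq> cspan ?N ?B" unfolding R_def V_def by auto
  then have "cdim ?N R \<le> cdim ?N (cspan ?N ?B)" by (rule cdim_mono[OF Rs sB(1)])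
  also have "\<dots> \<le> card ?B" using C2(1) Bc by (intro cdim_span_le) auto
  also have "\<dots> \<le> card C2" using C2(1) by (rule card_image_le)
  finally have dR: "cdim ?N R + card (L \<inter> {..<k}) \<le> k" using C2(6) d2 Fd[OF kN] by simp
  have "U1 \<subseteq> R"
  proof
    fix x assume x: "x \<in> U1"
    then have xc: "x \<in> carrier_vec ?N" using csubspaceD(1)[OF U1] by blast
    have "proj_E n x = x" using x xc by (intro eq_vecI) (auto simp: proj_E_def U1_def E_space_eq coord_space_def)
    then show "x \<in> R" using x xc proj_E_mult[OF xc] unfolding R_def U1_def by (metis IntD1 imageI)
  qed
  from csubspace_complement[OF U1 Rs this] obtain A1 C1 where C1: "finite C1" "A1 \<subseteq> U1" "C1 \<subseteq> R"
    "U1 = cspan ?N A1" "R = cspan ?N (A1 \<union> C1)" "card C1 + cdim ?N U1 \<le> cdim ?N R" .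
  from csubspace_basis[OF Fs[of j]] obtain Bj where Bj: "finite Bj" "Bj \<subseteq> ?F j" "card Bj = cdim ?N (?F j)" "?F j = cspan ?N Bj" .
  have c: "Bj \<union> C1 \<subseteq> carrier_vec ?N" using Bj(2) C1(3) csubspaceD(1)[OF Fs] csubspaceD(1)[OF Rs] by blast
  note sW = cspan_props[OF c]
  have Bjc: "Bj \<subseteq> carrier_vec ?N" using c by blast
  have FjW: "?F j \<subseteq> cspan ?N (Bj \<union> C1)"
    unfolding Bj(4) using sW(2) by (intro cspan_props(3)[OF Bjc sW(1)]) auto
  have "A1 \<union> C1 \<subseteq> cspan ?N (Bj \<union> C1)"
    using C1(2) FjW flag_mono[OF AD(1) ijk(2)] sW(2) unfolding U1_def by blast
  then have RW: "R \<subseteq> cspan ?N (Bj \<union> C1)"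
    unfolding C1(5) using c C1(2) csubspaceD(1)[OF U1] by (intro cspan_props(3)[OF _ sW(1)]) auto
  have "pair_sum n ?F i j \<subseteq> cspan ?N (Bj \<union> C1)"
  proof
    fix z assume "z \<in> pair_sum n ?F i j"
    then obtain x y where xy: "z = proj_E n x + y" "x \<in> ?F i" "y \<in> ?F j" by (auto simp: pair_sum_def)
    have xc: "x \<in> carrier_vec ?N" using xy(2) csubspaceD(1)[OF Fs] by blast
    have "proj_E n x \<in> R" unfolding R_def proj_E_mult[OF xc] using xy(2) flag_mono[OF AD(1) ijk(1)] by blast
    then show "z \<in> cspan ?N (Bj \<union> C1)" unfolding xy(1) using xy(3) FjW RW csubspaceD(3)[OF sW(1)] by blast
  qed
  then have "cdim ?N (pair_sum n ?F i j) \<le> cdim ?N (cspan ?N (Bj \<union> C1))"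
    by (intro cdim_mono[OF csubspace_pair_sum[where F = ?F and i = i and j = j, OF Fs Fs] sW(1)])
  also have "\<dots> \<le> card (Bj \<union> C1)" using Bj(1) C1(1) c by (intro cdim_span_le) auto
  also have "\<dots> \<le> card Bj + card C1" by (rule card_Un_le)
  also have "\<dots> = j + card C1" using Bj(3) Fd[OF ijk(3)] by simp
  finally show ?thesis using C1(6) d1 dR by linarith
qed

section \<open>Lower bounds by independence at a generic point of a line\<close>

lemma pair_sum_lower_bound:
  assumes A: "A \<in> Mat n" and Z: "Z \<in> Mat n" "det Z \<noteq> 0" and K: "K \<subseteq> {..<2*n}"
    and cols: "\<And>k. k \<in> K \<Longrightarrow> col Z k \<in> pair_sum n (flag_of (2*n) A) i j"
  shows "card K \<le> cdim (2*n) (pair_sum n (flag_of (2*n) A) i j)"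
proof -
  have s: "csubspace (2*n) (pair_sum n (flag_of (2*n) A) i j)"
    by (intro csubspace_pair_sum csubspace_flag A)
  have cc: "col Z ` K \<subseteq> carrier_vec (2*n)" using carrier_matD(1)[OF Z(1)] by (auto intro!: carrier_vecI)
  have "card K = cdim (2*n) (cspan (2*n) (col Z ` K))"
    using cdim_apply_coord[OF Z K] apply_coord_span[OF Z(1) K] by simp
  also have "\<dots> \<le> cdim (2*n) (pair_sum n (flag_of (2*n) A) i j)"
    using cols by (intro cdim_mono[OF cspan_props(1)[OF cc] s] cspan_props(3)[OF cc s]) auto
  finally show ?thesis .
qed

lemma col_mem_pair_sum:
  assumes A: "A \<in> Mat n"
  shows "k < j \<Longrightarrow> k < 2*n \<Longrightarrow> col A k \<in> pair_sum n (flag_of (2*n) A) i j"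
    "s < i \<Longrightarrow> s < 2*n \<Longrightarrow> proj_E n (col A s) \<in> pair_sum n (flag_of (2*n) A) i j"
proof -
  have c: "col A l \<in> flag_of (2*n) A m" if "l < m" "l < 2*n" for l m
  proof -
    have "unit_vec (2*n) l \<in> coord_space (2*n) {..<min m (2*n)}" using that by (auto simp: coord_space_def unit_vec_def)
    moreover have "col A l = A *\<^sub>v unit_vec (2*n) l" using A that by (intro eq_vecI) auto
    ultimately show ?thesis unfolding flag_of_eq'[OF A] by blast
  qed
  have z: "0\<^sub>v (2*n) \<in> flag_of (2*n) A m" for m by (rule csubspaceD(2)[OF csubspace_flag[OF A]])
  show "col A k \<in> pair_sum n (flag_of (2*n) A) i j" if "k < j" "k < 2*n"
  proof -
    have "col A k = proj_E n (0\<^sub>v (2*n)) + col A k" using A that by (intro eq_vecI) (auto simp: proj_E_def)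
    then show ?thesis unfolding pair_sum_def using c[OF that] z by blast
  qed
  show "proj_E n (col A s) \<in> pair_sum n (flag_of (2*n) A) i j" if "s < i" "s < 2*n"
  proof -
    have "proj_E n (col A s) = proj_E n (col A s) + 0\<^sub>v (2*n)" by (intro eq_vecI) (auto simp: proj_E_def)
    then show ?thesis unfolding pair_sum_def using c[OF that] z by blast
  qed
qed

lemma det_line_poly: "\<exists>q. \<forall>t. det (A + t \<cdot>\<^sub>m B) = poly q t" if "A \<in> carrier_mat N N" "B \<in> carrier_mat N N" for A B :: "complex mat"
proof (intro exI allI)
  fix t
  have c: "A + t \<cdot>\<^sub>m B \<in> carrier_mat N N" using that by auto
  have "det (A + t \<cdot>\<^sub>m B) = (\<Sum>p\<in>{p. p permutes {0..<N}}. signof p * (\<Prod>i=0..<N. A $$ (i, p i) + t * B $$ (i, p i)))"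
    unfolding det_def'[OF c]
  proof (intro sum.cong refl arg_cong2[where f = "(*)"] prod.cong)
    fix p i assume "p \<in> {p. p permutes {0..<N}}" "i \<in> {0..<N}"
    then have "i < N" "p i < N" using permutes_in_image[of p "{0..<N}" i] by auto
    then show "(A + t \<cdot>\<^sub>m B) $$ (i, p i) = A $$ (i, p i) + t * B $$ (i, p i)" using that by simp
  qed
  also have "\<dots> = poly (\<Sum>p\<in>{p. p permutes {0..<N}}. [:signof p:] * (\<Prod>i=0..<N. [:A $$ (i, p i), B $$ (i, p i):])) t"
    by (simp add: Polynomial.poly_sum Polynomial.poly_prod)
  finally show "det (A + t \<cdot>\<^sub>m B) = poly (\<Sum>p\<in>{p. p permutes {0..<N}}. [:signof p:] * (\<Prod>i=0..<N. [:A $$ (i, p i), B $$ (i, p i):])) t" .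
qed

text \<open>The determinant is a polynomial in t that is nonzero at t = 1. It has finitely many
  zeros, so 0 is at worst an isolated one.\<close>

lemma det_line_generic:
  fixes A B :: "complex mat"
  assumes "A \<in> carrier_mat N N" "B \<in> carrier_mat N N" "det (A + 1 \<cdot>\<^sub>m B) \<noteq> 0"
  shows "\<forall>\<^sub>F t in at 0. det (A + t \<cdot>\<^sub>m B) \<noteq> 0"
proof -
  obtain q where q: "\<And>t. det (A + t \<cdot>\<^sub>m B) = poly q t" using det_line_poly[OF assms(1,2)] by blast
  then have "q \<noteq> 0" using assms(3) by auto
  then have "finite {t. poly q t = 0}" by (rule poly_roots_finite)
  from eventually_notin_finite[OF this] show ?thesis unfolding q by simp
qed

lemma skew_echelon_comb:
  assumes f: "skew_echelon n J f" "skew_echelon n J f'"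
  shows "skew_echelon n J (f + f')" "skew_echelon n J (a \<cdot>\<^sub>m f)"
proof -
  have c: "f \<in> Mat n" "f' \<in> Mat n" and sk: "adjoint n f = - f" "adjoint n f' = - f'" using f by (auto simp: skew_echelon_def)
  have "adjoint n (f + f') = - (f + f')" using c sk by (simp add: adjoint_add) (intro eq_matI, auto)
  moreover have "(f + f') $$ (i,k) \<noteq> 0 \<longrightarrow> i \<notin> J \<and> k \<in> J \<and> i < k" if ik: "i < 2*n" "k < 2*n" for i k
  proof (intro impI)
    assume "(f + f') $$ (i,k) \<noteq> 0"
    then have "f $$ (i,k) \<noteq> 0 \<or> f' $$ (i,k) \<noteq> 0" using c ik by auto
    then show "i \<notin> J \<and> k \<in> J \<and> i < k" using f ik unfolding skew_echelon_def by blast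
  qed
  ultimately show "skew_echelon n J (f + f')" using c by (simp add: skew_echelon_def)
  have sm: "adjoint n (a \<cdot>\<^sub>m f) = - (a \<cdot>\<^sub>m f)"
    unfolding adjoint_smult[OF c(1)] sk(1) using c(1) by (intro eq_matI) auto
  have "(a \<cdot>\<^sub>m f) $$ (i,k) \<noteq> 0 \<longrightarrow> i \<notin> J \<and> k \<in> J \<and> i < k" if ik: "i < 2*n" "k < 2*n" for i k
  proof (intro impI)
    assume "(a \<cdot>\<^sub>m f) $$ (i,k) \<noteq> 0"
    then have "f $$ (i,k) \<noteq> 0" using c ik by auto
    then show "i \<notin> J \<and> k \<in> J \<and> i < k" using f(1) ik unfolding skew_echelon_def by blast
  qed
  then show "skew_echelon n J (a \<cdot>\<^sub>m f)" using sm c by (simp add: skew_echelon_def)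
qed

text \<open>As products vanish, multiplication becomes addition of the echelon matrices; comparing
  two Lagrangian subspaces of the same position amounts to subtracting them.\<close>

lemma skew_echelon_mult:
  assumes J: "lag n J" and f: "skew_echelon n J f" "skew_echelon n J f'"
  shows "(1\<^sub>m (2*n) + f) * (1\<^sub>m (2*n) + f') = 1\<^sub>m (2*n) + (f + f')"
proof -
  have c: "f \<in> Mat n" "f' \<in> Mat n" using f by (auto simp: skew_echelon_def)
  then have [simp]: "dim_row f = 2*n" "dim_col f = 2*n" "dim_row f' = 2*n" "dim_col f' = 2*n" by auto
  show ?thesis using skew_echelon_props(1)[OF J f(1,2)] by (simp add: mult_mat_distrib add_mat_assoc add_mat_comm[of f f'])
qed

section \<open>An explicit base point of the orbit\<close>

context clan_D
begin

text \<open>Compares the start of an arc with the start of its mirror image. By condition (2) on the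
  clan the two differ, so mirrored arcs get opposite signs, as the skewness of \<open>chi\<close>
  and \<open>psi\<close> requires.\<close>

definition arc_sign :: "nat \<Rightarrow> nat \<Rightarrow> complex" where
  "arc_sign s t = (if s < 2*n-1-t then 1 else -1)"

definition chi :: "complex mat" where
  "chi = mat (2*n) (2*n) (\<lambda>(i,k). if k < i \<and> matched c (Suc k) (Suc i) then arc_sign k i else 0)"

text \<open>The echelon matrix of the base point as seen from the complement of E: 1 + psi brings
  its subspace there to the coordinate subspace on \<open>JM\<close>, see
  \<open>base_point_cols_in_E_flip\<close>.\<close>

definition psi :: "complex mat" where
  "psi = mat (2*n) (2*n) (\<lambda>(i,k). if i < k \<and> matched c (Suc i) (Suc k) then - arc_sign i k else 0)"

text \<open>
  A matched pair \<open>s < t\<close> contributes columns \<open>y + x\<close> and \<open>\<plusminus>x\<close> with \<open>x \<in> E\<close> and \<open>y\<close> in the complement.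
  The sign makes the contributions of an arc and of its mirror image compatible with the form.
\<close>

definition base_point :: "complex mat" where
  "base_point = Wu * (1\<^sub>m (2*n) + chi)"

lemma chi_carrier: "chi \<in> Mat n" "psi \<in> Mat n"
  by (simp_all add: chi_def psi_def)

lemma chi_dim [simp]: "dim_row chi = 2*n" "dim_col chi = 2*n" "dim_row psi = 2*n" "dim_col psi = 2*n"
  by (simp_all add: chi_def psi_def)

lemma chi_index:
  assumes "i < 2*n" "k < 2*n"
  shows "chi $$ (i,k) = (if k < i \<and> matched c (Suc k) (Suc i) then arc_sign k i else 0)"
    "psi $$ (i,k) = (if i < k \<and> matched c (Suc i) (Suc k) then - arc_sign i k else 0)"
  using assms by (simp_all add: chi_def psi_def)

lemma arc_first: "s < t \<Longrightarrow> t < 2*n \<Longrightarrow> matched c (Suc s) (Suc t) \<Longrightarrow> first_occ n c (Suc s)"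
  unfolding first_occ_def by (intro exI[of _ "Suc t"]) auto

lemma arc_second: "s < t \<Longrightarrow> t < 2*n \<Longrightarrow> matched c (Suc s) (Suc t) \<Longrightarrow> second_occ c (Suc t)"
  unfolding second_occ_def by (intro exI[of _ "Suc s"]) auto

lemma first_not_in:
  assumes "i < 2*n" "first_occ n c (Suc i)"
  shows "i \<notin> JP" "i \<notin> JM" "\<not> second_occ c (Suc i)"
proof -
  have i: "Suc i \<in> {1..2*n}" using assms by auto
  have "c (Suc i) \<noteq> Plus \<and> c (Suc i) \<noteq> Minus \<and> \<not> second_occ c (Suc i)"
    using assms(2) by (cases rule: symbol_cases[OF i]) auto
  then show "i \<notin> JP" "i \<notin> JM" "\<not> second_occ c (Suc i)" by (auto simp: plus_or_second_def minus_or_second_def)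
qed

lemma second_in: "i < 2*n \<Longrightarrow> second_occ c (Suc i) \<Longrightarrow> i \<in> JP \<and> i \<in> JM"
  by (auto simp: plus_or_second_def minus_or_second_def)

lemma arc_flip:
  assumes "s < t" "t < 2*n" "matched c (Suc s) (Suc t)"
  shows "matched c (Suc (2*n-1-t)) (Suc (2*n-1-s))" "arc_sign (2*n-1-t) (2*n-1-s) = - arc_sign s t"
proof -
  have e: "2*n+1-Suc t = Suc (2*n-1-t)" "2*n+1-Suc s = Suc (2*n-1-s)" using assms by auto
  have "matched c (2*n+1-Suc t) (2*n+1-Suc s)" using assms matched_sym[OF assms(3)] by (intro matched_flip) auto
  then show "matched c (Suc (2*n-1-t)) (Suc (2*n-1-s))" unfolding e .
  have "Suc t \<noteq> 2*n+1-Suc s" using assms by (intro matched_not_flip) auto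
  then have "s \<noteq> 2*n-1-t" using assms e(2) by auto
  moreover have "2*n-1-(2*n-1-s) = s" using assms by auto
  ultimately show "arc_sign (2*n-1-t) (2*n-1-s) = - arc_sign s t" by (auto simp: arc_sign_def)
qed

lemma arc_flip_iff:
  assumes "i < 2*n" "k < 2*n"
  shows "2*n-1-i < 2*n-1-k \<and> matched c (Suc (2*n-1-i)) (Suc (2*n-1-k)) \<longleftrightarrow> k < i \<and> matched c (Suc k) (Suc i)"
proof
  assume a: "2*n-1-i < 2*n-1-k \<and> matched c (Suc (2*n-1-i)) (Suc (2*n-1-k))"
  have e: "2*n-1-(2*n-1-i) = i" "2*n-1-(2*n-1-k) = k" using assms by auto
  have "matched c (Suc (2*n-1-(2*n-1-k))) (Suc (2*n-1-(2*n-1-i)))"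
    using assms by (intro arc_flip(1)[OF conjunct1[OF a] _ conjunct2[OF a]]) auto
  then have "matched c (Suc k) (Suc i)" unfolding e .
  moreover have "k < i" using a assms by linarith
  ultimately show "k < i \<and> matched c (Suc k) (Suc i)" by blast
next
  assume a: "k < i \<and> matched c (Suc k) (Suc i)"
  then show "2*n-1-i < 2*n-1-k \<and> matched c (Suc (2*n-1-i)) (Suc (2*n-1-k))"
    using arc_flip(1)[of k i] assms by auto
qed

lemma chi_skew: "adjoint n chi = - chi" "adjoint n psi = - psi"
proof -
  have "adjoint n chi $$ (i,k) = (- chi) $$ (i,k) \<and> adjoint n psi $$ (i,k) = (- psi) $$ (i,k)" if ik: "i < 2*n" "k < 2*n" for i k
  proof -
    have b: "2*n-1-i < 2*n" "2*n-1-k < 2*n" using ik by auto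
    have "chi $$ (2*n-1-k, 2*n-1-i) = - chi $$ (i,k)"
      unfolding chi_index(1)[OF b(2,1)] chi_index(1)[OF ik] arc_flip_iff[OF ik]
      using arc_flip(2)[of k i] ik by simp
    moreover have "psi $$ (2*n-1-k, 2*n-1-i) = - psi $$ (i,k)"
      unfolding chi_index(2)[OF b(2,1)] chi_index(2)[OF ik] arc_flip_iff[OF ik(2,1)]
      using arc_flip(2)[of i k] ik by simp
    ultimately show ?thesis using ik by (simp add: adjoint_index)
  qed
  then show "adjoint n chi = - chi" "adjoint n psi = - psi" by (auto intro!: eq_matI)
qed

text \<open>No position is both the end of one arc and the start of another.\<close>

lemma chi_square: "chi * chi = 0\<^sub>m (2*n) (2*n)"
proof (rule eq_matI)
  fix i j assume "i < dim_row (0\<^sub>m (2*n) (2*n))" "j < dim_col (0\<^sub>m (2*n) (2*n))"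
  then have ij: "i < 2*n" "j < 2*n" by auto
  have "chi $$ (i,l) * chi $$ (l,j) = 0" if l: "l < 2*n" for l
    unfolding chi_index(1)[OF ij(1) l] chi_index(1)[OF l ij(2)]
    using arc_first[of l i] arc_second[of j l] first_not_in(3)[OF l] l ij by auto
  then show "(chi * chi) $$ (i,j) = 0\<^sub>m (2*n) (2*n) $$ (i,j)"
    unfolding mat_index_mult[OF chi_carrier(1) chi_carrier(1) ij] using ij by (simp add: sum.neutral)
qed auto

lemma psi_skew_echelon: "skew_echelon n JM psi"
  unfolding skew_echelon_def
proof (intro conjI allI impI chi_carrier chi_skew)
  fix i k assume ik: "i < 2*n" "k < 2*n" "psi $$ (i,k) \<noteq> 0"
  then have a: "i < k" "matched c (Suc i) (Suc k)" unfolding chi_index(2)[OF ik(1,2)] by (auto split: if_splits)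
  then show "i \<notin> JM" "k \<in> JM" "i < k"
    using first_not_in[OF ik(1) arc_first[OF a(1) ik(2) a(2)]] second_in[OF ik(2) arc_second[OF a(1) ik(2) a(2)]] by auto
qed

lemma base_point_SO: "base_point \<in> SO n"
  unfolding base_point_def
  by (rule SO_mult[OF Wu_SO one_plus_skew_SO(1)[OF chi_carrier(1) chi_square chi_skew(1)]])

lemma partner_0:
  assumes "i < 2*n" "j < 2*n" "k < 2*n" "matched c (Suc i) (Suc j)" "matched c (Suc i) (Suc k)" "j \<noteq> i" "k \<noteq> i"
  shows "j = k"
  using partner_unique[of "Suc i" "Suc j" "Suc k"] assms by auto

lemma chi_arc:
  assumes st: "s < t" "t < 2*n" "matched c (Suc s) (Suc t)" and l: "l < 2*n"
  shows "chi $$ (l,s) = (if l = t then arc_sign s t else 0)"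
proof -
  have s: "s < 2*n" using st by simp
  have "l = t" if "s < l" "matched c (Suc s) (Suc l)"
    by (rule partner_0[OF s l st(2) that(2) st(3)]) (use that(1) st(1) in auto)
  then have "s < l \<and> matched c (Suc s) (Suc l) \<longleftrightarrow> l = t" using st by blast
  then show ?thesis unfolding chi_index(1)[OF l s] by simp
qed

lemma psi_arc:
  assumes st: "s < t" "t < 2*n" "matched c (Suc s) (Suc t)" and l: "l < 2*n"
  shows "psi $$ (l,t) = (if l = s then - arc_sign s t else 0)"
proof -
  have s: "s < 2*n" using st by simp
  have "l = s" if "l < t" "matched c (Suc l) (Suc t)"
    by (rule partner_0[OF st(2) l s matched_sym[OF that(2)] matched_sym[OF st(3)]]) (use that(1) st(1) in auto)
  then have "l < t \<and> matched c (Suc l) (Suc t) \<longleftrightarrow> l = s" using st by blast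
  then show ?thesis unfolding chi_index(2)[OF l st(2)] by simp
qed

lemma base_point_JP:
  assumes "k \<in> JP" "r < 2*n"
  shows "base_point $$ (r,k) = Wu $$ (r,k)"
proof -
  have k: "k < 2*n" by (rule lagD(2)[OF lag_plus assms(1)])
  have "base_point $$ (r,k) = (\<Sum>l<2*n. Wu $$ (r,l) * (1\<^sub>m (2*n) + chi) $$ (l,k))"
    unfolding base_point_def using assms k chi_carrier by (intro mat_index_mult) auto
  also have "\<dots> = (\<Sum>l<2*n. if l = k then Wu $$ (r,k) else 0)"
  proof (rule sum.cong[OF refl])
    fix l assume "l \<in> {..<2*n}"
    then have l: "l < 2*n" by simp
    have "\<not> (k < l \<and> matched c (Suc k) (Suc l))" using arc_first[OF _ l] first_not_in(1)[OF k] assms(1) by blast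
    then have "chi $$ (l,k) = 0" unfolding chi_index(1)[OF l k] by (rule if_not_P)
    then show "Wu $$ (r,l) * (1\<^sub>m (2*n) + chi) $$ (l,k) = (if l = k then Wu $$ (r,k) else 0)" using l k by simp
  qed
  finally show ?thesis using k by simp
qed

text \<open>How the base point reaches the third ranks: \<open>Wu\<close> sends e_s to the
  complement and e_t to E, so for an arc with s among the first i and t beyond the first j
  positions, pi(F_i) + F_j gains column t.\<close>

lemma base_point_arc:
  assumes st: "s < t" "t < 2*n" "matched c (Suc s) (Suc t)" and r: "r < 2*n"
  shows "(P_E n * base_point) $$ (r,s) = arc_sign s t * base_point $$ (r,t)"
proof -
  have s: "s < 2*n" using st by simp
  have tJ: "t \<in> JP" using second_in[OF st(2) arc_second[OF st]] by blast
  have sJ: "s \<notin> JP" using first_not_in(1)[OF s arc_first[OF st]] .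
  have bc: "base_point \<in> Mat n" by (rule SO_carrier[OF base_point_SO])
  have "base_point $$ (r,s) = (\<Sum>l<2*n. Wu $$ (r,l) * (1\<^sub>m (2*n) + chi) $$ (l,s))"
    unfolding base_point_def using r s chi_carrier by (intro mat_index_mult) auto
  also have "\<dots> = (\<Sum>l<2*n. (if l = s then Wu $$ (r,s) else 0) + (if l = t then arc_sign s t * Wu $$ (r,t) else 0))"
  proof (rule sum.cong[OF refl])
    fix l assume "l \<in> {..<2*n}"
    then have l: "l < 2*n" by simp
    have "chi $$ (l,s) = (if l = t then arc_sign s t else 0)" by (rule chi_arc[OF st l])
    then show "Wu $$ (r,l) * (1\<^sub>m (2*n) + chi) $$ (l,s) =
        (if l = s then Wu $$ (r,s) else 0) + (if l = t then arc_sign s t * Wu $$ (r,t) else 0)"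
      using l s st by auto
  qed
  also have "\<dots> = Wu $$ (r,s) + arc_sign s t * Wu $$ (r,t)" using s st by (simp add: sum.distrib)
  finally have e: "base_point $$ (r,s) = Wu $$ (r,s) + arc_sign s t * Wu $$ (r,t)" .
  have "r < n \<Longrightarrow> Wu $$ (r,s) = 0" using u_class[OF s] sJ r s by (auto simp: u.perm_mat_index)
  moreover have "n \<le> r \<Longrightarrow> Wu $$ (r,t) = 0" using u_class[OF st(2)] tJ r st by (auto simp: u.perm_mat_index)
  ultimately show ?thesis
    unfolding entries_PE_PF(1)[OF bc r s] e base_point_JP[OF tJ r] by auto
qed

lemma base_point_cols_in_E: "cols_in_E n base_point JP"
  unfolding cols_in_E_def
proof (intro ballI)
  fix j i assume "j \<in> JP" "i \<in> {n..<2*n}"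
  then show "base_point $$ (i,j) = 0" using base_point_JP[of j i] cols_in_E_col_zero[OF Wu_cols_in_E, of j i] by simp
qed

text \<open>Before \<open>Wu\<close> is applied, column t of an arc is e_t - sign (e_s + sign e_t) =
  - sign e_s, and the column of a minus sign is a unit vector. Neither has a component in
  \<open>JP\<close>, and \<open>Wu\<close> sends the remaining unit vectors to the complement of
  E.\<close>

lemma base_point_cols_in_E_flip: "cols_in_E n ((flip_mat n * base_point) * (1\<^sub>m (2*n) + psi)) JM"
  unfolding cols_in_E_def
proof (intro ballI)
  fix j i assume j: "j \<in> JM" and "i \<in> {n..<2*n}"
  then have i: "n \<le> i" "i < 2*n" by auto
  have jN: "j < 2*n" by (rule lagD(2)[OF lag_minus j])
  let ?M = "(1\<^sub>m (2*n) + chi) * (1\<^sub>m (2*n) + psi)"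
  have c1: "1\<^sub>m (2*n) + chi \<in> Mat n" and c2: "1\<^sub>m (2*n) + psi \<in> Mat n" using chi_carrier by auto
  have M0: "?M $$ (l,j) = 0" if l: "l \<in> JP" for l
  proof -
    have lN: "l < 2*n" by (rule lagD(2)[OF lag_plus l])
    have nf: "\<not> first_occ n c (Suc j)" using first_not_in(2)[OF jN] j by blast
    have "\<not> (j < l \<and> matched c (Suc j) (Suc l))" using arc_first[OF _ lN] nf by blast
    then have chi_j: "chi $$ (l,j) = 0" unfolding chi_index(1)[OF lN jN] by (rule if_not_P)
    show ?thesis
    proof (cases "\<exists>s<j. matched c (Suc s) (Suc j)")
      case False
      have "?M $$ (l,j) = (\<Sum>m<2*n. if m = j then (1\<^sub>m (2*n) + chi) $$ (l,j) else 0)"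
        unfolding mat_index_mult[OF c1 c2 lN jN]
      proof (rule sum.cong[OF refl])
        fix m assume "m \<in> {..<2*n}"
        then have m: "m < 2*n" by simp
        have "psi $$ (m,j) = 0" unfolding chi_index(2)[OF m jN] using False by auto
        then show "(1\<^sub>m (2*n) + chi) $$ (l,m) * (1\<^sub>m (2*n) + psi) $$ (m,j) = (if m = j then (1\<^sub>m (2*n) + chi) $$ (l,j) else 0)"
          using m jN by simp
      qed
      also have "\<dots> = (1\<^sub>m (2*n) + chi) $$ (l,j)" using jN by simp
      also have "l \<noteq> j"
      proof
        assume "l = j"
        then have "second_occ c (Suc j)" using l j by (auto simp: plus_or_second_def minus_or_second_def)
        then obtain s where s: "1 \<le> s" "s < Suc j" "matched c s (Suc j)" by (auto simp: second_occ_def)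
        then have "s - 1 < j" "Suc (s - 1) = s" using s by auto
        then show False using False s(3) by metis
      qed
      then have "(1\<^sub>m (2*n) + chi) $$ (l,j) = 0" using chi_j lN jN by simp
      finally show ?thesis .
    next
      case True
      then obtain s where s: "s < j" "matched c (Suc s) (Suc j)" by blast
      have sN: "s < 2*n" using s jN by simp
      have "?M $$ (l,j) = (\<Sum>m<2*n. (if m = j then (1\<^sub>m (2*n) + chi) $$ (l,j) else 0) +
          (if m = s then - arc_sign s j * (1\<^sub>m (2*n) + chi) $$ (l,s) else 0))"
        unfolding mat_index_mult[OF c1 c2 lN jN]
      proof (rule sum.cong[OF refl])
        fix m assume "m \<in> {..<2*n}"
        then have m: "m < 2*n" by simp
        have "psi $$ (m,j) = (if m = s then - arc_sign s j else 0)" by (rule psi_arc[OF s(1) jN s(2) m])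
        then show "(1\<^sub>m (2*n) + chi) $$ (l,m) * (1\<^sub>m (2*n) + psi) $$ (m,j) =
            (if m = j then (1\<^sub>m (2*n) + chi) $$ (l,j) else 0) + (if m = s then - arc_sign s j * (1\<^sub>m (2*n) + chi) $$ (l,s) else 0)"
          using m jN s(1) by auto
      qed
      also have "\<dots> = (1\<^sub>m (2*n) + chi) $$ (l,j) - arc_sign s j * (1\<^sub>m (2*n) + chi) $$ (l,s)"
        using jN sN by (simp add: sum.distrib)
      also have "(1\<^sub>m (2*n) + chi) $$ (l,j) = (if l = j then 1 else 0)" using chi_j lN jN by simp
      also have "(1\<^sub>m (2*n) + chi) $$ (l,s) = (if l = j then arc_sign s j else 0)"
      proof -
        have "l \<noteq> s" using l first_not_in(1)[OF sN arc_first[OF s(1) jN s(2)]] by blast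
        moreover have "chi $$ (l,s) = (if l = j then arc_sign s j else 0)" by (rule chi_arc[OF s(1) jN s(2) lN])
        ultimately show ?thesis using lN sN by simp
      qed
      finally show ?thesis by (auto simp: arc_sign_def)
    qed
  qed
  have i': "2*n-1-i < 2*n" "2*n-1-i < n" using i by auto
  have Mc: "?M \<in> Mat n" using c1 c2 by simp
  have "((flip_mat n * base_point) * (1\<^sub>m (2*n) + psi)) = flip_mat n * (Wu * ?M)"
    unfolding base_point_def by (simp add: mult_mat_assoc)
  then have "((flip_mat n * base_point) * (1\<^sub>m (2*n) + psi)) $$ (i,j) = (Wu * ?M) $$ (2*n-1-i, j)"
    using flip_mult_index[of "Wu * ?M" n "2*n" i j] i jN Mc by simp
  also have "\<dots> = (\<Sum>l<2*n. Wu $$ (2*n-1-i, l) * ?M $$ (l,j))"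
    by (rule mat_index_mult[OF u.perm_mat_carrier Mc i'(1) jN])
  also have "\<dots> = 0"
  proof (rule sum.neutral, rule ballI)
    fix l assume "l \<in> {..<2*n}"
    then have l: "l < 2*n" by simp
    show "Wu $$ (2*n-1-i, l) * ?M $$ (l,j) = 0"
    proof (cases "l \<in> JP")
      case True
      then show ?thesis using M0 by simp
    next
      case False
      then have "2*n-1-i \<noteq> u.p l" using u_class[OF l] i'(2) by auto
      then show ?thesis using u.perm_mat_index[OF i'(1) l] by simp
    qed
  qed
  finally show "((flip_mat n * base_point) * (1\<^sub>m (2*n) + psi)) $$ (i,j) = 0" .
qed

lemma card_open_arcs_ends:
  "card {k. j \<le> k \<and> k < 2*n \<and> (\<exists>s<i. matched c (Suc s) (Suc k))} = card (open_arcs i j)" if "i \<le> j"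
proof -
  have "bij_betw (\<lambda>(s,t). t - 1) (open_arcs i j) {k. j \<le> k \<and> k < 2*n \<and> (\<exists>s<i. matched c (Suc s) (Suc k))}"
    unfolding bij_betw_def
  proof
    show "inj_on (\<lambda>(s,t). t - 1) (open_arcs i j)"
    proof (rule inj_onI)
      fix x y assume xy: "x \<in> open_arcs i j" "y \<in> open_arcs i j" "(case x of (s,t) \<Rightarrow> t - 1) = (case y of (s,t) \<Rightarrow> t - 1)"
      obtain s t where x: "x = (s,t)" by (cases x)
      obtain s' t' where y: "y = (s',t')" by (cases y)
      have r: "1 \<le> s" "s \<le> i" "j < t" "t \<le> 2*n" "matched c s t" "1 \<le> s'" "s' \<le> i" "j < t'" "t' \<le> 2*n" "matched c s' t'"
        using xy(1,2) unfolding x y open_arcs_def by auto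
      have tt: "t = t'" using xy(3) r unfolding x y by auto
      have "s = s'" using r that matched_sym[OF r(5)] matched_sym[OF r(10)] unfolding tt by (intro partner_unique[of t']) auto
      then show "x = y" using tt x y by simp
    qed
    show "(\<lambda>(s,t). t - 1) ` open_arcs i j = {k. j \<le> k \<and> k < 2*n \<and> (\<exists>s<i. matched c (Suc s) (Suc k))}"
    proof (intro equalityI subsetI)
      fix k assume "k \<in> (\<lambda>(s,t). t - 1) ` open_arcs i j"
      then obtain s t where st: "1 \<le> s" "s \<le> i" "j < t" "t \<le> 2*n" "matched c s t" "k = t - 1"
        by (auto simp: open_arcs_def)
      then have "s - 1 < i" "Suc (s - 1) = s" "Suc k = t" by auto
      then have "\<exists>s<i. matched c (Suc s) (Suc k)" using st(5) by metis
      then show "k \<in> {k. j \<le> k \<and> k < 2*n \<and> (\<exists>s<i. matched c (Suc s) (Suc k))}" using st by auto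
    next
      fix k assume "k \<in> {k. j \<le> k \<and> k < 2*n \<and> (\<exists>s<i. matched c (Suc s) (Suc k))}"
      then obtain s where "s < i" "matched c (Suc s) (Suc k)" "j \<le> k" "k < 2*n" by blast
      then have "(Suc s, Suc k) \<in> open_arcs i j" by (auto simp: open_arcs_def)
      then show "k \<in> (\<lambda>(s,t). t - 1) ` open_arcs i j" by force
    qed
  qed
  then show ?thesis by (rule bij_betw_same_card[symmetric])
qed

text \<open>
  The curve \<open>A + t B\<close> runs through a block diagonal multiple of the base point at \<open>t = 1\<close>. The columns
  of \<open>Z\<close> below are vectors of \<open>\<pi>(F\<^sub>i) + F\<^sub>j\<close> that are independent at \<open>t = 1\<close>.
\<close>

lemma generic_pair_sum:
  assumes AB: "A \<in> Mat n" "B \<in> Mat n" and D: "D \<in> Mat n" "P_E n * D = D * P_E n" "det D \<noteq> 0"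
    and one: "A + 1 \<cdot>\<^sub>m B = D * base_point" and ij: "i \<le> j" "j \<le> 2*n"
  shows "\<forall>\<^sub>F t in at 0. j + card (open_arcs i j) \<le> cdim (2*n) (pair_sum n (flag_of (2*n) (A + t \<cdot>\<^sub>m B)) i j)"
proof -
  let ?N = "2*n"
  define Q where "Q k \<longleftrightarrow> j \<le> k \<and> k < ?N \<and> (\<exists>s<i. matched c (Suc s) (Suc k))" for k
  have "\<exists>\<sigma>. \<forall>k. Q k \<longrightarrow> \<sigma> k < i \<and> matched c (Suc (\<sigma> k)) (Suc k)" unfolding Q_def by (intro choice) blast
  then obtain \<sigma> where \<sigma>: "\<And>k. Q k \<Longrightarrow> \<sigma> k < i" "\<And>k. Q k \<Longrightarrow> matched c (Suc (\<sigma> k)) (Suc k)" by blast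
  have bc: "base_point \<in> Mat n" by (rule SO_carrier[OF base_point_SO])
  define C where "C = D * base_point"
  have Cc: "C \<in> Mat n" unfolding C_def using D bc by simp
  \<comment> \<open>For an arc from the first i positions ending beyond the first j, the column of
    its end is replaced by the projection of the column of its start. The other columns beyond j are
    filled in from Y, which stays constant along the line, to make the matrix square.\<close>
  define Zm where "Zm X Y = mat ?N ?N (\<lambda>(r,k). if k < j then X $$ (r,k) else if Q k then (if r < n then X $$ (r, \<sigma> k) else 0) else Y $$ (r,k))"
    for X Y :: "complex mat"
  have Zc: "Zm X Y \<in> Mat n" for X Y by (simp add: Zm_def)
  have \<sigma>N: "\<sigma> k < ?N" "k < ?N" "\<sigma> k < k" if "Q k" for k using \<sigma>(1)[OF that] that ij unfolding Q_def by auto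
  have Zline: "Zm (A + t \<cdot>\<^sub>m B) C = Zm A C + t \<cdot>\<^sub>m Zm B (0\<^sub>m ?N ?N)" for t
    using AB \<sigma>N by (intro eq_matI) (auto simp: Zm_def)
  define \<epsilon> where "\<epsilon> k = (if k < j then 1 else if Q k then arc_sign (\<sigma> k) k else 1)" for k
  define E where "E = mat ?N ?N (\<lambda>(r,k). if r = k then \<epsilon> k else 0)"
  have Ec: "E \<in> Mat n" by (simp add: E_def)
  have "det E = prod_list (diag_mat E)" by (rule det_upper_triangular[OF _ Ec]) (auto simp: E_def)
  then have dE: "det E \<noteq> 0" unfolding prod_list_diag_prod by (auto simp: E_def \<epsilon>_def arc_sign_def)
  \<comment> \<open>This is the situation at t = 1. C is a block diagonal multiple of the base
    point, where the projected start of an arc is its end up to sign, so only a diagonal matrix of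
    signs appears.\<close>
  have "Zm C C = C * E"
  proof (rule eq_matI)
    fix r k assume "r < dim_row (C * E)" "k < dim_col (C * E)"
    then have rk: "r < ?N" "k < ?N" using Cc Ec by auto
    have "(C * E) $$ (r,k) = (\<Sum>l<?N. if l = k then C $$ (r,k) * \<epsilon> k else 0)"
      unfolding mat_index_mult[OF Cc Ec rk] using rk by (intro sum.cong) (auto simp: E_def)
    then have CE: "(C * E) $$ (r,k) = C $$ (r,k) * \<epsilon> k" using rk by simp
    show "Zm C C $$ (r,k) = (C * E) $$ (r,k)"
    proof (cases "\<not> k < j \<and> Q k")
      case True
      then have q: "Q k" by simp
      note s = \<sigma>N[OF q]
      have "(if r < n then C $$ (r, \<sigma> k) else 0) = (P_E n * C) $$ (r, \<sigma> k)"
        using entries_PE_PF(1)[OF Cc rk(1) s(1)] by simp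
      also have "P_E n * C = D * (P_E n * base_point)"
        unfolding C_def using D bc by (simp flip: mult_mat_assoc)
      also have "\<dots> $$ (r, \<sigma> k) = (\<Sum>l<?N. D $$ (r,l) * (P_E n * base_point) $$ (l, \<sigma> k))"
        by (rule mat_index_mult[OF D(1) mult_carrier_mat[OF diag_mat_of_carrier bc] rk(1) s(1)])
      also have "\<dots> = (\<Sum>l<?N. arc_sign (\<sigma> k) k * (D $$ (r,l) * base_point $$ (l,k)))"
        using base_point_arc[OF s(3,2) \<sigma>(2)[OF q]] by (intro sum.cong) (auto simp del: index_mult_mat(1))
      also have "\<dots> = arc_sign (\<sigma> k) k * C $$ (r,k)"
        unfolding C_def mat_index_mult[OF D(1) bc rk] by (simp add: sum_distrib_left)
      finally show ?thesis unfolding CE using True rk by (simp add: Zm_def \<epsilon>_def)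
    next
      case False
      then show ?thesis unfolding CE using rk by (auto simp: Zm_def \<epsilon>_def)
    qed
  qed (use Cc Ec in \<open>auto simp: Zm_def\<close>)
  moreover have "det C \<noteq> 0" unfolding C_def using det_mult[OF D(1) bc] D(3) orth_det_nonzero base_point_SO by (simp add: SO_iff)
  ultimately have "det (Zm (A + 1 \<cdot>\<^sub>m B) C) \<noteq> 0"
    unfolding one C_def[symmetric] using det_mult[OF Cc Ec] dE by simp
  then have "det (Zm A C + 1 \<cdot>\<^sub>m Zm B (0\<^sub>m ?N ?N)) \<noteq> 0" unfolding Zline .
  from det_line_generic[OF Zc Zc this] have ev: "\<forall>\<^sub>F t in at 0. det (Zm (A + t \<cdot>\<^sub>m B) C) \<noteq> 0" unfolding Zline .
  let ?K = "{..<j} \<union> {k. Q k}"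
  have "card ?K = card {..<j} + card {k. Q k}"
    by (rule card_Un_disjoint) (auto simp: Q_def)
  then have cK: "card ?K = j + card (open_arcs i j)" using card_open_arcs_ends[OF ij(1)] by (simp add: Q_def)
  show ?thesis
    using ev
  proof eventually_elim
    case (elim t)
    define X where "X = A + t \<cdot>\<^sub>m B"
    have Xc: "X \<in> Mat n" using AB by (auto simp: X_def)
    then have [simp]: "dim_row X = 2*n" "dim_col X = 2*n" by auto
    have "card ?K \<le> cdim ?N (pair_sum n (flag_of ?N X) i j)"
    proof (rule pair_sum_lower_bound[OF Xc Zc elim[folded X_def]])
      show "?K \<subseteq> {..<?N}" using ij by (auto simp: Q_def)
      fix k assume k: "k \<in> ?K"
      show "col (Zm X C) k \<in> pair_sum n (flag_of ?N X) i j"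
      proof (cases "k < j")
        case True
        then have "col (Zm X C) k = col X k" using ij by (intro eq_vecI) (auto simp: Zm_def)
        then show ?thesis using col_mem_pair_sum(1)[OF Xc True] True ij by simp
      next
        case False
        then have q: "Q k" using k by auto
        have "col (Zm X C) k = proj_E n (col X (\<sigma> k))"
          using False q \<sigma>N[OF q]  by (intro eq_vecI) (auto simp: Zm_def proj_E_def)
        then show ?thesis using col_mem_pair_sum(2)[OF Xc \<sigma>(1)[OF q] \<sigma>N(1)[OF q]] by simp
      qed
    qed
    then show ?case unfolding cK X_def .
  qed
qed

end

lemma lag_pos_mult_upper:
  assumes h: "h \<in> Mat n" and p: "lag_pos n h J" and x: "x \<in> orth n" "upper_tri (2*n) x"
  shows "lag_pos n (h * x) J"
proof -
  from p obtain b where J: "lag n J" and b: "b \<in> orth n" "upper_tri (2*n) b" "cols_in_E n (h * b) J"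
    unfolding lag_pos_def by blast
  have "(h * x) * (adjoint n x * b) = h * b"
    using orthD(1)[OF x(1)] orthD(1)[OF b(1)] h orth_cancel(2)[OF x(1) orthD(1)[OF b(1)]] by (simp add: mult_mat_assoc)
  moreover have "adjoint n x * b \<in> orth n" by (intro orth_mult orth_adjoint x b)
  moreover have "upper_tri (2*n) (adjoint n x * b)"
    by (intro upper_tri_mult upper_tri_adjoint x b)
  ultimately show ?thesis unfolding lag_pos_def using J b(3) by metis
qed

lemma skew_echelon_carrier: "skew_echelon n J f \<Longrightarrow> f \<in> Mat n"
  by (simp add: skew_echelon_def)

section \<open>Approximation by points of the orbit\<close>

context clan_D
begin

text \<open>The upper bounds for the third ranks come from a cut k with \<open>open_arcs k k\<close>
  inside \<open>open_arcs i j\<close>: by \<open>card_positions\<close>, j + k minus the two counts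
  is j plus the number of arcs open at k.\<close>

lemma flag_in_orbit:
  assumes av: "avoids_1212 n c" and g: "g \<in> SO n" and p: "lag_pos n g JP" "lag_pos n (flip_mat n * g) JM"
    and low: "\<And>i j. 1 \<le> i \<Longrightarrow> i < j \<Longrightarrow> j \<le> 2*n \<Longrightarrow> j + card (open_arcs i j) \<le> cdim (2*n) (pair_sum n (flag_of (2*n) g) i j)"
  shows "flag_of (2*n) g \<in> orbit_D n c"
proof -
  have go: "g \<in> orth n" using g by (simp add: SO_iff)
  have gc: "g \<in> Mat n" by (rule SO_carrier[OF g])
  have "cdim (2*n) (flag_of (2*n) g i \<inter> E_space n) = card {k\<in>{1..i}. c k = Plus} + num_pairs c i"
    "cdim (2*n) (flag_of (2*n) g i \<inter> E_tilde n) = card {k\<in>{1..i}. c k = Minus} + num_pairs c i"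
    if i: "i \<in> {1..2*n}" for i
  proof -
    have iN: "i \<le> 2*n" using i by simp
    show "cdim (2*n) (flag_of (2*n) g i \<inter> E_space n) = card {k\<in>{1..i}. c k = Plus} + num_pairs c i"
      unfolding card_plus[OF iN] by (rule lag_pos_cdim[OF go p(1) iN])
    show "cdim (2*n) (flag_of (2*n) g i \<inter> E_tilde n) = card {k\<in>{1..i}. c k = Minus} + num_pairs c i"
      unfolding card_minus[OF iN] cdim_E_tilde[OF gc] by (rule lag_pos_cdim[OF orth_mult[OF orth_flip go] p(2) iN])
  qed
  moreover have "cdim (2*n) (pair_sum n (flag_of (2*n) g) i j) = j + card (open_arcs i j)"
    if ij: "1 \<le> i" "i < j" "j \<le> 2*n" for i j
  proof (rule antisym[OF _ low[OF ij]])
    from noncrossing_cut[OF av ij(1) less_imp_le[OF ij(2)] ij(3)] obtain k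
      where k: "i \<le> k" "k \<le> j" "open_arcs k k \<subseteq> open_arcs i j" .
    from card_mono[OF finite_open_arcs k(3)] have "card (open_arcs k k) \<le> card (open_arcs i j)" .
    moreover have "k = card (JP \<inter> {..<k}) + card (JM \<inter> {..<k}) + card (open_arcs k k)"
      using k ij by (intro card_positions) simp
    moreover have "cdim (2*n) (pair_sum n (flag_of (2*n) g) i j) + card (JP \<inter> {..<k}) + card (JM \<inter> {..<k}) \<le> j + k"
      by (rule pair_sum_upper_bound[OF go p k(1,2) ij(3)])
    ultimately show "cdim (2*n) (pair_sum n (flag_of (2*n) g) i j) \<le> j + card (open_arcs i j)" by linarith
  qed
  ultimately have "flag_of (2*n) g \<in> orbit_GL n c"
    unfolding orbit_GL_def pair_sum_def[symmetric] open_arcs_def[symmetric]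
    using flag_of_complete[OF SO_GL[OF g]] by simp
  then show ?thesis unfolding orbit_D_def flags_D_def using g by blast
qed

text \<open>g and the base point have the same positions, so their pairs of Lagrangian subspaces
  differ by echelon matrices f and w. Moving along 1 + t f and 1 + t w keeps both positions and
  arrives at t = 1, up to a block diagonal factor, at the base point. Large rank there is given by a
  nonzero determinant, hence holds for small t \<noteq> 0 as well.\<close>

lemma generic_position:
  assumes av: "avoids_1212 n c" and g: "g \<in> SO n" and p: "lag_pos n g JP" "lag_pos n (flip_mat n * g) JM"
  shows "flag_of (2*n) g \<in> zariski_D n closure_of orbit_D n c"
proof -
  let ?P = "P_E n" and ?F = "P_F n" and ?I = "1\<^sub>m (2*n) :: complex mat" and ?N = "2*n"
  have go: "g \<in> orth n" using g by (simp add: SO_iff)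
  have fgo: "flip_mat n * g \<in> orth n" by (rule orth_mult[OF orth_flip go])
  have gc: "g \<in> Mat n" by (rule SO_carrier[OF g])
  from skew_echelon_normal_form[OF go p(1)] obtain f where f: "skew_echelon n JP f" "cols_in_E n (g * (?I + f)) JP" .
  from skew_echelon_normal_form[OF fgo p(2)] obtain e where e: "skew_echelon n JM e" "cols_in_E n ((flip_mat n * g) * (?I + e)) JM" .
  note sp = psi_skew_echelon skew_echelon_comb(2)[OF psi_skew_echelon psi_skew_echelon, of "-1"]
  \<comment> \<open>Seen from the complement the base point has echelon matrix \<open>psi\<close>
    instead of 0, so the difference from e is needed; on the side of E the matrix f suffices by
    \<open>base_point_cols_in_E\<close>.\<close>
  define w where "w = e + (-1) \<cdot>\<^sub>m psi"
  have w: "skew_echelon n JM w" unfolding w_def by (rule skew_echelon_comb(1)[OF e(1) sp(2)])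
  have fc: "f \<in> Mat n" and wc: "w \<in> Mat n" and ec: "e \<in> Mat n" 
    using skew_echelon_carrier[OF f(1)] skew_echelon_carrier[OF w] skew_echelon_carrier[OF e(1)] .
  have bS: "base_point \<in> SO n" by (rule base_point_SO)
  then have bo: "base_point \<in> orth n" by (simp add: SO_iff)
  have bc: "base_point \<in> Mat n" by (rule SO_carrier[OF bS])
  have [simp]: "dim_row f = ?N" "dim_col f = ?N" "dim_row w = ?N" "dim_col w = ?N" "dim_row e = ?N" "dim_col e = ?N"
    "dim_row g = ?N" "dim_col g = ?N" "dim_row base_point = ?N" "dim_col base_point = ?N" using fc wc ec gc bc by auto
  define x1 where "x1 t = ?I + t \<cdot>\<^sub>m f" for t
  define x2 where "x2 t = ?I + t \<cdot>\<^sub>m w" for t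
  note x1p = skew_echelon_props[OF lag_plus skew_echelon_comb(2)[OF f(1) f(1)], folded x1_def]
  note x2p = skew_echelon_props[OF lag_minus skew_echelon_comb(2)[OF w w], folded x2_def]
  have lim: "mat_tendsto ?N ?N x1 ?I" "mat_tendsto ?N ?N x2 ?I"
    unfolding x1_def x2_def by (intro mat_tendsto_line fc wc one_carrier_mat)+
  from lift_curves[OF g x1p(3) x2p(3) lim] obtain G D where Glim: "mat_tendsto ?N ?N G g"
    and ev: "\<forall>\<^sub>F t in at 0. G t \<in> SO n \<and> D t \<in> Mat n \<and> det (D t) \<noteq> 0 \<and> ?P * D t = D t * ?P \<and>
       G t = D t * (?P * (g * x2 t) + ?F * (g * x1 t))" by blast
  have p1: "lag_pos n (g * x1 t) JP" for t by (rule lag_pos_mult_upper[OF gc p(1) x1p(3,4)])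
  have p2: "lag_pos n (flip_mat n * (g * x2 t)) JM" for t
    using lag_pos_mult_upper[OF orthD(1)[OF fgo] p(2) x2p(3,4), of t] orthD(1)[OF x2p(3)[of t]] by (simp add: mult_mat_assoc)
  define B where "B = ?P * (g * w) + ?F * (g * f)"
  have Bc: "B \<in> Mat n" unfolding B_def by (auto intro!: carrier_matI)
  have line: "?P * (g * x2 t) + ?F * (g * x1 t) = g + t \<cdot>\<^sub>m B" for t
  proof -
    have "?P * (g * x2 t) + ?F * (g * x1 t) = (?P * g + t \<cdot>\<^sub>m (?P * (g * w))) + (?F * g + t \<cdot>\<^sub>m (?F * (g * f)))"
      by (simp add: x1_def x2_def mult_mat_distrib mult_smult_distrib[OF gc wc] mult_smult_distrib[OF gc fc]
          mult_smult_distrib[OF diag_mat_of_carrier mult_carrier_mat[OF gc wc]]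
          mult_smult_distrib[OF diag_mat_of_carrier mult_carrier_mat[OF gc fc]])
    also have "\<dots> = (?P * g + ?F * g) + t \<cdot>\<^sub>m B"
      unfolding B_def by (rule eq_matI) (auto simp del: index_mult_mat(1) simp: distrib_left)
    also have "?P * g + ?F * g = g" by (rule split_PE) simp
    finally show ?thesis .
  qed
  \<comment> \<open>k1 and k2 carry the base point to g times the value of x1 and of x2 at t = 1; k1
    preserves E, and k2 preserves its complement.\<close>
  define k1 where "k1 = (g * (?I + f)) * adjoint n base_point"
  define k2 where "k2 = (g * (?I + w)) * adjoint n base_point"
  have ko: "k1 \<in> orth n" "k2 \<in> orth n"
    unfolding k1_def k2_def by (intro orth_mult orth_adjoint go bo skew_echelon_props(3)[OF lag_plus f(1)] skew_echelon_props(3)[OF lag_minus w])+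
  note k1D = orthD[OF ko(1)] and k2D = orthD[OF ko(2)]
  have [simp]: "dim_row k1 = ?N" "dim_col k1 = ?N" "dim_row k2 = ?N" "dim_col k2 = ?N" using k1D(1) k2D(1) by auto
  have kb: "k1 * base_point = g * (?I + f)" "k2 * base_point = g * (?I + w)"
    unfolding k1_def k2_def using orthD(2)[OF bo] by (simp_all add: mult_mat_assoc)
  have z1: "?F * (k1 * ?P) = 0\<^sub>m ?N ?N"
    unfolding k1_def using bo base_point_cols_in_E f(2)
    by (intro cols_in_E_parabolic[OF _ _ _ _ lag_plus] orth_mult go skew_echelon_props(3)[OF lag_plus f(1)])
  have z2: "?P * (k2 * ?F) = 0\<^sub>m ?N ?N"
  proof -
    let ?a = "(flip_mat n * g) * (?I + e)" and ?b = "(flip_mat n * base_point) * (?I + psi)"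
    have bo': "?b \<in> orth n" by (intro orth_mult orth_flip bo skew_echelon_props(3)[OF lag_minus psi_skew_echelon])
    have "adjoint n ?b = adjoint n (?I + psi) * (adjoint n base_point * flip_mat n)"
      using bc chi_carrier by (simp add: adjoint_mult adjoint_flip_mat)
    also have "adjoint n (?I + psi) = ?I + (-1) \<cdot>\<^sub>m psi"
      unfolding skew_echelon_props(5)[OF lag_minus psi_skew_echelon] by (rule arg_cong[where f = "(+) ?I"], rule eq_matI) auto
    finally have "?a * adjoint n ?b = flip_mat n * (g * (((?I + e) * (?I + (-1) \<cdot>\<^sub>m psi)) * (adjoint n base_point * flip_mat n)))"
      by (simp add: mult_mat_assoc)
    also have "(?I + e) * (?I + (-1) \<cdot>\<^sub>m psi) = ?I + w"
      unfolding w_def by (rule skew_echelon_mult[OF lag_minus e(1) sp(2)])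
    finally have ab: "?a * adjoint n ?b = flip_mat n * (k2 * flip_mat n)" unfolding k2_def by (simp add: mult_mat_assoc)
    have "?F * ((?a * adjoint n ?b) * ?P) = 0\<^sub>m ?N ?N"
      by (intro cols_in_E_parabolic[OF _ e(2) bo' base_point_cols_in_E_flip lag_minus] orth_mult orth_flip go
          skew_echelon_props(3)[OF lag_minus e(1)])
    then have z: "?F * ((flip_mat n * (k2 * flip_mat n)) * ?P) = 0\<^sub>m ?N ?N" unfolding ab .
    have PQ: "?P * (flip_mat n * X) = flip_mat n * (?F * X)" if "dim_row X = ?N" for X
      using arg_cong[OF flip_PE[of n], of "\<lambda>Y. flip_mat n * (Y * (flip_mat n * X))"] that
      by (simp add: mult_mat_assoc flip_flip_left)
    have "flip_mat n * ?F = ?P * flip_mat n"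
      using arg_cong[OF flip_PE[of n], of "\<lambda>Y. flip_mat n * (Y * flip_mat n)"] by (simp add: mult_mat_assoc flip_flip_left flip_flip)
    then have "?P * (k2 * ?F) = ?P * (flip_mat n * ((flip_mat n * (k2 * flip_mat n)) * (?P * flip_mat n)))"
      by (simp add: mult_mat_assoc flip_flip_left flip: \<open>flip_mat n * ?F = ?P * flip_mat n\<close>)
    also have "\<dots> = flip_mat n * ((?F * ((flip_mat n * (k2 * flip_mat n)) * ?P)) * flip_mat n)"
      by (subst PQ) (simp_all add: mult_mat_assoc)
    finally show ?thesis unfolding z by simp
  qed
  \<comment> \<open>Since F k1 = F k1 F and P k2 = P k2 P, these two diagonal blocks suffice to send
    the base point to the point t = 1 of the line.\<close>
  define D0 where "D0 = ?P * (k2 * ?P) + ?F * (k1 * ?F)"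
  define H0 where "H0 = ?P * (adjoint n k2 * ?P) + ?F * (adjoint n k1 * ?F)"
  have one_smult_matD: "1 \<cdot>\<^sub>m X = X" for X :: "complex mat" by (rule eq_matI) auto
  have [simp]: "dim_row D0 = ?N" "dim_col D0 = ?N" "dim_row H0 = ?N" "dim_col H0 = ?N" by (simp_all add: D0_def H0_def)
  have D0c: "D0 \<in> Mat n" and H0c: "H0 \<in> Mat n" by (auto intro!: carrier_matI)
  have e1: "?F * (k1 * X) = ?F * (k1 * (?F * X))" if "dim_row X = ?N" for X
  proof -
    have "?F * (k1 * X) = ?F * (k1 * (?P * X + ?F * X))" using split_PE[OF that] by simp
    also have "\<dots> = (?F * (k1 * ?P)) * X + ?F * (k1 * (?F * X))" using that by (simp add: mult_mat_distrib mult_mat_assoc)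
    finally show ?thesis unfolding z1 using that by simp
  qed
  have e2: "?P * (k2 * X) = ?P * (k2 * (?P * X))" if "dim_row X = ?N" for X
  proof -
    have "?P * (k2 * X) = ?P * (k2 * (?P * X + ?F * X))" using split_PE[OF that] by simp
    also have "\<dots> = ?P * (k2 * (?P * X)) + (?P * (k2 * ?F)) * X" using that by (simp add: mult_mat_distrib mult_mat_assoc)
    finally show ?thesis unfolding z2 using that by simp
  qed
  have "D0 * H0 = ?P * (k2 * (?P * (adjoint n k2 * ?P))) + ?F * (k1 * (?F * (adjoint n k1 * ?F)))"
    unfolding D0_def H0_def by (simp add: mult_mat_distrib mult_mat_assoc PE_PF_left)
  also have "\<dots> = ?P * (k2 * (adjoint n k2 * ?P)) + ?F * (k1 * (adjoint n k1 * ?F))"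
    by (simp flip: e1 e2)
  also have "\<dots> = ?I" by (simp add: orth_cancel(2)[OF ko(1)] orth_cancel(2)[OF ko(2)] PE_PF)
  finally have "det D0 * det H0 = 1" using det_mult[OF D0c H0c] by simp
  then have dD0: "det D0 \<noteq> 0" by auto
  have PD0: "?P * D0 = D0 * ?P"
    unfolding D0_def by (simp add: mult_mat_distrib mult_mat_assoc PE_PF PE_PF_left)
  have "D0 * base_point = ?P * (k2 * (?P * base_point)) + ?F * (k1 * (?F * base_point))"
    unfolding D0_def by (simp add: mult_mat_distrib mult_mat_assoc)
  also have "\<dots> = ?P * (k2 * base_point) + ?F * (k1 * base_point)" by (simp flip: e1 e2)
  also have "\<dots> = ?P * (g * x2 1) + ?F * (g * x1 1)"
    unfolding kb x1_def x2_def by (simp add: one_smult_matD)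
  finally have one: "g + 1 \<cdot>\<^sub>m B = D0 * base_point" unfolding line by simp
  \<comment> \<open>There are finitely many pairs (i,j), so one punctured neighbourhood of 0 serves
    all of them.\<close>
  have "\<forall>\<^sub>F t in at 0. \<forall>ij\<in>{..2*n}\<times>{..2*n}. fst ij \<le> snd ij \<longrightarrow>
      snd ij + card (open_arcs (fst ij) (snd ij)) \<le> cdim ?N (pair_sum n (flag_of ?N (g + t \<cdot>\<^sub>m B)) (fst ij) (snd ij))"
  proof (intro eventually_ball_finite ballI finite_cartesian_product finite_atMost)
    fix ij :: "nat \<times> nat" assume ij: "ij \<in> {..2*n}\<times>{..2*n}"
    show "\<forall>\<^sub>F t in at 0. fst ij \<le> snd ij \<longrightarrow>
      snd ij + card (open_arcs (fst ij) (snd ij)) \<le> cdim ?N (pair_sum n (flag_of ?N (g + t \<cdot>\<^sub>m B)) (fst ij) (snd ij))"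
    proof (cases "fst ij \<le> snd ij")
      case True
      have "snd ij \<le> ?N" using ij by auto
      from generic_pair_sum[OF gc Bc D0c PD0 dD0 one True this] show ?thesis by (rule eventually_mono) blast
    qed simp
  qed
  with ev have "\<forall>\<^sub>F t in at 0. G t \<in> SO n \<and> flag_of ?N (G t) \<in> orbit_D n c"
  proof eventually_elim
    case (elim t)
    have GS: "G t \<in> SO n" and Dt: "D t \<in> Mat n" "det (D t) \<noteq> 0" "?P * D t = D t * ?P"
      and Gt: "G t = D t * (?P * (g * x2 t) + ?F * (g * x1 t))" using elim(1) by auto
    note lp = lift_lag_pos[OF gc orthD(1)[OF x1p(3)] orthD(1)[OF x2p(3)] Dt(1,3) Gt]
    have Xc: "g + t \<cdot>\<^sub>m B \<in> Mat n" using gc Bc by simp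
    have Gl: "G t = D t * (g + t \<cdot>\<^sub>m B)" using Gt unfolding line .
    have "flag_of ?N (G t) \<in> orbit_D n c"
    proof (rule flag_in_orbit[OF av GS lp(1)[OF p1] lp(2)[OF p2]])
      fix i j assume ij: "1 \<le> i" "i < j" "j \<le> 2*n"
      have s: "csubspace ?N (pair_sum n (flag_of ?N (g + t \<cdot>\<^sub>m B)) i j)"
        by (intro csubspace_pair_sum csubspace_flag Xc)
      have "cdim ?N (pair_sum n (flag_of ?N (G t)) i j) = cdim ?N (pair_sum n (flag_of ?N (g + t \<cdot>\<^sub>m B)) i j)"
        unfolding Gl pair_sum_block[OF Dt(1,3) Xc] by (rule cdim_apply[OF Dt(1,2) s])
      moreover have "(i,j) \<in> {..2*n}\<times>{..2*n}" using ij by auto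
      ultimately show "j + card (open_arcs i j) \<le> cdim ?N (pair_sum n (flag_of ?N (G t)) i j)"
        using elim(2) ij(2) by fastforce
    qed
    with GS show ?case by blast
  qed
  from limit_in_closure[OF g Glim this] show ?thesis .
qed


text \<open>det g = 1 is the sign of the count of J from n on and of the count of L below n, so both
  are even, as they are for the clan; \<open>lag_cards\<close> moves the first comparison to the
  lower half.\<close>

lemma even_signs:
  assumes g: "g \<in> SO n" and p: "lag_pos n g J" "lag_pos n (flip_mat n * g) L"
  shows "even (card (J \<inter> {..<n}) + card (JP \<inter> {..<n}))" "even (card (L \<inter> {..<n}) + card (JM \<inter> {..<n}))"
proof -
  have go: "g \<in> orth n" and dg: "det g = 1" using g by (simp_all add: SO_iff)
  have J: "lag n J" and L: "lag n L" using p by (auto simp: lag_pos_def)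
  have "even (card (J \<inter> {n..}))" using det_lag_pos[OF go p(1)] dg by (cases "even (card (J \<inter> {n..}))") auto
  moreover note even_plus lag_cards(2)[OF J] lag_cards(2)[OF lag_plus]
  ultimately show "even (card (J \<inter> {..<n}) + card (JP \<inter> {..<n}))" by (metis even_add)
  have "det g = (-1) ^ card (L \<inter> {..<n})"
    by (rule det_lag_pos_flip[OF go L det_lag_pos[OF orth_mult[OF orth_flip go] p(2)]])
  then have "even (card (L \<inter> {..<n}))" using dg by (cases "even (card (L \<inter> {..<n}))") auto
  then show "even (card (L \<inter> {..<n}) + card (JM \<inter> {..<n}))" using even_minus by simp
qed

text \<open>The induction is on the sum of all values of both counting functions. The points of each
  curve are only known to lie in the closure of the orbit, which suffices because a closure is
  closed.\<close>

lemma flag_in_orbit_closure: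
  assumes av: "avoids_1212 n c" and g: "g \<in> SO n" and p: "lag_pos n g J" "lag_pos n (flip_mat n * g) L"
    and dom: "\<And>m. m \<le> 2*n \<Longrightarrow> card (JP \<inter> {..<m}) \<le> card (J \<inter> {..<m})"
      "\<And>m. m \<le> 2*n \<Longrightarrow> card (JM \<inter> {..<m}) \<le> card (L \<inter> {..<m})"
  shows "flag_of (2*n) g \<in> zariski_D n closure_of orbit_D n c"
  using g p dom
proof (induction "(\<Sum>m\<le>2*n. card (J \<inter> {..<m})) + (\<Sum>m\<le>2*n. card (L \<inter> {..<m}))" arbitrary: g J L rule: less_induct)
  case less
  let ?cl = "zariski_D n closure_of orbit_D n c"
  note g = less.prems(1) and p = less.prems(2,3)
  have go: "g \<in> orth n" using g by (simp add: SO_iff)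
  have gc: "g \<in> Mat n" by (rule SO_carrier[OF g])
  have fgo: "flip_mat n * g \<in> orth n" by (rule orth_mult[OF orth_flip go])
  have J: "lag n J" and L: "lag n L" using p by (auto simp: lag_pos_def)
  have I: "1\<^sub>m (2*n) \<in> orth n" "mat_tendsto (2*n) (2*n) (\<lambda>t. 1\<^sub>m (2*n)) (1\<^sub>m (2*n))"
    by (rule orth_one) (simp add: mat_tendsto_const)
  have nz: "\<forall>\<^sub>F t in at (0::complex). t \<noteq> 0" by (simp add: eventually_at_filter)
  have lim: "flag_of (2*n) g \<in> ?cl"
    if x: "\<And>t. x1 t \<in> orth n" "\<And>t. x2 t \<in> orth n" "mat_tendsto (2*n) (2*n) x1 (1\<^sub>m (2*n))" "mat_tendsto (2*n) (2*n) x2 (1\<^sub>m (2*n))"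
      and p': "\<And>t. t \<noteq> 0 \<Longrightarrow> lag_pos n (g * x1 t) J'" "\<And>t. t \<noteq> 0 \<Longrightarrow> lag_pos n (flip_mat n * (g * x2 t)) L'"
      and IH: "\<And>h. h \<in> SO n \<Longrightarrow> lag_pos n h J' \<Longrightarrow> lag_pos n (flip_mat n * h) L' \<Longrightarrow> flag_of (2*n) h \<in> ?cl"
    for x1 x2 J' L'
  proof -
    from lift_curves[OF g x] obtain G D where Glim: "mat_tendsto (2*n) (2*n) G g"
      and ev: "\<forall>\<^sub>F t in at 0. G t \<in> SO n \<and> D t \<in> Mat n \<and> det (D t) \<noteq> 0 \<and> P_E n * D t = D t * P_E n \<and>
         G t = D t * (P_E n * (g * x2 t) + P_F n * (g * x1 t))" by blast
    from ev nz have "\<forall>\<^sub>F t in at 0. G t \<in> SO n \<and> flag_of (2*n) (G t) \<in> ?cl"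
    proof eventually_elim
      case (elim t)
      have GS: "G t \<in> SO n" and D: "D t \<in> Mat n" "P_E n * D t = D t * P_E n"
        and Gt: "G t = D t * (P_E n * (g * x2 t) + P_F n * (g * x1 t))" using elim(1) by auto
      note lp = lift_lag_pos[OF gc orthD(1)[OF x(1)] orthD(1)[OF x(2)] D Gt]
      show ?case using IH[OF GS lp(1)[OF p'(1)[OF elim(2)]] lp(2)[OF p'(2)[OF elim(2)]]] GS by blast
    qed
    from limit_in_closure[OF g Glim this] show ?thesis by simp
  qed
  consider "J \<noteq> JP" | "L \<noteq> JM" | "J = JP" "L = JM" by blast
  then show ?case
  proof cases
    case 1
    from exists_lag_move[OF J lag_plus 1 less.prems(4) even_signs(1)[OF g p]] obtain i k
      where ik: "i \<in> J" "k \<in> J" "i \<noteq> k" "i < 2*n-1-k"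
      and dom: "\<And>m. m \<le> 2*n \<Longrightarrow> card (JP \<inter> {..<m}) \<le> card (lag_move n J i k \<inter> {..<m})" by metis
    from move_curve[OF go p(1) ik] obtain x where x: "\<And>t. x t \<in> orth n"
      "mat_tendsto (2*n) (2*n) x (1\<^sub>m (2*n))" "\<And>t. t \<noteq> 0 \<Longrightarrow> lag_pos n (g * x t) (lag_move n J i k)" by metis
    show ?thesis
    proof (rule lim[OF x(1) I(1) x(2) I(2) x(3)])
      show "lag_pos n (flip_mat n * (g * 1\<^sub>m (2*n))) L" using p(2) gc by simp
      fix h assume h: "h \<in> SO n" "lag_pos n h (lag_move n J i k)" "lag_pos n (flip_mat n * h) L"
      show "flag_of (2*n) h \<in> ?cl"
        by (rule less.hyps[OF _ h dom less.prems(5)]) (use lag_move_less[OF J ik] in simp)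
    qed
  next
    case 2
    from exists_lag_move[OF L lag_minus 2 less.prems(5) even_signs(2)[OF g p]] obtain i k
      where ik: "i \<in> L" "k \<in> L" "i \<noteq> k" "i < 2*n-1-k"
      and dom: "\<And>m. m \<le> 2*n \<Longrightarrow> card (JM \<inter> {..<m}) \<le> card (lag_move n L i k \<inter> {..<m})" by metis
    from move_curve[OF fgo p(2) ik] obtain x where x: "\<And>t. x t \<in> orth n"
      "mat_tendsto (2*n) (2*n) x (1\<^sub>m (2*n))" "\<And>t. t \<noteq> 0 \<Longrightarrow> lag_pos n ((flip_mat n * g) * x t) (lag_move n L i k)" by metis
    show ?thesis
    proof (rule lim[OF I(1) x(1) I(2) x(2)])
      show "lag_pos n (g * 1\<^sub>m (2*n)) J" using p(1) gc by simp
      fix t :: complex assume "t \<noteq> 0"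
      moreover have "(flip_mat n * g) * x t = flip_mat n * (g * x t)"
        using gc orthD(1)[OF x(1)[of t]] by (simp add: mult_mat_assoc)
      ultimately show "lag_pos n (flip_mat n * (g * x t)) (lag_move n L i k)" using x(3)[of t] by simp
    next
      fix h assume h: "h \<in> SO n" "lag_pos n h J" "lag_pos n (flip_mat n * h) (lag_move n L i k)"
      show "flag_of (2*n) h \<in> ?cl"
        by (rule less.hyps[OF _ h less.prems(4) dom]) (use lag_move_less[OF L ik] in simp)
    qed
  next
    case 3
    then show ?thesis using generic_position[OF av g] p by simp
  qed
qed

section \<open>Positions on the orbit, on the cells and on the closures of the cells\<close>

lemma orbit_lag_pos:
  assumes g: "g \<in> SO n" and F: "flag_of (2*n) g \<in> orbit_D n c"
  shows "lag_pos n g JP" "lag_pos n (flip_mat n * g) JM"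
proof -
  have go: "g \<in> orth n" using g by (simp add: SO_iff)
  have gc: "g \<in> Mat n" by (rule SO_carrier[OF g])
  have *: "lag_pos n h J0"
    if h: "h \<in> orth n" and J0: "J0 \<subseteq> {..<2*n}"
      and d: "\<And>i. i \<in> {1..2*n} \<Longrightarrow> cdim (2*n) (flag_of (2*n) h i \<inter> E_space n) = card (J0 \<inter> {..<i})" for h J0
  proof -
    from lagrangian_echelon[OF h] obtain J f where Jf: "lag n J" "skew_echelon n J f" "cols_in_E n (h * (1\<^sub>m (2*n) + f)) J" .
    have p: "lag_pos n h J" by (rule skew_echelon_lag_pos[OF Jf])
    have "J = J0"
    proof (rule lag_pos_unique[OF h p J0])
      fix i :: nat assume "i \<le> 2*n"
      \<comment> \<open>The conditions of the orbit start at i = 1; the value at i = 0 is taken from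
        the position itself.\<close>
      then show "cdim (2*n) (flag_of (2*n) h i \<inter> E_space n) = card (J0 \<inter> {..<i})"
        using d[of i] lag_pos_cdim[OF h p, of 0] by (cases "i = 0") auto
    qed
    then show ?thesis using p by simp
  qed
  have d: "cdim (2*n) (flag_of (2*n) g i \<inter> E_space n) = card (JP \<inter> {..<i})"
    "cdim (2*n) (flag_of (2*n) (flip_mat n * g) i \<inter> E_space n) = card (JM \<inter> {..<i})" if i: "i \<in> {1..2*n}" for i
  proof -
    have iN: "i \<le> 2*n" using i by simp
    have "cdim (2*n) (flag_of (2*n) g i \<inter> E_space n) = card {k\<in>{1..i}. c k = Plus} + num_pairs c i"
      "cdim (2*n) (flag_of (2*n) g i \<inter> E_tilde n) = card {k\<in>{1..i}. c k = Minus} + num_pairs c i"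
      using F i unfolding orbit_D_def orbit_GL_def by blast+
    then show "cdim (2*n) (flag_of (2*n) g i \<inter> E_space n) = card (JP \<inter> {..<i})"
      "cdim (2*n) (flag_of (2*n) (flip_mat n * g) i \<inter> E_space n) = card (JM \<inter> {..<i})"
      unfolding card_plus[OF iN] card_minus[OF iN] cdim_E_tilde[OF gc] by auto
  qed
  show "lag_pos n g JP" by (rule *[OF go lagD(1)[OF lag_plus] d(1)])
  show "lag_pos n (flip_mat n * g) JM" by (rule *[OF orth_mult[OF orth_flip go] lagD(1)[OF lag_minus] d(2)])
qed

text \<open>For j in \<open>JP\<close>, column j of \<open>b * W\<close> is a multiple of column
  u(j) of b, where u(j) < n counted from 0; as b is upper triangular, it lies in E.\<close>

lemma cell_lag_pos:
  assumes s: "weyl_embed n s = clan_u n c" and b: "b \<in> Borel n" "W \<in> weyl_reps n s" "b' \<in> Borel n"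
  shows "b * W * b' \<in> orth n" "lag_pos n (b * W * b') JP"
proof -
  have bb: "b \<in> orth n" "upper_tri (2*n) b" "b' \<in> orth n" "upper_tri (2*n) b'" using b by (auto simp: Borel_iff SO_iff)
  have W: "W \<in> orth n" using b(2) by (simp add: weyl_reps_def SO_iff)
  have bc: "b \<in> Mat n" and Wc: "W \<in> Mat n" using orthD(1) bb(1) W by blast+
  show "b * W * b' \<in> orth n" by (intro orth_mult bb W)
  have "cols_in_E n (b * W) JP"
    unfolding cols_in_E_def
  proof (intro ballI)
    fix j i assume j: "j \<in> JP" and i: "i \<in> {n..<2*n}"
    then have ij: "i < 2*n" "j < 2*n" "n \<le> i" using lagD(2)[OF lag_plus j] by auto
    have "b $$ (i,l) * W $$ (l,j) = 0" if l: "l < 2*n" for l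
    proof (cases "l = u.p j")
      case True
      then have "l < i" using u_class[OF ij(2)] j ij(3) by simp
      then show ?thesis using bb(2) l ij by (simp add: upper_tri_def)
    next
      case False
      then show ?thesis using u.weyl_rep_index[OF s b(2) l ij(2)] by simp
    qed
    then show "(b * W) $$ (i,j) = 0" unfolding mat_index_mult[OF bc Wc ij(1,2)] by (simp add: sum.neutral)
  qed
  then have "lag_pos n (b * W) JP"
    unfolding lag_pos_def using lag_plus orth_one upper_tri_one mult_carrier_mat[OF bc Wc] by (metis right_mult_one_mat)
  then show "lag_pos n (b * W * b') JP" by (rule lag_pos_mult_upper[OF mult_carrier_mat[OF bc Wc] _ bb(3,4)])
qed

lemma opp_cell_lag_pos:
  assumes s: "weyl_embed n s = clan_v n c" and b: "b \<in> Borel_opp n" "W \<in> weyl_reps n s" "b' \<in> Borel n"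
  shows "b * W * b' \<in> orth n" "lag_pos n (flip_mat n * (b * W * b')) JM"
proof -
  have bb: "b \<in> orth n" "lower_tri (2*n) b" "b' \<in> orth n" "upper_tri (2*n) b'"
    using b by (auto simp: Borel_iff Borel_opp_iff SO_iff)
  have W: "W \<in> orth n" using b(2) by (simp add: weyl_reps_def SO_iff)
  have bc: "b \<in> Mat n" and Wc: "W \<in> Mat n" and bc': "b' \<in> Mat n" using orthD(1) bb(1,3) W by blast+
  show "b * W * b' \<in> orth n" by (intro orth_mult bb W)
  have fc: "flip_mat n * (b * W) \<in> Mat n" using bc Wc by simp
  have "cols_in_E n (flip_mat n * (b * W)) JM"
    unfolding cols_in_E_def
  proof (intro ballI)
    fix j i assume j: "j \<in> JM" and i: "i \<in> {n..<2*n}"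
    define i' where "i' = 2*n-1-i"
    have ij: "i < 2*n" "j < 2*n" "i' < n" "i' < 2*n" using i lagD(2)[OF lag_minus j] by (auto simp: i'_def)
    have "b $$ (i',l) * W $$ (l,j) = 0" if l: "l < 2*n" for l
    proof (cases "l = v.p j")
      case True
      then have "i' < l" using v_class[OF ij(2)] j ij(3) by simp
      then show ?thesis using bb(2) l ij by (simp add: lower_tri_def)
    next
      case False
      then show ?thesis using v.weyl_rep_index[OF s b(2) l ij(2)] by simp
    qed
    then have "(b * W) $$ (i',j) = 0" unfolding mat_index_mult[OF bc Wc ij(4,2)] by (simp add: sum.neutral)
    then show "(flip_mat n * (b * W)) $$ (i,j) = 0"
      unfolding i'_def using flip_mult_index[OF mult_carrier_mat[OF bc Wc] ij(1,2)] by simp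
  qed
  then have "lag_pos n (flip_mat n * (b * W)) JM"
    unfolding lag_pos_def using lag_minus orth_one upper_tri_one fc by (metis right_mult_one_mat)
  then have "lag_pos n (flip_mat n * (b * W) * b') JM" by (rule lag_pos_mult_upper[OF fc _ bb(3,4)])
  moreover have "flip_mat n * (b * W) * b' = flip_mat n * (b * W * b')" using bc Wc bc' by (simp add: mult_mat_assoc)
  ultimately show "lag_pos n (flip_mat n * (b * W * b')) JM" by simp
qed

text \<open>On the cell the dimensions are the counts of \<open>JP\<close>, by
  \<open>cell_lag_pos\<close>; passing to the closure is semicontinuity with c = 1.\<close>

lemma schubert_dominance:
  assumes s: "weyl_embed n s = clan_u n c" and g: "g \<in> SO n" and p: "lag_pos n g J"
    and F: "flag_of (2*n) g \<in> schubert n s" and m: "m \<le> 2*n"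
  shows "card (JP \<inter> {..<m}) \<le> card (J \<inter> {..<m})"
proof (rule cdim_semicontinuous[OF g orth_one _ m F[unfolded schubert_def]])
  show "lag_pos n (1\<^sub>m (2*n) * g) J" using p SO_carrier[OF g] by simp
  fix g' assume g': "g' \<in> GL (2*n)"
    and "flag_of (2*n) g' \<in> {flag_of (2*n) (b * W * b') | b W b'. b \<in> Borel n \<and> W \<in> weyl_reps n s \<and> b' \<in> Borel n}"
  then obtain b W b' where b: "b \<in> Borel n" "W \<in> weyl_reps n s" "b' \<in> Borel n"
    and e: "flag_of (2*n) g' = flag_of (2*n) (b * W * b')" by blast
  have "g' \<in> Mat n" using g' by (simp add: GL_def)
  then show "card (JP \<inter> {..<m}) \<le> cdim (2*n) (flag_of (2*n) (1\<^sub>m (2*n) * g') m \<inter> E_space n)"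
    using lag_pos_cdim[OF cell_lag_pos[OF s b] m] e by simp
qed

lemma schubert_opp_dominance:
  assumes s: "weyl_embed n s = clan_v n c" and g: "g \<in> SO n" and p: "lag_pos n (flip_mat n * g) L"
    and F: "flag_of (2*n) g \<in> schubert_opp n s" and m: "m \<le> 2*n"
  shows "card (JM \<inter> {..<m}) \<le> card (L \<inter> {..<m})"
proof (rule cdim_semicontinuous[OF g orth_flip p m F[unfolded schubert_opp_def]])
  fix g' assume g': "g' \<in> GL (2*n)"
    and "flag_of (2*n) g' \<in> {flag_of (2*n) (b * W * b') | b W b'. b \<in> Borel_opp n \<and> W \<in> weyl_reps n s \<and> b' \<in> Borel n}"
  then obtain b W b' where b: "b \<in> Borel_opp n" "W \<in> weyl_reps n s" "b' \<in> Borel n"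
    and e: "flag_of (2*n) g' = flag_of (2*n) (b * W * b')" by blast
  have g'c: "g' \<in> Mat n" using g' by (simp add: GL_def)
  note cp = opp_cell_lag_pos[OF s b]
  have "flag_of (2*n) (flip_mat n * g') m = flag_of (2*n) (flip_mat n * (b * W * b')) m"
    unfolding flag_mult[OF flip_carrier g'c] flag_mult[OF flip_carrier orthD(1)[OF cp(1)]] e ..
  then show "card (JM \<inter> {..<m}) \<le> cdim (2*n) (flag_of (2*n) (flip_mat n * g') m \<inter> E_space n)"
    using lag_pos_cdim[OF orth_mult[OF orth_flip cp(1)] cp(2) m] by simp
qed

end

theorem corollary4p6:
  fixes n :: nat and \<gamma> :: clan
  assumes "type_D_clan n \<gamma>"
    and "avoids_1212 n \<gamma>"
  shows "\<exists>u\<in>weyl_D n. \<exists>v\<in>weyl_D n.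
           weyl_embed n u = clan_u n \<gamma> \<and> weyl_embed n v = clan_v n \<gamma> \<and>
           orbit_closure_D n \<gamma> = richardson n u v"
proof -
  interpret clan_D n \<gamma> by unfold_locales (rule assms(1))
  obtain u where u: "u \<in> weyl_D n" "weyl_embed n u = clan_u n \<gamma>" using clan_u_weyl by blast
  obtain v where v: "v \<in> weyl_D n" "weyl_embed n v = clan_v n \<gamma>" using clan_v_weyl by blast
  have "orbit_closure_D n \<gamma> = richardson n u v"
  proof
    have "orbit_D n \<gamma> \<subseteq> richardson n u v"
    proof
      fix F assume F: "F \<in> orbit_D n \<gamma>"
      then obtain g where g: "g \<in> SO n" "F = flag_of (2*n) g" by (auto simp: orbit_D_def flags_D_def)
      note p = orbit_lag_pos[OF g(1) F[unfolded g(2)]]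
      show "F \<in> richardson n u v"
        unfolding richardson_def g(2) using flag_in_schubert[OF g(1) p(1) u(2)] flag_in_schubert_opp[OF g(1) p(2) v(2)] by blast
    qed
    moreover have "closedin (zariski_D n) (richardson n u v)"
      unfolding richardson_def schubert_def schubert_opp_def by (intro closedin_Int closedin_closure_of)
    ultimately show "orbit_closure_D n \<gamma> \<subseteq> richardson n u v"
      unfolding orbit_closure_D_def by (rule closure_of_minimal)
    show "richardson n u v \<subseteq> orbit_closure_D n \<gamma>"
    proof
      fix F assume F: "F \<in> richardson n u v"
      then have "F \<in> topspace (zariski_D n)"
        unfolding richardson_def schubert_def using subsetD[OF closure_of_subset_topspace] by (elim IntE)
      then obtain g where g: "g \<in> SO n" "F = flag_of (2*n) g" by (auto simp: topspace_zariski_D flags_D_def)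
      have go: "g \<in> orth n" using g by (simp add: SO_iff)
      from lagrangian_echelon[OF go] obtain J f where "lag n J" "skew_echelon n J f" "cols_in_E n (g * (1\<^sub>m (2*n) + f)) J" .
      then have J: "lag_pos n g J" by (rule skew_echelon_lag_pos)
      from lagrangian_echelon[OF orth_mult[OF orth_flip go]] obtain L f'
        where "lag n L" "skew_echelon n L f'" "cols_in_E n (flip_mat n * g * (1\<^sub>m (2*n) + f')) L" .
      then have L: "lag_pos n (flip_mat n * g) L" by (rule skew_echelon_lag_pos)
      have S: "flag_of (2*n) g \<in> schubert n u" "flag_of (2*n) g \<in> schubert_opp n v"
        using F g(2) by (auto simp: richardson_def)
      show "F \<in> orbit_closure_D n \<gamma>"
        unfolding orbit_closure_D_def g(2)
        by (rule flag_in_orbit_closure[OF assms(2) g(1) J L schubert_dominance[OF u(2) g(1) J S(1)]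
              schubert_opp_dominance[OF v(2) g(1) L S(2)]])
    qed
  qed
  then show ?thesis using u v by blast
qed

end
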